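(* Let $1\le p < \infty$, $m \in \mathbb{N}$, and $a \in \mathbb{R}$. Let $K\subset\mathbb{R}^d$ be a truncated rotationally symmetric smooth cone with vertex at the origin (as defined in the context). The Kondratiev space $\mathcal{K}^{m}_{a,p} (K,\{0\})$ is an algebra with respect to pointwise multiplication if, and only if, $a\ge\frac{d}{p}$ with either $1<p<\infty$ and $m>d/p$, or $p=1$ and $m\ge d$.
   Context: $\mathbb{N}=\{1,2,\dots\}$, $\mathbb{N}_0=\mathbb{N}\cup\{0\}$, $d\ge2$. An infinite smooth cone with vertex at the origin is a set $K'=\{x\in\mathbb{R}^d: 0<|x|<\infty,\ x/|x|\in\omega\}$ with $\omega$ a subdomain of the unit sphere $S^{d-1}$ with $C^\infty$ boundary. Here $K=K'\cap B_1(0)$, where $K'$ is an infinite smooth cone that is rotationally invariant with respect to the axis $\{(0,\dots,0,x_d):x_d\in\mathbb{R}\}$, with opening angle $\gamma\in(0,\pi)$, and $B_1(0)$ is the open unit ball. For $m\in\mathbb{N}_0$, $a\in\mathbb{R}$, $1\le p<\infty$, the Kondratiev space $\mathcal{K}^m_{a,p}(K,\{0\})$ consists of all measurable functions $u$ on $K$ having weak derivatives $\partial^\alpha u$, $|\alpha|\le m$, in $K$ with $\|u|\mathcal{K}^m_{a,p}(K,\{0\})\|=\big(\sum_{|\alpha|\le m}\int_K\big||x|^{|\alpha|-a}\partial^\alpha u(x)\big|^p\,dx\big)^{1/p}<\infty$. It is an algebra with respect to pointwise multiplication if there exists a constant $c$ such that $\|uv|\mathcal{K}^m_{a,p}(K,\{0\})\|\le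 c\,\|u|\mathcal{K}^m_{a,p}(K,\{0\})\|\,\|v|\mathcal{K}^m_{a,p}(K,\{0\})\|$ for all $u,v\in\mathcal{K}^m_{a,p}(K,\{0\})$. *)

theory Defs
  imports "HOL-Analysis.Analysis"
begin

section \<open>Classical and weak derivatives\<close>

definition partial_deriv :: "'n \<Rightarrow> (real^'n \<Rightarrow> real) \<Rightarrow> real^'n \<Rightarrow> real" where
  "partial_deriv i f x = deriv (\<lambda>t. f (x + t *\<^sub>R axis i 1)) 0"

text \<open>On an open set, differentiability of all iterated partial derivatives is
  the same as being of class C-infinity.\<close>

definition smooth_on :: "(real^'n) set \<Rightarrow> (real^'n \<Rightarrow> real) \<Rightarrow> bool" where
  "smooth_on U f \<longleftrightarrow> (\<forall>l. \<forall>x\<in>U. foldr partial_deriv l f differentiable (at x))"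

text \<open>Multi-indices are functions on the coordinate indices.\<close>

definition mi_order :: "('n::finite \<Rightarrow> nat) \<Rightarrow> nat" where
  "mi_order \<alpha> = (\<Sum>i\<in>UNIV. \<alpha> i)"

lemma finite_mi_order_le: "finite {\<alpha> :: 'n::finite \<Rightarrow> nat. mi_order \<alpha> \<le> m}"
proof (rule finite_subset)
  show "{\<alpha> :: 'n \<Rightarrow> nat. mi_order \<alpha> \<le> m} \<subseteq> PiE UNIV (\<lambda>_. {..m})"
  proof
    fix \<alpha> :: "'n \<Rightarrow> nat" assume "\<alpha> \<in> {\<alpha>. mi_order \<alpha> \<le> m}"
    moreover have "\<alpha> i \<le> mi_order \<alpha>" for i
      unfolding mi_order_def by (rule member_le_sum) simp_all
    ultimately have "\<alpha> i \<le> m" for i using le_trans by blast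
    then show "\<alpha> \<in> PiE UNIV (\<lambda>_. {..m})" by (simp add: PiE_UNIV_domain)
  qed
qed (simp add: finite_PiE)

text \<open>The coordinates are processed in an arbitrary fixed enumeration; the choice is
  irrelevant for smooth functions, to which this is applied exclusively.\<close>

definition multi_deriv :: "('n::finite \<Rightarrow> nat) \<Rightarrow> (real^'n \<Rightarrow> real) \<Rightarrow> real^'n \<Rightarrow> real" where
  "multi_deriv \<alpha> f =
     foldr (\<lambda>i. partial_deriv i ^^ \<alpha> i) (SOME l. distinct l \<and> set l = UNIV) f"

definition test_functions :: "(real^'n) set \<Rightarrow> (real^'n \<Rightarrow> real) set" where
  "test_functions U = {\<phi>. smooth_on UNIV \<phi> \<and>
     compact (closure {x. \<phi> x \<noteq> 0}) \<and> closure {x. \<phi> x \<noteq> 0} \<subseteq> U}"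

definition locally_integrable :: "(real^'n) set \<Rightarrow> (real^'n \<Rightarrow> real) \<Rightarrow> bool" where
  "locally_integrable U u \<longleftrightarrow> u \<in> borel_measurable (lebesgue_on U) \<and>
     (\<forall>C. compact C \<and> C \<subseteq> U \<longrightarrow> integrable (lebesgue_on C) u)"

definition has_weak_deriv ::
    "(real^'n) set \<Rightarrow> ('n \<Rightarrow> nat) \<Rightarrow> (real^'n \<Rightarrow> real) \<Rightarrow> (real^'n \<Rightarrow> real) \<Rightarrow> bool" where
  "has_weak_deriv U \<alpha> u g \<longleftrightarrow> locally_integrable U u \<and> locally_integrable U g \<and>
     (\<forall>\<phi>\<in>test_functions U.
        (LINT x|lebesgue_on U. u x * multi_deriv \<alpha> \<phi> x)
          = (-1) ^ mi_order \<alpha> * (LINT x|lebesgue_on U. g x * \<phi> x))"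

text \<open>A weak derivative is unique up to null sets, so the choice of a representative
  does not influence the integrals below.\<close>

definition weak_deriv ::
    "(real^'n) set \<Rightarrow> ('n \<Rightarrow> nat) \<Rightarrow> (real^'n \<Rightarrow> real) \<Rightarrow> real^'n \<Rightarrow> real" where
  "weak_deriv U \<alpha> u = (SOME g. has_weak_deriv U \<alpha> u g)"


section \<open>Kondratiev spaces with singular set the origin\<close>

text \<open>The \<open>p\<close>-th power of the norm, possibly infinite.\<close>

definition kondratiev_energy ::
    "nat \<Rightarrow> real \<Rightarrow> real \<Rightarrow> (real^'n) set \<Rightarrow> (real^'n \<Rightarrow> real) \<Rightarrow> ennreal" where
  "kondratiev_energy m a p K u =
     (\<Sum>\<alpha> | mi_order \<alpha> \<le> m. \<integral>\<^sup>+ x.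
        ennreal (\<bar>norm x powr (real (mi_order \<alpha>) - a) * weak_deriv K \<alpha> u x\<bar> powr p)
        \<partial>lebesgue_on K)"

definition kondratiev_space ::
    "nat \<Rightarrow> real \<Rightarrow> real \<Rightarrow> (real^'n) set \<Rightarrow> (real^'n \<Rightarrow> real) set" where
  "kondratiev_space m a p K =
     {u. u \<in> borel_measurable (lebesgue_on K) \<and>
         (\<forall>\<alpha>. mi_order \<alpha> \<le> m \<longrightarrow> (\<exists>g. has_weak_deriv K \<alpha> u g)) \<and>
         kondratiev_energy m a p K u < \<infinity>}"

definition kondratiev_norm ::
    "nat \<Rightarrow> real \<Rightarrow> real \<Rightarrow> (real^'n) set \<Rightarrow> (real^'n \<Rightarrow> real) \<Rightarrow> real" where
  "kondratiev_norm m a p K u = enn2real (kondratiev_energy m a p K u) powr (1 / p)"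

text \<open>Membership of the product is explicit because the real-valued norm is
  meaningful only on the space.\<close>

definition kondratiev_algebra ::
    "nat \<Rightarrow> real \<Rightarrow> real \<Rightarrow> (real^'n) set \<Rightarrow> bool" where
  "kondratiev_algebra m a p K \<longleftrightarrow>
     (\<exists>c. \<forall>u\<in>kondratiev_space m a p K. \<forall>v\<in>kondratiev_space m a p K.
        (\<lambda>x. u x * v x) \<in> kondratiev_space m a p K \<and>
        kondratiev_norm m a p K (\<lambda>x. u x * v x)
          \<le> c * kondratiev_norm m a p K u * kondratiev_norm m a p K v)"


section \<open>Smooth cones\<close>

text \<open>The boundary of the subdomain relative to the sphere is locally the zero set of a
  smooth function with non-vanishing tangential derivative, the domain lying on one side.\<close>

definition smooth_sphere_domain :: "(real^'n) set \<Rightarrow> bool" where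
  "smooth_sphere_domain \<omega> \<longleftrightarrow>
     \<omega> \<noteq> {} \<and> connected \<omega> \<and> openin (top_of_set (sphere 0 1)) \<omega> \<and>
     (\<forall>\<xi>\<in>top_of_set (sphere 0 1) frontier_of \<omega>. \<exists>U \<rho>.
        open U \<and> \<xi> \<in> U \<and> smooth_on U \<rho> \<and>
        (\<exists>v. v \<bullet> \<xi> = 0 \<and> frechet_derivative \<rho> (at \<xi>) v \<noteq> 0) \<and>
        \<omega> \<inter> U = {x \<in> sphere 0 1 \<inter> U. \<rho> x < 0})"

definition infinite_smooth_cone :: "(real^'n) set \<Rightarrow> bool" where
  "infinite_smooth_cone K \<longleftrightarrow>
     (\<exists>\<omega>. smooth_sphere_domain \<omega> \<and> K = {x. 0 < norm x \<and> x /\<^sub>R norm x \<in> \<omega>})"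

text \<open>The index \<open>k\<close> singles out the coordinate axis of symmetry.\<close>

definition rotationally_invariant :: "'n::finite \<Rightarrow> (real^'n) set \<Rightarrow> bool" where
  "rotationally_invariant k K \<longleftrightarrow>
     (\<forall>f. orthogonal_transformation f \<and> f (axis k 1) = axis k 1 \<longrightarrow> f ` K = K)"

text \<open>The opening angle is measured from the axis to the lateral surface, so that all
  \<open>\<gamma>\<close> between \<open>0\<close> and \<open>\<pi>\<close> occur; the cone may be directed along either half-axis.\<close>

definition has_opening_angle :: "'n::finite \<Rightarrow> real \<Rightarrow> (real^'n) set \<Rightarrow> bool" where
  "has_opening_angle k \<gamma> K \<longleftrightarrow>
     (\<exists>e\<in>{axis k 1, - axis k 1}. K = {x. x \<noteq> 0 \<and> arccos ((x \<bullet> e) / norm x) < \<gamma>})"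

text \<open>Every such set is a rotationally invariant smooth cone.\<close>

lemma has_opening_angle_imp_rotationally_invariant:
  assumes "has_opening_angle k \<gamma> K"
  shows "rotationally_invariant k K"
  unfolding rotationally_invariant_def
proof (intro allI impI)
  fix f :: "real^'a \<Rightarrow> real^'a"
  assume f: "orthogonal_transformation f \<and> f (axis k 1) = axis k 1"
  then have lin: "linear f" by (simp add: orthogonal_transformation_def)
  from assms obtain e where e: "e = axis k 1 \<or> e = - axis k 1"
    and K: "K = {x. x \<noteq> 0 \<and> arccos ((x \<bullet> e) / norm x) < \<gamma>}"
    unfolding has_opening_angle_def by blast
  have fe: "f e = e"
    using e
  proof
    assume "e = - axis k 1"
    moreover have "f (- axis k 1) = - axis k 1" using f linear_neg[OF lin, of "axis k 1"] by simp
    ultimately show ?thesis by simp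
  qed (use f in simp)
  have dot: "f x \<bullet> e = x \<bullet> e" for x
    using f fe unfolding orthogonal_transformation_def by metis
  have nrm: "norm (f x) = norm x" for x
    using f orthogonal_transformation_norm by blast
  have "f x = 0 \<longleftrightarrow> x = 0" for x using nrm[of x] norm_eq_zero by metis
  then have iff: "f x \<in> K \<longleftrightarrow> x \<in> K" for x unfolding K by (simp add: dot nrm)
  from f have "surj f" using orthogonal_transformation_surj by blast
  show "f ` K = K"
  proof
    show "f ` K \<subseteq> K" using iff by auto
    show "K \<subseteq> f ` K"
    proof
      fix y assume "y \<in> K"
      moreover obtain x where "y = f x" using \<open>surj f\<close> by (metis surjD)
      ultimately show "y \<in> f ` K" using iff by auto
    qed
  qed
qed

lemma partial_deriv_affine:
  "partial_deriv i (\<lambda>x::real^'n. c + x \<bullet> w) = (\<lambda>x. axis i 1 \<bullet> w + x \<bullet> 0)"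
  unfolding partial_deriv_def
  by (rule ext, rule DERIV_imp_deriv)
     (auto intro!: derivative_eq_intros simp: inner_add_left)

lemma foldr_partial_deriv_affine:
  "\<exists>c' w'. foldr partial_deriv l (\<lambda>x::real^'n. c + x \<bullet> w) = (\<lambda>x. c' + x \<bullet> w')"
proof (induction l)
  case Nil
  show ?case by auto
next
  case (Cons i l)
  then show ?case using partial_deriv_affine by (metis foldr_Cons o_apply)
qed

lemma smooth_on_affine: "smooth_on U (\<lambda>x::real^'n. c + x \<bullet> w)"
  unfolding smooth_on_def
proof (intro allI ballI)
  fix l :: "'n list" and x :: "real^'n"
  obtain c' w' where *:
    "foldr partial_deriv l (\<lambda>x::real^'n. c + x \<bullet> w) = (\<lambda>x. c' + x \<bullet> w')"
    using foldr_partial_deriv_affine[of l c w] by (elim exE)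
  show "foldr partial_deriv l (\<lambda>x::real^'n. c + x \<bullet> w) differentiable (at x)"
    unfolding * by (rule differentiableI) (auto intro!: derivative_eq_intros)
qed

lemma smooth_sphere_domain_cap:
  fixes e :: "real^'n"
  assumes e: "norm e = 1" and \<gamma>: "0 < \<gamma>" "\<gamma> < pi"
  shows "smooth_sphere_domain {x \<in> sphere 0 1. cos \<gamma> < x \<bullet> e}"
proof -
  let ?S = "sphere 0 1 :: (real^'n) set"
  let ?C = "{x \<in> ?S. cos \<gamma> < x \<bullet> e}"
  let ?T = "top_of_set ?S"
  have ee: "e \<bullet> e = 1" using e by (simp add: dot_square_norm)
  have c1: "cos \<gamma> < 1" using \<gamma> cos_monotone_0_pi[of 0 \<gamma>] by simp
  have c2: "-1 < cos \<gamma>" using \<gamma> cos_monotone_0_pi[of \<gamma> pi] by simp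
  have eC: "e \<in> ?C" using e ee c1 by simp
  have conn: "\<exists>T. connected T \<and> T \<subseteq> ?C \<and> e \<in> T \<and> \<xi> \<in> T" if \<xi>: "\<xi> \<in> ?C" for \<xi>
  proof -
    define s where "s = \<xi> \<bullet> e"
    have n\<xi>: "norm \<xi> = 1" using \<xi> by simp
    have \<xi>\<xi>: "\<xi> \<bullet> \<xi> = 1" using n\<xi> by (simp add: dot_square_norm)
    have s: "cos \<gamma> < s" using \<xi> by (simp add: s_def)
    have s1: "\<bar>s\<bar> \<le> 1" using Cauchy_Schwarz_ineq2[of \<xi> e] n\<xi> e by (simp add: s_def)
    define y where "y t = (1 - t) *\<^sub>R \<xi> + t *\<^sub>R e" for t
    have dy: "y t \<bullet> e = (1 - t) * s + t" for t
      by (simp add: y_def inner_add_left s_def ee)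
    have ny2: "(norm (y t))\<^sup>2 = (1 - t)\<^sup>2 + 2 * t * (1 - t) * s + t\<^sup>2" for t
      unfolding power2_norm_eq_inner y_def
      by (simp add: inner_add_left inner_add_right s_def inner_commute[of e \<xi>]
          \<xi>\<xi> ee power2_eq_square algebra_simps)
    have y0: "y t \<noteq> 0" if "t \<in> {0..1}" for t
    proof
      assume "y t = 0"
      then have yt: "(1 - t) *\<^sub>R \<xi> = - (t *\<^sub>R e)" unfolding y_def by (simp add: eq_neg_iff_add_eq_0)
      then have "norm ((1 - t) *\<^sub>R \<xi>) = norm (t *\<^sub>R e)" by simp
      then have t: "t = 1/2" using that n\<xi> e by simp
      have "(1 - t) * s + t = 0" using \<open>y t = 0\<close> dy[of t] by simp
      then have "s = -1" using t by simp
      with s c2 show False by simp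
    qed
    have key: "s * norm (y t) \<le> y t \<bullet> e" if t: "t \<in> {0..1}" for t
    proof (cases "0 \<le> y t \<bullet> e")
      case True
      show ?thesis
      proof (cases "0 \<le> s")
        case True
        have "norm (y t) \<le> (1 - t) * 1 + t * 1"
          unfolding y_def using t n\<xi> e norm_triangle_ineq[of "(1 - t) *\<^sub>R \<xi>" "t *\<^sub>R e"] by simp
        then have "s * norm (y t) \<le> s * 1" using True by (intro mult_left_mono) auto
        also have "s \<le> (1 - t) * s + t" using t s1 mult_left_le[of s t] by (simp add: algebra_simps)
        finally show ?thesis by (simp add: dy)
      next
        case False
        then have "s * norm (y t) \<le> 0" by (simp add: mult_nonpos_nonneg)
        with \<open>0 \<le> y t \<bullet> e\<close> show ?thesis by simp
      qed
    next
      case False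
      then have neg: "(1 - t) * s + t < 0" by (simp add: dy)
      then have s0: "s < 0" using t by (smt (verit) atLeastAtMost_iff mult_nonneg_nonneg)
      have "((1 - t) * s + t)\<^sup>2 - s\<^sup>2 * (norm (y t))\<^sup>2 = (1 - s\<^sup>2) * (t * (2 * ((1 - t) * s) + t))"
        unfolding ny2 by (simp add: power2_eq_square algebra_simps)
      also have "\<dots> \<le> 0"
      proof (rule mult_nonneg_nonpos)
        show "0 \<le> 1 - s\<^sup>2" using s1 by (simp add: abs_square_le_1)
        show "t * (2 * ((1 - t) * s) + t) \<le> 0"
          using t neg by (intro mult_nonneg_nonpos) auto
      qed
      finally have "((1 - t) * s + t)\<^sup>2 \<le> (s * norm (y t))\<^sup>2" by (simp add: power_mult_distrib)
      then have "\<bar>(1 - t) * s + t\<bar> \<le> \<bar>s * norm (y t)\<bar>" by (simp add: abs_le_square_iff)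
      moreover have "s * norm (y t) \<le> 0" using s0 by (simp add: mult_nonpos_nonneg)
      ultimately show ?thesis using neg by (simp add: dy)
    qed
    let ?P = "(\<lambda>t. y t /\<^sub>R norm (y t)) ` {0..1}"
    have "connected ?P"
      using y0 unfolding y_def
      by (intro connected_continuous_image continuous_intros connected_Icc) auto
    moreover have "?P \<subseteq> ?C"
    proof
      fix z assume "z \<in> ?P"
      then obtain t where t: "t \<in> {0..1}" and z: "z = y t /\<^sub>R norm (y t)" by blast
      have "cos \<gamma> * norm (y t) < s * norm (y t)" using s y0[OF t] by simp
      then have "cos \<gamma> * norm (y t) < y t \<bullet> e" using key[OF t] by linarith
      then show "z \<in> ?C"
        using y0[OF t] by (simp add: z field_simps)
    qed
    moreover have "\<xi> = y 0 /\<^sub>R norm (y 0)" "e = y 1 /\<^sub>R norm (y 1)"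
      using n\<xi> e by (simp_all add: y_def)
    then have "\<xi> \<in> ?P" "e \<in> ?P" by force+
    ultimately show ?thesis by blast
  qed
  have "connected ?C"
  proof -
    have *: "connected_component ?C e \<xi>" if "\<xi> \<in> ?C" for \<xi>
      unfolding connected_component_def using conn[OF that] .
    show ?thesis
      unfolding connected_iff_connected_component
    proof (intro ballI)
      fix x y assume x: "x \<in> ?C" and y: "y \<in> ?C"
      show "connected_component ?C x y"
        by (rule connected_component_trans[OF connected_component_sym[OF *[OF x]] *[OF y]])
    qed
  qed
  moreover have op: "openin ?T ?C"
  proof -
    have "open {x. cos \<gamma> < x \<bullet> e}" by (intro open_Collect_less continuous_intros)
    moreover have "?C = ?S \<inter> {x. cos \<gamma> < x \<bullet> e}" by auto
    ultimately show ?thesis by (metis openin_open_Int)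
  qed
  moreover have "\<exists>U \<rho>. open U \<and> \<xi> \<in> U \<and> smooth_on U \<rho> \<and>
        (\<exists>v. v \<bullet> \<xi> = 0 \<and> frechet_derivative \<rho> (at \<xi>) v \<noteq> 0) \<and>
        ?C \<inter> U = {x \<in> ?S \<inter> U. \<rho> x < 0}" if fr: "\<xi> \<in> ?T frontier_of ?C" for \<xi>
  proof -
    have \<xi>S: "\<xi> \<in> ?S" using fr frontier_of_subset_topspace[of ?T ?C] by auto
    have "\<xi> \<notin> ?C" using fr op by (simp add: frontier_of_def interior_of_openin)
    moreover have "cos \<gamma> \<le> \<xi> \<bullet> e"
    proof -
      have "closed {x. cos \<gamma> \<le> x \<bullet> e}" by (intro closed_Collect_le continuous_intros)
      then have "closedin ?T (?S \<inter> {x. cos \<gamma> \<le> x \<bullet> e})" by (rule closedin_closed_Int)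
      then have "?T closure_of ?C \<subseteq> ?S \<inter> {x. cos \<gamma> \<le> x \<bullet> e}"
        by (intro closure_of_minimal) auto
      then show ?thesis using fr by (auto simp: frontier_of_def)
    qed
    ultimately have \<xi>e: "\<xi> \<bullet> e = cos \<gamma>" using \<xi>S by auto
    let ?\<rho> = "\<lambda>x. cos \<gamma> + x \<bullet> (- e)"
    let ?v = "e - cos \<gamma> *\<^sub>R \<xi>"
    have "(?\<rho> has_derivative (\<lambda>v. v \<bullet> (- e))) (at \<xi>)"
      by (auto intro!: derivative_eq_intros)
    then have D: "frechet_derivative ?\<rho> (at \<xi>) = (\<lambda>v. v \<bullet> (- e))"
      using frechet_derivative_at by metis
    have "?v \<bullet> \<xi> = 0" using \<xi>e \<xi>S by (simp add: inner_diff_left inner_commute[of e \<xi>] dot_square_norm)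
    moreover have "?v \<bullet> e \<noteq> 0"
    proof -
      have "?v \<bullet> e = 1 - (cos \<gamma>)\<^sup>2" using \<xi>e ee by (simp add: inner_diff_left power2_eq_square)
      also have "\<dots> = (sin \<gamma>)\<^sup>2" by (simp add: sin_squared_eq)
      also have "\<dots> \<noteq> 0" using sin_gt_zero[OF \<gamma>] by simp
      finally show ?thesis .
    qed
    ultimately have "\<exists>v. v \<bullet> \<xi> = 0 \<and> frechet_derivative ?\<rho> (at \<xi>) v \<noteq> 0"
      unfolding D by (intro exI[of _ ?v]) simp
    moreover have "?C \<inter> UNIV = {x \<in> ?S \<inter> UNIV. ?\<rho> x < 0}" by auto
    ultimately show ?thesis
      by (intro exI[of _ UNIV] exI[of _ ?\<rho>]) (simp add: smooth_on_affine del: inner_minus_right)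
  qed
  ultimately show ?thesis unfolding smooth_sphere_domain_def using eC by blast
qed

lemma has_opening_angle_imp_infinite_smooth_cone:
  assumes "has_opening_angle k \<gamma> K" and \<gamma>: "0 < \<gamma>" "\<gamma> < pi"
  shows "infinite_smooth_cone K"
proof -
  from assms(1) obtain e where "e = axis k 1 \<or> e = - axis k 1"
    and K: "K = {x. x \<noteq> 0 \<and> arccos ((x \<bullet> e) / norm x) < \<gamma>}"
    unfolding has_opening_angle_def by blast
  then have e: "norm e = 1" by auto
  have "arccos ((x \<bullet> e) / norm x) < \<gamma> \<longleftrightarrow> cos \<gamma> < (x /\<^sub>R norm x) \<bullet> e" if "x \<noteq> 0" for x
  proof -
    have b: "\<bar>(x \<bullet> e) / norm x\<bar> \<le> 1"
      using Cauchy_Schwarz_ineq2[of x e] e that by (simp add: field_simps)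
    have "arccos ((x \<bullet> e) / norm x) < arccos (cos \<gamma>) \<longleftrightarrow> cos \<gamma> < (x \<bullet> e) / norm x"
      using b by (intro arccos_less_mono) auto
    then show ?thesis using \<gamma> by (simp add: arccos_cos field_simps)
  qed
  then have "K = {x. 0 < norm x \<and> x /\<^sub>R norm x \<in> {x \<in> sphere 0 1. cos \<gamma> < x \<bullet> e}}"
    unfolding K by auto
  then show ?thesis
    unfolding infinite_smooth_cone_def using smooth_sphere_domain_cap[OF e \<gamma>] by blast
qed

end

theory Submission
  imports Defs
begin

text \<open>
  Sufficiency. Weak derivatives are recovered from their increments along almost every segment,
  so a lower-order derivative is controlled by averages, over a small cone of segments, of the
  derivatives of order \<open>m\<close> together with lower-order terms at scale \<open>\<rho>\<close>. For points at distance about \<open>\<rho>\<close> from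
  the vertex this bounds products of derivatives of total order at most \<open>m\<close> in \<open>L\<^sup>p\<close>: by Jensen's
  inequality if \<open>m > d/p\<close>, and for \<open>p = 1\<close>, \<open>m = d\<close> by a Gagliardo-type argument that distributes \<open>d\<close>
  linearly independent directions between the two factors. After scaling, the constants on
  the dyadic shells are \<open>O(\<rho> powr (a - d/p))\<close>, hence bounded since \<open>a \<ge> d/p\<close>, and the Leibniz rule finishes.

  Necessity. If \<open>w = 1\<close> on an open set, the norms of the powers \<open>w ^ n\<close> are bounded below, whereas in an
  algebra they decay geometrically once the norm of \<open>w\<close> is small. If \<open>a < d/p\<close>, small plateaus arise by dilating a bump
  towards the vertex; if \<open>m\<close> is too small, by averaging bumps at lacunary scales around an interior point.\<close>

section \<open>Smooth functions\<close>

text \<open>Averaged over a ball of directions, the segment bounds become Riesz-type potentials of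
  order \<open>m - i\<close>. In the p-th power of a potential part of the smoothing can be traded
  for integrability. For factors of orders \<open>i + i' \<le> m\<close>, both below
  \<open>m\<close>, the amount d/p to be gained is split in proportion to \<open>m - i\<close> and
  \<open>m - i'\<close>, and d/p < m leaves both kernels integrable. At p = 1, m = d this margin is
  gone: the corresponding double integral over the two scales diverges logarithmically. There one
  factor is bounded by an integral along q directions and the other along the remaining d - q;
  integration in \<open>x\<close> joins them to a single integral over the whole space, in which no
  singular kernel is left.

  The Leibniz rule is proved by integration by parts on almost every line, since only local
  integrability of the products is at hand. The cone may fail to be convex and its truncation adds a
  second boundary piece, so the directions of the segments depend on the position of the point;
  compactness of the sphere leaves finitely many of them, and all constants are chosen before the
  scale.\<close>

abbreviation smooth :: "(real^'n \<Rightarrow> real) \<Rightarrow> bool" where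
  "smooth f \<equiv> smooth_on UNIV f"

abbreviation gradient_form :: "('n \<Rightarrow> real^'n \<Rightarrow> real) \<Rightarrow> real^'n \<Rightarrow> real^'n \<Rightarrow> real" where
  "gradient_form g x v \<equiv> \<Sum>i\<in>UNIV. v $ i * g i x"

lemma partial_deriv_eq:
  assumes "(f has_derivative D) (at x)"
  shows "partial_deriv i f x = D (axis i 1)"
proof -
  have "((\<lambda>t. f (x + t *\<^sub>R axis i 1)) has_derivative (\<lambda>t. D (t *\<^sub>R axis i 1))) (at 0)"
    by (rule has_derivative_compose[where f="\<lambda>t. x + t *\<^sub>R axis i 1"])
       (auto intro!: derivative_eq_intros simp: assms)
  moreover have "D (t *\<^sub>R axis i 1) = D (axis i 1) * t" for t
    using has_derivative_linear[OF assms] by (simp add: linear_scale)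
  ultimately have "((\<lambda>t. f (x + t *\<^sub>R axis i 1)) has_field_derivative D (axis i 1)) (at 0)"
    by (simp add: has_field_derivative_def)
  then show ?thesis unfolding partial_deriv_def by (rule DERIV_imp_deriv)
qed

lemma partial_deriv_gradient_form:
  assumes "\<And>x. (f has_derivative gradient_form g x) (at x)"
  shows "partial_deriv i f = g i"
proof
  fix x
  have "partial_deriv i f x = (\<Sum>j\<in>UNIV. (axis i 1 :: real^'a) $ j * g j x)"
    using partial_deriv_eq[OF assms] .
  also have "\<dots> = (\<Sum>j\<in>UNIV. if j = i then g j x else 0)"
    by (intro sum.cong) (auto simp: axis_def)
  finally show "partial_deriv i f x = g i x" by simp
qed

text \<open>Smoothness speaks of all iterated partial derivatives at once. A class of functions
  stable under partial derivatives contains all of them, so it suffices to name such a class; higher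
  derivatives are never written out.\<close>

lemma smooth_coinduct:
  assumes "f \<in> X"
    and step: "\<And>g. g \<in> X \<Longrightarrow> \<exists>g'. (\<forall>i. g' i \<in> X) \<and> (\<forall>x. (g has_derivative gradient_form g' x) (at x))"
  shows "smooth f"
proof -
  have *: "foldr partial_deriv l f \<in> X" for l
  proof (induction l)
    case (Cons i l)
    obtain g' where g': "\<forall>i. g' i \<in> X" "\<forall>x. (foldr partial_deriv l f has_derivative gradient_form g' x) (at x)"
      using step[OF Cons] by auto
    have "partial_deriv i (foldr partial_deriv l f) = g' i"
      using g' by (intro partial_deriv_gradient_form) auto
    then show ?case using g' by simp
  qed (use assms in simp)
  show ?thesis unfolding smooth_on_def differentiable_def using step[OF *] by blast
qed

lemma smooth_partial_deriv: "smooth f \<Longrightarrow> smooth (partial_deriv i f)"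
  unfolding smooth_on_def
proof (intro allI ballI)
  fix l x assume "\<forall>l. \<forall>x\<in>UNIV. foldr partial_deriv l f differentiable at x"
  then have "foldr partial_deriv (l @ [i]) f differentiable at x" by blast
  then show "foldr partial_deriv l (partial_deriv i f) differentiable at x" by simp
qed

lemma smooth_has_derivative:
  fixes f :: "real^'n \<Rightarrow> real"
  assumes "smooth f"
  shows "(f has_derivative gradient_form (\<lambda>i. partial_deriv i f) x) (at x)"
proof -
  have "foldr partial_deriv [] f differentiable at x"
    using assms unfolding smooth_on_def by blast
  then obtain D where D: "(f has_derivative D) (at x)" by (auto simp: differentiable_def)
  have "D v = gradient_form (\<lambda>i. partial_deriv i f) x v" for v
  proof -
    have "D v = D (\<Sum>i\<in>UNIV. v $ i *\<^sub>R axis i 1)"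
      using basis_expansion[of v] by (simp add: scalar_mult_eq_scaleR)
    also have "\<dots> = (\<Sum>i\<in>UNIV. v $ i * D (axis i 1))"
      using has_derivative_linear[OF D] by (simp add: linear_sum linear_scale)
    finally show ?thesis by (simp add: partial_deriv_eq[OF D])
  qed
  then have "D = gradient_form (\<lambda>i. partial_deriv i f) x" by auto
  with D show ?thesis by simp
qed

lemma smooth_continuous: "smooth f \<Longrightarrow> continuous_on S f"
  by (meson continuous_at_imp_continuous_on has_derivative_continuous smooth_has_derivative)

lemma smooth_borel [measurable_dest]: "smooth f \<Longrightarrow> f \<in> borel_measurable borel"
  by (intro borel_measurable_continuous_onI smooth_continuous)

lemma smooth_line_deriv:
  assumes "smooth f"
  shows "((\<lambda>t. f (x + t *\<^sub>R v)) has_real_derivative gradient_form (\<lambda>i. partial_deriv i f) (x + t *\<^sub>R v) v) (at t)"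
proof -
  have "((\<lambda>t. f (x + t *\<^sub>R v)) has_derivative
      (\<lambda>s. gradient_form (\<lambda>i. partial_deriv i f) (x + t *\<^sub>R v) (s *\<^sub>R v))) (at t)"
    by (rule has_derivative_compose[where f="\<lambda>t. x + t *\<^sub>R v"])
       (auto intro!: derivative_eq_intros simp: smooth_has_derivative[OF assms])
  moreover have "gradient_form (\<lambda>i. partial_deriv i f) (x + t *\<^sub>R v) (s *\<^sub>R v)
      = gradient_form (\<lambda>i. partial_deriv i f) (x + t *\<^sub>R v) v * s" for s
    by (simp add: sum_distrib_right) (intro sum.cong, auto)
  ultimately show ?thesis by (simp add: has_field_derivative_def)
qed

section \<open>Sums, products and powers of smooth functions\<close>

lemma smooth_add:
  assumes "smooth f" "smooth g"
  shows "smooth (\<lambda>x. f x + g x)"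
proof (rule smooth_coinduct)
  let ?X = "{\<lambda>x. f x + g x | f g. smooth f \<and> smooth g}"
  show "(\<lambda>x. f x + g x) \<in> ?X" using assms by blast
  fix h assume "h \<in> ?X"
  then obtain f g where h: "h = (\<lambda>x. f x + g x)" and f: "smooth f" and g: "smooth g" by blast
  let ?h = "\<lambda>i x. partial_deriv i f x + partial_deriv i g x"
  have "(h has_derivative gradient_form ?h x) (at x)" for x
    unfolding h
    by (rule has_derivative_eq_rhs[OF has_derivative_add[OF smooth_has_derivative[OF f] smooth_has_derivative[OF g]]])
       (simp add: sum.distrib distrib_left)
  moreover have "?h i \<in> ?X" for i using smooth_partial_deriv f g by blast
  ultimately show "\<exists>g'. (\<forall>i. g' i \<in> ?X) \<and> (\<forall>x. (h has_derivative gradient_form g' x) (at x))"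
    by (intro exI[of _ ?h] conjI allI)
qed

lemma smooth_mult:
  assumes "smooth f" "smooth g"
  shows "smooth (\<lambda>x. f x * g x)"
proof (rule smooth_coinduct)
  \<comment> \<open>Single products are not stable under differentiation, but finite sums of
    products are. Lists keep all terms that the product rule produces, repetitions included.\<close>
  let ?S = "\<lambda>L x. \<Sum>(a, b)\<leftarrow>L. a x * b x"
  let ?P = "\<lambda>L. \<forall>(a, b)\<in>set L. smooth a \<and> smooth b"
  let ?D = "\<lambda>i L. map (\<lambda>(a, b). (partial_deriv i a, b)) L @ map (\<lambda>(a, b). (a, partial_deriv i b)) L"
  let ?X = "{?S L | L. ?P L}"
  have "(\<lambda>x. f x * g x) = ?S [(f, g)]" by simp
  moreover have "?P [(f, g)]" using assms by simp
  ultimately show "(\<lambda>x. f x * g x) \<in> ?X" by blast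
  fix h assume "h \<in> ?X"
  then obtain L where h: "h = ?S L" and L: "?P L" by blast
  have "(?S L has_derivative gradient_form (\<lambda>i. ?S (?D i L)) x) (at x)" for x
    using L
  proof (induction L)
    case Nil
    then show ?case by simp
  next
    case (Cons ab L)
    obtain a b where ab: "ab = (a, b)" by (cases ab)
    have sm: "smooth a" "smooth b" using Cons.prems ab by auto
    have "(?S L has_derivative gradient_form (\<lambda>i. ?S (?D i L)) x) (at x)"
      using Cons by auto
    from has_derivative_add[OF has_derivative_mult[OF smooth_has_derivative[OF sm(1)] smooth_has_derivative[OF sm(2)]] this]
    have "((\<lambda>x. a x * b x + ?S L x) has_derivative gradient_form (\<lambda>i. ?S (?D i (ab # L))) x) (at x)"
      by (rule has_derivative_eq_rhs)
         (simp add: fun_eq_iff ab distrib_left sum.distrib sum_distrib_left sum_distrib_right mult.assoc mult.left_commute)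
    then show ?case by (simp add: ab)
  qed
  moreover have "?P (?D i L)" for i using L smooth_partial_deriv by fastforce
  then have "?S (?D i L) \<in> ?X" for i by blast
  ultimately show "\<exists>g'. (\<forall>i. g' i \<in> ?X) \<and> (\<forall>x. (h has_derivative gradient_form g' x) (at x))"
    unfolding h by (intro exI[of _ "\<lambda>i. ?S (?D i L)"] conjI allI)
qed

lemma smooth_const: "smooth (\<lambda>x::real^'n. c)"
  using smooth_on_affine[of UNIV c 0] by simp

lemma smooth_cmult: "smooth f \<Longrightarrow> smooth (\<lambda>x. c * f x)"
  by (intro smooth_mult smooth_const)

lemma smooth_power: "smooth f \<Longrightarrow> smooth (\<lambda>x. f x ^ k)"
  by (induction k) (auto intro: smooth_const smooth_mult)

lemma smooth_sum: "(\<And>k. k \<in> A \<Longrightarrow> smooth (f k)) \<Longrightarrow> smooth (\<lambda>x. \<Sum>k\<in>A. f k x)"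
  by (induction A rule: infinite_finite_induct) (auto intro: smooth_const smooth_add)

lemma smooth_prod: "(\<And>k. k \<in> A \<Longrightarrow> smooth (f k)) \<Longrightarrow> smooth (\<lambda>x. \<Prod>k\<in>A. f k x)"
  by (induction A rule: infinite_finite_induct) (auto intro: smooth_const smooth_mult)

section \<open>Affine changes of variables and finite sums\<close>

lemma affine_has_derivative:
  assumes "smooth f"
  shows "((\<lambda>x. k * f (c *\<^sub>R (x - a))) has_derivative
    gradient_form (\<lambda>i x. (k * c) * partial_deriv i f (c *\<^sub>R (x - a))) x) (at x)"
proof -
  have "((\<lambda>x. f (c *\<^sub>R (x - a))) has_derivative
      (\<lambda>v. gradient_form (\<lambda>i. partial_deriv i f) (c *\<^sub>R (x - a)) (c *\<^sub>R v))) (at x)"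
    by (rule has_derivative_compose[where f="\<lambda>x. c *\<^sub>R (x - a)"])
       (auto intro!: derivative_eq_intros simp: smooth_has_derivative[OF assms])
  from has_derivative_mult_right[OF this, of k] show ?thesis
    by (rule has_derivative_eq_rhs) (auto simp: sum_distrib_left mult_ac)
qed

lemma smooth_affine:
  assumes "smooth f"
  shows "smooth (\<lambda>x. f (c *\<^sub>R (x - a)))"
proof (rule smooth_coinduct)
  let ?X = "{\<lambda>x. k * g (c *\<^sub>R (x - a)) | k g. smooth g}"
  show "(\<lambda>x. f (c *\<^sub>R (x - a))) \<in> ?X"
    using assms by (auto intro!: exI[of _ 1] exI[of _ f])
  fix h assume "h \<in> ?X"
  then obtain k g where h: "h = (\<lambda>x. k * g (c *\<^sub>R (x - a)))" and g: "smooth g" by blast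
  show "\<exists>g'. (\<forall>i. g' i \<in> ?X) \<and> (\<forall>x. (h has_derivative gradient_form g' x) (at x))"
    unfolding h using affine_has_derivative[OF g, of k c a] smooth_partial_deriv[OF g]
    by (intro exI[of _ "\<lambda>i x. (k * c) * partial_deriv i g (c *\<^sub>R (x - a))"]) blast
qed

lemma partial_deriv_affine_comp:
  assumes "smooth f"
  shows "partial_deriv i (\<lambda>x. k * f (c *\<^sub>R (x - a))) = (\<lambda>x. (k * c) * partial_deriv i f (c *\<^sub>R (x - a)))"
  by (rule partial_deriv_gradient_form) (rule affine_has_derivative[OF assms])

lemma partial_deriv_sum:
  assumes "finite A" "\<And>k. k \<in> A \<Longrightarrow> smooth (f k)"
  shows "partial_deriv i (\<lambda>x. \<Sum>k\<in>A. f k x) = (\<lambda>x. \<Sum>k\<in>A. partial_deriv i (f k) x)"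
proof (rule partial_deriv_gradient_form)
  fix x
  have "((\<lambda>x. \<Sum>k\<in>A. f k x) has_derivative (\<lambda>v. \<Sum>k\<in>A. gradient_form (\<lambda>i. partial_deriv i (f k)) x v)) (at x)"
    by (intro has_derivative_sum smooth_has_derivative assms)
  also have "(\<lambda>v. \<Sum>k\<in>A. gradient_form (\<lambda>i. partial_deriv i (f k)) x v) =
     gradient_form (\<lambda>i x. \<Sum>k\<in>A. partial_deriv i (f k) x) x"
    by (rule ext) (simp add: sum_distrib_left, rule sum.swap)
  finally show "((\<lambda>x. \<Sum>k\<in>A. f k x) has_derivative gradient_form (\<lambda>i x. \<Sum>k\<in>A. partial_deriv i (f k) x) x) (at x)" .
qed

subsection \<open>Mixed partial derivatives\<close>

text \<open>The mixed second difference is symmetric in the two directions. The mean value theorem,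
  applied once in each direction, turns it into a mixed derivative at a nearby point, and doing so
  in both orders makes the derivatives commute.\<close>

lemma second_difference:
  assumes f: "smooth f" and h: "0 < (h::real)"
  shows "\<exists>s\<in>{0<..<h}. \<exists>t\<in>{0<..<h}.
    f (x + h *\<^sub>R axis i 1 + h *\<^sub>R axis j 1) - f (x + h *\<^sub>R axis i 1) - f (x + h *\<^sub>R axis j 1) + f x
     = h * h * partial_deriv j (partial_deriv i f) (x + s *\<^sub>R axis i 1 + t *\<^sub>R axis j 1)"
proof -
  have line: "((\<lambda>t. g (y + t *\<^sub>R axis k 1)) has_real_derivative partial_deriv k g (y + t *\<^sub>R axis k 1)) (at t)"
    if "smooth g" for g y k t
  proof -
    have "gradient_form (\<lambda>i. partial_deriv i g) (y + t *\<^sub>R axis k 1) (axis k 1)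
      = (\<Sum>j\<in>UNIV. if j = k then partial_deriv j g (y + t *\<^sub>R axis k 1) else 0)"
      by (intro sum.cong) (auto simp: axis_def)
    then show ?thesis using smooth_line_deriv[OF that, of y "axis k 1" t] by simp
  qed
  let ?p = "\<lambda>s. f ((x + h *\<^sub>R axis j 1) + s *\<^sub>R axis i 1) - f (x + s *\<^sub>R axis i 1)"
  let ?p' = "\<lambda>s. partial_deriv i f ((x + h *\<^sub>R axis j 1) + s *\<^sub>R axis i 1) - partial_deriv i f (x + s *\<^sub>R axis i 1)"
  have "\<exists>s>0. s < h \<and> ?p h - ?p 0 = (h - 0) * ?p' s"
    by (rule MVT2[OF h]) (intro DERIV_diff line f)
  then obtain s where s: "0 < s" "s < h" and e1: "?p h - ?p 0 = h * ?p' s" by auto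
  let ?q = "\<lambda>t. partial_deriv i f ((x + s *\<^sub>R axis i 1) + t *\<^sub>R axis j 1)"
  let ?q' = "\<lambda>t. partial_deriv j (partial_deriv i f) ((x + s *\<^sub>R axis i 1) + t *\<^sub>R axis j 1)"
  have "\<exists>t>0. t < h \<and> ?q h - ?q 0 = (h - 0) * ?q' t"
    by (rule MVT2[OF h]) (intro line smooth_partial_deriv f)
  then obtain t where t: "0 < t" "t < h" and e2: "?q h - ?q 0 = h * ?q' t" by auto
  have "f (x + h *\<^sub>R axis i 1 + h *\<^sub>R axis j 1) - f (x + h *\<^sub>R axis i 1) - f (x + h *\<^sub>R axis j 1) + f x = ?p h - ?p 0"
    by (simp add: algebra_simps)
  also have "\<dots> = h * (?q h - ?q 0)" unfolding e1 by (simp add: algebra_simps)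
  also have "\<dots> = h * h * ?q' t" unfolding e2 by simp
  finally show ?thesis using s t by (intro bexI[of _ s] bexI[of _ t]) auto
qed

lemma partial_deriv_commute:
  assumes f: "smooth f"
  shows "partial_deriv i (partial_deriv j f) = partial_deriv j (partial_deriv i f)"
proof
  fix x
  have *: "(\<lambda>n. partial_deriv j (partial_deriv i f) (x + s n *\<^sub>R axis i 1 + t n *\<^sub>R axis j 1))
    \<longlonglongrightarrow> partial_deriv j (partial_deriv i f) x"
    if st: "\<forall>n. s n \<in> {0<..<1 / real (Suc n)}" "\<forall>n. t n \<in> {0<..<1 / real (Suc n)}" for i j s t
  proof -
    have z: "(\<lambda>n. 1 / real (Suc n)) \<longlonglongrightarrow> 0" using lim_1_over_n by (rule LIMSEQ_Suc)
    have s0: "s \<longlonglongrightarrow> 0" using st by (intro tendsto_sandwich[OF _ _ tendsto_const z] always_eventually allI)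
      (auto simp: less_eq_real_def)
    have t0: "t \<longlonglongrightarrow> 0" using st by (intro tendsto_sandwich[OF _ _ tendsto_const z] always_eventually allI)
      (auto simp: less_eq_real_def)
    have "(\<lambda>n. x + s n *\<^sub>R axis i 1 + t n *\<^sub>R axis j 1) \<longlonglongrightarrow> x + 0 *\<^sub>R axis i 1 + 0 *\<^sub>R axis j 1"
      by (intro tendsto_intros s0 t0)
    moreover have "isCont (partial_deriv j (partial_deriv i f)) x"
      using smooth_has_derivative[OF smooth_partial_deriv[OF smooth_partial_deriv[OF f]]]
        has_derivative_continuous by blast
    ultimately show ?thesis
      using isCont_tendsto_compose[of x "partial_deriv j (partial_deriv i f)" _ sequentially] by simp
  qed
  \<comment> \<open>The step 1/(n+1) gives one second difference, hence one equality between the two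
    mixed derivatives at two points that both tend to \<open>x\<close>; continuity does the
    rest.\<close>
  have "\<forall>n. \<exists>s\<in>{0<..<1 / real (Suc n)}. \<exists>t\<in>{0<..<1 / real (Suc n)}.
     \<exists>s'\<in>{0<..<1 / real (Suc n)}. \<exists>t'\<in>{0<..<1 / real (Suc n)}.
     partial_deriv j (partial_deriv i f) (x + s *\<^sub>R axis i 1 + t *\<^sub>R axis j 1) =
     partial_deriv i (partial_deriv j f) (x + s' *\<^sub>R axis j 1 + t' *\<^sub>R axis i 1)"
  proof
    fix n
    let ?h = "1 / real (Suc n)"
    have h: "0 < ?h" by simp
    obtain s t where a: "s \<in> {0<..<?h}" "t \<in> {0<..<?h}"
      "f (x + ?h *\<^sub>R axis i 1 + ?h *\<^sub>R axis j 1) - f (x + ?h *\<^sub>R axis i 1) - f (x + ?h *\<^sub>R axis j 1) + f x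
       = ?h * ?h * partial_deriv j (partial_deriv i f) (x + s *\<^sub>R axis i 1 + t *\<^sub>R axis j 1)"
      using second_difference[OF f h] by blast
    obtain s' t' where b: "s' \<in> {0<..<?h}" "t' \<in> {0<..<?h}"
      "f (x + ?h *\<^sub>R axis j 1 + ?h *\<^sub>R axis i 1) - f (x + ?h *\<^sub>R axis j 1) - f (x + ?h *\<^sub>R axis i 1) + f x
       = ?h * ?h * partial_deriv i (partial_deriv j f) (x + s' *\<^sub>R axis j 1 + t' *\<^sub>R axis i 1)"
      using second_difference[OF f h] by blast
    have "x + ?h *\<^sub>R axis j 1 + ?h *\<^sub>R axis i 1 = x + ?h *\<^sub>R axis i 1 + ?h *\<^sub>R axis j 1"
      by (simp add: algebra_simps)
    then have "?h * ?h * partial_deriv j (partial_deriv i f) (x + s *\<^sub>R axis i 1 + t *\<^sub>R axis j 1) =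
      ?h * ?h * partial_deriv i (partial_deriv j f) (x + s' *\<^sub>R axis j 1 + t' *\<^sub>R axis i 1)"
      using a(3) b(3) by (simp only:)
    then have "partial_deriv j (partial_deriv i f) (x + s *\<^sub>R axis i 1 + t *\<^sub>R axis j 1) =
      partial_deriv i (partial_deriv j f) (x + s' *\<^sub>R axis j 1 + t' *\<^sub>R axis i 1)"
      using h by simp
    then show "\<exists>s\<in>{0<..<?h}. \<exists>t\<in>{0<..<?h}. \<exists>s'\<in>{0<..<?h}. \<exists>t'\<in>{0<..<?h}.
     partial_deriv j (partial_deriv i f) (x + s *\<^sub>R axis i 1 + t *\<^sub>R axis j 1) =
     partial_deriv i (partial_deriv j f) (x + s' *\<^sub>R axis j 1 + t' *\<^sub>R axis i 1)"
      using a(1,2) b(1,2) by blast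
  qed
  then obtain s t s' t' where
    st: "\<forall>n. s n \<in> {0<..<1 / real (Suc n)}" "\<forall>n. t n \<in> {0<..<1 / real (Suc n)}"
     "\<forall>n. s' n \<in> {0<..<1 / real (Suc n)}" "\<forall>n. t' n \<in> {0<..<1 / real (Suc n)}"
    and eq: "\<And>n. partial_deriv j (partial_deriv i f) (x + s n *\<^sub>R axis i 1 + t n *\<^sub>R axis j 1) =
     partial_deriv i (partial_deriv j f) (x + s' n *\<^sub>R axis j 1 + t' n *\<^sub>R axis i 1)"
    unfolding Bex_def by metis
  have "(\<lambda>n. partial_deriv j (partial_deriv i f) (x + s n *\<^sub>R axis i 1 + t n *\<^sub>R axis j 1))
     \<longlonglongrightarrow> partial_deriv i (partial_deriv j f) x"
    unfolding eq by (rule *[OF st(3,4)])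
  with *[OF st(1,2)] show "partial_deriv i (partial_deriv j f) x = partial_deriv j (partial_deriv i f) x"
    using LIMSEQ_unique by blast
qed

subsection \<open>Multi-indices\<close>

definition mi_inc :: "'n \<Rightarrow> ('n \<Rightarrow> nat) \<Rightarrow> 'n \<Rightarrow> nat" where
  "mi_inc i \<alpha> = \<alpha>(i := Suc (\<alpha> i))"

lemma mi_order_inc [simp]: "mi_order (mi_inc i \<alpha>) = Suc (mi_order \<alpha>)"
proof -
  have "mi_order (mi_inc i \<alpha>) = mi_inc i \<alpha> i + (\<Sum>j\<in>UNIV - {i}. mi_inc i \<alpha> j)"
    unfolding mi_order_def by (rule sum.remove) auto
  also have "(\<Sum>j\<in>UNIV - {i}. mi_inc i \<alpha> j) = (\<Sum>j\<in>UNIV - {i}. \<alpha> j)"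
    by (rule sum.cong) (auto simp: mi_inc_def)
  also have "mi_inc i \<alpha> i + \<dots> = Suc (\<alpha> i + (\<Sum>j\<in>UNIV - {i}. \<alpha> j))" by (simp add: mi_inc_def)
  also have "\<alpha> i + (\<Sum>j\<in>UNIV - {i}. \<alpha> j) = mi_order \<alpha>"
    unfolding mi_order_def by (rule sum.remove[symmetric]) auto
  finally show ?thesis .
qed

lemma mi_order_0 [simp]: "mi_order (\<lambda>_. 0) = 0"
  by (simp add: mi_order_def)

lemma mi_induct [case_names zero inc]:
  fixes \<alpha> :: "'n::finite \<Rightarrow> nat"
  assumes "P (\<lambda>_. 0)" "\<And>i \<alpha>. P \<alpha> \<Longrightarrow> P (mi_inc i \<alpha>)"
  shows "P \<alpha>"
proof (induction "mi_order \<alpha>" arbitrary: \<alpha>)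
  case 0
  then have "\<alpha> = (\<lambda>_. 0)" by (auto simp: mi_order_def)
  then show ?case using assms by simp
next
  case (Suc n)
  then have "\<exists>i. \<alpha> i \<noteq> 0" by (metis mi_order_0 nat.distinct(1) ext)
  then obtain i where i: "\<alpha> i \<noteq> 0" by blast
  let ?\<beta> = "\<alpha>(i := \<alpha> i - 1)"
  have eq: "\<alpha> = mi_inc i ?\<beta>" using i by (auto simp: mi_inc_def)
  then have "mi_order \<alpha> = Suc (mi_order ?\<beta>)" by (metis mi_order_inc)
  then have "P ?\<beta>" using Suc by simp
  then show ?case using assms(2) eq by metis
qed

lemma smooth_partial_deriv_funpow: "smooth f \<Longrightarrow> smooth ((partial_deriv i ^^ k) f)"
  by (induction k) (auto intro: smooth_partial_deriv)

lemma smooth_foldr_partial: "smooth f \<Longrightarrow> smooth (foldr (\<lambda>i. partial_deriv i ^^ \<alpha> i) l f)"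
  by (induction l) (auto intro: smooth_partial_deriv_funpow)

lemma smooth_multi_deriv: "smooth f \<Longrightarrow> smooth (multi_deriv \<alpha> f)"
  unfolding multi_deriv_def by (rule smooth_foldr_partial)

lemma partial_deriv_funpow_commute:
  "smooth f \<Longrightarrow> (partial_deriv i ^^ k) (partial_deriv j f) = partial_deriv j ((partial_deriv i ^^ k) f)"
  by (induction k) (auto simp: partial_deriv_commute[OF smooth_partial_deriv_funpow])

lemma foldr_partial_commute:
  "smooth f \<Longrightarrow> foldr (\<lambda>i. partial_deriv i ^^ \<alpha> i) l (partial_deriv j f) =
     partial_deriv j (foldr (\<lambda>i. partial_deriv i ^^ \<alpha> i) l f)"
  by (induction l) (auto simp: partial_deriv_funpow_commute smooth_foldr_partial)

text \<open>The additional derivative enters at the position of \<open>i\<close> in the enumeration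
  and is commuted to the outside; distinctness ensures that \<open>i\<close> is met only
  once.\<close>

lemma foldr_partial_inc:
  assumes "smooth f" "distinct l"
  shows "foldr (\<lambda>j. partial_deriv j ^^ mi_inc i \<alpha> j) l f =
    (if i \<in> set l then partial_deriv i else id) (foldr (\<lambda>j. partial_deriv j ^^ \<alpha> j) l f)"
  using assms(2)
proof (induction l)
  case (Cons j l)
  show ?case
  proof (cases "j = i")
    case True
    then show ?thesis using Cons by (simp add: mi_inc_def)
  next
    case False
    then show ?thesis using Cons
      by (auto simp: mi_inc_def partial_deriv_funpow_commute[OF smooth_foldr_partial[OF assms(1)]])
  qed
qed simp

lemma multi_deriv_zero: "multi_deriv (\<lambda>_. 0) f = f"
proof -
  have "foldr (\<lambda>i. partial_deriv i ^^ 0) l f = f" for l :: "'a list"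
    by (induction l) auto
  then show ?thesis unfolding multi_deriv_def .
qed

text \<open>Both forms are used: the first differentiates a derivative already obtained, the second
  moves one derivative onto the test function when weak derivatives of higher order are built up by
  induction.\<close>

lemma multi_deriv_inc:
  fixes f :: "real^'n \<Rightarrow> real"
  assumes "smooth f"
  shows "multi_deriv (mi_inc i \<alpha>) f = partial_deriv i (multi_deriv \<alpha> f)"
    and "multi_deriv (mi_inc i \<alpha>) f = multi_deriv \<alpha> (partial_deriv i f)"
proof -
  define l where "l = (SOME l :: 'n list. distinct l \<and> set l = UNIV)"
  have "\<exists>l :: 'n list. distinct l \<and> set l = UNIV" using finite_distinct_list[OF finite_class.finite_UNIV] by blast
  then have l: "distinct l" "set l = UNIV" unfolding l_def by (metis (mono_tags, lifting) someI_ex)+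
  show 1: "multi_deriv (mi_inc i \<alpha>) f = partial_deriv i (multi_deriv \<alpha> f)"
    unfolding multi_deriv_def l_def[symmetric]
    by (subst foldr_partial_inc[OF assms l(1)]) (simp add: l)
  show "multi_deriv (mi_inc i \<alpha>) f = multi_deriv \<alpha> (partial_deriv i f)"
    unfolding 1 unfolding multi_deriv_def by (rule foldr_partial_commute[OF assms, symmetric])
qed

lemma multi_deriv_affine:
  assumes "smooth f"
  shows "multi_deriv \<alpha> (\<lambda>x. f (c *\<^sub>R (x - a))) = (\<lambda>x. c ^ mi_order \<alpha> * multi_deriv \<alpha> f (c *\<^sub>R (x - a)))"
proof (induction \<alpha> rule: mi_induct)
  case zero
  then show ?case by (simp add: multi_deriv_zero)
next
  case (inc i \<alpha>)
  show ?case
    by (simp add: multi_deriv_inc(1)[OF smooth_affine[OF assms]] inc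
       partial_deriv_affine_comp[OF smooth_multi_deriv[OF assms]] multi_deriv_inc(1)[OF assms] mult_ac)
qed

lemma multi_deriv_sum:
  assumes "finite A" "\<And>k. k \<in> A \<Longrightarrow> smooth (f k)"
  shows "multi_deriv \<alpha> (\<lambda>x. \<Sum>k\<in>A. f k x) = (\<lambda>x. \<Sum>k\<in>A. multi_deriv \<alpha> (f k) x)"
proof (induction \<alpha> rule: mi_induct)
  case zero
  then show ?case by (simp add: multi_deriv_zero)
next
  case (inc i \<alpha>)
  have "multi_deriv (mi_inc i \<alpha>) (\<lambda>x. \<Sum>k\<in>A. f k x) = partial_deriv i (\<lambda>x. \<Sum>k\<in>A. multi_deriv \<alpha> (f k) x)"
    using assms by (simp add: multi_deriv_inc(1)[OF smooth_sum] inc)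
  also have "\<dots> = (\<lambda>x. \<Sum>k\<in>A. partial_deriv i (multi_deriv \<alpha> (f k)) x)"
    using assms by (intro partial_deriv_sum smooth_multi_deriv) auto
  also have "\<dots> = (\<lambda>x. \<Sum>k\<in>A. multi_deriv (mi_inc i \<alpha>) (f k) x)"
    using assms by (simp add: multi_deriv_inc(1))
  finally show ?case .
qed

lemma partial_deriv_cmult:
  assumes "smooth f"
  shows "partial_deriv i (\<lambda>x. c * f x) = (\<lambda>x. c * partial_deriv i f x)"
  using partial_deriv_affine_comp[OF assms, of i c 1 0] by simp

lemma multi_deriv_cmult:
  assumes "smooth f"
  shows "multi_deriv \<alpha> (\<lambda>x. c * f x) = (\<lambda>x. c * multi_deriv \<alpha> f x)"
proof (induction \<alpha> rule: mi_induct)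
  case (inc i \<alpha>)
  then show ?case using assms
    by (simp add: multi_deriv_inc(1) smooth_cmult partial_deriv_cmult smooth_multi_deriv)
qed (simp add: multi_deriv_zero)

section \<open>Locality of derivatives\<close>

lemma partial_deriv_local:
  fixes f g :: "real^'n \<Rightarrow> real"
  assumes "open S" "x \<in> S" "\<And>y. y \<in> S \<Longrightarrow> f y = g y" "smooth f" "smooth g"
  shows "partial_deriv i f x = partial_deriv i g x"
proof -
  have "(g has_derivative gradient_form (\<lambda>i. partial_deriv i f) x) (at x)"
    by (rule has_derivative_transform_within_open[OF smooth_has_derivative[OF assms(4)]])
       (use assms in auto)
  from has_derivative_unique[OF this smooth_has_derivative[OF assms(5)]]
  have eq: "gradient_form (\<lambda>i. partial_deriv i f) x (axis i 1) = gradient_form (\<lambda>i. partial_deriv i g) x (axis i 1)"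
    by metis
  have gf: "gradient_form h x (axis i 1) = h i x" for h :: "'n \<Rightarrow> real^'n \<Rightarrow> real"
  proof -
    have "gradient_form h x (axis i 1) = (\<Sum>j\<in>UNIV. if j = i then h j x else 0)"
      by (intro sum.cong) (auto simp: axis_def)
    then show ?thesis by simp
  qed
  show ?thesis
    using eq unfolding gf[of "\<lambda>i. partial_deriv i f"] gf[of "\<lambda>i. partial_deriv i g"] .
qed

lemma multi_deriv_local:
  assumes "open S" "\<And>y. y \<in> S \<Longrightarrow> f y = g y" "smooth f" "smooth g"
  shows "x \<in> S \<Longrightarrow> multi_deriv \<alpha> f x = multi_deriv \<alpha> g x"
proof (induction \<alpha> arbitrary: x rule: mi_induct)
  case (inc i \<alpha>)
  show ?case
    unfolding multi_deriv_inc(1)[OF assms(3)] multi_deriv_inc(1)[OF assms(4)]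
    by (rule partial_deriv_local[OF assms(1) inc(2)]) (use inc assms smooth_multi_deriv in auto)
qed (use assms in \<open>simp add: multi_deriv_zero\<close>)

subsection \<open>Smooth functions of one variable\<close>

text \<open>Infinite differentiability in one variable, encoded as membership in some class closed
  under derivatives. This is the form in which exp(-1/t) is accessible and which
  \<open>smooth_coinduct\<close> can consume.\<close>

definition smooth1 :: "(real \<Rightarrow> real) \<Rightarrow> bool" where
  "smooth1 h \<longleftrightarrow> (\<exists>X. h \<in> X \<and> (\<forall>g\<in>X. \<exists>g'\<in>X. \<forall>t. (g has_real_derivative g' t) (at t)))"

lemma smooth1_coord:
  assumes "smooth1 h"
  shows "smooth (\<lambda>x::real^'n. h (x $ i))"
proof -
  obtain X where h: "h \<in> X" and X: "\<forall>g\<in>X. \<exists>g'\<in>X. \<forall>t. (g has_real_derivative g' t) (at t)"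
    using assms unfolding smooth1_def by auto
  let ?Y = "{\<lambda>x::real^'n. c * g (x $ i) | c g. g \<in> X}"
  have "(\<lambda>x. h (x $ i)) \<in> ?Y" using h by (auto intro!: exI[of _ 1] exI[of _ h])
  then show ?thesis
  proof (rule smooth_coinduct)
    fix f assume "f \<in> ?Y"
    then obtain c g where f: "f = (\<lambda>x. c * g (x $ i))" and g: "g \<in> X" by blast
    from X g obtain g' where g': "g' \<in> X" "\<forall>t. (g has_real_derivative g' t) (at t)" by auto
    let ?f = "\<lambda>j (x::real^'n). (if j = i then c else 0) * g' (x $ i)"
    have "(f has_derivative gradient_form ?f x) (at x)" for x
    proof -
      have "((\<lambda>x::real^'n. g (x $ i)) has_derivative (\<lambda>v. g' (x $ i) * (v $ i))) (at x)"
        by (rule has_derivative_compose[where f="\<lambda>x::real^'n. x $ i" and g=g and g'="\<lambda>v. g' (x $ i) * v"])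
           (use g' in \<open>auto intro!: derivative_eq_intros bounded_linear_imp_has_derivative
              bounded_linear_vec_nth simp: has_field_derivative_def\<close>)
      from has_derivative_mult_right[OF this, of c]
      have "(f has_derivative (\<lambda>v. c * (g' (x $ i) * v $ i))) (at x)" unfolding f .
      moreover have "gradient_form ?f x v = c * (g' (x $ i) * v $ i)" for v
      proof -
        have "gradient_form ?f x v = (\<Sum>j\<in>UNIV. if j = i then c * (g' (x $ i) * v $ i) else 0)"
          by (intro sum.cong) auto
        then show ?thesis by simp
      qed
      ultimately show ?thesis by simp
    qed
    moreover have "?f j \<in> ?Y" for j using g' by blast
    ultimately show "\<exists>g'. (\<forall>i. g' i \<in> ?Y) \<and> (\<forall>x. (f has_derivative gradient_form g' x) (at x))"
      by (intro exI[of _ ?f] conjI allI)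
  qed
qed

text \<open>The classical flat function exp(-1/t), extended by zero, with a polynomial in 1/t as
  prefactor. Differentiation only changes the polynomial, so the family is closed under
  derivatives.\<close>

definition flat :: "real poly \<Rightarrow> real \<Rightarrow> real" where
  "flat P t = (if 0 < t then poly P (1 / t) * exp (- (1 / t)) else 0)"

lemma poly_mult_exp_tendsto_0: "((\<lambda>x::real. poly P x * exp (- x)) \<longlongrightarrow> 0) at_top"
proof -
  have "((\<lambda>x. \<Sum>i\<le>degree P. coeff P i * (x ^ i / exp x)) \<longlongrightarrow> (\<Sum>i\<le>degree P. coeff P i * 0)) at_top"
    by (intro tendsto_sum tendsto_mult tendsto_const tendsto_power_div_exp_0)
  moreover have "(\<Sum>i\<le>degree P. coeff P i * (x ^ i / exp x)) = poly P x * exp (- x)" for x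
    by (simp add: poly_altdef exp_minus field_simps sum_distrib_right sum_divide_distrib)
  ultimately show ?thesis by simp
qed

definition flat_deriv_poly :: "real poly \<Rightarrow> real poly" where
  "flat_deriv_poly P = [:0, 0, 1:] * (P - pderiv P)"

lemma flat_deriv: "(flat P has_real_derivative flat (flat_deriv_poly P) t) (at t)"
proof -
  consider "t < 0" | "t = 0" | "0 < t" by linarith
  then show ?thesis
  proof cases
    case 1
    have "((\<lambda>_. 0) has_real_derivative 0) (at t)" by simp
    then have "(flat P has_real_derivative 0) (at t)"
      by (rule has_field_derivative_transform_within_open[of _ _ _ "{..<0}"]) (use 1 in \<open>auto simp: flat_def\<close>)
    then show ?thesis using 1 by (simp add: flat_def)
  next
    case 2
    have r: "((\<lambda>h. flat P h / h) \<longlongrightarrow> 0) (at_right 0)"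
    proof -
      \<comment> \<open>The difference quotient at 0 contributes a factor 1/h; it is absorbed by
        passing to the polynomial \<open>pCons 0 P\<close> in the variable 1/h.\<close>
      have "((\<lambda>h. poly (pCons 0 P) (inverse h) * exp (- inverse h)) \<longlongrightarrow> 0) (at_right 0)"
        by (rule filterlim_compose[OF poly_mult_exp_tendsto_0 filterlim_inverse_at_top_right])
      then show ?thesis
        by (rule Lim_transform_eventually)
           (auto simp: eventually_at_right_less flat_def field_simps intro!: eventually_mono[OF eventually_at_right_less])
    qed
    have l: "((\<lambda>h. flat P h / h) \<longlongrightarrow> 0) (at_left 0)"
      by (rule Lim_transform_eventually[OF tendsto_const])
         (auto simp: flat_def eventually_at_left_field intro!: exI[of _ "-1"])
    from filterlim_split_at[OF l r] show ?thesis
      unfolding 2 DERIV_def by (simp add: flat_def)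
  next
    case 3
    have "((\<lambda>t. poly P (1 / t) * exp (- (1 / t))) has_real_derivative flat (flat_deriv_poly P) t) (at t)"
    proof (rule DERIV_cong)
      show "((\<lambda>t. poly P (1 / t) * exp (- (1 / t))) has_real_derivative
        poly P (1 / t) * (exp (- (1 / t)) * (1 / (t * t)))
         + (poly (pderiv P) (1 / t) * (- 1 / (t * t))) * exp (- (1 / t))) (at t)"
      proof (rule DERIV_mult')
        have inv: "((\<lambda>t. 1 / t) has_real_derivative - 1 / (t * t)) (at t)"
          using 3 by (auto intro!: derivative_eq_intros)
        show "((\<lambda>t. poly P (1 / t)) has_real_derivative poly (pderiv P) (1 / t) * (- 1 / (t * t))) (at t)"
          by (rule DERIV_chain2[OF poly_DERIV inv])
        show "((\<lambda>t. exp (- (1 / t))) has_real_derivative exp (- (1 / t)) * (1 / (t * t))) (at t)"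
          using 3 by (auto intro!: derivative_eq_intros)
      qed
    qed (use 3 in \<open>simp add: flat_def flat_deriv_poly_def field_simps\<close>)
    then show ?thesis
      by (rule has_field_derivative_transform_within_open[of _ _ _ "{0<..}"]) (use 3 in \<open>auto simp: flat_def\<close>)
  qed
qed

lemma flat_reflect_deriv:
  "((\<lambda>t. flat P (1 - t)) has_real_derivative flat (- flat_deriv_poly P) (1 - t)) (at t)"
proof -
  have "((\<lambda>t. flat P (1 - t)) has_real_derivative flat (flat_deriv_poly P) (1 - t) * (- 1)) (at t)"
    by (rule DERIV_chain2[OF flat_deriv]) (auto intro!: derivative_eq_intros)
  moreover have "flat (flat_deriv_poly P) (1 - t) * (- 1) = flat (- flat_deriv_poly P) (1 - t)"
    by (simp add: flat_def)
  ultimately show ?thesis by simp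
qed

text \<open>A normalized primitive of a bump: \<open>g\<close> is positive exactly between 0 and 1,
  so its integral \<open>G\<close> is constant on either side of that interval, and division by
  \<open>G 1\<close> gives a step from 0 to 1.\<close>

lemma smooth_step_exists:
  "\<exists>h. smooth1 h \<and> (\<forall>t\<le>0. h t = 0) \<and> (\<forall>t\<ge>1. h t = 1) \<and> (\<forall>t. 0 \<le> h t \<and> h t \<le> 1)"
proof -
  let ?S = "\<lambda>L t. \<Sum>(P, Q)\<leftarrow>L. flat P t * flat Q (1 - t)"
  let ?D = "\<lambda>L. map (\<lambda>(P, Q). (flat_deriv_poly P, Q)) L @ map (\<lambda>(P, Q). (P, - flat_deriv_poly Q)) L"
  have S: "(?S L has_real_derivative ?S (?D L) t) (at t)" for L t
  proof (induction L)
    case (Cons a L)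
    obtain P Q where a: "a = (P, Q)" by (cases a)
    from DERIV_add[OF DERIV_mult'[OF flat_deriv[of P] flat_reflect_deriv[of Q]] Cons]
    show ?case by (simp add: a algebra_simps)
  qed simp
  define g where "g t = flat 1 t * flat 1 (1 - t)" for t
  have g_S: "g = ?S [(1, 1)]" by (auto simp: g_def)
  have g0: "0 \<le> g t" for t by (simp add: g_def flat_def)
  have gz: "g t = 0" if "t \<le> 0 \<or> 1 \<le> t" for t using that by (auto simp: g_def flat_def)
  have gp: "0 < g t" if "0 < t" "t < 1" for t using that by (auto simp: g_def flat_def)
  have gc: "continuous_on A g" for A
  proof (rule continuous_at_imp_continuous_on, rule ballI)
    fix t show "isCont g t" unfolding g_S by (rule DERIV_isCont[OF S[of "[(1, 1)]" t]])
  qed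
  \<comment> \<open>The lower limit -1 lies strictly to the left of the support of \<open>g\<close>,
    so that 0 is an interior point when the integral is differentiated there.\<close>
  define G where "G t = integral {-1..t} g" for t
  have G0: "G t = 0" if "t \<le> 0" for t
  proof -
    have "G t = integral {-1..t} (\<lambda>_. 0)" unfolding G_def by (rule integral_cong) (use gz that in auto)
    then show ?thesis by simp
  qed
  have G': "(G has_real_derivative g t) (at t)" for t
  proof (cases "t < 0")
    case True
    have "((\<lambda>_. 0) has_real_derivative 0) (at t)" by simp
    then have "(G has_real_derivative 0) (at t)"
      by (rule has_field_derivative_transform_within_open[of _ _ _ "{..<0}"]) (use True G0 in auto)
    then show ?thesis using True gz by simp
  next
    case False
    have "((\<lambda>u. integral {-1..u} g) has_real_derivative g t) (at t within {-1..t+1})"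
      by (rule integral_has_real_derivative) (use gc False in auto)
    then have "(G has_real_derivative g t) (at t within {-1..t+1})" unfolding G_def .
    moreover have "t \<in> interior {-1..t+1}" using False by simp
    ultimately show ?thesis using at_within_interior by metis
  qed
  have mono: "G s \<le> G t" if "s \<le> t" for s t
    using that by (rule DERIV_nonneg_imp_nondecreasing) (use G' g0 in blast)
  have G1: "G t = G 1" if "1 \<le> t" for t
  proof -
    have "(\<lambda>s. - G s) 1 \<le> (\<lambda>s. - G s) t"
    proof (rule DERIV_nonneg_imp_nondecreasing[OF that])
      fix x assume "1 \<le> x" "x \<le> t"
      then show "\<exists>y. ((\<lambda>s. - G s) has_real_derivative y) (at x) \<and> 0 \<le> y"
        using DERIV_minus[OF G'[of x]] gz[of x] by (intro exI[of _ 0]) auto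
    qed
    then show ?thesis using mono[OF that] by simp
  qed
  have "G (1/4) < G (3/4)"
  proof (rule DERIV_pos_imp_increasing[of "1/4" "3/4" G])
    fix x :: real assume "1/4 \<le> x" "x \<le> 3/4"
    then show "\<exists>y. (G has_real_derivative y) (at x) \<and> 0 < y"
      using G'[of x] gp[of x] by (intro exI[of _ "g x"]) simp
  qed simp
  moreover have "0 \<le> G (1/4)" "G (3/4) \<le> G 1" using mono[of 0 "1/4"] mono[of "3/4" 1] G0[of 0] by auto
  ultimately have Gpos: "0 < G 1" by linarith
  define h where "h t = G t / G 1" for t
  have "smooth1 h"
    unfolding smooth1_def
  \<comment> \<open>The step \<open>h\<close> is given as an integral, while its derivative is a sum
    of products of \<open>flat\<close> functions; hence the class consists of such sums together
    with \<open>h\<close>.\<close>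
  proof (intro exI[of _ "insert h {\<lambda>t. ?S L t / G 1 | L. True}"] conjI ballI)
    fix f assume "f \<in> insert h {\<lambda>t. ?S L t / G 1 | L. True}"
    then consider "f = h" | L where "f = (\<lambda>t. ?S L t / G 1)" by blast
    then show "\<exists>g'\<in>insert h {\<lambda>t. ?S L t / G 1 | L. True}. \<forall>t. (f has_real_derivative g' t) (at t)"
    proof cases
      case 1
      have "(f has_real_derivative g t / G 1) (at t)" for t
        unfolding 1 h_def by (rule DERIV_cdivide[OF G'])
      then have "\<forall>t. (f has_real_derivative (\<lambda>t. ?S [(1, 1)] t / G 1) t) (at t)" by (simp add: g_def)
      moreover have "(\<lambda>t. ?S [(1, 1)] t / G 1) \<in> insert h {\<lambda>t. ?S L t / G 1 | L. True}" by blast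
      ultimately show ?thesis by (rule bexI)
    next
      case 2
      have "(f has_real_derivative ?S (?D L) t / G 1) (at t)" for t
        unfolding 2 by (rule DERIV_cdivide[OF S])
      then have "\<forall>t. (f has_real_derivative (\<lambda>t. ?S (?D L) t / G 1) t) (at t)" by simp
      moreover have "(\<lambda>t. ?S (?D L) t / G 1) \<in> insert h {\<lambda>t. ?S L t / G 1 | L. True}" by blast
      ultimately show ?thesis by (rule bexI)
    qed
  qed simp
  moreover have "h t = 0" if "t \<le> 0" for t using that G0 by (simp add: h_def)
  moreover have "h t = 1" if "1 \<le> t" for t using G1[OF that] Gpos by (simp add: h_def)
  moreover have "0 \<le> h t \<and> h t \<le> 1" for t
    using mono[of 0 t] mono[of t 1] G0[of 0] G0[of t] G1[of t] Gpos
    by (cases "t \<le> 0"; cases "1 \<le> t") (auto simp: h_def)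
  ultimately show ?thesis by blast
qed

section \<open>Bumps adapted to boxes\<close>

definition smooth_step :: "real \<Rightarrow> real" where
  "smooth_step = (SOME h. smooth1 h \<and> (\<forall>t\<le>0. h t = 0) \<and> (\<forall>t\<ge>1. h t = 1) \<and> (\<forall>t. 0 \<le> h t \<and> h t \<le> 1))"

lemma smooth_step: "smooth1 smooth_step" "t \<le> 0 \<Longrightarrow> smooth_step t = 0" "1 \<le> t \<Longrightarrow> smooth_step t = 1"
  "0 \<le> smooth_step t" "smooth_step t \<le> 1"
  using someI_ex[OF smooth_step_exists] unfolding smooth_step_def by blast+

text \<open>The parameter \<open>n\<close> is the steepness: the function climbs from 0 to 1 within
  distance 1/\<open>n\<close> of each face, on the inner side of the box.\<close>

definition box_bump :: "real \<Rightarrow> real^'n \<Rightarrow> real^'n \<Rightarrow> real^'n \<Rightarrow> real" where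
  "box_bump n a b x = (\<Prod>i\<in>UNIV. smooth_step (n * (x $ i - a $ i)) * smooth_step (n * (b $ i - x $ i)))"

lemma smooth_box_bump:
  fixes a b :: "real^'n"
  shows "smooth (box_bump n a b)"
proof -
  have "smooth (\<lambda>x::real^'n. smooth_step ((n *\<^sub>R (x - a)) $ i))" for i
    by (rule smooth_affine[OF smooth1_coord[OF smooth_step(1)]])
  moreover have "smooth (\<lambda>x::real^'n. smooth_step (((- n) *\<^sub>R (x - b)) $ i))" for i
    by (rule smooth_affine[OF smooth1_coord[OF smooth_step(1)]])
  ultimately have "smooth (\<lambda>x::real^'n. \<Prod>i\<in>UNIV. smooth_step ((n *\<^sub>R (x - a)) $ i) * smooth_step (((- n) *\<^sub>R (x - b)) $ i))"
    by (intro smooth_prod smooth_mult)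
  moreover have "(\<lambda>x::real^'n. \<Prod>i\<in>UNIV. smooth_step ((n *\<^sub>R (x - a)) $ i) * smooth_step (((- n) *\<^sub>R (x - b)) $ i)) = box_bump n a b"
    by (auto simp: box_bump_def fun_eq_iff algebra_simps)
  ultimately show ?thesis by simp
qed

lemma box_bump_bounds: "0 \<le> box_bump n a b x" "box_bump n a b x \<le> 1"
  unfolding box_bump_def
  by (intro prod_nonneg prod_le_1 conjI ballI mult_nonneg_nonneg mult_le_one smooth_step)+

lemma box_bump_zero:
  assumes "0 < n" "x \<notin> box a b"
  shows "box_bump n a b x = 0"
proof -
  obtain i where "x $ i \<le> a $ i \<or> b $ i \<le> x $ i"
    using assms(2) unfolding mem_box_cart by (meson not_less)
  then have "smooth_step (n * (x $ i - a $ i)) = 0 \<or> smooth_step (n * (b $ i - x $ i)) = 0"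
    using assms(1) by (auto intro!: smooth_step(2) simp: mult_le_0_iff)
  then show ?thesis unfolding box_bump_def by (intro prod_zero) auto
qed

lemma box_bump_one:
  assumes "0 < n" "\<And>i. a $ i + 1 / n \<le> x $ i \<and> x $ i \<le> b $ i - 1 / n"
  shows "box_bump n a b x = 1"
proof -
  have "1 \<le> n * (x $ i - a $ i)" "1 \<le> n * (b $ i - x $ i)" for i
    using assms(1) assms(2)[of i] by (auto simp: field_simps)
  then show ?thesis unfolding box_bump_def by (simp add: smooth_step(3))
qed

lemma box_bump_tendsto:
  "(\<lambda>n. box_bump (real (Suc n)) a b x) \<longlonglongrightarrow> indicator (box a b) x"
proof (cases "x \<in> box a b")
  case False
  then show ?thesis by (simp add: box_bump_zero)
next
  case True
  have "\<forall>\<^sub>F n in sequentially. \<forall>i. 1 / real (Suc n) < x $ i - a $ i \<and> 1 / real (Suc n) < b $ i - x $ i"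
  proof (intro eventually_all_finite eventually_conj)
    fix i
    have p: "0 < x $ i - a $ i" "0 < b $ i - x $ i" using True by (auto simp: mem_box_cart)
    have z: "(\<lambda>n. 1 / real (Suc n)) \<longlonglongrightarrow> 0" using lim_1_over_n by (rule LIMSEQ_Suc)
    show "\<forall>\<^sub>F n in sequentially. 1 / real (Suc n) < x $ i - a $ i" by (rule order_tendstoD(2)[OF z p(1)])
    show "\<forall>\<^sub>F n in sequentially. 1 / real (Suc n) < b $ i - x $ i" by (rule order_tendstoD(2)[OF z p(2)])
  qed
  then have "\<forall>\<^sub>F n in sequentially. 1 = box_bump (real (Suc n)) a b x"
  proof (rule eventually_mono)
    fix n assume *: "\<forall>i. 1 / real (Suc n) < x $ i - a $ i \<and> 1 / real (Suc n) < b $ i - x $ i"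
    then show "1 = box_bump (real (Suc n)) a b x"
    proof (intro box_bump_one[symmetric] conjI)
      fix i
      show "a $ i + 1 / real (Suc n) \<le> x $ i" using *[THEN spec, of i] by linarith
      show "x $ i \<le> b $ i - 1 / real (Suc n)" using *[THEN spec, of i] by linarith
    qed simp
  qed
  then show ?thesis using True by (simp add: Lim_transform_eventually[OF tendsto_const])
qed

subsection \<open>Test functions\<close>

lemma test_functionsI:
  assumes "smooth f" "compact C" "C \<subseteq> U" "\<And>x. f x \<noteq> 0 \<Longrightarrow> x \<in> C"
  shows "f \<in> test_functions U"
proof -
  have "closure {x. f x \<noteq> 0} \<subseteq> C"
    using assms by (intro closure_minimal compact_imp_closed) auto
  then show ?thesis unfolding test_functions_def
    using assms compact_Int_closed[of C "closure {x. f x \<noteq> 0}"] by (auto simp: Int_absorb1)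
qed

lemma test_functionsD:
  assumes "f \<in> test_functions U"
  shows "smooth f" "\<exists>C. compact C \<and> C \<subseteq> U \<and> (\<forall>x. x \<notin> C \<longrightarrow> f x = 0)"
proof -
  show "smooth f" using assms by (simp add: test_functions_def)
  show "\<exists>C. compact C \<and> C \<subseteq> U \<and> (\<forall>x. x \<notin> C \<longrightarrow> f x = 0)"
    using assms closure_subset[of "{x. f x \<noteq> 0}"]
    by (intro exI[of _ "closure {x. f x \<noteq> 0}"]) (auto simp: test_functions_def)
qed

lemma partial_deriv_zero_outside:
  assumes "smooth f" "closed C" "\<And>x. x \<notin> C \<Longrightarrow> f x = 0" "x \<notin> C"
  shows "partial_deriv i f x = 0"
proof -
  have "partial_deriv i f x = partial_deriv i (\<lambda>x. 0) x"
    by (rule partial_deriv_local[of "- C"]) (use assms smooth_const in auto)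
  also have "partial_deriv i (\<lambda>x. 0) x = 0"
    using partial_deriv_gradient_form[of "\<lambda>x. 0" "\<lambda>i x. 0" i] by simp
  finally show ?thesis .
qed

lemma multi_deriv_zero_outside:
  assumes "smooth f" "closed C" "\<And>x. x \<notin> C \<Longrightarrow> f x = 0"
  shows "x \<notin> C \<Longrightarrow> multi_deriv \<alpha> f x = 0"
proof (induction \<alpha> arbitrary: x rule: mi_induct)
  case (inc i \<alpha>)
  then show ?case unfolding multi_deriv_inc(1)[OF assms(1)]
    by (intro partial_deriv_zero_outside[OF smooth_multi_deriv[OF assms(1)] assms(2)]) auto
qed (use assms in \<open>simp add: multi_deriv_zero\<close>)

lemma test_functions_partial_deriv:
  assumes "f \<in> test_functions U"
  shows "partial_deriv i f \<in> test_functions U"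
proof -
  obtain C where C: "compact C" "C \<subseteq> U" "\<forall>x. x \<notin> C \<longrightarrow> f x = 0"
    using test_functionsD[OF assms] by auto
  show ?thesis
    by (rule test_functionsI[OF smooth_partial_deriv[OF test_functionsD(1)[OF assms]] C(1,2)])
       (metis C(1,3) compact_imp_closed partial_deriv_zero_outside test_functionsD(1)[OF assms])
qed

lemma test_functions_multi_deriv:
  "f \<in> test_functions U \<Longrightarrow> multi_deriv \<alpha> f \<in> test_functions U"
proof (induction \<alpha> rule: mi_induct)
  case (inc i \<alpha>)
  then show ?case
    using test_functions_partial_deriv multi_deriv_inc(1)[OF test_functionsD(1)] by metis
qed (simp add: multi_deriv_zero)

lemma test_functions_bounded:
  assumes "f \<in> test_functions U"
  obtains M where "0 \<le> M" "\<And>x. \<bar>f x\<bar> \<le> M"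
proof -
  obtain C where C: "compact C" "\<forall>x. x \<notin> C \<longrightarrow> f x = 0" and f: "smooth f"
    using test_functionsD[OF assms] by auto
  have "bounded (f ` C)" by (intro compact_imp_bounded compact_continuous_image smooth_continuous f C)
  then obtain B where B: "\<forall>y\<in>f ` C. \<bar>y\<bar> \<le> B" unfolding bounded_iff by auto
  show ?thesis
  proof (rule that[of "max 0 B"])
    fix x show "\<bar>f x\<bar> \<le> max 0 B" using B C(2) by (cases "x \<in> C") auto
  qed simp
qed

lemma box_bump_test:
  assumes "0 < n" "cbox a b \<subseteq> U"
  shows "box_bump n a b \<in> test_functions U"
  by (rule test_functionsI[OF smooth_box_bump compact_cbox assms(2)])
     (metis assms(1) box_bump_zero box_subset_cbox subsetD)

section \<open>Weak derivatives and line integrals\<close>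

subsection \<open>Translations\<close>

lemma nn_integral_translate:
  fixes a :: "'a::euclidean_space"
  assumes [measurable]: "f \<in> borel_measurable borel"
  shows "(\<integral>\<^sup>+x. f (x + a) \<partial>lborel) = (\<integral>\<^sup>+x. f x \<partial>lborel)"
proof -
  have "(\<integral>\<^sup>+x. f x \<partial>lborel) = (\<integral>\<^sup>+x. f x \<partial>distr lborel borel ((+) a))"
    by (simp add: lborel_distr_plus)
  also have "\<dots> = (\<integral>\<^sup>+x. f (a + x) \<partial>lborel)" by (rule nn_integral_distr) auto
  finally show ?thesis by (simp add: add.commute)
qed

lemma integral_translate:
  fixes a :: "'a::euclidean_space" and f :: "'a \<Rightarrow> real"
  assumes [measurable]: "f \<in> borel_measurable borel"
  shows "(LINT x|lborel. f (x + a)) = (LINT x|lborel. f x)"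
proof -
  have "(LINT x|lborel. f x) = (LINT x|distr lborel borel ((+) a). f x)"
    by (simp add: lborel_distr_plus)
  also have "\<dots> = (LINT x|lborel. f (a + x))" by (rule integral_distr) auto
  finally show ?thesis by (simp add: add.commute)
qed

lemma integrable_translate:
  fixes a :: "'a::euclidean_space" and f :: "'a \<Rightarrow> real"
  assumes "integrable lborel f"
  shows "integrable lborel (\<lambda>x. f (x + a))"
proof -
  have [measurable]: "f \<in> borel_measurable borel" using assms by simp
  show ?thesis
    using assms nn_integral_translate[of "\<lambda>x. ennreal (norm (f x))" a]
    unfolding integrable_iff_bounded by simp
qed

lemma AE_lborel_translate:
  fixes a :: "'a::euclidean_space"
  assumes "AE x in lborel. P x"
  shows "AE x in lborel. P (x + a)"
proof -
  obtain N where N: "{x. \<not> P x} \<subseteq> N" "N \<in> sets borel" "emeasure lborel N = 0"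
    using AE_E[OF assms] by auto
  note N(2)[measurable]
  have "(\<integral>\<^sup>+x. indicator N (x + a) \<partial>lborel) = (\<integral>\<^sup>+x. indicator N x \<partial>(lborel :: 'a measure))"
    by (rule nn_integral_translate) simp
  also have "\<dots> = 0" using N by simp
  finally have "AE x in lborel. (indicator N (x + a) :: ennreal) = 0"
    by (subst (asm) nn_integral_0_iff_AE) simp_all
  then show ?thesis
    by eventually_elim (use N in \<open>auto simp: indicator_def split: if_splits\<close>)
qed

text \<open>Every translate of a null set is null, and Fubini exchanges "for all \<open>s\<close>,
  almost all \<open>x\<close>" for "almost all \<open>x\<close>, almost all \<open>s\<close>". This
  gives meaning to the restriction to lines of functions that are fixed only up to null
  sets.\<close>

lemma AE_lborel_line:
  fixes b :: "'a::euclidean_space"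
  assumes "AE x in lborel. P x"
  shows "AE x in lborel. AE s in (lborel :: real measure). P (x + s *\<^sub>R b)"
proof -
  obtain N where N: "{x. \<not> P x} \<subseteq> N" "N \<in> sets borel" "emeasure lborel N = 0"
    using AE_E[OF assms] by auto
  note N(2)[measurable]
  have "AE x in lborel. x \<notin> N" using N by (intro AE_not_in) (auto simp: null_sets_def)
  then have "AE x in lborel. x + s *\<^sub>R b \<notin> N" for s
    by (rule AE_lborel_translate)
  then have "AE s in (lborel :: real measure). AE x in lborel. x + s *\<^sub>R b \<notin> N"
    by (rule AE_I2)
  then have "AE x in lborel. AE s in (lborel :: real measure). x + s *\<^sub>R b \<notin> N"
  proof (subst lborel_pair.AE_commute)
    show "{x \<in> space (lborel \<Otimes>\<^sub>M lborel). fst x + snd x *\<^sub>R b \<notin> N} \<in> sets (lborel \<Otimes>\<^sub>M (lborel :: real measure))"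
      by measurable
  qed
  then show ?thesis
  proof eventually_elim
    case (elim x)
    then show ?case by eventually_elim (use N in auto)
  qed
qed

lemma nn_integral_scale:
  fixes f :: "'a::euclidean_space \<Rightarrow> ennreal"
  assumes [measurable]: "f \<in> borel_measurable borel" and c: "c \<noteq> 0"
  shows "(\<integral>\<^sup>+x. f x \<partial>lborel) = ennreal (\<bar>c\<bar> ^ DIM('a)) * (\<integral>\<^sup>+x. f (t + c *\<^sub>R x) \<partial>lborel)"
  by (subst lborel_affine[OF c, of t]) (simp add: nn_integral_density nn_integral_distr nn_integral_cmult)

subsection \<open>The fundamental lemma of the calculus of variations\<close>

text \<open>The counterpart of \<open>locally_integrable\<close> for Borel functions and
  \<open>lborel\<close>. Measurability is demanded on the whole space, so that translations and
  Fubini apply without restricted measures.\<close>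

definition loc_int :: "(real^'n) set \<Rightarrow> (real^'n \<Rightarrow> real) \<Rightarrow> bool" where
  "loc_int U f \<longleftrightarrow> f \<in> borel_measurable borel \<and> (\<forall>C. compact C \<longrightarrow> C \<subseteq> U \<longrightarrow> set_integrable lborel C f)"

lemma loc_int_borel [measurable_dest]: "loc_int U f \<Longrightarrow> f \<in> borel_measurable borel"
  by (simp add: loc_int_def)

lemma loc_int_add: "loc_int U f \<Longrightarrow> loc_int U g \<Longrightarrow> loc_int U (\<lambda>x. f x + g x)"
  unfolding loc_int_def by (auto intro: set_integral_add)

lemma loc_int_diff: "loc_int U f \<Longrightarrow> loc_int U g \<Longrightarrow> loc_int U (\<lambda>x. f x - g x)"
  unfolding loc_int_def by (auto intro: set_integral_diff)

lemma loc_int_cmult: "loc_int U f \<Longrightarrow> loc_int U (\<lambda>x. c * f x)"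
  unfolding loc_int_def by (auto intro: set_integrable_mult_right)

lemma loc_int_sum: "(\<And>i. i \<in> A \<Longrightarrow> loc_int U (f i)) \<Longrightarrow> loc_int U (\<lambda>x. \<Sum>i\<in>A. f i x)"
proof (induction A rule: infinite_finite_induct)
  case (insert i A)
  then show ?case using loc_int_add[of U "f i" "\<lambda>x. \<Sum>i\<in>A. f i x"] by simp
qed (auto simp: loc_int_def set_integrable_def)

lemma loc_int_subset: "loc_int U f \<Longrightarrow> V \<subseteq> U \<Longrightarrow> loc_int V f"
  unfolding loc_int_def by blast

lemma integrable_bounded_support:
  fixes f g :: "'a::euclidean_space \<Rightarrow> real"
  assumes "set_integrable lborel C f" and [measurable]: "f \<in> borel_measurable borel" "g \<in> borel_measurable borel"
    and "\<And>x. \<bar>g x\<bar> \<le> M" "\<And>x. x \<notin> C \<Longrightarrow> g x = 0"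
  shows "integrable lborel (\<lambda>x. f x * g x)"
proof (rule Bochner_Integration.integrable_bound)
  show "integrable lborel (\<lambda>x. M * (indicator C x *\<^sub>R f x))"
    using assms(1) unfolding set_integrable_def by (rule integrable_mult_right)
  show "AE x in lborel. norm (f x * g x) \<le> norm (M * (indicator C x *\<^sub>R f x))"
  proof (rule AE_I2)
    fix x
    have "0 \<le> M" using assms(4)[of x] by linarith
    then show "norm (f x * g x) \<le> norm (M * (indicator C x *\<^sub>R f x))"
      using assms(4)[of x] assms(5)[of x]
      by (cases "x \<in> C") (auto simp: abs_mult mult.commute[of "\<bar>f x\<bar>"] intro: mult_right_mono)
  qed
qed simp

lemma loc_int_test:
  assumes "loc_int U f" "\<phi> \<in> test_functions U"
  shows "integrable lborel (\<lambda>x. f x * \<phi> x)"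
proof -
  obtain C where C: "compact C" "C \<subseteq> U" "\<forall>x. x \<notin> C \<longrightarrow> \<phi> x = 0"
    using test_functionsD[OF assms(2)] by auto
  obtain M where M: "0 \<le> M" "\<And>x. \<bar>\<phi> x\<bar> \<le> M" using test_functions_bounded[OF assms(2)] by blast
  show ?thesis
    by (rule integrable_bounded_support[where C=C and M=M])
       (use assms C M test_functionsD(1)[OF assms(2)] in \<open>auto simp: loc_int_def intro: smooth_borel\<close>)
qed

text \<open>Positive and negative part of \<open>g\<close> are densities of finite measures that
  agree on boxes. Boxes form a generator stable under intersections, so the measures coincide, and
  with them the densities.\<close>

lemma lborel_integral_zero_boxes:
  fixes g :: "'a::euclidean_space \<Rightarrow> real"
  assumes g: "integrable lborel g" and z: "\<And>c d. (LINT x|lborel. g x * indicator (box c d) x) = 0"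
  shows "AE x in lborel. g x = 0"
proof -
  have [measurable]: "g \<in> borel_measurable borel" using g by simp
  let ?M = "density lborel (\<lambda>x. ennreal (g x))" and ?N = "density lborel (\<lambda>x. ennreal (- g x))"
  have fin: "(\<integral>\<^sup>+x. ennreal (g x) \<partial>lborel) < \<infinity>" "(\<integral>\<^sup>+x. ennreal (- g x) \<partial>lborel) < \<infinity>"
    using g unfolding real_integrable_def by (auto simp: less_top)
  have eq: "emeasure ?M (box c d) = emeasure ?N (box c d)" for c d
  proof -
    let ?h = "\<lambda>x. g x * indicator (box c d) x"
    have h: "integrable lborel ?h"
      using integrable_mult_indicator[of "box c d" lborel g] g by (simp add: mult.commute)
    have "enn2real (\<integral>\<^sup>+x. ennreal (?h x) \<partial>lborel) = enn2real (\<integral>\<^sup>+x. ennreal (- ?h x) \<partial>lborel)"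
      using z[of c d] real_lebesgue_integral_def[OF h] by simp
    moreover have "(\<integral>\<^sup>+x. ennreal (?h x) \<partial>lborel) < \<infinity>" "(\<integral>\<^sup>+x. ennreal (- ?h x) \<partial>lborel) < \<infinity>"
      using h unfolding real_integrable_def by (auto simp: less_top)
    ultimately have "(\<integral>\<^sup>+x. ennreal (?h x) \<partial>lborel) = (\<integral>\<^sup>+x. ennreal (- ?h x) \<partial>lborel)"
      by (metis ennreal_enn2real infinity_ennreal_def)
    moreover have "ennreal (?h x) = ennreal (g x) * indicator (box c d) x"
      "ennreal (- ?h x) = ennreal (- g x) * indicator (box c d) x" for x
      by (auto simp: indicator_def)
    ultimately show ?thesis by (simp add: emeasure_density)
  qed
  have "?M = ?N"
  proof (rule measure_eqI_generator_eq[where E="range (\<lambda>(a, b). box a b)" and \<Omega>=UNIV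
        and A="\<lambda>n. box (- (real n *\<^sub>R One)) (real n *\<^sub>R One)"])
    show "Int_stable (range (\<lambda>(a, b). box a b :: 'a set))"
      by (auto simp: Int_stable_def box_Int_box)
    show "sets ?M = sigma_sets UNIV (range (\<lambda>(a, b). box a b))"
      "sets ?N = sigma_sets UNIV (range (\<lambda>(a, b). box a b))"
      by (simp_all add: borel_eq_box)
    show "(\<Union>n. box (- (real n *\<^sub>R One)) (real n *\<^sub>R One)) = (UNIV :: 'a set)"
      by (rule UN_box_eq_UNIV)
    show "emeasure ?M (box (- (real n *\<^sub>R One)) (real n *\<^sub>R One)) \<noteq> \<infinity>" for n
    proof -
      have "emeasure ?M (box (- (real n *\<^sub>R One)) (real n *\<^sub>R One)) \<le> emeasure ?M (space ?M)"
        by (rule emeasure_space)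
      also have "\<dots> < \<infinity>" using fin by (simp add: emeasure_density)
      finally show ?thesis by simp
    qed
  qed (use eq in auto)
  moreover have "sigma_finite_measure ?M"
    using fin by (intro finite_measure.axioms(1) finite_measureI) (simp add: emeasure_density)
  ultimately have "AE x in lborel. ennreal (g x) = ennreal (- g x)"
    by (subst (asm) sigma_finite_density_unique) auto
  then show ?thesis
  proof eventually_elim
    case (elim x)
    then show ?case by (cases "0 \<le> g x") (auto simp: ennreal_neg)
  qed
qed

text \<open>Smooth bumps converge boundedly to the indicator of a box, so the integral of
  \<open>f\<close> vanishes over every box whose closure lies in \<open>V\<close>, and
  \<open>f\<close> vanishes almost everywhere there. By Lindelof countably many such boxes cover
  \<open>V\<close>.\<close>

lemma fundamental_lemma:
  fixes f :: "real^'n \<Rightarrow> real"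
  assumes V: "open V" and f: "loc_int V f"
    and z: "\<And>\<phi>. \<phi> \<in> test_functions V \<Longrightarrow> (LINT x|lborel. f x * \<phi> x) = 0"
  shows "AE x in lborel. x \<in> V \<longrightarrow> f x = 0"
proof -
  have [measurable]: "f \<in> borel_measurable borel" using f by simp
  have box0: "(LINT x|lborel. f x * indicator (box a b) x) = 0" if ab: "cbox a b \<subseteq> V" for a b
  proof -
    let ?s = "\<lambda>n x. f x * box_bump (real (Suc n)) a b x"
    have "(\<lambda>n. LINT x|lborel. ?s n x) \<longlonglongrightarrow> (LINT x|lborel. f x * indicator (box a b) x)"
    proof (rule integral_dominated_convergence[where w="\<lambda>x. norm (indicator (cbox a b) x *\<^sub>R f x)"])
      show "integrable lborel (\<lambda>x. norm (indicator (cbox a b) x *\<^sub>R f x))"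
        using f ab unfolding loc_int_def set_integrable_def by auto
      show "AE x in lborel. (\<lambda>n. ?s n x) \<longlonglongrightarrow> f x * indicator (box a b) x"
        by (intro AE_I2 tendsto_mult tendsto_const box_bump_tendsto)
      show "AE x in lborel. norm (?s n x) \<le> norm (indicator (cbox a b) x *\<^sub>R f x)" for n
      proof (rule AE_I2)
        fix x show "norm (?s n x) \<le> norm (indicator (cbox a b) x *\<^sub>R f x)"
        proof (cases "x \<in> box a b")
          case True
          then have "x \<in> cbox a b" using box_subset_cbox by blast
          then show ?thesis
            using box_bump_bounds[of "real (Suc n)" a b x] by (auto simp: abs_mult mult_left_le)
        qed (simp add: box_bump_zero)
      qed
      show "?s n \<in> borel_measurable lborel" for n
        using smooth_borel[OF smooth_box_bump[of "real (Suc n)" a b]] by simp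
    qed simp
    moreover have "(LINT x|lborel. ?s n x) = 0" for n
      by (rule z[OF box_bump_test[OF _ ab]]) simp
    ultimately show ?thesis by (simp add: LIMSEQ_const_iff)
  qed
  have box_AE: "AE x in lborel. x \<in> box a b \<longrightarrow> f x = 0" if ab: "cbox a b \<subseteq> V" for a b
  proof -
    let ?g = "\<lambda>x. f x * indicator (box a b) x"
    have "set_integrable lborel (box a b) f"
      by (rule set_integrable_subset[of lborel "cbox a b"])
         (use f ab in \<open>auto simp: loc_int_def intro: subsetD[OF box_subset_cbox]\<close>)
    then have "integrable lborel ?g" unfolding set_integrable_def by (simp add: mult.commute)
    then have "AE x in lborel. ?g x = 0"
    proof (rule lborel_integral_zero_boxes)
      fix c d :: "real^'n"
      obtain e h where eh: "box a b \<inter> box c d = box e h" by (simp add: box_Int_box)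
      have "(LINT x|lborel. ?g x * indicator (box c d) x) = (LINT x|lborel. f x * indicator (box e h) x)"
        unfolding eh[symmetric] by (intro Bochner_Integration.integral_cong) (auto simp: indicator_def)
      also have "\<dots> = 0"
      proof (cases "box e h = {}")
        case False
        have "box e h \<subseteq> cbox a b" using eh box_subset_cbox by blast
        then have "closure (box e h) \<subseteq> cbox a b" by (intro closure_minimal) auto
        then have "cbox e h \<subseteq> V" using False ab by (simp add: closure_box)
        then show ?thesis by (rule box0)
      qed simp
      finally show "(LINT x|lborel. ?g x * indicator (box c d) x) = 0" .
    qed
    then show ?thesis by eventually_elim auto
  qed
  let ?F = "{box a b | a b. cbox a b \<subseteq> V}"
  obtain F where F: "F \<subseteq> ?F" "countable F" "\<Union>F = \<Union>?F"
    by (rule Lindelof[of ?F]) auto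
  have "V \<subseteq> \<Union>?F"
  proof
    fix x assume "x \<in> V"
    then obtain e where e: "0 < e" "cball x e \<subseteq> V" using V open_contains_cball by blast
    obtain a b where ab: "x \<in> box a b" "box a b \<subseteq> ball x e" using rational_boxes[OF e(1), of x] by auto
    have "closure (box a b) \<subseteq> cball x e"
      using ab ball_subset_cball by (intro closure_minimal) auto
    moreover have "closure (box a b) = cbox a b" using ab(1) by (intro closure_box) auto
    ultimately have "cbox a b \<subseteq> V" using e by simp
    then show "x \<in> \<Union>?F" using ab by auto
  qed
  moreover have "AE x in lborel. \<forall>S\<in>F. x \<in> S \<longrightarrow> f x = 0"
    using F box_AE by (subst AE_ball_countable) auto
  ultimately show ?thesis
    using F by (auto elim!: eventually_mono)
qed

subsection \<open>Averages along segments\<close>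

definition seg_dom :: "(real^'n) set \<Rightarrow> real^'n \<Rightarrow> (real^'n) set" where
  "seg_dom U b = {x. \<forall>s\<in>{0..1}. x + s *\<^sub>R b \<in> U}"

text \<open>The complement is the Minkowski difference of the closed set \<open>- U\<close> and a
  compact segment, hence closed.\<close>

lemma open_seg_dom:
  assumes "open U"
  shows "open (seg_dom U b)"
proof -
  have "closed (\<Union>x\<in>- U. \<Union>y\<in>(\<lambda>s. s *\<^sub>R b) ` {0..1}. {x - y})"
    using assms by (intro closed_compact_differences compact_continuous_image continuous_intros) auto
  moreover have "(\<Union>x\<in>- U. \<Union>y\<in>(\<lambda>s. s *\<^sub>R b) ` {0..1}. {x - y}) = - seg_dom U b"
  proof (intro set_eqI iffI)
    fix z assume "z \<in> - seg_dom U b"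
    then obtain s where "s \<in> {0..1}" "z + s *\<^sub>R b \<notin> U" by (auto simp: seg_dom_def)
    then show "z \<in> (\<Union>x\<in>- U. \<Union>y\<in>(\<lambda>s. s *\<^sub>R b) ` {0..1}. {x - y})"
      by (intro UN_I[of "z + s *\<^sub>R b"] UN_I[of "s *\<^sub>R b"]) auto
  next
    fix z assume "z \<in> (\<Union>x\<in>- U. \<Union>y\<in>(\<lambda>s. s *\<^sub>R b) ` {0..1}. {x - y})"
    then obtain x s where "x \<notin> U" "s \<in> {0..1}" "z = x - s *\<^sub>R b" by auto
    then show "z \<in> - seg_dom U b" by (auto simp: seg_dom_def intro!: bexI[of _ s])
  qed
  ultimately show ?thesis by (simp add: open_closed)
qed

definition seg_hull :: "(real^'n) set \<Rightarrow> real^'n \<Rightarrow> (real^'n) set" where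
  "seg_hull C b = (\<lambda>(x, s). x + s *\<^sub>R b) ` (C \<times> {0..1})"

lemma compact_seg_hull: "compact C \<Longrightarrow> compact (seg_hull C b)"
  unfolding seg_hull_def
  by (intro compact_continuous_image compact_Times) (auto intro!: continuous_intros simp: case_prod_beta)

lemma seg_hull_subset: "C \<subseteq> seg_dom U b \<Longrightarrow> seg_hull C b \<subseteq> U"
  by (auto simp: seg_hull_def seg_dom_def)

lemma seg_hull_mem: "x \<in> C \<Longrightarrow> s \<in> {0..1} \<Longrightarrow> x + s *\<^sub>R b \<in> seg_hull C b"
  by (auto simp: seg_hull_def)

text \<open>These are the two hypotheses of Fubini in the exchange below. All points at which
  \<open>G\<close> is evaluated with nonzero weight lie in the compact set
  \<open>seg_hull C b\<close> inside \<open>U\<close>, where \<open>G\<close> is integrable.\<close>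

lemma integrable_seg_product:
  fixes G \<phi> :: "real^'n \<Rightarrow> real"
  assumes G: "loc_int U G" and C: "compact C" "C \<subseteq> seg_dom U b"
    and [measurable]: "\<phi> \<in> borel_measurable borel" and \<phi>: "\<And>x. \<bar>\<phi> x\<bar> \<le> M" "\<And>x. x \<notin> C \<Longrightarrow> \<phi> x = 0"
  shows "integrable (lborel \<Otimes>\<^sub>M lborel) (\<lambda>(x, s). indicator {0..1::real} s * (G (x + s *\<^sub>R b) * \<phi> x))"
    and "integrable (lborel \<Otimes>\<^sub>M lborel) (\<lambda>(x, s). indicator {0..1::real} s * (G x * \<phi> (x - s *\<^sub>R b)))"
proof -
  have [measurable]: "G \<in> borel_measurable borel" using G by simp
  let ?D = "seg_hull C b"
  have D: "compact ?D" "?D \<subseteq> U" using compact_seg_hull[OF C(1)] seg_hull_subset[OF C(2)] by auto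
  then have [measurable]: "?D \<in> sets borel" by (simp add: borel_closed compact_imp_closed)
  have "integrable lborel (\<lambda>x. indicator ?D x *\<^sub>R G x)"
    using G D unfolding loc_int_def set_integrable_def by blast
  then have fin: "(\<integral>\<^sup>+x. ennreal (norm (indicator ?D x *\<^sub>R G x)) \<partial>lborel) < \<infinity>"
    unfolding integrable_iff_bounded by blast
  have M: "0 \<le> M" using \<phi>(1)[of 0] by linarith
  let ?B = "\<lambda>x. ennreal M * ennreal (norm (indicator ?D x *\<^sub>R G x))"
  have B: "(\<integral>\<^sup>+x. ?B x \<partial>lborel) < \<infinity>" using fin by (simp add: nn_integral_cmult ennreal_mult_less_top)
  have fin2: "(\<integral>\<^sup>+s. indicator {0..1::real} s * (\<integral>\<^sup>+x. ?B x \<partial>lborel) \<partial>lborel) < \<infinity>"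
    using B by (simp add: nn_integral_multc)
  show "integrable (lborel \<Otimes>\<^sub>M lborel) (\<lambda>(x, s). indicator {0..1::real} s * (G (x + s *\<^sub>R b) * \<phi> x))"
  proof (rule integrableI_bounded)
    have "(\<integral>\<^sup>+z. ennreal (norm (case z of (x, s) \<Rightarrow> indicator {0..1::real} s * (G (x + s *\<^sub>R b) * \<phi> x))) \<partial>(lborel \<Otimes>\<^sub>M lborel))
      = (\<integral>\<^sup>+s. \<integral>\<^sup>+x. ennreal (norm (indicator {0..1::real} s * (G (x + s *\<^sub>R b) * \<phi> x))) \<partial>lborel \<partial>lborel)"
      by (subst lborel_pair.nn_integral_snd[symmetric]) simp_all
    also have "\<dots> \<le> (\<integral>\<^sup>+s. indicator {0..1::real} s * (\<integral>\<^sup>+x. ?B x \<partial>lborel) \<partial>lborel)"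
    proof (rule nn_integral_mono)
      fix s :: real
      have "(\<integral>\<^sup>+x. ennreal (norm (indicator {0..1::real} s * (G (x + s *\<^sub>R b) * \<phi> x))) \<partial>lborel)
        \<le> (\<integral>\<^sup>+x. indicator {0..1} s * ?B (x + s *\<^sub>R b) \<partial>lborel)"
      proof (rule nn_integral_mono)
        fix x
        show "ennreal (norm (indicator {0..1::real} s * (G (x + s *\<^sub>R b) * \<phi> x))) \<le> indicator {0..1} s * ?B (x + s *\<^sub>R b)"
        proof (cases "s \<in> {0..1} \<and> x \<in> C")
          case True
          then have "x + s *\<^sub>R b \<in> ?D" by (auto intro: seg_hull_mem)
          then show ?thesis using True mult_right_mono[OF \<phi>(1)[of x], of "\<bar>G (x + s *\<^sub>R b)\<bar>"] M
            by (auto simp: abs_mult ennreal_mult[symmetric] mult.commute[of _ "\<bar>\<phi> x\<bar>"] intro!: ennreal_leI)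
        qed (auto simp: \<phi>(2))
      qed
      also have "\<dots> = indicator {0..1} s * (\<integral>\<^sup>+x. ?B (x + s *\<^sub>R b) \<partial>lborel)"
        by (rule nn_integral_cmult) simp
      also have "(\<integral>\<^sup>+x. ?B (x + s *\<^sub>R b) \<partial>lborel) = (\<integral>\<^sup>+x. ?B x \<partial>lborel)"
        by (rule nn_integral_translate) simp
      finally show "(\<integral>\<^sup>+x. ennreal (norm (indicator {0..1::real} s * (G (x + s *\<^sub>R b) * \<phi> x))) \<partial>lborel)
        \<le> indicator {0..1} s * (\<integral>\<^sup>+x. ?B x \<partial>lborel)" .
    qed
    also note fin2
    finally show "(\<integral>\<^sup>+z. ennreal (norm (case z of (x, s) \<Rightarrow> indicator {0..1::real} s * (G (x + s *\<^sub>R b) * \<phi> x))) \<partial>(lborel \<Otimes>\<^sub>M lborel)) < \<infinity>" .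
  qed measurable
  show "integrable (lborel \<Otimes>\<^sub>M lborel) (\<lambda>(x, s). indicator {0..1::real} s * (G x * \<phi> (x - s *\<^sub>R b)))"
  proof (rule integrableI_bounded)
    have "(\<integral>\<^sup>+z. ennreal (norm (case z of (x, s) \<Rightarrow> indicator {0..1::real} s * (G x * \<phi> (x - s *\<^sub>R b)))) \<partial>(lborel \<Otimes>\<^sub>M lborel))
      = (\<integral>\<^sup>+s. \<integral>\<^sup>+x. ennreal (norm (indicator {0..1::real} s * (G x * \<phi> (x - s *\<^sub>R b)))) \<partial>lborel \<partial>lborel)"
      by (subst lborel_pair.nn_integral_snd[symmetric]) simp_all
    also have "\<dots> \<le> (\<integral>\<^sup>+s. indicator {0..1::real} s * (\<integral>\<^sup>+x. ?B x \<partial>lborel) \<partial>lborel)"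
    proof (rule nn_integral_mono)
      fix s :: real
      have "(\<integral>\<^sup>+x. ennreal (norm (indicator {0..1::real} s * (G x * \<phi> (x - s *\<^sub>R b)))) \<partial>lborel)
        \<le> (\<integral>\<^sup>+x. indicator {0..1} s * ?B x \<partial>lborel)"
      proof (rule nn_integral_mono)
        fix x
        show "ennreal (norm (indicator {0..1::real} s * (G x * \<phi> (x - s *\<^sub>R b)))) \<le> indicator {0..1} s * ?B x"
        proof (cases "s \<in> {0..1} \<and> x - s *\<^sub>R b \<in> C")
          case True
          then have "x \<in> ?D" using seg_hull_mem[of "x - s *\<^sub>R b" C s b] by auto
          then show ?thesis using True mult_right_mono[OF \<phi>(1)[of "x - s *\<^sub>R b"], of "\<bar>G x\<bar>"] M
            by (auto simp: abs_mult ennreal_mult[symmetric] mult.commute[of _ "\<bar>\<phi> (x - s *\<^sub>R b)\<bar>"] intro!: ennreal_leI)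
        qed (auto simp: \<phi>(2))
      qed
      also have "\<dots> = indicator {0..1} s * (\<integral>\<^sup>+x. ?B x \<partial>lborel)"
        by (rule nn_integral_cmult) simp
      finally show "(\<integral>\<^sup>+x. ennreal (norm (indicator {0..1::real} s * (G x * \<phi> (x - s *\<^sub>R b)))) \<partial>lborel)
        \<le> indicator {0..1} s * (\<integral>\<^sup>+x. ?B x \<partial>lborel)" .
    qed
    also note fin2
    finally show "(\<integral>\<^sup>+z. ennreal (norm (case z of (x, s) \<Rightarrow> indicator {0..1::real} s * (G x * \<phi> (x - s *\<^sub>R b)))) \<partial>(lborel \<Otimes>\<^sub>M lborel)) < \<infinity>" .
  qed measurable
qed

text \<open>Fubini and, for each fixed \<open>s\<close>, a translation by
  \<open>s *\<^sub>R b\<close>: the forward average along the segment is adjoint to the backward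
  average, which is why \<open>seg_avg\<close> carries a minus sign.\<close>

lemma seg_average_swap:
  fixes G \<phi> :: "real^'n \<Rightarrow> real"
  assumes G: "loc_int U G" and C: "compact C" "C \<subseteq> seg_dom U b"
    and [measurable]: "\<phi> \<in> borel_measurable borel" and \<phi>: "\<And>x. \<bar>\<phi> x\<bar> \<le> M" "\<And>x. x \<notin> C \<Longrightarrow> \<phi> x = 0"
  shows "(LINT x|lborel. (LINT s:{0..1}|lborel. G (x + s *\<^sub>R b)) * \<phi> x)
     = (LINT x|lborel. G x * (LINT s:{0..1}|lborel. \<phi> (x - s *\<^sub>R b)))"
proof -
  have [measurable]: "G \<in> borel_measurable borel" using G by simp
  note int = integrable_seg_product[OF assms]
  have "(LINT x|lborel. (LINT s:{0..1}|lborel. G (x + s *\<^sub>R b)) * \<phi> x) =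
     (LINT x|lborel. LINT s|lborel. indicator {0..1} s * (G (x + s *\<^sub>R b) * \<phi> x))"
    unfolding set_lebesgue_integral_def
    by (intro Bochner_Integration.integral_cong refl) (simp add: mult.assoc[symmetric])
  also have "\<dots> = (LINT s|lborel. LINT x|lborel. indicator {0..1} s * (G (x + s *\<^sub>R b) * \<phi> x))"
    by (rule lborel_pair.Fubini_integral[OF int(1), symmetric])
  also have "\<dots> = (LINT s|lborel. LINT x|lborel. indicator {0..1} s * (G x * \<phi> (x - s *\<^sub>R b)))"
  proof (rule Bochner_Integration.integral_cong[OF refl])
    fix s :: real
    show "(LINT x|lborel. indicator {0..1} s * (G (x + s *\<^sub>R b) * \<phi> x)) =
      (LINT x|lborel. indicator {0..1} s * (G x * \<phi> (x - s *\<^sub>R b)))"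
      using integral_translate[of "\<lambda>x. indicator {0..1} s * (G x * \<phi> (x - s *\<^sub>R b))" "s *\<^sub>R b"] by simp
  qed
  also have "\<dots> = (LINT x|lborel. LINT s|lborel. indicator {0..1} s * (G x * \<phi> (x - s *\<^sub>R b)))"
    by (rule lborel_pair.Fubini_integral[OF int(2)])
  also have "\<dots> = (LINT x|lborel. G x * (LINT s:{0..1}|lborel. \<phi> (x - s *\<^sub>R b)))"
    unfolding set_lebesgue_integral_def
    by (intro Bochner_Integration.integral_cong refl) (simp add: mult.left_commute)
  finally show ?thesis .
qed

abbreviation seg_avg :: "real^'n \<Rightarrow> (real^'n \<Rightarrow> real) \<Rightarrow> real^'n \<Rightarrow> real" where
  "seg_avg b \<phi> x \<equiv> (LINT s:{0..1}|lborel. \<phi> (x - s *\<^sub>R b))"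

lemma smooth_line_continuous: "smooth \<phi> \<Longrightarrow> continuous_on S (\<lambda>s. \<phi> (x - s *\<^sub>R b))"
  by (rule continuous_on_compose2[OF smooth_continuous[of _ UNIV]]) (auto intro!: continuous_intros)

lemma smooth_line_set_integrable: "smooth \<phi> \<Longrightarrow> set_integrable lborel {0..1::real} (\<lambda>s. \<phi> (x - s *\<^sub>R b))"
  by (intro borel_integrable_atLeastAtMost' smooth_line_continuous)

lemma seg_avg_eq_integral: "smooth \<phi> \<Longrightarrow> seg_avg b \<phi> x = integral {0..1} (\<lambda>s. \<phi> (x - s *\<^sub>R b))"
  by (rule set_borel_integral_eq_integral(2)[OF smooth_line_set_integrable])

lemma seg_avg_has_derivative:
  fixes \<phi> :: "real^'n \<Rightarrow> real"
  assumes \<phi>: "smooth \<phi>"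
  shows "(seg_avg b \<phi> has_derivative gradient_form (\<lambda>i. seg_avg b (partial_deriv i \<phi>)) x) (at x)"
proof -
  \<comment> \<open>The rule for differentiation under the integral takes the derivative as a
    continuous family of bounded linear maps; the coordinate functionals \<open>c i\<close> express
    the gradient in that form.\<close>
  define c :: "'n \<Rightarrow> (real^'n) \<Rightarrow>\<^sub>L real" where "c i = Blinfun (\<lambda>v. v $ i)" for i
  have c: "blinfun_apply (c i) v = v $ i" for i v
    unfolding c_def by (simp add: bounded_linear_Blinfun_apply bounded_linear_vec_nth)
  define fx where "fx x s = (\<Sum>i\<in>UNIV. partial_deriv i \<phi> (x - s *\<^sub>R b) *\<^sub>R c i)" for x :: "real^'n" and s :: real
  have fx: "blinfun_apply (fx x s) = (\<lambda>v. gradient_form (\<lambda>i. partial_deriv i \<phi>) (x - s *\<^sub>R b) v)" for x s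
    by (rule ext) (simp add: fx_def blinfun.sum_left blinfun.scaleR_left c mult.commute)
  have cont: "continuous_on S (\<lambda>z. partial_deriv i \<phi> (fst z - snd z *\<^sub>R b))" for S i
    by (rule continuous_on_compose2[OF smooth_continuous[of _ UNIV]])
       (auto intro!: continuous_intros smooth_partial_deriv \<phi>)
  have cfx: "continuous_on S (\<lambda>(x, s). fx x s)" for S
    unfolding fx_def case_prod_beta by (intro continuous_on_sum continuous_on_scaleR cont continuous_on_const)
  have 1: "((\<lambda>x. integral (cbox 0 1) (\<lambda>s. \<phi> (x - s *\<^sub>R b))) has_derivative integral (cbox 0 1) (fx x)) (at x within UNIV)"
  proof (rule leibniz_rule)
    fix x :: "real^'n" and s :: real
    show "((\<lambda>x. \<phi> (x - s *\<^sub>R b)) has_derivative blinfun_apply (fx x s)) (at x within UNIV)"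
      unfolding fx
    proof (rule has_derivative_compose[of "\<lambda>x. x - s *\<^sub>R b" "\<lambda>v. v" x UNIV \<phi>, OF _ smooth_has_derivative[OF \<phi>]])
      show "((\<lambda>x. x - s *\<^sub>R b) has_derivative (\<lambda>v. v)) (at x)"
        by (auto intro!: derivative_eq_intros)
    qed
    show "(\<lambda>s. \<phi> (x - s *\<^sub>R b)) integrable_on cbox 0 1"
      by (intro integrable_continuous smooth_line_continuous \<phi>)
  qed (auto simp: cfx)
  have 2: "blinfun_apply (integral (cbox 0 1) (fx x)) v = gradient_form (\<lambda>i. seg_avg b (partial_deriv i \<phi>)) x v" for v
  proof -
    have "fx x integrable_on cbox 0 1"
      by (rule integrable_continuous)
         (unfold fx_def, intro continuous_on_sum continuous_on_scaleR continuous_on_const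
           smooth_line_continuous smooth_partial_deriv \<phi>)
    then have "blinfun_apply (integral (cbox 0 1) (fx x)) v = integral (cbox 0 1) (\<lambda>s. blinfun_apply (fx x s) v)"
      by (rule blinfun_apply_integral)
    also have "\<dots> = integral {0..1} (\<lambda>s. \<Sum>i\<in>UNIV. v $ i * partial_deriv i \<phi> (x - s *\<^sub>R b))"
      by (simp add: fx)
    also have "\<dots> = (\<Sum>i\<in>UNIV. integral {0..1} (\<lambda>s. v $ i * partial_deriv i \<phi> (x - s *\<^sub>R b)))"
      by (intro integral_sum integrable_continuous_interval continuous_on_mult continuous_on_const
          smooth_line_continuous smooth_partial_deriv \<phi>) auto
    finally show ?thesis by (simp add: seg_avg_eq_integral smooth_partial_deriv \<phi>)
  qed
  have 3: "seg_avg b \<phi> = (\<lambda>x. integral (cbox 0 1) (\<lambda>s. \<phi> (x - s *\<^sub>R b)))"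
    by (rule ext) (simp add: seg_avg_eq_integral \<phi>)
  show ?thesis unfolding 3 by (rule has_derivative_eq_rhs[OF 1 ext[OF 2]])
qed

lemma smooth_seg_avg: "smooth \<phi> \<Longrightarrow> smooth (seg_avg b \<phi>)"
proof (rule smooth_coinduct[of _ "{seg_avg b f | f. smooth f}"])
  fix g assume "g \<in> {seg_avg b f | f. smooth f}"
  then obtain f where f: "g = seg_avg b f" "smooth f" by blast
  have "\<forall>i. seg_avg b (partial_deriv i f) \<in> {seg_avg b f | f. smooth f}"
    using smooth_partial_deriv[OF f(2)] by blast
  moreover have "\<forall>x. (g has_derivative gradient_form (\<lambda>i. seg_avg b (partial_deriv i f)) x) (at x)"
    unfolding f(1) using seg_avg_has_derivative[OF f(2)] by (rule allI)
  ultimately show "\<exists>g'. (\<forall>i. g' i \<in> {seg_avg b f | f. smooth f}) \<and> (\<forall>x. (g has_derivative gradient_form g' x) (at x))"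
    by (intro exI[of _ "\<lambda>i. seg_avg b (partial_deriv i f)"] conjI)
qed blast

lemma partial_deriv_seg_avg: "smooth \<phi> \<Longrightarrow> partial_deriv i (seg_avg b \<phi>) = seg_avg b (partial_deriv i \<phi>)"
  by (rule partial_deriv_gradient_form[OF seg_avg_has_derivative])

abbreviation dir_deriv :: "real^'n \<Rightarrow> (real^'n \<Rightarrow> real) \<Rightarrow> real^'n \<Rightarrow> real" where
  "dir_deriv b \<phi> x \<equiv> gradient_form (\<lambda>i. partial_deriv i \<phi>) x b"

lemma smooth_dir_deriv: "smooth \<phi> \<Longrightarrow> smooth (dir_deriv b \<phi>)"
  by (intro smooth_sum smooth_cmult smooth_partial_deriv)

lemma seg_avg_dir_deriv:
  assumes \<phi>: "smooth \<phi>"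
  shows "seg_avg b (dir_deriv b \<phi>) x = \<phi> x - \<phi> (x - b)"
proof -
  have "((\<lambda>s. dir_deriv (- b) \<phi> (x + s *\<^sub>R (- b))) has_integral (\<phi> (x + 1 *\<^sub>R (- b)) - \<phi> (x + 0 *\<^sub>R (- b)))) {0..1}"
    by (rule fundamental_theorem_of_calculus)
       (auto simp: has_real_derivative_iff_has_vector_derivative[symmetric] simp del: vector_uminus_component scaleR_minus_right
         intro: DERIV_subset[OF smooth_line_deriv[OF \<phi>]])
  then have "integral {0..1} (\<lambda>s. dir_deriv (- b) \<phi> (x + s *\<^sub>R (- b))) = \<phi> (x - b) - \<phi> x"
    by (intro integral_unique) simp
  moreover have "dir_deriv (- b) \<phi> (x + s *\<^sub>R (- b)) = - dir_deriv b \<phi> (x - s *\<^sub>R b)" for s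
    by (simp add: sum_negf)
  ultimately show ?thesis
    by (simp add: seg_avg_eq_integral[OF smooth_dir_deriv[OF \<phi>]])
qed

lemma seg_avg_bound:
  assumes "smooth \<phi>" "\<And>x. \<bar>\<phi> x\<bar> \<le> M"
  shows "\<bar>seg_avg b \<phi> x\<bar> \<le> M"
proof -
  have "norm (integral {0..1} (\<lambda>s. \<phi> (x - s *\<^sub>R b))) \<le> M * (1 - 0)"
    by (rule integral_bound) (use assms smooth_line_continuous in auto)
  then show ?thesis by (simp add: seg_avg_eq_integral assms)
qed

lemma seg_avg_zero:
  assumes "\<And>s. s \<in> {0..1} \<Longrightarrow> \<phi> (x - s *\<^sub>R b) = 0"
  shows "seg_avg b \<phi> x = 0"
proof -
  have "seg_avg b \<phi> x = (LINT s:{0..1::real}|lborel. 0)"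
    by (rule set_lebesgue_integral_cong) (use assms in auto)
  then show ?thesis by (simp add: set_lebesgue_integral_def)
qed

lemma seg_avg_test:
  assumes "\<phi> \<in> test_functions (seg_dom U b)"
  shows "seg_avg b \<phi> \<in> test_functions U"
proof -
  obtain C where C: "compact C" "C \<subseteq> seg_dom U b" "\<forall>x. x \<notin> C \<longrightarrow> \<phi> x = 0"
    using test_functionsD[OF assms] by auto
  show ?thesis
  proof (rule test_functionsI[OF smooth_seg_avg[OF test_functionsD(1)[OF assms]] compact_seg_hull[OF C(1)] seg_hull_subset[OF C(2)]])
    fix x assume "seg_avg b \<phi> x \<noteq> 0"
    then obtain s where s: "s \<in> {0..1}" "\<phi> (x - s *\<^sub>R b) \<noteq> 0" using seg_avg_zero[of \<phi> x b] by blast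
    then have "x - s *\<^sub>R b \<in> C" using C by blast
    from seg_hull_mem[OF this s(1), of b] show "x \<in> seg_hull C b" by simp
  qed
qed

subsection \<open>Weak directional derivatives\<close>

text \<open>The integrals extend over the whole space; since test functions and their derivatives
  vanish off a compact subset of \<open>U\<close>, only the values on \<open>U\<close> enter. The
  direction \<open>b\<close> is an arbitrary vector, so that segments of any length are
  covered.\<close>

definition weak_dir :: "(real^'n) set \<Rightarrow> real^'n \<Rightarrow> (real^'n \<Rightarrow> real) \<Rightarrow> (real^'n \<Rightarrow> real) \<Rightarrow> bool" where
  "weak_dir U b f G \<longleftrightarrow> (\<forall>\<phi>\<in>test_functions U.
     (LINT x|lborel. f x * dir_deriv b \<phi> x) = - (LINT x|lborel. G x * \<phi> x))"

lemma weak_dir_scale: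
  assumes "weak_dir U b f G"
  shows "weak_dir U (t *\<^sub>R b) f (\<lambda>x. t * G x)"
  unfolding weak_dir_def
proof
  fix \<phi> assume "\<phi> \<in> test_functions U"
  with assms have *: "(LINT x|lborel. f x * dir_deriv b \<phi> x) = - (LINT x|lborel. G x * \<phi> x)"
    by (simp add: weak_dir_def)
  have "(LINT x|lborel. f x * dir_deriv (t *\<^sub>R b) \<phi> x) = (LINT x|lborel. t * (f x * dir_deriv b \<phi> x))"
    by (intro Bochner_Integration.integral_cong refl) (simp add: sum_distrib_left mult_ac)
  also have "\<dots> = t * (LINT x|lborel. f x * dir_deriv b \<phi> x)" by simp
  also have "\<dots> = - (LINT x|lborel. t * (G x * \<phi> x))" unfolding * by simp
  finally show "(LINT x|lborel. f x * dir_deriv (t *\<^sub>R b) \<phi> x) = - (LINT x|lborel. t * G x * \<phi> x)"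
    by (simp add: mult.assoc)
qed

lemma seg_integral_borel [measurable]:
  fixes G :: "real^'n \<Rightarrow> real"
  assumes [measurable]: "G \<in> borel_measurable borel"
  shows "(\<lambda>x. LINT s:{0..1}|lborel. G (x + s *\<^sub>R b)) \<in> borel_measurable borel"
  unfolding set_lebesgue_integral_def by measurable

lemma seg_integral_loc_int:
  fixes G :: "real^'n \<Rightarrow> real"
  assumes G: "loc_int U G"
  shows "loc_int (seg_dom U b) (\<lambda>x. LINT s:{0..1}|lborel. G (x + s *\<^sub>R b))"
    and "compact C \<Longrightarrow> C \<subseteq> seg_dom U b \<Longrightarrow>
      AE x in lborel. x \<in> C \<longrightarrow> set_integrable lborel {0..1} (\<lambda>s. G (x + s *\<^sub>R b))"
proof -
  have [measurable]: "G \<in> borel_measurable borel" using G by simp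
  have int: "integrable (lborel \<Otimes>\<^sub>M lborel) (\<lambda>(x, s). indicator {0..1::real} s * (G (x + s *\<^sub>R b) * indicator C x))"
    if C: "compact C" "C \<subseteq> seg_dom U b" for C
  proof (rule integrable_seg_product(1)[OF G C, where M=1])
    have [measurable]: "C \<in> sets borel" using C by (simp add: borel_closed compact_imp_closed)
    show "indicator C \<in> borel_measurable borel" by measurable
  qed (auto simp: indicator_def)
  show "loc_int (seg_dom U b) (\<lambda>x. LINT s:{0..1}|lborel. G (x + s *\<^sub>R b))"
    unfolding loc_int_def
  proof (intro conjI allI impI)
    fix C assume "compact C" "C \<subseteq> seg_dom U b"
    from lborel_pair.integrable_fst'[OF int[OF this]]
    have "integrable lborel (\<lambda>x. LINT s|lborel. indicator {0..1} s * (G (x + s *\<^sub>R b) * indicator C x))" by simp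
    moreover have "(LINT s|lborel. indicator {0..1} s * (G (x + s *\<^sub>R b) * indicator C x)) =
      indicator C x *\<^sub>R (LINT s:{0..1}|lborel. G (x + s *\<^sub>R b))" for x
      unfolding set_lebesgue_integral_def by (cases "x \<in> C") simp_all
    ultimately show "set_integrable lborel C (\<lambda>x. LINT s:{0..1}|lborel. G (x + s *\<^sub>R b))"
      unfolding set_integrable_def by simp
  qed measurable
  assume "compact C" "C \<subseteq> seg_dom U b"
  from lborel_pair.AE_integrable_fst'[OF int[OF this]]
  show "AE x in lborel. x \<in> C \<longrightarrow> set_integrable lborel {0..1} (\<lambda>s. G (x + s *\<^sub>R b))"
  proof eventually_elim
    case (elim x)
    show ?case
    proof
      assume "x \<in> C"
      with elim show "set_integrable lborel {0..1} (\<lambda>s. G (x + s *\<^sub>R b))"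
        unfolding set_integrable_def by simp
    qed
  qed
qed

text \<open>The weak formulation is tested with \<open>seg_avg b \<phi>\<close>, whose derivative in
  direction \<open>b\<close> is the increment of the test function. By duality the same increment
  falls on \<open>f\<close>, and the averages fall on \<open>G\<close>; the fundamental lemma
  removes the test function.\<close>

lemma weak_dir_line:
  fixes f G :: "real^'n \<Rightarrow> real"
  assumes U: "open U" and f: "loc_int U f" and G: "loc_int U G" and w: "weak_dir U b f G"
  shows "AE x in lborel. x \<in> seg_dom U b \<longrightarrow>
    f (x + b) - f x = (LINT s:{0..1}|lborel. G (x + s *\<^sub>R b)) \<and> set_integrable lborel {0..1} (\<lambda>s. G (x + s *\<^sub>R b))"
proof -
  have [measurable]: "f \<in> borel_measurable borel" "G \<in> borel_measurable borel" using f G by simp_all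
  let ?V = "seg_dom U b"
  let ?I = "\<lambda>x. LINT s:{0..1}|lborel. G (x + s *\<^sub>R b)"
  have V: "open ?V" by (rule open_seg_dom[OF U])
  have VU: "?V \<subseteq> U"
  proof
    fix x assume "x \<in> ?V"
    then have "\<forall>s\<in>{0..1}. x + s *\<^sub>R b \<in> U" by (simp add: seg_dom_def)
    from bspec[OF this, of 0] show "x \<in> U" by simp
  qed
  have fb: "loc_int ?V (\<lambda>x. f (x + b))"
    unfolding loc_int_def
  proof (intro conjI allI impI)
    fix C assume C: "compact C" "C \<subseteq> ?V"
    have "x + b \<in> U" if "x \<in> C" for x
    proof -
      have "\<forall>s\<in>{0..1}. x + s *\<^sub>R b \<in> U" using that C(2) by (auto simp: seg_dom_def)
      from bspec[OF this, of 1] show ?thesis by simp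
    qed
    then have "(\<lambda>x. x + b) ` C \<subseteq> U" by blast
    moreover have "compact ((\<lambda>x. x + b) ` C)" by (intro compact_continuous_image continuous_intros C)
    ultimately have "integrable lborel (\<lambda>x. indicator ((\<lambda>x. x + b) ` C) x *\<^sub>R f x)"
      using f unfolding loc_int_def set_integrable_def by blast
    from integrable_translate[OF this, of b] show "set_integrable lborel C (\<lambda>x. f (x + b))"
      unfolding set_integrable_def by (simp add: indicator_def image_iff)
  qed simp
  have I: "loc_int ?V ?I" by (rule seg_integral_loc_int(1)[OF G])
  have h: "loc_int ?V (\<lambda>x. f (x + b) - f x - ?I x)"
    by (intro loc_int_diff fb I loc_int_subset[OF f VU])
  have "AE x in lborel. x \<in> ?V \<longrightarrow> f (x + b) - f x - ?I x = 0"
  proof (rule fundamental_lemma[OF V h])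
    fix \<phi> assume \<phi>: "\<phi> \<in> test_functions ?V"
    have sm: "smooth \<phi>" using test_functionsD(1)[OF \<phi>] .
    have [measurable]: "\<phi> \<in> borel_measurable borel" by (rule smooth_borel[OF sm])
    obtain C where C: "compact C" "C \<subseteq> ?V" "\<forall>x. x \<notin> C \<longrightarrow> \<phi> x = 0" using test_functionsD[OF \<phi>] by auto
    obtain M where M: "\<And>x. \<bar>\<phi> x\<bar> \<le> M" using test_functions_bounded[OF \<phi>] by blast
    have i1: "integrable lborel (\<lambda>x. f (x + b) * \<phi> x)" by (rule loc_int_test[OF fb \<phi>])
    have i2: "integrable lborel (\<lambda>x. f x * \<phi> x)" by (rule loc_int_test[OF loc_int_subset[OF f VU] \<phi>])
    have i3: "integrable lborel (\<lambda>x. ?I x * \<phi> x)" by (rule loc_int_test[OF I \<phi>])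
    have i1': "integrable lborel (\<lambda>x. f x * \<phi> (x - b))"
      using integrable_translate[OF i1, of "- b"] by simp
    have tr: "(LINT x|lborel. f (x + b) * \<phi> x) = (LINT x|lborel. f x * \<phi> (x - b))"
      using integral_translate[of "\<lambda>x. f x * \<phi> (x - b)" b] by simp
    have "(LINT x|lborel. f x * dir_deriv b (seg_avg b \<phi>) x) = - (LINT x|lborel. G x * seg_avg b \<phi> x)"
      using w seg_avg_test[OF \<phi>] unfolding weak_dir_def by blast
    moreover have "dir_deriv b (seg_avg b \<phi>) x = \<phi> x - \<phi> (x - b)" for x
    proof -
      have "dir_deriv b (seg_avg b \<phi>) x = (\<Sum>i\<in>UNIV. b $ i * seg_avg b (partial_deriv i \<phi>) x)"
        by (simp add: partial_deriv_seg_avg[OF sm])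
      also have "\<dots> = (\<Sum>i\<in>UNIV. integral {0..1} (\<lambda>s. b $ i * partial_deriv i \<phi> (x - s *\<^sub>R b)))"
        by (simp add: seg_avg_eq_integral smooth_partial_deriv sm)
      also have "\<dots> = integral {0..1} (\<lambda>s. dir_deriv b \<phi> (x - s *\<^sub>R b))"
        by (intro integral_sum[symmetric] integrable_continuous_interval continuous_on_mult continuous_on_const
            smooth_line_continuous smooth_partial_deriv sm) auto
      also have "\<dots> = seg_avg b (dir_deriv b \<phi>) x"
        by (rule seg_avg_eq_integral[OF smooth_dir_deriv[OF sm], symmetric])
      finally show ?thesis by (simp add: seg_avg_dir_deriv[OF sm])
    qed
    moreover have "(LINT x|lborel. ?I x * \<phi> x) = (LINT x|lborel. G x * seg_avg b \<phi> x)"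
      by (rule seg_average_swap[OF G C(1,2) _ M]) (use C(3) in auto)
    ultimately have "(LINT x|lborel. f x * \<phi> x - f x * \<phi> (x - b)) = - (LINT x|lborel. ?I x * \<phi> x)"
      by (simp add: right_diff_distrib)
    then have "(LINT x|lborel. f x * \<phi> x) - (LINT x|lborel. f (x + b) * \<phi> x) = - (LINT x|lborel. ?I x * \<phi> x)"
      unfolding tr using i2 i1' by simp
    moreover have "(LINT x|lborel. (f (x + b) - f x - ?I x) * \<phi> x) =
      (LINT x|lborel. f (x + b) * \<phi> x) - (LINT x|lborel. f x * \<phi> x) - (LINT x|lborel. ?I x * \<phi> x)"
      unfolding left_diff_distrib using i1 i2 i3 by simp
    ultimately show "(LINT x|lborel. (f (x + b) - f x - ?I x) * \<phi> x) = 0" by linarith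
  qed
  moreover have "AE x in lborel. x \<in> ?V \<longrightarrow> set_integrable lborel {0..1} (\<lambda>s. G (x + s *\<^sub>R b))"
  proof -
    \<comment> \<open>Integrability along segments is known over each compact set only; countably
      many compact sets exhaust the open set of starting points.\<close>
    obtain C :: "nat \<Rightarrow> (real^'n) set" where C: "\<And>n. compact (C n)" "\<And>n. C n \<subseteq> ?V" "\<Union>(range C) = ?V"
      by (rule open_Union_compact_subsets[OF V]) (rule that; assumption)
    have "AE x in lborel. \<forall>n::nat. x \<in> C n \<longrightarrow> set_integrable lborel {0..1} (\<lambda>s. G (x + s *\<^sub>R b))"
      unfolding AE_all_countable by (intro allI seg_integral_loc_int(2)[OF G] C)
    then show ?thesis by eventually_elim (use C(3) in blast)
  qed
  ultimately show ?thesis by eventually_elim auto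
qed

text \<open>As the segments shrink, the averages converge pointwise while they stay bounded by
  \<open>M\<close> and supported in one compact set \<open>D\<close>; this dominates the products
  although \<open>f\<close> is merely locally integrable.\<close>

lemma seg_avg_limit:
  fixes f \<phi> :: "real^'n \<Rightarrow> real"
  assumes f: "loc_int U f" and \<phi>: "smooth \<phi>" "\<And>x. \<bar>\<phi> x\<bar> \<le> M"
    and D: "compact D" "D \<subseteq> U" "\<And>n x. x \<notin> D \<Longrightarrow> seg_avg (t n *\<^sub>R b) \<phi> x = 0" and t: "t \<longlonglongrightarrow> 0"
  shows "(\<lambda>n. LINT x|lborel. f x * seg_avg (t n *\<^sub>R b) \<phi> x) \<longlonglongrightarrow> (LINT x|lborel. f x * \<phi> x)"
proof (rule integral_dominated_convergence[where w="\<lambda>x. M * norm (indicator D x *\<^sub>R f x)"])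
  have [measurable]: "f \<in> borel_measurable borel" using f by simp
  note [measurable] = smooth_borel[OF \<phi>(1)]
  show "(\<lambda>x. f x * \<phi> x) \<in> borel_measurable lborel" by simp
  show "(\<lambda>x. f x * seg_avg (t n *\<^sub>R b) \<phi> x) \<in> borel_measurable lborel" for n
    using smooth_borel[OF smooth_seg_avg[OF \<phi>(1)], of "t n *\<^sub>R b"] by simp
  show "integrable lborel (\<lambda>x. M * norm (indicator D x *\<^sub>R f x))"
    using f D unfolding loc_int_def set_integrable_def by (intro integrable_mult_right integrable_norm) auto
  show "AE x in lborel. norm (f x * seg_avg (t n *\<^sub>R b) \<phi> x) \<le> M * norm (indicator D x *\<^sub>R f x)" for n
  proof (rule AE_I2)
    fix x
    show "norm (f x * seg_avg (t n *\<^sub>R b) \<phi> x) \<le> M * norm (indicator D x *\<^sub>R f x)"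
    proof (cases "x \<in> D")
      case True
      have "norm (f x * seg_avg (t n *\<^sub>R b) \<phi> x) = \<bar>f x\<bar> * \<bar>seg_avg (t n *\<^sub>R b) \<phi> x\<bar>"
        by (simp only: real_norm_def abs_mult)
      also have "\<dots> \<le> \<bar>f x\<bar> * M" by (intro mult_left_mono seg_avg_bound \<phi>) simp
      finally show ?thesis using True by (simp add: mult.commute)
    next
      case False
      show ?thesis unfolding D(3)[OF False] using False by simp
    qed
  qed
  show "AE x in lborel. (\<lambda>n. f x * seg_avg (t n *\<^sub>R b) \<phi> x) \<longlonglongrightarrow> f x * \<phi> x"
  proof (rule AE_I2, intro tendsto_mult tendsto_const)
    fix x
    have "(\<lambda>n. LINT s|lborel. indicator {0..1} s *\<^sub>R \<phi> (x - s *\<^sub>R (t n *\<^sub>R b))) \<longlonglongrightarrow> (LINT s|lborel. indicator {0..1::real} s *\<^sub>R \<phi> x)"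
    proof (rule integral_dominated_convergence[where w="\<lambda>s. M * indicator {0..1} s"])
      show "AE s in lborel. (\<lambda>n. indicator {0..1} s *\<^sub>R \<phi> (x - s *\<^sub>R (t n *\<^sub>R b))) \<longlonglongrightarrow> indicator {0..1::real} s *\<^sub>R \<phi> x"
      proof (rule AE_I2, intro tendsto_scaleR tendsto_const)
        fix s :: real
        have "(\<lambda>n. x - s *\<^sub>R (t n *\<^sub>R b)) \<longlonglongrightarrow> x - s *\<^sub>R (0 *\<^sub>R b)" by (intro tendsto_intros t)
        moreover have "isCont \<phi> x" using smooth_has_derivative[OF \<phi>(1)] has_derivative_continuous by blast
        ultimately show "(\<lambda>n. \<phi> (x - s *\<^sub>R (t n *\<^sub>R b))) \<longlonglongrightarrow> \<phi> x"
          using isCont_tendsto_compose[of x \<phi> "\<lambda>n. x - s *\<^sub>R (t n *\<^sub>R b)" sequentially] by simp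
      qed
      show "integrable lborel (\<lambda>s. M * indicator {0..1::real} s)" by (intro integrable_mult_right) simp
      show "AE s in lborel. norm (indicator {0..1} s *\<^sub>R \<phi> (x - s *\<^sub>R (t n *\<^sub>R b))) \<le> M * indicator {0..1::real} s" for n
        using \<phi>(2) by (auto simp: indicator_def)
    qed measurable
    then show "(\<lambda>n. seg_avg (t n *\<^sub>R b) \<phi> x) \<longlonglongrightarrow> \<phi> x"
      unfolding set_lebesgue_integral_def by simp
  qed
qed

text \<open>The converse of \<open>weak_dir_line\<close>. Paired with a test function, the
  difference quotient of \<open>f\<close> along \<open>t n *\<^sub>R b\<close> is an average of the
  derivative of the test function on one side and of \<open>G\<close> on the other; both converge as
  the step tends to 0.\<close>

lemma line_weak_dir:
  fixes f G :: "real^'n \<Rightarrow> real"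
  assumes U: "open U" and f: "loc_int U f" and G: "loc_int U G"
    and line: "\<And>t. 0 < t \<Longrightarrow> t \<le> 1 \<Longrightarrow> AE x in lborel. x \<in> seg_dom U (t *\<^sub>R b) \<longrightarrow>
      f (x + t *\<^sub>R b) - f x = t * (LINT s:{0..1}|lborel. G (x + s *\<^sub>R (t *\<^sub>R b)))"
  shows "weak_dir U b f G"
  unfolding weak_dir_def
proof
  fix \<phi> assume \<phi>: "\<phi> \<in> test_functions U"
  have [measurable]: "f \<in> borel_measurable borel" "G \<in> borel_measurable borel" using f G by simp_all
  have sm: "smooth \<phi>" using test_functionsD(1)[OF \<phi>] .
  note [measurable] = smooth_borel[OF sm] smooth_borel[OF smooth_dir_deriv[OF sm]]
  obtain C where C: "compact C" "C \<subseteq> U" "\<forall>x. x \<notin> C \<longrightarrow> \<phi> x = 0" using test_functionsD[OF \<phi>] by auto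
  obtain M where M: "\<And>x. \<bar>\<phi> x\<bar> \<le> M" using test_functions_bounded[OF \<phi>] by blast
  have pz: "partial_deriv i \<phi> x = 0" if "x \<notin> C" for x i
    using partial_deriv_zero_outside[OF sm compact_imp_closed[OF C(1)] _ that] C(3) by blast
  have dC: "dir_deriv b \<phi> x = 0" if "x \<notin> C" for x
    using pz[OF that] by simp
  have dtest: "dir_deriv b \<phi> \<in> test_functions U"
    by (rule test_functionsI[OF smooth_dir_deriv[OF sm] C(1,2)]) (use dC in blast)
  obtain M' where M': "\<And>x. \<bar>dir_deriv b \<phi> x\<bar> \<le> M'" using test_functions_bounded[OF dtest] by blast
  obtain e where e: "0 < e" "(\<Union>x\<in>C. cball x e) \<subseteq> U"
    using compact_subset_open_imp_cball_epsilon_subset[OF C(1) U C(2)] by blast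
  define D where "D = {x + y | x y. x \<in> C \<and> y \<in> cball 0 e}"
  have D: "compact D" unfolding D_def using compact_sums[OF C(1) compact_cball[of 0 e]] .
  have DU: "D \<subseteq> U" unfolding D_def using e by (force simp: dist_norm)
  have DI: "x \<in> D" if "y \<in> C" "norm (x - y) \<le> e" for x y
    unfolding D_def using that by (intro CollectI exI[of _ y] exI[of _ "x - y"]) auto
  \<comment> \<open>Shifts of \<open>C\<close> by at most \<open>\<tau> *\<^sub>R b\<close> stay in
    the closed \<open>e\<close>-neighbourhood \<open>D\<close>, and so in \<open>U\<close>. The
    bound 1 keeps the steps in the range for which the increment formula is assumed.\<close>
  define \<tau> where "\<tau> = min 1 (e / (norm b + 1))"
  have \<tau>: "0 < \<tau>" "\<tau> \<le> 1" using e by (auto simp: \<tau>_def add_nonneg_pos)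
  have \<tau>b: "\<tau> * norm b \<le> e"
  proof -
    have "\<tau> * norm b \<le> e / (norm b + 1) * norm b" unfolding \<tau>_def by (intro mult_right_mono) auto
    also have "\<dots> = e * (norm b / (norm b + 1))" by simp
    also have "\<dots> \<le> e * 1" using e by (intro mult_left_mono) (auto simp: divide_le_eq_1 add_nonneg_pos)
    also have "e * 1 = e" by simp
    finally show ?thesis .
  qed
  define t where "t n = \<tau> / real (Suc n)" for n
  have t: "0 < t n" "t n \<le> \<tau>" for n using \<tau> by (auto simp: t_def field_simps)
  have t0: "t \<longlonglongrightarrow> 0"
    using tendsto_mult[OF tendsto_const[of \<tau>] LIMSEQ_Suc[OF lim_1_over_n]] by (simp add: t_def[abs_def])
  have small: "norm (s *\<^sub>R (t n *\<^sub>R b)) \<le> e" if "s \<in> {0..1}" for s n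
  proof -
    have "norm (s *\<^sub>R (t n *\<^sub>R b)) = s * t n * norm b" using that t(1)[of n] by (simp add: abs_mult)
    also have "\<dots> \<le> 1 * \<tau> * norm b"
      using that t[of n] \<tau> by (intro mult_right_mono mult_mono) auto
    finally show ?thesis using \<tau>b by simp
  qed
  have Cseg: "C \<subseteq> seg_dom U (t n *\<^sub>R b)" for n
  proof
    fix x assume x: "x \<in> C"
    show "x \<in> seg_dom U (t n *\<^sub>R b)"
      unfolding seg_dom_def
    proof (intro CollectI ballI)
      fix s :: real assume "s \<in> {0..1}"
      then have "x + s *\<^sub>R (t n *\<^sub>R b) \<in> D" using DI[OF x] small by simp
      then show "x + s *\<^sub>R (t n *\<^sub>R b) \<in> U" using DU by blast
    qed
  qed
  have avgD: "seg_avg (t n *\<^sub>R b) \<psi> x = 0" if "x \<notin> D" "\<And>x. x \<notin> C \<Longrightarrow> \<psi> x = 0" for n x \<psi>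
  proof (rule seg_avg_zero)
    fix s :: real assume s: "s \<in> {0..1}"
    show "\<psi> (x - s *\<^sub>R (t n *\<^sub>R b)) = 0"
      using DI[of "x - s *\<^sub>R (t n *\<^sub>R b)" x] small[OF s, of n] that by auto
  qed
  have key: "- (LINT x|lborel. f x * seg_avg (t n *\<^sub>R b) (dir_deriv b \<phi>) x) = (LINT x|lborel. G x * seg_avg (t n *\<^sub>R b) \<phi> x)" for n
  proof -
    let ?b = "t n *\<^sub>R b"
    have i2: "integrable lborel (\<lambda>x. f x * \<phi> x)" by (rule loc_int_test[OF f \<phi>])
    have i1': "integrable lborel (\<lambda>x. f x * \<phi> (x - ?b))"
    proof (rule integrable_bounded_support[where C=D and M=M])
      show "set_integrable lborel D f" using f D DU by (simp add: loc_int_def)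
      fix x assume "x \<notin> D"
      then show "\<phi> (x - ?b) = 0" using DI[of "x - ?b" x] small[of 1 n] C(3) by auto
    qed (use M in auto)
    have i1: "integrable lborel (\<lambda>x. f (x + ?b) * \<phi> x)"
      using integrable_translate[OF i1', of ?b] by simp
    have tr: "(LINT x|lborel. f (x + ?b) * \<phi> x) = (LINT x|lborel. f x * \<phi> (x - ?b))"
      using integral_translate[of "\<lambda>x. f x * \<phi> (x - ?b)" ?b] by simp
    have dd: "t n * seg_avg ?b (dir_deriv b \<phi>) x = \<phi> x - \<phi> (x - ?b)" for x
    proof -
      have "dir_deriv ?b \<phi> y = t n * dir_deriv b \<phi> y" for y
        by (simp add: sum_distrib_left mult_ac)
      then have "seg_avg ?b (dir_deriv ?b \<phi>) x = (LINT s:{0..1}|lborel. t n * dir_deriv b \<phi> (x - s *\<^sub>R ?b))"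
        by (intro set_lebesgue_integral_cong) auto
      also have "\<dots> = t n * seg_avg ?b (dir_deriv b \<phi>) x" by (rule set_integral_mult_right)
      finally show ?thesis using seg_avg_dir_deriv[OF sm, of ?b x] by simp
    qed
    have "t n * (LINT x|lborel. f x * seg_avg ?b (dir_deriv b \<phi>) x) = (LINT x|lborel. f x * (t n * seg_avg ?b (dir_deriv b \<phi>) x))"
      unfolding integral_mult_right_zero[symmetric]
      by (intro Bochner_Integration.integral_cong refl) (simp only: mult.left_commute)
    also have "\<dots> = (LINT x|lborel. f x * \<phi> x) - (LINT x|lborel. f x * \<phi> (x - ?b))"
      unfolding dd right_diff_distrib using i2 i1' by simp
    also have "\<dots> = - ((LINT x|lborel. f (x + ?b) * \<phi> x) - (LINT x|lborel. f x * \<phi> x))"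
      unfolding tr by simp
    also have "(LINT x|lborel. f (x + ?b) * \<phi> x) - (LINT x|lborel. f x * \<phi> x) = (LINT x|lborel. (f (x + ?b) - f x) * \<phi> x)"
      unfolding left_diff_distrib using i1 i2 by simp
    also have "\<dots> = (LINT x|lborel. t n * ((LINT s:{0..1}|lborel. G (x + s *\<^sub>R ?b)) * \<phi> x))"
    proof (rule integral_cong_AE)
      show "AE x in lborel. (f (x + ?b) - f x) * \<phi> x = t n * ((LINT s:{0..1}|lborel. G (x + s *\<^sub>R ?b)) * \<phi> x)"
        using line[OF t(1)[of n] order_trans[OF t(2)[of n] \<tau>(2)]]
      proof eventually_elim
        case (elim x)
        show ?case
        proof (cases "x \<in> C")
          case True
          then have "x \<in> seg_dom U ?b" using Cseg by blast
          then have "f (x + ?b) - f x = t n * (LINT s:{0..1}|lborel. G (x + s *\<^sub>R ?b))"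
            using elim by auto
          then show ?thesis by simp
        qed (use C(3) in simp)
      qed
    qed measurable
    also have "\<dots> = t n * (LINT x|lborel. (LINT s:{0..1}|lborel. G (x + s *\<^sub>R ?b)) * \<phi> x)" by simp
    also have "(LINT x|lborel. (LINT s:{0..1}|lborel. G (x + s *\<^sub>R ?b)) * \<phi> x) = (LINT x|lborel. G x * seg_avg ?b \<phi> x)"
      by (rule seg_average_swap[OF G C(1) Cseg _ M]) (use C(3) in auto)
    finally have "t n * (LINT x|lborel. f x * seg_avg ?b (dir_deriv b \<phi>) x) = t n * - (LINT x|lborel. G x * seg_avg ?b \<phi> x)"
      by (simp only: mult_minus_right)
    moreover have "t n \<noteq> 0" using t(1)[of n] by simp
    moreover have "\<And>c X Y :: real. c * X = c * - Y \<Longrightarrow> c \<noteq> 0 \<Longrightarrow> - X = Y" by (metis equation_minus_iff mult_left_cancel)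
    ultimately show ?thesis by blast
  qed
  have "(\<lambda>n. LINT x|lborel. f x * seg_avg (t n *\<^sub>R b) (dir_deriv b \<phi>) x) \<longlonglongrightarrow> (LINT x|lborel. f x * dir_deriv b \<phi> x)"
    by (rule seg_avg_limit[OF f smooth_dir_deriv[OF sm] M' D DU avgD t0]) (auto intro: dC)
  then have "(\<lambda>n. - (LINT x|lborel. f x * seg_avg (t n *\<^sub>R b) (dir_deriv b \<phi>) x)) \<longlonglongrightarrow> - (LINT x|lborel. f x * dir_deriv b \<phi> x)"
    by (rule tendsto_minus)
  moreover have "(\<lambda>n. LINT x|lborel. G x * seg_avg (t n *\<^sub>R b) \<phi> x) \<longlonglongrightarrow> (LINT x|lborel. G x * \<phi> x)"
    by (rule seg_avg_limit[OF G sm M D DU avgD t0]) (use C(3) in auto)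
  ultimately have "- (LINT x|lborel. f x * dir_deriv b \<phi> x) = (LINT x|lborel. G x * \<phi> x)"
    unfolding key by (rule LIMSEQ_unique)
  then show "(LINT x|lborel. f x * dir_deriv b \<phi> x) = - (LINT x|lborel. G x * \<phi> x)" by linarith
qed


subsection \<open>The product rule\<close>

lemma integrable_pair_mult:
  fixes f g :: "real \<Rightarrow> real"
  assumes f: "integrable lborel f" and g: "integrable lborel g"
  shows "integrable (lborel \<Otimes>\<^sub>M lborel) (\<lambda>(s, r). f s * g r)"
proof -
  have [measurable]: "f \<in> borel_measurable borel" "g \<in> borel_measurable borel" using f g by simp_all
  show ?thesis
  proof (rule lborel_pair.Fubini_integrable)
    show "integrable lborel (\<lambda>x. LINT y|lborel. norm (case (x, y) of (s, r) \<Rightarrow> f s * g r))"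
      using integrable_mult_left[OF integrable_norm[OF f], of "LINT y|lborel. norm (g y)"]
      by (simp add: abs_mult)
    show "AE x in lborel. integrable lborel (\<lambda>y. case (x, y) of (s, r) \<Rightarrow> f s * g r)"
      using g by simp
  qed measurable
qed

text \<open>A product rule for primitives that are controlled at almost every \<open>s\<close> only.
  \<open>P\<close> is expanded from the right end point and \<open>Q\<close> from the left one, so
  both corrections are integrals of the same kernel \<open>K\<close> over the triangle
  \<open>s \<le> r\<close>; by Fubini they cancel and the boundary terms remain.\<close>

lemma line_product:
  fixes p q P Q :: "real \<Rightarrow> real"
  assumes p: "set_integrable lborel {0..1} p" and q: "set_integrable lborel {0..1} q"
    and [measurable]: "p \<in> borel_measurable borel" "q \<in> borel_measurable borel"
      "P \<in> borel_measurable borel" "Q \<in> borel_measurable borel"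
    and P: "AE s in lborel. s \<in> {0..1} \<longrightarrow> P 1 - P s = (LINT r|lborel. indicator {s..1} r * p r)"
    and Q: "AE s in lborel. s \<in> {0..1} \<longrightarrow> Q s - Q 0 = (LINT r|lborel. indicator {0..s} r * q r)"
    and P1: "P 1 - P 0 = (LINT s:{0..1}|lborel. p s)" and Q1: "Q 1 - Q 0 = (LINT s:{0..1}|lborel. q s)"
  shows "P 1 * Q 1 - P 0 * Q 0 = (LINT s:{0..1}|lborel. p s * Q s + P s * q s)"
proof -
  define p' where "p' r = indicator {0..1} r * p r" for r
  define q' where "q' r = indicator {0..1} r * q r" for r
  have p': "integrable lborel p'" and q': "integrable lborel q'"
    using p q unfolding p'_def q'_def set_integrable_def by simp_all
  have [measurable]: "p' \<in> borel_measurable borel" "q' \<in> borel_measurable borel"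
    unfolding p'_def q'_def by measurable
  define K where "K s r = (if s \<le> r then q' s * p' r else 0)" for s r
  have K: "integrable (lborel \<Otimes>\<^sub>M lborel) (\<lambda>(s, r). K s r)"
  proof (rule Bochner_Integration.integrable_bound[OF integrable_pair_mult[OF q' p']])
    show "(\<lambda>(s, r). K s r) \<in> borel_measurable (lborel \<Otimes>\<^sub>M lborel)" unfolding K_def by measurable
  qed (auto simp: K_def)
  have a: "AE s in lborel. (LINT r|lborel. K s r) = P 1 * q' s - P s * q' s"
    using P
  proof eventually_elim
    case (elim s)
    have "(LINT r|lborel. K s r) = (LINT r|lborel. q' s * (if s \<le> r then p' r else 0))"
      by (intro Bochner_Integration.integral_cong) (simp_all add: K_def)
    also have "\<dots> = q' s * (LINT r|lborel. (if s \<le> r then p' r else 0))" by (rule integral_mult_right_zero)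
    also have "\<dots> = q' s * (P 1 - P s)"
    proof (cases "s \<in> {0..1}")
      case True
      have "(LINT r|lborel. (if s \<le> r then p' r else 0)) = (LINT r|lborel. indicator {s..1} r * p r)"
        using True by (intro Bochner_Integration.integral_cong) (auto simp: p'_def indicator_def)
      then show ?thesis using elim True by simp
    qed (auto simp: q'_def)
    finally show ?case by (simp add: algebra_simps)
  qed
  have c: "AE r in lborel. (LINT s|lborel. K s r) = p' r * Q r - p' r * Q 0"
    using Q
  proof eventually_elim
    case (elim r)
    have "(LINT s|lborel. K s r) = (LINT s|lborel. p' r * (if s \<le> r then q' s else 0))"
      by (intro Bochner_Integration.integral_cong) (simp_all add: K_def)
    also have "\<dots> = p' r * (LINT s|lborel. (if s \<le> r then q' s else 0))" by (rule integral_mult_right_zero)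
    also have "\<dots> = p' r * (Q r - Q 0)"
    proof (cases "r \<in> {0..1}")
      case True
      have "(LINT s|lborel. (if s \<le> r then q' s else 0)) = (LINT s|lborel. indicator {0..r} s * q s)"
        using True by (intro Bochner_Integration.integral_cong) (auto simp: q'_def indicator_def)
      then show ?thesis using elim True by simp
    qed (auto simp: p'_def)
    finally show ?case by (simp add: algebra_simps)
  qed
  have ia: "integrable lborel (\<lambda>s. LINT r|lborel. K s r)"
    using lborel_pair.integrable_fst'[OF K] by simp
  have ic: "integrable lborel (\<lambda>r. LINT s|lborel. K s r)"
    using lborel_pair.integrable_snd[OF K] by simp
  have sw: "(LINT r|lborel. LINT s|lborel. K s r) = (LINT s|lborel. LINT r|lborel. K s r)"
    by (rule lborel_pair.Fubini_integral[OF K])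
  have "(LINT s:{0..1}|lborel. p s * Q s + P s * q s) = (LINT s|lborel. p' s * Q s + P s * q' s)"
    unfolding set_lebesgue_integral_def p'_def q'_def
    by (intro Bochner_Integration.integral_cong) (auto simp: algebra_simps)
  also have "\<dots> = (LINT s|lborel. (Q 0 * p' s + (LINT t|lborel. K t s)) + (P 1 * q' s - (LINT r|lborel. K s r)))"
  proof (rule integral_cong_AE)
    show "AE s in lborel. p' s * Q s + P s * q' s = (Q 0 * p' s + (LINT t|lborel. K t s)) + (P 1 * q' s - (LINT r|lborel. K s r))"
      using a c by eventually_elim (simp add: algebra_simps)
    show "(\<lambda>s. (Q 0 * p' s + (LINT t|lborel. K t s)) + (P 1 * q' s - (LINT r|lborel. K s r))) \<in> borel_measurable lborel"
      using ia ic by (intro borel_measurable_add borel_measurable_diff) auto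
  qed measurable
  also have "\<dots> = Q 0 * (LINT s|lborel. p' s) + (LINT s|lborel. LINT t|lborel. K t s)
     + (P 1 * (LINT s|lborel. q' s) - (LINT s|lborel. LINT r|lborel. K s r))"
    using p' q' ia ic by simp
  also have "\<dots> = Q 0 * (P 1 - P 0) + P 1 * (Q 1 - Q 0)"
    unfolding sw P1 Q1 set_lebesgue_integral_def p'_def q'_def by simp
  finally show ?thesis by (simp add: algebra_simps)
qed

lemma segment_reparam:
  fixes p :: "real \<Rightarrow> real"
  assumes "0 \<le> c" and [measurable]: "p \<in> borel_measurable borel"
  shows "(LINT \<tau>:{0..1}|lborel. c * p (a + \<tau> * c)) = (LINT r|lborel. indicator {a..a + c} r * p r)"
proof (cases "c = 0")
  case True
  have "(LINT r|lborel. indicator {a..a + c} r * p r) = (LINT r:{a}|lborel. p r)"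
    unfolding set_lebesgue_integral_def using True by simp
  also have "\<dots> = 0"
    unfolding set_lebesgue_integral_def
  proof (subst integral_cong_AE[where g="\<lambda>_. 0"])
    show "AE x in lborel. indicator {a} x *\<^sub>R p x = 0"
      using AE_lborel_singleton[of a] by eventually_elim simp
    show "(\<lambda>x. indicator {a} x *\<^sub>R p x) \<in> borel_measurable lborel"
      by (intro borel_measurable_scaleR borel_measurable_indicator) simp_all
  qed simp_all
  finally show ?thesis using True by (simp add: set_lebesgue_integral_def)
next
  case False
  then have c: "0 < c" using assms by simp
  have "(LINT r|lborel. indicator {a..a + c} r * p r) = \<bar>c\<bar> *\<^sub>R (LINT \<tau>|lborel. indicator {a..a + c} (a + c * \<tau>) * p (a + c * \<tau>))"
    by (rule lborel_integral_real_affine[OF False])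
  also have "\<dots> = (LINT \<tau>|lborel. c * (indicator {a..a + c} (a + c * \<tau>) * p (a + c * \<tau>)))"
    using c by simp
  also have "\<dots> = (LINT \<tau>:{0..1}|lborel. c * p (a + \<tau> * c))"
    unfolding set_lebesgue_integral_def
    by (intro Bochner_Integration.integral_cong refl)
       (use c in \<open>auto simp: indicator_def mult.commute zero_le_mult_iff\<close>)
  finally show ?thesis by simp
qed

text \<open>On almost every line both factors satisfy the increment formula between an end point and
  almost every intermediate point, which is all that \<open>line_product\<close> asks for.\<close>

lemma weak_dir_line_mult:
  fixes f g F G :: "real^'n \<Rightarrow> real"
  assumes U: "open U" and f: "loc_int U f" and F: "loc_int U F" and g: "loc_int U g" and G: "loc_int U G"
    and wf: "weak_dir U b f F" and wg: "weak_dir U b g G"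
  shows "AE x in lborel. x \<in> seg_dom U b \<longrightarrow>
    f (x + b) * g (x + b) - f x * g x
     = (LINT s:{0..1}|lborel. F (x + s *\<^sub>R b) * g (x + s *\<^sub>R b) + f (x + s *\<^sub>R b) * G (x + s *\<^sub>R b))"
proof -
  have [measurable]: "f \<in> borel_measurable borel" "F \<in> borel_measurable borel"
     "g \<in> borel_measurable borel" "G \<in> borel_measurable borel" using f F g G by simp_all
  have V[measurable]: "seg_dom U b \<in> sets borel" by (intro borel_open open_seg_dom U)
  have mem: "x + s *\<^sub>R b \<in> U" if "x \<in> seg_dom U b" "s \<in> {0..1}" for x s
    using that by (auto simp: seg_dom_def)
  \<comment> \<open>For fixed \<open>s\<close> this is the increment formula for the shorter vector
    \<open>s *\<^sub>R b\<close>. The exchange of the quantifiers then makes it available on almost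
    every whole line.\<close>
  have "AE s in lborel. AE x in lborel. x \<in> seg_dom U b \<and> s \<in> {0..1::real} \<longrightarrow>
    g (x + s *\<^sub>R b) - g x = (LINT \<tau>:{0..1}|lborel. s * G (x + \<tau> *\<^sub>R (s *\<^sub>R b)))"
  proof (rule AE_I2)
    fix s :: real
    show "AE x in lborel. x \<in> seg_dom U b \<and> s \<in> {0..1} \<longrightarrow>
      g (x + s *\<^sub>R b) - g x = (LINT \<tau>:{0..1}|lborel. s * G (x + \<tau> *\<^sub>R (s *\<^sub>R b)))"
    proof (cases "s \<in> {0..1}")
      case True
      have "x \<in> seg_dom U (s *\<^sub>R b)" if "x \<in> seg_dom U b" for x
        unfolding seg_dom_def
      proof (intro CollectI ballI)
        fix r :: real assume "r \<in> {0..1}"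
        then have "r * s \<in> {0..1}" using True by (auto intro: mult_le_one)
        from mem[OF that this] show "x + r *\<^sub>R (s *\<^sub>R b) \<in> U" by simp
      qed
      then show ?thesis
        using weak_dir_line[OF U g loc_int_cmult[OF G] weak_dir_scale[OF wg], of s]
        by (auto elim!: eventually_mono)
    next
      case False
      then show ?thesis by (intro AE_I2) blast
    qed
  qed
  then have AG: "AE x in lborel. AE s in lborel. x \<in> seg_dom U b \<and> s \<in> {0..1::real} \<longrightarrow>
    g (x + s *\<^sub>R b) - g x = (LINT \<tau>:{0..1}|lborel. s * G (x + \<tau> *\<^sub>R (s *\<^sub>R b)))"
    unfolding set_lebesgue_integral_def
  proof (subst lborel_pair.AE_commute)
    show "{x \<in> space (lborel \<Otimes>\<^sub>M lborel). fst x \<in> seg_dom U b \<and> snd x \<in> {0..1::real} \<longrightarrow>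
      g (fst x + snd x *\<^sub>R b) - g (fst x) =
        (LINT \<tau>|lborel. indicator {0..1} \<tau> *\<^sub>R (snd x * G (fst x + \<tau> *\<^sub>R (snd x *\<^sub>R b))))}
      \<in> sets (lborel \<Otimes>\<^sub>M lborel)"
      by measurable
  qed
  \<comment> \<open>The remaining piece of the segment, from \<open>x + s *\<^sub>R b\<close> to its
    end, obtained by translating the exceptional set.\<close>
  have "AE s in lborel. AE x in lborel. x \<in> seg_dom U b \<and> s \<in> {0..1::real} \<longrightarrow>
    f (x + b) - f (x + s *\<^sub>R b) = (LINT \<tau>:{0..1}|lborel. (1 - s) * F (x + s *\<^sub>R b + \<tau> *\<^sub>R ((1 - s) *\<^sub>R b)))"
  proof (rule AE_I2)
    fix s :: real
    show "AE x in lborel. x \<in> seg_dom U b \<and> s \<in> {0..1} \<longrightarrow>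
      f (x + b) - f (x + s *\<^sub>R b) = (LINT \<tau>:{0..1}|lborel. (1 - s) * F (x + s *\<^sub>R b + \<tau> *\<^sub>R ((1 - s) *\<^sub>R b)))"
    proof (cases "s \<in> {0..1}")
      case True
      have *: "x + s *\<^sub>R b \<in> seg_dom U ((1 - s) *\<^sub>R b)" if "x \<in> seg_dom U b" for x
        unfolding seg_dom_def
      proof (intro CollectI ballI)
        fix r :: real assume r: "r \<in> {0..1}"
        have "s + r * (1 - s) \<le> s + 1 * (1 - s)" using r True by (intro add_left_mono mult_right_mono) auto
        then have "s + r * (1 - s) \<in> {0..1}" using True r by auto
        from mem[OF that this] show "x + s *\<^sub>R b + r *\<^sub>R ((1 - s) *\<^sub>R b) \<in> U" by (simp add: scaleR_add_left add.assoc)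
      qed
      have "x + s *\<^sub>R b + (1 - s) *\<^sub>R b = x + b" for x by (simp add: algebra_simps)
      with AE_lborel_translate[OF weak_dir_line[OF U f loc_int_cmult[OF F] weak_dir_scale[OF wf], of "1 - s"], of "s *\<^sub>R b"]
      show ?thesis by (auto elim!: eventually_mono dest: *)
    next
      case False
      then show ?thesis by (intro AE_I2) blast
    qed
  qed
  then have AF: "AE x in lborel. AE s in lborel. x \<in> seg_dom U b \<and> s \<in> {0..1::real} \<longrightarrow>
    f (x + b) - f (x + s *\<^sub>R b) = (LINT \<tau>:{0..1}|lborel. (1 - s) * F (x + s *\<^sub>R b + \<tau> *\<^sub>R ((1 - s) *\<^sub>R b)))"
    unfolding set_lebesgue_integral_def
  proof (subst lborel_pair.AE_commute)
    show "{x \<in> space (lborel \<Otimes>\<^sub>M lborel). fst x \<in> seg_dom U b \<and> snd x \<in> {0..1::real} \<longrightarrow>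
      f (fst x + b) - f (fst x + snd x *\<^sub>R b) =
        (LINT \<tau>|lborel. indicator {0..1} \<tau> *\<^sub>R ((1 - snd x) * F (fst x + snd x *\<^sub>R b + \<tau> *\<^sub>R ((1 - snd x) *\<^sub>R b))))}
      \<in> sets (lborel \<Otimes>\<^sub>M lborel)"
      by measurable
  qed
  show ?thesis
    using AG AF weak_dir_line[OF U f F wf] weak_dir_line[OF U g G wg]
  proof eventually_elim
    case (elim x)
    show ?case
    proof
      assume x: "x \<in> seg_dom U b"
      let ?p = "\<lambda>s. F (x + s *\<^sub>R b)" and ?q = "\<lambda>s. G (x + s *\<^sub>R b)"
      let ?P = "\<lambda>s. f (x + s *\<^sub>R b)" and ?Q = "\<lambda>s. g (x + s *\<^sub>R b)"
      have "?P 1 * ?Q 1 - ?P 0 * ?Q 0 = (LINT s:{0..1}|lborel. ?p s * ?Q s + ?P s * ?q s)"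
      proof (rule line_product)
        show "AE s in lborel. s \<in> {0..1} \<longrightarrow> ?P 1 - ?P s = (LINT r|lborel. indicator {s..1} r * ?p r)"
          using elim(2)
        proof eventually_elim
          case (elim s)
          have "(LINT \<tau>:{0..1}|lborel. (1 - s) * F (x + s *\<^sub>R b + \<tau> *\<^sub>R ((1 - s) *\<^sub>R b)))
              = (LINT r|lborel. indicator {s..1} r * ?p r)" if "s \<in> {0..1}"
            using segment_reparam[of "1 - s" ?p s] that by (simp add: scaleR_add_left add.assoc)
          then show ?case using elim x by simp
        qed
        show "AE s in lborel. s \<in> {0..1} \<longrightarrow> ?Q s - ?Q 0 = (LINT r|lborel. indicator {0..s} r * ?q r)"
          using elim(1)
        proof eventually_elim
          case (elim s)
          have "(LINT \<tau>:{0..1}|lborel. s * G (x + \<tau> *\<^sub>R (s *\<^sub>R b)))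
              = (LINT r|lborel. indicator {0..s} r * ?q r)" if "s \<in> {0..1}"
            using segment_reparam[of s ?q 0] that by simp
          then show ?case using elim x by simp
        qed
      qed (use elim(3,4) x in auto)
      then show "f (x + b) * g (x + b) - f x * g x
        = (LINT s:{0..1}|lborel. F (x + s *\<^sub>R b) * g (x + s *\<^sub>R b) + f (x + s *\<^sub>R b) * G (x + s *\<^sub>R b))" by simp
    qed
  qed
qed

text \<open>The product and the sum of the two terms enter only through local integrability, and
  this is exactly what the bilinear estimates will supply; neither factor has to be bounded.\<close>

lemma weak_dir_mult:
  fixes f g F G :: "real^'n \<Rightarrow> real"
  assumes U: "open U" and f: "loc_int U f" and F: "loc_int U F" and g: "loc_int U g" and G: "loc_int U G"
    and wf: "weak_dir U b f F" and wg: "weak_dir U b g G"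
    and fg: "loc_int U (\<lambda>x. f x * g x)" and D: "loc_int U (\<lambda>x. F x * g x + f x * G x)"
  shows "weak_dir U b (\<lambda>x. f x * g x) (\<lambda>x. F x * g x + f x * G x)"
proof (rule line_weak_dir[OF U fg D])
  fix t :: real
  have eq: "(LINT s:{0..1}|lborel. t * F (x + s *\<^sub>R (t *\<^sub>R b)) * g (x + s *\<^sub>R (t *\<^sub>R b)) + f (x + s *\<^sub>R (t *\<^sub>R b)) * (t * G (x + s *\<^sub>R (t *\<^sub>R b))))
    = t * (LINT s:{0..1}|lborel. F (x + s *\<^sub>R (t *\<^sub>R b)) * g (x + s *\<^sub>R (t *\<^sub>R b)) + f (x + s *\<^sub>R (t *\<^sub>R b)) * G (x + s *\<^sub>R (t *\<^sub>R b)))" for x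
    unfolding set_integral_mult_right[symmetric]
    by (intro set_lebesgue_integral_cong) (auto simp: algebra_simps)
  show "AE x in lborel. x \<in> seg_dom U (t *\<^sub>R b) \<longrightarrow>
      f (x + t *\<^sub>R b) * g (x + t *\<^sub>R b) - f x * g x =
      t * (LINT s:{0..1}|lborel. F (x + s *\<^sub>R (t *\<^sub>R b)) * g (x + s *\<^sub>R (t *\<^sub>R b)) + f (x + s *\<^sub>R (t *\<^sub>R b)) * G (x + s *\<^sub>R (t *\<^sub>R b)))"
    using weak_dir_line_mult[OF U f loc_int_cmult[OF F, of t] g loc_int_cmult[OF G, of t] weak_dir_scale[OF wf] weak_dir_scale[OF wg]]
    unfolding eq .
qed

section \<open>Pointwise bounds along segments\<close>

lemma tangent_powr:
  fixes F a p :: real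
  assumes "1 \<le> p" "0 \<le> F" "0 < a"
  shows "p * a powr (p - 1) * F \<le> F powr p + (p - 1) * a powr p"
proof (cases "F = 0")
  case True
  then show ?thesis using assms by simp
next
  case False
  define z where "z = F / a"
  have z: "0 < z" using False assms by (simp add: z_def)
  have "(z powr p) powr (1 / p) * 1 powr (1 - 1 / p) \<le> (1 / p) * z powr p + (1 - 1 / p) * 1"
    by (rule Youngs_inequality_0) (use assms z in auto)
  then have "z \<le> (1 / p) * z powr p + (1 - 1 / p)" using assms z by (simp add: powr_powr)
  then have "p * z \<le> p * ((1 / p) * z powr p + (1 - 1 / p))" using assms by (intro mult_left_mono) auto
  also have "\<dots> = z powr p + (p - 1)" using assms by (simp add: field_simps)
  finally have "a powr p * (p * z) \<le> a powr p * (z powr p + (p - 1))" by (rule mult_left_mono) simp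
  moreover have "a powr p * z powr p = F powr p"
    unfolding z_def using assms False by (simp add: powr_divide)
  moreover have "a powr p * z = a powr (p - 1) * F"
    unfolding z_def using assms by (simp add: powr_diff)
  ultimately show ?thesis by (simp add: algebra_simps)
qed

text \<open>The tangent of the p-th power at the mean value \<open>X / V\<close> lies below the
  power; integrating it gives Jensen's inequality. The form chosen here applies to a mere lower
  bound \<open>X\<close> and to functions of infinite integral.\<close>

lemma jensen_powr:
  fixes F :: "'a \<Rightarrow> real"
  assumes p: "1 \<le> p" and [measurable]: "F \<in> borel_measurable M" and F: "\<And>x. 0 \<le> F x"
    and V: "emeasure M (space M) = ennreal V" "0 < V" and X: "0 \<le> X" "ennreal X \<le> (\<integral>\<^sup>+x. ennreal (F x) \<partial>M)"
  shows "ennreal (X powr p) \<le> ennreal (V powr (p - 1)) * (\<integral>\<^sup>+x. ennreal (F x powr p) \<partial>M)"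
proof (cases "X = 0")
  case False
  define a where "a = X / V"
  have a: "0 < a" using False X V by (simp add: a_def)
  let ?I = "\<integral>\<^sup>+x. ennreal (F x powr p) \<partial>M"
  have "ennreal (p * a powr (p - 1) * X) \<le> ennreal (p * a powr (p - 1)) * (\<integral>\<^sup>+x. ennreal (F x) \<partial>M)"
    using X p a by (subst ennreal_mult) (auto intro!: mult_left_mono)
  also have "\<dots> = (\<integral>\<^sup>+x. ennreal (p * a powr (p - 1) * F x) \<partial>M)"
    using p a F by (subst nn_integral_cmult[symmetric]) (auto simp: ennreal_mult)
  also have "\<dots> \<le> (\<integral>\<^sup>+x. ennreal (F x powr p) + ennreal ((p - 1) * a powr p) \<partial>M)"
    using tangent_powr[OF p F a] p by (intro nn_integral_mono) (auto simp: ennreal_plus[symmetric] simp del: ennreal_plus intro!: ennreal_leI)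
  also have "\<dots> = ?I + ennreal ((p - 1) * a powr p * V)"
    using p V by (subst nn_integral_add) (auto simp: ennreal_mult[symmetric])
  finally have le: "ennreal (p * a powr (p - 1) * X) \<le> ?I + ennreal ((p - 1) * a powr p * V)" .
  have aX: "a powr (p - 1) * X = a powr p * V"
    using a V X by (simp add: a_def powr_diff)
  have "ennreal (a powr p * V) \<le> ?I"
  proof (cases ?I)
    case (real y)
    have "p * a powr (p - 1) * X \<le> y + (p - 1) * a powr p * V"
      using le real p V by (simp add: ennreal_plus[symmetric] del: ennreal_plus)
    then have "p * (a powr p * V) \<le> y + (p - 1) * (a powr p * V)" using aX by (simp add: mult.assoc)
    then have "a powr p * V \<le> y" by (simp add: algebra_simps)
    then show ?thesis using real by (simp add: ennreal_leI)
  qed simp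
  moreover have "X powr p = V powr (p - 1) * (a powr p * V)"
    using V X by (simp add: a_def powr_divide powr_diff)
  ultimately show ?thesis using V by (simp add: ennreal_mult mult_left_mono)
qed simp

lemma nn_integral_powr_01:
  assumes "- 1 < e"
  shows "(\<integral>\<^sup>+s. indicator {0..1::real} s * ennreal (s powr e) \<partial>lborel) = ennreal (1 / (e + 1))"
proof -
  have "((\<lambda>s::real. s powr e) has_integral 1 / (e + 1)) {0..1}"
    using has_integral_powr_from_0[OF assms, of 1] by simp
  then have "(\<integral>\<^sup>+s. ennreal (s powr e) * indicator {0..1} s \<partial>lborel) = ennreal (1 / (e + 1))"
    by (intro nn_integral_has_integral_lebesgue') auto
  then show ?thesis by (simp add: mult.commute)
qed

text \<open>For \<open>s \<le> 1/2\<close> the bound for \<open>F0\<close> is inserted and the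
  integrals are exchanged; the integral of \<open>s ^ k\<close> up to \<open>r\<close> is at most
  \<open>r ^ Suc k\<close>. For larger \<open>s\<close>, where no bound is given,
  \<open>s ^ k \<le> 2 * s ^ Suc k\<close> and \<open>F0 \<le> F1\<close> suffice.\<close>

lemma hardy_step:
  fixes F0 F1 :: "real \<Rightarrow> ennreal"
  assumes [measurable]: "F0 \<in> borel_measurable borel" "F1 \<in> borel_measurable borel"
    and AE: "AE s in lborel. s \<in> {0..1/2} \<longrightarrow> F0 s \<le> C * (\<integral>\<^sup>+r. indicator {s..1} r * F1 r \<partial>lborel)"
    and le: "\<And>s. F0 s \<le> F1 s"
  shows "(\<integral>\<^sup>+s. indicator {0..1} s * (ennreal (s ^ k) * F0 s) \<partial>lborel)
    \<le> (C + 2) * (\<integral>\<^sup>+s. indicator {0..1} s * (ennreal (s ^ Suc k) * F1 s) \<partial>lborel)"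
proof -
  let ?L = "\<lambda>s r. if 0 \<le> s \<and> s \<le> r \<and> r \<le> 1 then ennreal (s ^ k) * F1 r else 0"
  let ?R = "\<lambda>s. indicator {0..1} s * (ennreal (s ^ Suc k) * F1 s)"
  have "(\<integral>\<^sup>+s. indicator {0..1} s * (ennreal (s ^ k) * F0 s) \<partial>lborel)
     \<le> (\<integral>\<^sup>+s. C * (\<integral>\<^sup>+r. ?L s r \<partial>lborel) + 2 * ?R s \<partial>lborel)"
  proof (rule nn_integral_mono_AE)
    show "AE s in lborel. indicator {0..1} s * (ennreal (s ^ k) * F0 s) \<le> C * (\<integral>\<^sup>+r. ?L s r \<partial>lborel) + 2 * ?R s"
      using AE
    proof eventually_elim
      case (elim s)
      consider "s \<notin> {0..1}" | "s \<in> {0..1/2}" | "s \<in> {1/2<..1}" by force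
      then show ?case
      proof cases
        case 2
        have "ennreal (s ^ k) * (\<integral>\<^sup>+r. indicator {s..1} r * F1 r \<partial>lborel) = (\<integral>\<^sup>+r. ennreal (s ^ k) * (indicator {s..1} r * F1 r) \<partial>lborel)"
          by (rule nn_integral_cmult[symmetric]) simp
        also have "\<dots> = (\<integral>\<^sup>+r. ?L s r \<partial>lborel)"
          by (intro nn_integral_cong) (use 2 in \<open>auto simp: indicator_def\<close>)
        finally have eq: "ennreal (s ^ k) * (\<integral>\<^sup>+r. indicator {s..1} r * F1 r \<partial>lborel) = (\<integral>\<^sup>+r. ?L s r \<partial>lborel)" .
        have "ennreal (s ^ k) * F0 s \<le> ennreal (s ^ k) * (C * (\<integral>\<^sup>+r. indicator {s..1} r * F1 r \<partial>lborel))"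
          using elim 2 by (intro mult_left_mono) auto
        also have "\<dots> = C * (\<integral>\<^sup>+r. ?L s r \<partial>lborel)" unfolding eq[symmetric] by (simp add: mult.left_commute)
        finally have "ennreal (s ^ k) * F0 s \<le> C * (\<integral>\<^sup>+r. ?L s r \<partial>lborel)" .
        moreover have "indicator {0..1} s = (1 :: ennreal)" using 2 by (auto simp: indicator_def)
        ultimately show ?thesis by (simp add: add_increasing2)
      next
        case 3
        then have "ennreal (s ^ k) \<le> ennreal (2 * s ^ Suc k)"
          using mult_right_mono[of 1 "2 * s" "s ^ k"] by (intro ennreal_leI) (simp add: mult_ac)
        then have "ennreal (s ^ k) \<le> 2 * ennreal (s ^ Suc k)" using 3 by (simp add: ennreal_mult)
        then have "ennreal (s ^ k) * F0 s \<le> 2 * ennreal (s ^ Suc k) * F1 s" using le by (intro mult_mono) auto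
        then have "indicator {0..1} s * (ennreal (s ^ k) * F0 s) \<le> 2 * ?R s"
          using 3 by (simp add: indicator_def mult.assoc)
        then show ?thesis by (rule order_trans) simp
      qed simp
    qed
  qed
  also have "\<dots> = C * (\<integral>\<^sup>+s. \<integral>\<^sup>+r. ?L s r \<partial>lborel \<partial>lborel) + 2 * (\<integral>\<^sup>+s. ?R s \<partial>lborel)"
    by (subst nn_integral_add) (simp_all add: nn_integral_cmult)
  also have "(\<integral>\<^sup>+s. \<integral>\<^sup>+r. ?L s r \<partial>lborel \<partial>lborel) = (\<integral>\<^sup>+r. \<integral>\<^sup>+s. ?L s r \<partial>lborel \<partial>lborel)"
    by (rule lborel_pair.Fubini') measurable
  also have "\<dots> \<le> (\<integral>\<^sup>+r. ?R r \<partial>lborel)"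
  proof (rule nn_integral_mono)
    fix r :: real
    show "(\<integral>\<^sup>+s. ?L s r \<partial>lborel) \<le> ?R r"
    proof (cases "r \<in> {0..1}")
      case True
      have "(\<integral>\<^sup>+s. ?L s r \<partial>lborel) \<le> (\<integral>\<^sup>+s. (ennreal (r ^ k) * F1 r) * indicator {0..r} s \<partial>lborel)"
        using True by (intro nn_integral_mono) (auto simp: indicator_def intro!: mult_right_mono ennreal_leI power_mono)
      also have "\<dots> = ennreal (r ^ k) * F1 r * ennreal r" using True by (simp add: nn_integral_cmult_indicator)
      also have "\<dots> = ?R r" using True by (simp add: ennreal_mult mult_ac)
      finally show ?thesis .
    next
      case False
      then have "(\<integral>\<^sup>+s. ?L s r \<partial>lborel) = (\<integral>\<^sup>+s. 0 \<partial>(lborel::real measure))" by (intro nn_integral_cong) auto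
      then show ?thesis by simp
    qed
  qed
  finally show ?thesis by (simp add: distrib_right mult_left_mono add_mono)
qed

subsection \<open>Chains\<close>

text \<open>\<open>P i\<close> stands for the sum of the moduli of all derivatives of order at most \<open>i\<close>,
  those of order \<open>k\<close> being weighted by \<open>\<rho> ^ k\<close>; only the following property of it enters the estimates.\<close>

definition chain :: "(real^'n) set \<Rightarrow> nat \<Rightarrow> real \<Rightarrow> (nat \<Rightarrow> real^'n \<Rightarrow> real) \<Rightarrow> bool" where
  "chain K m \<rho> P \<longleftrightarrow> (\<forall>i. P i \<in> borel_measurable borel) \<and> (\<forall>i x. 0 \<le> P i x) \<and> (\<forall>i x. P i x \<le> P (Suc i) x) \<and>
    (\<forall>i<m. \<forall>b. norm b \<le> \<rho> \<longrightarrow> (AE x in lborel. x \<in> seg_dom K b \<longrightarrow>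
      ennreal (P i x) \<le> ennreal (1 + real CARD('n)) * (\<integral>\<^sup>+s. indicator {0..1} s * ennreal (P (Suc i) (x + s *\<^sub>R b)) \<partial>lborel)))"

lemma chain_borel [measurable_dest]: "chain K m \<rho> P \<Longrightarrow> P i \<in> borel_measurable borel"
  and chain_nonneg: "chain K m \<rho> P \<Longrightarrow> 0 \<le> P i x"
  and chain_step: "chain K m \<rho> P \<Longrightarrow> i < m \<Longrightarrow> norm b \<le> \<rho> \<Longrightarrow> AE x in lborel. x \<in> seg_dom K b \<longrightarrow>
      ennreal (P i x) \<le> ennreal (1 + real CARD('n)) * (\<integral>\<^sup>+s. indicator {0..1} s * ennreal (P (Suc i) (x + s *\<^sub>R b)) \<partial>lborel)"
  for P :: "nat \<Rightarrow> real^'n \<Rightarrow> real"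
  by (simp_all add: chain_def)

lemma chain_mono:
  assumes "chain K m \<rho> P" "i \<le> j"
  shows "P i x \<le> P j x"
  using assms(2) by (rule lift_Suc_mono_le[rotated]) (use assms(1) in \<open>simp add: chain_def\<close>)

text \<open>The loss of one Hardy step: \<open>1 + d\<close> from the chain inequality, doubled
  because only the part of the segment beyond \<open>s \<le> 1/2\<close> is used, plus the 2 of
  \<open>hardy_step\<close> for the far half.\<close>

definition chain_const :: "'n itself \<Rightarrow> ennreal" where
  "chain_const _ = 2 * ennreal (1 + real CARD('n)) + 2"

lemma nn_segment_reparam:
  fixes f :: "real \<Rightarrow> ennreal"
  assumes c: "0 < c" and [measurable]: "f \<in> borel_measurable borel"
  shows "ennreal c * (\<integral>\<^sup>+\<tau>. indicator {0..1} \<tau> * f (a + \<tau> * c) \<partial>lborel) = (\<integral>\<^sup>+r. indicator {a..a + c} r * f r \<partial>lborel)"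
proof -
  have "(\<integral>\<^sup>+r. indicator {a..a + c} r * f r \<partial>lborel)
      = ennreal \<bar>c\<bar> * (\<integral>\<^sup>+\<tau>. indicator {a..a + c} (a + c * \<tau>) * f (a + c * \<tau>) \<partial>lborel)"
    using c by (intro nn_integral_real_affine) auto
  also have "(\<integral>\<^sup>+\<tau>. indicator {a..a + c} (a + c * \<tau>) * f (a + c * \<tau>) \<partial>lborel) = (\<integral>\<^sup>+\<tau>. indicator {0..1} \<tau> * f (a + \<tau> * c) \<partial>lborel)"
    by (intro nn_integral_cong) (use c in \<open>auto simp: indicator_def mult.commute zero_le_mult_iff\<close>)
  finally show ?thesis using c by simp
qed

text \<open>The chain inequality is applied from \<open>x + s *\<^sub>R b\<close> to the end of the
  segment. For \<open>s \<le> 1/2\<close> the remaining length is at least one half, so the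
  normalization of the average costs a factor 2.\<close>

lemma chain_hardy:
  fixes P :: "nat \<Rightarrow> real^'n \<Rightarrow> real"
  assumes K: "open K" and P: "chain K m \<rho> P" and i: "i < m" and b: "norm b \<le> \<rho>"
  shows "AE x in lborel. x \<in> seg_dom K b \<longrightarrow>
    (\<integral>\<^sup>+s. indicator {0..1} s * (ennreal (s ^ k) * ennreal (P i (x + s *\<^sub>R b))) \<partial>lborel)
     \<le> chain_const TYPE('n) * (\<integral>\<^sup>+s. indicator {0..1} s * (ennreal (s ^ Suc k) * ennreal (P (Suc i) (x + s *\<^sub>R b))) \<partial>lborel)"
proof -
  note [measurable] = chain_borel[OF P]
  have V[measurable]: "seg_dom K b \<in> sets borel" by (intro borel_open open_seg_dom K)
  define c where "c = ennreal (1 + real CARD('n))"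
  have "AE s in lborel. AE x in lborel. x \<in> seg_dom K b \<and> s \<in> {0..1/2} \<longrightarrow>
     ennreal (P i (x + s *\<^sub>R b)) \<le> 2 * c * (\<integral>\<^sup>+r. indicator {s..1} r * ennreal (P (Suc i) (x + r *\<^sub>R b)) \<partial>lborel)"
  proof (rule AE_I2)
    fix s :: real
    show "AE x in lborel. x \<in> seg_dom K b \<and> s \<in> {0..1/2} \<longrightarrow>
      ennreal (P i (x + s *\<^sub>R b)) \<le> 2 * c * (\<integral>\<^sup>+r. indicator {s..1} r * ennreal (P (Suc i) (x + r *\<^sub>R b)) \<partial>lborel)"
    proof (cases "s \<in> {0..1/2}")
      case True
      have "norm ((1 - s) *\<^sub>R b) \<le> \<rho>" using True b mult_left_le_one_le[of "norm b" "1 - s"] by simp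
      from AE_lborel_translate[OF chain_step[OF P i this, folded c_def], of "s *\<^sub>R b"]
      show ?thesis
      proof eventually_elim
        case (elim x)
        show ?case
        proof
          assume x: "x \<in> seg_dom K b \<and> s \<in> {0..1/2}"
          have "x + s *\<^sub>R b \<in> seg_dom K ((1 - s) *\<^sub>R b)"
            unfolding seg_dom_def
          proof (intro CollectI ballI)
            fix r :: real assume r: "r \<in> {0..1}"
            have "s + r * (1 - s) \<le> s + 1 * (1 - s)" using r True by (intro add_left_mono mult_right_mono) auto
            then have "s + r * (1 - s) \<in> {0..1}" using True r by auto
            then have "x + (s + r * (1 - s)) *\<^sub>R b \<in> K" using x by (auto simp: seg_dom_def)
            then show "x + s *\<^sub>R b + r *\<^sub>R ((1 - s) *\<^sub>R b) \<in> K" by (simp add: scaleR_add_left add.assoc)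
          qed
          with elim have 1: "ennreal (P i (x + s *\<^sub>R b)) \<le>
            c * (\<integral>\<^sup>+\<tau>. indicator {0..1} \<tau> * ennreal (P (Suc i) (x + s *\<^sub>R b + \<tau> *\<^sub>R ((1 - s) *\<^sub>R b))) \<partial>lborel)" by simp
          have 2: "(\<integral>\<^sup>+\<tau>. indicator {0..1} \<tau> * ennreal (P (Suc i) (x + s *\<^sub>R b + \<tau> *\<^sub>R ((1 - s) *\<^sub>R b))) \<partial>lborel)
            = (\<integral>\<^sup>+\<tau>. indicator {0..1} \<tau> * ennreal (P (Suc i) (x + (s + \<tau> * (1 - s)) *\<^sub>R b)) \<partial>lborel)"
            by (intro nn_integral_cong) (simp add: scaleR_add_left add.assoc)
          have 3: "X \<le> 2 * (ennreal (1 - s) * X)" for X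
          proof -
            have "1 \<le> ennreal (2 * (1 - s))" using True by simp
            also have "\<dots> = 2 * ennreal (1 - s)" using True by (subst ennreal_mult) auto
            finally have "1 \<le> 2 * ennreal (1 - s)" .
            from mult_right_mono[OF this, of X] show ?thesis by (simp add: mult.assoc)
          qed
          have 4: "ennreal (1 - s) * (\<integral>\<^sup>+\<tau>. indicator {0..1} \<tau> * ennreal (P (Suc i) (x + (s + \<tau> * (1 - s)) *\<^sub>R b)) \<partial>lborel)
            = (\<integral>\<^sup>+r. indicator {s..1} r * ennreal (P (Suc i) (x + r *\<^sub>R b)) \<partial>lborel)"
            using nn_segment_reparam[of "1 - s" "\<lambda>r. ennreal (P (Suc i) (x + r *\<^sub>R b))" s] True by simp
          note 1
          also have "c * (\<integral>\<^sup>+\<tau>. indicator {0..1} \<tau> * ennreal (P (Suc i) (x + s *\<^sub>R b + \<tau> *\<^sub>R ((1 - s) *\<^sub>R b))) \<partial>lborel)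
            \<le> c * (2 * (\<integral>\<^sup>+r. indicator {s..1} r * ennreal (P (Suc i) (x + r *\<^sub>R b)) \<partial>lborel))"
            unfolding 2 unfolding 4[symmetric] by (rule mult_left_mono[OF 3]) simp
          finally show "ennreal (P i (x + s *\<^sub>R b)) \<le> 2 * c * (\<integral>\<^sup>+r. indicator {s..1} r * ennreal (P (Suc i) (x + r *\<^sub>R b)) \<partial>lborel)"
            by (simp add: mult_ac)
        qed
      qed
    next
      case False
      then show ?thesis by (intro AE_I2) blast
    qed
  qed
  then have "AE x in lborel. AE s in lborel. x \<in> seg_dom K b \<and> s \<in> {0..1/2} \<longrightarrow>
     ennreal (P i (x + s *\<^sub>R b)) \<le> 2 * c * (\<integral>\<^sup>+r. indicator {s..1} r * ennreal (P (Suc i) (x + r *\<^sub>R b)) \<partial>lborel)"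
  proof (subst lborel_pair.AE_commute)
    have [measurable]: "(\<lambda>z::(real^'n) \<times> real. \<integral>\<^sup>+r. indicator {snd z..1} r * ennreal (P (Suc i) (fst z + r *\<^sub>R b)) \<partial>lborel)
       \<in> borel_measurable (lborel \<Otimes>\<^sub>M lborel)"
    proof -
      have "(\<lambda>z::(real^'n) \<times> real. \<integral>\<^sup>+r. indicator {snd z..1} r * ennreal (P (Suc i) (fst z + r *\<^sub>R b)) \<partial>lborel)
        = (\<lambda>z::(real^'n) \<times> real. \<integral>\<^sup>+r. (if snd z \<le> r \<and> r \<le> 1 then ennreal (P (Suc i) (fst z + r *\<^sub>R b)) else 0) \<partial>lborel)"
        by (intro ext nn_integral_cong) (auto simp: indicator_def)
      then show ?thesis by simp
    qed
    show "{z \<in> space (lborel \<Otimes>\<^sub>M lborel). fst z \<in> seg_dom K b \<and> snd z \<in> {0..1/2} \<longrightarrow>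
      ennreal (P i (fst z + snd z *\<^sub>R b)) \<le> 2 * c * (\<integral>\<^sup>+r. indicator {snd z..1} r * ennreal (P (Suc i) (fst z + r *\<^sub>R b)) \<partial>lborel)}
     \<in> sets (lborel \<Otimes>\<^sub>M lborel)"
      by measurable
  qed
  then show ?thesis
  proof eventually_elim
    case (elim x)
    show ?case
    proof
      assume x: "x \<in> seg_dom K b"
      show "(\<integral>\<^sup>+s. indicator {0..1} s * (ennreal (s ^ k) * ennreal (P i (x + s *\<^sub>R b))) \<partial>lborel)
        \<le> chain_const TYPE('n) * (\<integral>\<^sup>+s. indicator {0..1} s * (ennreal (s ^ Suc k) * ennreal (P (Suc i) (x + s *\<^sub>R b))) \<partial>lborel)"
        unfolding chain_const_def c_def[symmetric]
        by (rule hardy_step) (use elim x chain_mono[OF P, of i "Suc i"] in \<open>auto intro: ennreal_leI\<close>)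
    qed
  qed
qed

text \<open>Every Hardy step raises the order by one and gains one power of \<open>s\<close>. The
  weight \<open>s ^ k\<close> is the polar form of a Riesz kernel: after averaging over directions
  it corresponds to a potential of order \<open>Suc k\<close>.\<close>

lemma chain_iterate:
  fixes P :: "nat \<Rightarrow> real^'n \<Rightarrow> real"
  assumes K: "open K" and P: "chain K m \<rho> P" and b: "norm b \<le> \<rho>"
  shows "i + Suc k \<le> m \<Longrightarrow> AE x in lborel. x \<in> seg_dom K b \<longrightarrow>
    ennreal (P i x) \<le> chain_const TYPE('n) ^ Suc k *
      (\<integral>\<^sup>+s. indicator {0..1} s * (ennreal (s ^ k) * ennreal (P (i + Suc k) (x + s *\<^sub>R b))) \<partial>lborel)"
proof (induction k)
  case 0
  then have "i < m" by simp
  have c: "ennreal (1 + real CARD('n)) \<le> chain_const TYPE('n)"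
  proof -
    have "1 * ennreal (1 + real CARD('n)) \<le> 2 * ennreal (1 + real CARD('n))" by (intro mult_right_mono) auto
    then show ?thesis unfolding chain_const_def by (simp add: add_increasing2)
  qed
  from chain_step[OF P \<open>i < m\<close> b] show ?case
  proof eventually_elim
    case (elim x)
    then show ?case using mult_right_mono[OF c] by (auto intro: order_trans)
  qed
next
  case (Suc k)
  then have "i + Suc k \<le> m" "i + Suc k < m" by auto
  from Suc.IH[OF this(1)] chain_hardy[OF K P this(2) b, of k] show ?case
  proof eventually_elim
    case (elim x)
    show ?case
    proof
      assume x: "x \<in> seg_dom K b"
      let ?c = "chain_const TYPE('n)"
      have "ennreal (P i x) \<le> ?c ^ Suc k * (\<integral>\<^sup>+s. indicator {0..1} s * (ennreal (s ^ k) * ennreal (P (i + Suc k) (x + s *\<^sub>R b))) \<partial>lborel)"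
        using elim x by blast
      also have "\<dots> \<le> ?c ^ Suc k * (?c * (\<integral>\<^sup>+s. indicator {0..1} s * (ennreal (s ^ Suc k) * ennreal (P (Suc (i + Suc k)) (x + s *\<^sub>R b))) \<partial>lborel))"
        using elim x by (intro mult_left_mono) auto
      finally show "ennreal (P i x) \<le> ?c ^ Suc (Suc k) * (\<integral>\<^sup>+s. indicator {0..1} s * (ennreal (s ^ Suc k) * ennreal (P (i + Suc (Suc k)) (x + s *\<^sub>R b))) \<partial>lborel)"
        by (simp add: mult_ac)
    qed
  qed
qed

section \<open>The bilinear estimate on a cone, subcritical case\<close>

lemma ball_borel [measurable]: "ball c r \<in> sets borel"
  by (rule borel_open) simp

text \<open>An interior cone condition for the points of \<open>E\<close> at scale
  \<open>\<rho>\<close>. The set \<open>G\<close> that contains the cones is kept apart from the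
  domain, so that only the energy of a neighbouring shell is charged in the end.\<close>

definition cone_at :: "(real^'n) set \<Rightarrow> (real^'n) set \<Rightarrow> real^'n \<Rightarrow> real \<Rightarrow> real \<Rightarrow> bool" where
  "cone_at E G c r \<rho> \<longleftrightarrow> (\<forall>x\<in>E. \<forall>b\<in>ball c r. x \<in> seg_dom G (\<rho> *\<^sub>R b))"

definition cone_avg :: "real^'n \<Rightarrow> real \<Rightarrow> real \<Rightarrow> (real^'n \<Rightarrow> ennreal) \<Rightarrow> real \<Rightarrow> real^'n \<Rightarrow> ennreal" where
  "cone_avg c r \<rho> h s x = (\<integral>\<^sup>+b. indicator (ball c r) b * h (x + (s * \<rho>) *\<^sub>R b) \<partial>lborel)"

lemma cone_avg_borel [measurable]:
  assumes [measurable]: "h \<in> borel_measurable borel"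
  shows "(\<lambda>(s, x). cone_avg c r \<rho> h s x) \<in> borel_measurable (borel \<Otimes>\<^sub>M borel)"
  unfolding cone_avg_def by measurable

lemma cone_avg_le:
  fixes h :: "real^'n \<Rightarrow> ennreal"
  assumes [measurable]: "h \<in> borel_measurable borel" and s: "0 < s" "0 < \<rho>"
  shows "cone_avg c r \<rho> h s x \<le> ennreal (1 / (s * \<rho>) ^ CARD('n)) * (\<integral>\<^sup>+y. h y \<partial>lborel)"
proof -
  have "cone_avg c r \<rho> h s x \<le> (\<integral>\<^sup>+b. h (x + (s * \<rho>) *\<^sub>R b) \<partial>lborel)"
    unfolding cone_avg_def by (intro nn_integral_mono) (auto simp: indicator_def)
  moreover have "(\<integral>\<^sup>+y. h y \<partial>lborel) = ennreal (\<bar>s * \<rho>\<bar> ^ DIM(real^'n)) * (\<integral>\<^sup>+b. h (x + (s * \<rho>) *\<^sub>R b) \<partial>lborel)"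
    using s by (intro nn_integral_scale) auto
  then have "ennreal (1 / (s * \<rho>) ^ CARD('n)) * (\<integral>\<^sup>+y. h y \<partial>lborel) =
     ennreal (1 / (s * \<rho>) ^ CARD('n)) * ennreal ((s * \<rho>) ^ CARD('n)) * (\<integral>\<^sup>+b. h (x + (s * \<rho>) *\<^sub>R b) \<partial>lborel)"
    using s by (simp add: mult.assoc)
  moreover have "ennreal (1 / (s * \<rho>) ^ CARD('n)) * ennreal ((s * \<rho>) ^ CARD('n)) = 1"
    using s by (subst ennreal_mult[symmetric]) auto
  ultimately show ?thesis by simp
qed

lemma cone_avg_integral:
  fixes h :: "real^'n \<Rightarrow> ennreal"
  assumes [measurable]: "h \<in> borel_measurable borel"
  shows "(\<integral>\<^sup>+x. cone_avg c r \<rho> h s x \<partial>lborel) = emeasure lborel (ball c r) * (\<integral>\<^sup>+y. h y \<partial>lborel)"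
proof -
  have "(\<integral>\<^sup>+x. cone_avg c r \<rho> h s x \<partial>lborel) = (\<integral>\<^sup>+b. \<integral>\<^sup>+x. indicator (ball c r) b * h (x + (s * \<rho>) *\<^sub>R b) \<partial>lborel \<partial>lborel)"
    unfolding cone_avg_def by (rule lborel_pair.Fubini') measurable
  also have "\<dots> = (\<integral>\<^sup>+b. indicator (ball c r) b * (\<integral>\<^sup>+y. h y \<partial>lborel) \<partial>lborel)"
    by (intro nn_integral_cong) (simp add: nn_integral_cmult nn_integral_translate)
  also have "\<dots> = emeasure lborel (ball c r) * (\<integral>\<^sup>+y. h y \<partial>lborel)"
    by (simp add: nn_integral_multc)
  finally show ?thesis .
qed

text \<open>The factor averaged over the larger scale is bounded uniformly by
  \<open>cone_avg_le\<close>, the other one is only integrated; this choice produces the maximum of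
  \<open>s\<close> and \<open>t\<close> in the denominator.\<close>

lemma cone_avg_product:
  fixes h h' :: "real^'n \<Rightarrow> ennreal"
  assumes [measurable]: "h \<in> borel_measurable borel" "h' \<in> borel_measurable borel" and s: "0 < s" "0 < t" "0 < \<rho>"
  shows "(\<integral>\<^sup>+x. cone_avg c r \<rho> h s x * cone_avg c r \<rho> h' t x \<partial>lborel)
    \<le> ennreal (1 / (max s t * \<rho>) ^ CARD('n)) * (emeasure lborel (ball c r) * ((\<integral>\<^sup>+y. h y \<partial>lborel) * (\<integral>\<^sup>+y. h' y \<partial>lborel)))"
proof (cases "s \<le> t")
  case True
  have "(\<integral>\<^sup>+x. cone_avg c r \<rho> h s x * cone_avg c r \<rho> h' t x \<partial>lborel)
     \<le> (\<integral>\<^sup>+x. cone_avg c r \<rho> h s x * (ennreal (1 / (t * \<rho>) ^ CARD('n)) * (\<integral>\<^sup>+y. h' y \<partial>lborel)) \<partial>lborel)"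
    by (intro nn_integral_mono mult_left_mono cone_avg_le s) auto
  also have "\<dots> = emeasure lborel (ball c r) * (\<integral>\<^sup>+y. h y \<partial>lborel) * (ennreal (1 / (t * \<rho>) ^ CARD('n)) * (\<integral>\<^sup>+y. h' y \<partial>lborel))"
    by (subst nn_integral_multc) (simp_all add: cone_avg_integral)
  finally show ?thesis using True by (simp add: max_def mult_ac)
next
  case False
  have "(\<integral>\<^sup>+x. cone_avg c r \<rho> h s x * cone_avg c r \<rho> h' t x \<partial>lborel)
     \<le> (\<integral>\<^sup>+x. (ennreal (1 / (s * \<rho>) ^ CARD('n)) * (\<integral>\<^sup>+y. h y \<partial>lborel)) * cone_avg c r \<rho> h' t x \<partial>lborel)"
    by (intro nn_integral_mono mult_right_mono cone_avg_le s) auto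
  also have "\<dots> = (ennreal (1 / (s * \<rho>) ^ CARD('n)) * (\<integral>\<^sup>+y. h y \<partial>lborel)) * (emeasure lborel (ball c r) * (\<integral>\<^sup>+y. h' y \<partial>lborel))"
    by (subst nn_integral_cmult) (simp_all add: cone_avg_integral)
  finally show ?thesis using False by (simp add: max_def mult_ac)
qed

text \<open>A Riesz-type potential of order \<open>e + 1\<close> restricted to a cone. It is left as
  an integral over scales and directions, so that its kernel is never computed.\<close>

definition cone_potential :: "real^'n \<Rightarrow> real \<Rightarrow> real \<Rightarrow> real \<Rightarrow> (real^'n \<Rightarrow> ennreal) \<Rightarrow> real^'n \<Rightarrow> ennreal" where
  "cone_potential c r \<rho> e h x = (\<integral>\<^sup>+s. indicator {0..1} s * (ennreal (s powr e) * cone_avg c r \<rho> h s x) \<partial>lborel)"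

lemma cone_potential_borel [measurable]:
  assumes [measurable]: "h \<in> borel_measurable borel"
  shows "cone_potential c r \<rho> e h \<in> borel_measurable borel"
  unfolding cone_potential_def[abs_def] by measurable

text \<open>Since \<open>q1 + q2\<close> is the dimension, \<open>s powr q1 * t powr q2\<close> is
  at most the d-th power of the maximum of \<open>s\<close> and \<open>t\<close> and cancels the
  loss of \<open>cone_avg_product\<close>. The exponents \<open>a1\<close> and \<open>a2\<close>
  that remain are integrable near 0.\<close>

lemma cone_potential_product:
  fixes h h' :: "real^'n \<Rightarrow> ennreal"
  assumes [measurable]: "h \<in> borel_measurable borel" "h' \<in> borel_measurable borel" and \<rho>: "0 < \<rho>"
    and a: "- 1 < a1" "- 1 < a2" and q: "0 \<le> q1" "0 \<le> q2" "q1 + q2 = real CARD('n)"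
  shows "(\<integral>\<^sup>+x. cone_potential c r \<rho> (a1 + q1) h x * cone_potential c r \<rho> (a2 + q2) h' x \<partial>lborel)
    \<le> ennreal (1 / (a1 + 1)) * ennreal (1 / (a2 + 1)) * (ennreal (1 / \<rho> ^ CARD('n)) *
      (emeasure lborel (ball c r) * ((\<integral>\<^sup>+y. h y \<partial>lborel) * (\<integral>\<^sup>+y. h' y \<partial>lborel))))"
proof -
  let ?D = "ennreal (1 / \<rho> ^ CARD('n)) * (emeasure lborel (ball c r) * ((\<integral>\<^sup>+y. h y \<partial>lborel) * (\<integral>\<^sup>+y. h' y \<partial>lborel)))"
  let ?f = "\<lambda>s x. indicator {0..1::real} s * (ennreal (s powr (a1 + q1)) * cone_avg c r \<rho> h s x)"
  let ?g = "\<lambda>t x. indicator {0..1::real} t * (ennreal (t powr (a2 + q2)) * cone_avg c r \<rho> h' t x)"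
  have "(\<integral>\<^sup>+x. cone_potential c r \<rho> (a1 + q1) h x * cone_potential c r \<rho> (a2 + q2) h' x \<partial>lborel)
     = (\<integral>\<^sup>+x. \<integral>\<^sup>+s. ?f s x * (\<integral>\<^sup>+t. ?g t x \<partial>lborel) \<partial>lborel \<partial>lborel)"
    unfolding cone_potential_def by (intro nn_integral_cong nn_integral_multc[symmetric]) measurable
  also have "\<dots> = (\<integral>\<^sup>+s. \<integral>\<^sup>+x. ?f s x * (\<integral>\<^sup>+t. ?g t x \<partial>lborel) \<partial>lborel \<partial>lborel)"
    by (rule lborel_pair.Fubini') measurable
  also have "\<dots> = (\<integral>\<^sup>+s. \<integral>\<^sup>+x. \<integral>\<^sup>+t. ?f s x * ?g t x \<partial>lborel \<partial>lborel \<partial>lborel)"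
    by (intro nn_integral_cong nn_integral_cmult[symmetric]) measurable
  also have "\<dots> = (\<integral>\<^sup>+s. \<integral>\<^sup>+t. \<integral>\<^sup>+x. ?f s x * ?g t x \<partial>lborel \<partial>lborel \<partial>lborel)"
    by (intro nn_integral_cong lborel_pair.Fubini') measurable
  also have "\<dots> \<le> (\<integral>\<^sup>+s. \<integral>\<^sup>+t. (indicator {0..1::real} s * ennreal (s powr a1)) * ((indicator {0..1::real} t * ennreal (t powr a2)) * ?D) \<partial>lborel \<partial>lborel)"
  proof (intro nn_integral_mono)
    fix s t :: real
    show "(\<integral>\<^sup>+x. ?f s x * ?g t x \<partial>lborel) \<le> (indicator {0..1::real} s * ennreal (s powr a1)) * ((indicator {0..1::real} t * ennreal (t powr a2)) * ?D)"
    proof (cases "s \<in> {0<..1} \<and> t \<in> {0<..1}")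
      case True
      have "(\<integral>\<^sup>+x. ?f s x * ?g t x \<partial>lborel) = (\<integral>\<^sup>+x. (ennreal (s powr (a1 + q1)) * ennreal (t powr (a2 + q2))) * (cone_avg c r \<rho> h s x * cone_avg c r \<rho> h' t x) \<partial>lborel)"
        using True by (intro nn_integral_cong) (auto simp: indicator_def mult_ac)
      also have "\<dots> = (ennreal (s powr (a1 + q1)) * ennreal (t powr (a2 + q2))) * (\<integral>\<^sup>+x. cone_avg c r \<rho> h s x * cone_avg c r \<rho> h' t x \<partial>lborel)"
        by (rule nn_integral_cmult) measurable
      also have "\<dots> \<le> (ennreal (s powr (a1 + q1)) * ennreal (t powr (a2 + q2))) *
        (ennreal (1 / (max s t * \<rho>) ^ CARD('n)) * (emeasure lborel (ball c r) * ((\<integral>\<^sup>+y. h y \<partial>lborel) * (\<integral>\<^sup>+y. h' y \<partial>lborel))))"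
        using True \<rho> by (intro mult_left_mono cone_avg_product) auto
      also have "ennreal (1 / (max s t * \<rho>) ^ CARD('n)) = ennreal (1 / max s t ^ CARD('n)) * ennreal (1 / \<rho> ^ CARD('n))"
        using True \<rho> by (subst ennreal_mult[symmetric]) (auto simp: power_mult_distrib)
      finally have 1: "(\<integral>\<^sup>+x. ?f s x * ?g t x \<partial>lborel) \<le>
        (ennreal (s powr (a1 + q1)) * ennreal (t powr (a2 + q2)) * ennreal (1 / max s t ^ CARD('n))) * ?D"
        by (simp add: mult_ac)
      have "s powr q1 * t powr q2 \<le> max s t powr q1 * max s t powr q2"
        using True q by (intro mult_mono powr_mono2) auto
      also have "\<dots> = max s t ^ CARD('n)"
      proof -
        have "0 < max s t" using True by auto
        then show ?thesis using q by (simp only: powr_add[symmetric] powr_realpow)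
      qed
      finally have "s powr q1 * t powr q2 * (1 / max s t ^ CARD('n)) \<le> 1"
        using True by (simp add: divide_le_eq_1 zero_less_power less_max_iff_disj)
      then have "(s powr a1 * t powr a2) * (s powr q1 * t powr q2 * (1 / max s t ^ CARD('n))) \<le> (s powr a1 * t powr a2) * 1"
        by (intro mult_left_mono) auto
      then have "s powr (a1 + q1) * t powr (a2 + q2) * (1 / max s t ^ CARD('n)) \<le> s powr a1 * t powr a2"
        by (simp add: powr_add mult_ac)
      then have "ennreal (s powr (a1 + q1)) * ennreal (t powr (a2 + q2)) * ennreal (1 / max s t ^ CARD('n)) \<le> ennreal (s powr a1) * ennreal (t powr a2)"
        using True by (auto simp: ennreal_mult[symmetric] simp del: times_divide_eq_right intro!: ennreal_leI)
      from order_trans[OF 1 mult_right_mono[OF this]] show ?thesis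
        using True by (simp add: indicator_def mult_ac)
    next
      case False
      \<comment> \<open>This includes \<open>s = 0\<close> and \<open>t = 0\<close>, where the
        weight vanishes by the convention \<open>0 powr e = 0\<close>.\<close>
      then have z: "?f s x * ?g t x = 0" for x by (auto simp: indicator_def)
      have "(\<integral>\<^sup>+x. ?f s x * ?g t x \<partial>lborel) = (\<integral>\<^sup>+x. 0 \<partial>(lborel :: (real^'n) measure))"
        by (rule nn_integral_cong) (rule z)
      then have "(\<integral>\<^sup>+x. ?f s x * ?g t x \<partial>lborel) = 0" by (simp only: nn_integral_const mult_zero_left)
      then show ?thesis by (simp only: zero_le)
    qed
  qed
  also have "\<dots> = (\<integral>\<^sup>+s. (indicator {0..1::real} s * ennreal (s powr a1)) * (ennreal (1 / (a2 + 1)) * ?D) \<partial>lborel)"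
    by (intro nn_integral_cong)
       (simp add: nn_integral_cmult nn_integral_multc nn_integral_powr_01[OF a(2)])
  also have "\<dots> = ennreal (1 / (a1 + 1)) * (ennreal (1 / (a2 + 1)) * ?D)"
    by (subst nn_integral_multc) (simp_all add: nn_integral_powr_01[OF a(1)])
  finally show ?thesis by (simp add: mult.assoc)
qed

text \<open>The additional exponent d outweighs the loss of \<open>cone_avg_le\<close> at every
  scale, so the potential is bounded uniformly. This plays the part of the Sobolev embedding into
  bounded functions.\<close>

lemma cone_potential_single:
  fixes h h' :: "real^'n \<Rightarrow> ennreal"
  assumes [measurable]: "h \<in> borel_measurable borel" "h' \<in> borel_measurable borel" and \<rho>: "0 < \<rho>"
    and a: "- 1 < a"
  shows "(\<integral>\<^sup>+x. h x * cone_potential c r \<rho> (a + real CARD('n)) h' x \<partial>lborel)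
    \<le> ennreal (1 / (a + 1)) * (ennreal (1 / \<rho> ^ CARD('n)) * ((\<integral>\<^sup>+y. h y \<partial>lborel) * (\<integral>\<^sup>+y. h' y \<partial>lborel)))"
proof -
  let ?J = "\<integral>\<^sup>+y. h' y \<partial>lborel"
  have "cone_potential c r \<rho> (a + real CARD('n)) h' x \<le> ennreal (1 / (a + 1)) * (ennreal (1 / \<rho> ^ CARD('n)) * ?J)" for x
  proof -
    have "cone_potential c r \<rho> (a + real CARD('n)) h' x \<le>
      (\<integral>\<^sup>+s. (indicator {0..1::real} s * ennreal (s powr a)) * (ennreal (1 / \<rho> ^ CARD('n)) * ?J) \<partial>lborel)"
      unfolding cone_potential_def
    proof (rule nn_integral_mono)
      fix s :: real
      show "indicator {0..1} s * (ennreal (s powr (a + real CARD('n))) * cone_avg c r \<rho> h' s x)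
        \<le> (indicator {0..1::real} s * ennreal (s powr a)) * (ennreal (1 / \<rho> ^ CARD('n)) * ?J)"
      proof (cases "s \<in> {0<..1}")
        case True
        have "ennreal (s powr (a + real CARD('n))) * cone_avg c r \<rho> h' s x
          \<le> ennreal (s powr (a + real CARD('n))) * (ennreal (1 / (s * \<rho>) ^ CARD('n)) * ?J)"
          using True \<rho> by (intro mult_left_mono cone_avg_le) auto
        also have "\<dots> = ennreal (s powr (a + real CARD('n)) * (1 / (s * \<rho>) ^ CARD('n))) * ?J"
          using True \<rho> by (subst ennreal_mult) (auto simp: mult.assoc)
        also have "s powr (a + real CARD('n)) * (1 / (s * \<rho>) ^ CARD('n)) = s powr a * (1 / \<rho> ^ CARD('n))"
          using True \<rho> by (simp add: powr_add powr_realpow power_mult_distrib)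
        also have "ennreal (s powr a * (1 / \<rho> ^ CARD('n))) * ?J = ennreal (s powr a) * (ennreal (1 / \<rho> ^ CARD('n)) * ?J)"
          using True \<rho> by (subst ennreal_mult) (auto simp: mult.assoc)
        finally show ?thesis using True by (simp add: indicator_def)
      qed (auto simp: indicator_def)
    qed
    also have "\<dots> = ennreal (1 / (a + 1)) * (ennreal (1 / \<rho> ^ CARD('n)) * ?J)"
      by (subst nn_integral_multc) (simp_all add: nn_integral_powr_01[OF a])
    finally show ?thesis .
  qed
  then have "(\<integral>\<^sup>+x. h x * cone_potential c r \<rho> (a + real CARD('n)) h' x \<partial>lborel)
    \<le> (\<integral>\<^sup>+x. h x * (ennreal (1 / (a + 1)) * (ennreal (1 / \<rho> ^ CARD('n)) * ?J)) \<partial>lborel)"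
    by (intro nn_integral_mono mult_left_mono) auto
  also have "\<dots> = (\<integral>\<^sup>+y. h y \<partial>lborel) * (ennreal (1 / (a + 1)) * (ennreal (1 / \<rho> ^ CARD('n)) * ?J))"
    by (rule nn_integral_multc) measurable
  finally show ?thesis by (simp add: mult_ac)
qed

section \<open>From chains to cone potentials\<close>

definition power_density :: "real \<Rightarrow> (real^'n) set \<Rightarrow> (real^'n \<Rightarrow> real) \<Rightarrow> real^'n \<Rightarrow> ennreal" where
  "power_density p G f y = indicator G y * ennreal (f y powr p)"

text \<open>Jensen's inequality for the weight \<open>s powr (k - \<kappa>)\<close> over scales and
  directions: the factor \<open>s powr \<kappa>\<close> stays under the p-th power and becomes
  \<open>s powr (\<kappa> * p)\<close>. The condition on \<open>\<kappa>\<close> makes the weight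
  integrable; its value is left open for distributing the gain between two factors. \<open>A\<close>
  is chosen before \<open>K\<close>, \<open>\<rho>\<close> and \<open>P\<close>, hence is the same
  on all shells.\<close>

lemma chain_power:
  fixes c :: "real^'n"
  assumes p: "1 \<le> p" and r: "0 < r" and ball: "\<And>b. b \<in> ball c r \<Longrightarrow> norm b \<le> 1"
    and i: "i < m" and \<kappa>: "\<kappa> < real (m - i)"
  shows "\<exists>A\<ge>0. \<forall>K \<rho> P E G. open K \<longrightarrow> 0 < \<rho> \<longrightarrow> chain K m \<rho> P \<longrightarrow> E \<in> sets borel \<longrightarrow> G \<in> sets borel \<longrightarrow> G \<subseteq> K \<longrightarrow>
    cone_at E G c r \<rho> \<longrightarrow> (AE x in lborel. x \<in> E \<longrightarrow> ennreal (P i x powr p) \<le>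
      ennreal A * cone_potential c r \<rho> (real (m - i) - 1 - \<kappa> + \<kappa> * p) (power_density p G (P m)) x)"
proof -
  define k where "k = m - i - 1"
  have ik: "i + Suc k = m" "real (m - i) = real k + 1" using i by (auto simp: k_def)
  define B where "B = measure lborel (ball c r)"
  have B: "0 < B" "emeasure lborel (ball c r) = ennreal B"
    unfolding B_def using r emeasure_lborel_ball_finite[of c r] emeasure_eq_ennreal_measure[of lborel "ball c r"]
    by (auto simp: content_ball_pos less_top)
  define C where "C = enn2real (chain_const TYPE('n) ^ Suc k)"
  have C: "0 \<le> C" "chain_const TYPE('n) ^ Suc k = ennreal C"
  proof -
    have "chain_const TYPE('n) < top" unfolding chain_const_def by (simp add: ennreal_mult_less_top)
    then have "chain_const TYPE('n) ^ Suc k < top" by (simp add: power_less_top_ennreal del: power_Suc)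
    then show "chain_const TYPE('n) ^ Suc k = ennreal C" unfolding C_def by simp
  qed (simp add: C_def)
  \<comment> \<open>The total mass of that weight on the product of the unit interval and the ball
    of directions.\<close>
  define V where "V = 1 / (real k - \<kappa> + 1) * B"
  have V: "0 < V" using \<kappa> ik B by (simp add: V_def)
  define A where "A = V powr (p - 1) * C powr p / B powr p"
  show ?thesis
  proof (intro exI[of _ A] conjI allI impI)
    show "0 \<le> A" by (simp add: A_def)
    fix K \<rho> E G and P :: "nat \<Rightarrow> real^'n \<Rightarrow> real"
    assume K: "open K" and \<rho>: "0 < \<rho>" and P: "chain K m \<rho> P" and [measurable]: "E \<in> sets borel" "G \<in> sets borel"
      and GK: "G \<subseteq> K" and cone: "cone_at E G c r \<rho>"
    note [measurable] = chain_borel[OF P]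
    define H where "H y = indicator G y * P m y" for y
    have [measurable]: "H \<in> borel_measurable borel" unfolding H_def by measurable
    have H0: "0 \<le> H y" for y unfolding H_def using chain_nonneg[OF P] by (simp add: indicator_def)
    have Hp: "ennreal (H y powr p) = power_density p G (P m) y" for y
      by (simp add: H_def power_density_def indicator_def)
    have "AE b in lborel. AE x in lborel. x \<in> E \<and> b \<in> ball c r \<longrightarrow>
      ennreal (P i x) \<le> ennreal C * (\<integral>\<^sup>+s. indicator {0..1} s * (ennreal (s ^ k) * ennreal (H (x + (s * \<rho>) *\<^sub>R b))) \<partial>lborel)"
    proof (rule AE_I2)
      fix b :: "real^'n"
      show "AE x in lborel. x \<in> E \<and> b \<in> ball c r \<longrightarrow>
        ennreal (P i x) \<le> ennreal C * (\<integral>\<^sup>+s. indicator {0..1} s * (ennreal (s ^ k) * ennreal (H (x + (s * \<rho>) *\<^sub>R b))) \<partial>lborel)"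
      proof (cases "b \<in> ball c r")
        case True
        have "norm (\<rho> *\<^sub>R b) \<le> \<rho>" using ball[OF True] \<rho> by simp
        from chain_iterate[OF K P this, of i k] ik(1)
        have "AE x in lborel. x \<in> seg_dom K (\<rho> *\<^sub>R b) \<longrightarrow> ennreal (P i x) \<le> ennreal C *
          (\<integral>\<^sup>+s. indicator {0..1} s * (ennreal (s ^ k) * ennreal (P m (x + s *\<^sub>R (\<rho> *\<^sub>R b)))) \<partial>lborel)"
          unfolding C(2)[symmetric] by simp
        then show ?thesis
        proof eventually_elim
          case (elim x)
          show ?case
          proof
            assume x: "x \<in> E \<and> b \<in> ball c r"
            then have xG: "x \<in> seg_dom G (\<rho> *\<^sub>R b)" using cone by (auto simp: cone_at_def)
            then have "x \<in> seg_dom K (\<rho> *\<^sub>R b)" using GK by (auto simp: seg_dom_def)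
            moreover have "(\<integral>\<^sup>+s. indicator {0..1} s * (ennreal (s ^ k) * ennreal (P m (x + s *\<^sub>R (\<rho> *\<^sub>R b)))) \<partial>lborel)
               = (\<integral>\<^sup>+s. indicator {0..1} s * (ennreal (s ^ k) * ennreal (H (x + (s * \<rho>) *\<^sub>R b))) \<partial>lborel)"
              using xG by (intro nn_integral_cong) (auto simp: seg_dom_def H_def indicator_def)
            ultimately show "ennreal (P i x) \<le> ennreal C * (\<integral>\<^sup>+s. indicator {0..1} s * (ennreal (s ^ k) * ennreal (H (x + (s * \<rho>) *\<^sub>R b))) \<partial>lborel)"
              using elim by simp
          qed
        qed
      qed simp
    qed
    then have "AE x in lborel. AE b in lborel. x \<in> E \<and> b \<in> ball c r \<longrightarrow>
      ennreal (P i x) \<le> ennreal C * (\<integral>\<^sup>+s. indicator {0..1} s * (ennreal (s ^ k) * ennreal (H (x + (s * \<rho>) *\<^sub>R b))) \<partial>lborel)"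
    proof (subst lborel_pair.AE_commute)
      show "{z \<in> space (lborel \<Otimes>\<^sub>M lborel). fst z \<in> E \<and> snd z \<in> ball c r \<longrightarrow>
        ennreal (P i (fst z)) \<le> ennreal C * (\<integral>\<^sup>+s. indicator {0..1} s * (ennreal (s ^ k) * ennreal (H (fst z + (s * \<rho>) *\<^sub>R snd z))) \<partial>lborel)}
        \<in> sets (lborel \<Otimes>\<^sub>M lborel)"
        by measurable
    qed
    then show "AE x in lborel. x \<in> E \<longrightarrow> ennreal (P i x powr p) \<le>
      ennreal A * cone_potential c r \<rho> (real (m - i) - 1 - \<kappa> + \<kappa> * p) (power_density p G (P m)) x"
    proof eventually_elim
      case (elim x)
      show ?case
      proof
        assume x: "x \<in> E"
        \<comment> \<open>The measure to which Jensen's inequality is applied, and the integrand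
          that keeps the share \<open>\<kappa>\<close> of the exponent.\<close>
        let ?w = "\<lambda>(s, b). indicator {0..1::real} s * ennreal (s powr (real k - \<kappa>)) * indicator (ball c r) b"
        let ?N = "density (lborel \<Otimes>\<^sub>M lborel) ?w"
        let ?F = "\<lambda>(s, b). C * (s powr \<kappa> * H (x + (s * \<rho>) *\<^sub>R b))"
        have N: "(\<integral>\<^sup>+z. f z \<partial>?N) = (\<integral>\<^sup>+s. \<integral>\<^sup>+b. ?w (s, b) * f (s, b) \<partial>lborel \<partial>lborel)"
          if [measurable]: "f \<in> borel_measurable (lborel \<Otimes>\<^sub>M lborel)" for f
          by (subst nn_integral_density, measurable, subst lborel.nn_integral_fst[symmetric]) measurable
        have "emeasure ?N (space ?N) = (\<integral>\<^sup>+z. 1 \<partial>?N)" by simp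
        also have "\<dots> = (\<integral>\<^sup>+s. \<integral>\<^sup>+b. indicator {0..1::real} s * ennreal (s powr (real k - \<kappa>)) * indicator (ball c r) b \<partial>lborel \<partial>lborel)"
          by (subst N) simp_all
        also have "\<dots> = (\<integral>\<^sup>+s. indicator {0..1::real} s * ennreal (s powr (real k - \<kappa>)) * ennreal B \<partial>lborel)"
          by (intro nn_integral_cong) (simp add: nn_integral_cmult B)
        also have "\<dots> = ennreal (1 / (real k - \<kappa> + 1)) * ennreal B"
          using \<kappa> ik by (subst nn_integral_multc) (simp_all add: nn_integral_powr_01)
        also have "\<dots> = ennreal V" unfolding V_def using \<kappa> ik B by (subst ennreal_mult) auto
        finally have NV: "emeasure ?N (space ?N) = ennreal V" .
        have "ennreal (P i x * B) = (\<integral>\<^sup>+b. indicator (ball c r) b * ennreal (P i x) \<partial>lborel)"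
          using B chain_nonneg[OF P, of i x] by (subst nn_integral_multc) (simp_all add: ennreal_mult mult.commute)
        also have "\<dots> \<le> (\<integral>\<^sup>+b. indicator (ball c r) b * (ennreal C * (\<integral>\<^sup>+s. indicator {0..1} s * (ennreal (s ^ k) * ennreal (H (x + (s * \<rho>) *\<^sub>R b))) \<partial>lborel)) \<partial>lborel)"
        proof (rule nn_integral_mono_AE)
          show "AE b in lborel. indicator (ball c r) b * ennreal (P i x) \<le> indicator (ball c r) b *
             (ennreal C * (\<integral>\<^sup>+s. indicator {0..1} s * (ennreal (s ^ k) * ennreal (H (x + (s * \<rho>) *\<^sub>R b))) \<partial>lborel))"
            using elim by eventually_elim (use x in \<open>auto simp: indicator_def\<close>)
        qed
        also have "\<dots> = (\<integral>\<^sup>+b. \<integral>\<^sup>+s. indicator (ball c r) b * (ennreal C * (indicator {0..1} s * (ennreal (s ^ k) * ennreal (H (x + (s * \<rho>) *\<^sub>R b))))) \<partial>lborel \<partial>lborel)"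
          by (intro nn_integral_cong) (simp add: nn_integral_cmult)
        also have "\<dots> = (\<integral>\<^sup>+s. \<integral>\<^sup>+b. indicator (ball c r) b * (ennreal C * (indicator {0..1} s * (ennreal (s ^ k) * ennreal (H (x + (s * \<rho>) *\<^sub>R b))))) \<partial>lborel \<partial>lborel)"
          by (rule lborel_pair.Fubini') measurable
        also have "\<dots> = (\<integral>\<^sup>+s. \<integral>\<^sup>+b. ?w (s, b) * ennreal (?F (s, b)) \<partial>lborel \<partial>lborel)"
        proof (rule nn_integral_cong_AE)
          show "AE s in lborel. (\<integral>\<^sup>+b. indicator (ball c r) b * (ennreal C * (indicator {0..1} s * (ennreal (s ^ k) * ennreal (H (x + (s * \<rho>) *\<^sub>R b))))) \<partial>lborel)
             = (\<integral>\<^sup>+b. ?w (s, b) * ennreal (?F (s, b)) \<partial>lborel)"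
            \<comment> \<open>Splitting \<open>s ^ k\<close> into two real powers may fail at
              \<open>s = 0\<close>, because \<open>0 ^ 0 = 1\<close> while
              \<open>0 powr 0 = 0\<close>; the point is null.\<close>
            using AE_lborel_singleton[of "0::real"]
          proof eventually_elim
            case (elim s)
            show ?case
            proof (intro nn_integral_cong)
              fix b
              have "s ^ k = s powr (real k - \<kappa>) * s powr \<kappa>" if "s \<in> {0..1}"
                using that elim by (simp add: powr_add[symmetric] powr_realpow)
              then show "indicator (ball c r) b * (ennreal C * (indicator {0..1} s * (ennreal (s ^ k) * ennreal (H (x + (s * \<rho>) *\<^sub>R b)))))
                = ?w (s, b) * ennreal (?F (s, b))"
                using C H0 by (auto simp: indicator_def ennreal_mult mult_ac)
            qed
          qed
        qed
        also have "\<dots> = (\<integral>\<^sup>+z. ennreal (?F z) \<partial>?N)" by (rule N[symmetric]) measurable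
        finally have X: "ennreal (P i x * B) \<le> (\<integral>\<^sup>+z. ennreal (?F z) \<partial>?N)" .
        have F0: "0 \<le> ?F z" for z using C H0 by (cases z) auto
        have Fm: "?F \<in> borel_measurable ?N" by measurable
        have X0: "0 \<le> P i x * B" using B chain_nonneg[OF P, of i x] by simp
        have "ennreal ((P i x * B) powr p) \<le> ennreal (V powr (p - 1)) * (\<integral>\<^sup>+z. ennreal (?F z powr p) \<partial>?N)"
          by (rule jensen_powr[OF p Fm F0 NV V X0 X])
        also have "(\<integral>\<^sup>+z. ennreal (?F z powr p) \<partial>?N) = (\<integral>\<^sup>+s. \<integral>\<^sup>+b. ?w (s, b) * ennreal (?F (s, b) powr p) \<partial>lborel \<partial>lborel)"
          by (rule N) measurable
        also have "\<dots> = (\<integral>\<^sup>+s. ennreal (C powr p) * (indicator {0..1} s * (ennreal (s powr (real (m - i) - 1 - \<kappa> + \<kappa> * p)) * cone_avg c r \<rho> (power_density p G (P m)) s x)) \<partial>lborel)"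
        proof (intro nn_integral_cong)
          fix s :: real
          have "(\<integral>\<^sup>+b. ?w (s, b) * ennreal (?F (s, b) powr p) \<partial>lborel) =
             (\<integral>\<^sup>+b. (ennreal (C powr p) * (indicator {0..1} s * ennreal (s powr (real (m - i) - 1 - \<kappa> + \<kappa> * p)))) * (indicator (ball c r) b * power_density p G (P m) (x + (s * \<rho>) *\<^sub>R b)) \<partial>lborel)"
          proof (intro nn_integral_cong)
            fix b
            show "?w (s, b) * ennreal (?F (s, b) powr p) =
              (ennreal (C powr p) * (indicator {0..1} s * ennreal (s powr (real (m - i) - 1 - \<kappa> + \<kappa> * p)))) * (indicator (ball c r) b * power_density p G (P m) (x + (s * \<rho>) *\<^sub>R b))"
              unfolding Hp[symmetric] ik(2)
              by (auto simp: indicator_def powr_mult powr_powr powr_add ennreal_mult mult_ac)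
          qed
          also have "\<dots> = (ennreal (C powr p) * (indicator {0..1} s * ennreal (s powr (real (m - i) - 1 - \<kappa> + \<kappa> * p)))) * cone_avg c r \<rho> (power_density p G (P m)) s x"
            unfolding cone_avg_def by (rule nn_integral_cmult) (simp add: power_density_def)
          finally show "(\<integral>\<^sup>+b. ?w (s, b) * ennreal (?F (s, b) powr p) \<partial>lborel) =
             ennreal (C powr p) * (indicator {0..1} s * (ennreal (s powr (real (m - i) - 1 - \<kappa> + \<kappa> * p)) * cone_avg c r \<rho> (power_density p G (P m)) s x))"
            by (simp add: mult.assoc)
        qed
        also have "\<dots> = ennreal (C powr p) * cone_potential c r \<rho> (real (m - i) - 1 - \<kappa> + \<kappa> * p) (power_density p G (P m)) x"
          unfolding cone_potential_def
        proof (rule nn_integral_cmult)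
          have [measurable]: "power_density p G (P m) \<in> borel_measurable borel" unfolding power_density_def[abs_def] by measurable
          show "(\<lambda>s. indicator {0..1} s * (ennreal (s powr (real (m - i) - 1 - \<kappa> + \<kappa> * p)) * cone_avg c r \<rho> (power_density p G (P m)) s x)) \<in> borel_measurable lborel"
            by measurable
        qed
        finally have fin: "ennreal ((P i x * B) powr p) \<le> ennreal (V powr (p - 1)) * (ennreal (C powr p) * cone_potential c r \<rho> (real (m - i) - 1 - \<kappa> + \<kappa> * p) (power_density p G (P m)) x)" .
        have "ennreal (P i x powr p) = ennreal (1 / B powr p) * ennreal ((P i x * B) powr p)"
          using B by (subst ennreal_mult[symmetric]) (auto simp: powr_mult)
        also have "\<dots> \<le> ennreal (1 / B powr p) * (ennreal (V powr (p - 1)) * (ennreal (C powr p) * cone_potential c r \<rho> (real (m - i) - 1 - \<kappa> + \<kappa> * p) (power_density p G (P m)) x))"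
          using fin by (intro mult_left_mono) auto
        also have "\<dots> = ennreal A * cone_potential c r \<rho> (real (m - i) - 1 - \<kappa> + \<kappa> * p) (power_density p G (P m)) x"
        proof -
          have "ennreal (1 / B powr p) * (ennreal (V powr (p - 1)) * ennreal (C powr p)) = ennreal A"
            unfolding A_def by (subst ennreal_mult[symmetric], simp, simp, subst ennreal_mult[symmetric]) auto
          then show ?thesis by (metis mult.assoc)
        qed
        finally show "ennreal (P i x powr p) \<le> ennreal A * cone_potential c r \<rho> (real (m - i) - 1 - \<kappa> + \<kappa> * p) (power_density p G (P m)) x" .
      qed
    qed
  qed
qed


section \<open>Products of derivatives for m > d/p\<close>

lemma power_density_borel [measurable]:
  assumes [measurable]: "f \<in> borel_measurable borel" "G \<in> sets borel"
  shows "power_density p G f \<in> borel_measurable borel"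
  unfolding power_density_def[abs_def] by measurable

text \<open>A factor of top order has no smoothing left, so the other one has to be bounded
  uniformly. With \<open>\<kappa> = d/p\<close> its potential has exponent
  \<open>m - 1 - \<kappa>\<close> plus d, the situation of \<open>cone_potential_single\<close>;
  \<open>\<kappa> < m\<close> is the hypothesis on \<open>m\<close>.\<close>

lemma top_order_product:
  fixes c :: "real^'n"
  assumes p: "1 \<le> p" and r: "0 < r" and ball: "\<And>b. b \<in> ball c r \<Longrightarrow> norm b \<le> 1"
    and mp: "real CARD('n) / p < real m"
  shows "\<exists>A\<ge>0. \<forall>K \<rho> P P' E G. open K \<longrightarrow> 0 < \<rho> \<longrightarrow> chain K m \<rho> P \<longrightarrow> chain K m \<rho> P' \<longrightarrow> E \<in> sets borel \<longrightarrow> G \<in> sets borel \<longrightarrow> G \<subseteq> K \<longrightarrow>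
    cone_at E G c r \<rho> \<longrightarrow> (\<integral>\<^sup>+x. indicator E x * (ennreal (P m x powr p) * ennreal (P' 0 x powr p)) \<partial>lborel) \<le>
      ennreal (A / \<rho> ^ CARD('n)) * ((\<integral>\<^sup>+x. power_density p G (P m) x \<partial>lborel) * (\<integral>\<^sup>+x. power_density p G (P' m) x \<partial>lborel))"
proof -
  define \<kappa> where "\<kappa> = real CARD('n) / p"
  have \<kappa>: "0 < \<kappa>" "\<kappa> < real m" "\<kappa> * p = real CARD('n)" using p mp by (auto simp: \<kappa>_def)
  then have m: "0 < m" by (cases m) auto
  have \<kappa>': "\<kappa> < real (m - 0)" using \<kappa> by simp
  obtain A1 where A1: "0 \<le> A1" and pot: "\<And>K \<rho> P E G. open K \<Longrightarrow> 0 < \<rho> \<Longrightarrow> chain K m \<rho> P \<Longrightarrow> E \<in> sets borel \<Longrightarrow> G \<in> sets borel \<Longrightarrow> G \<subseteq> K \<Longrightarrow>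
    cone_at E G c r \<rho> \<Longrightarrow> (AE x in lborel. x \<in> E \<longrightarrow> ennreal (P 0 x powr p) \<le>
      ennreal A1 * cone_potential c r \<rho> (real (m - 0) - 1 - \<kappa> + \<kappa> * p) (power_density p G (P m)) x)"
    using chain_power[OF p r ball m \<kappa>'] by blast
  define A where "A = A1 * (1 / (real m - \<kappa>))"
  show ?thesis
  proof (intro exI[of _ A] conjI allI impI)
    show "0 \<le> A" unfolding A_def using A1 \<kappa> by simp
    fix K \<rho> E G and P P' :: "nat \<Rightarrow> real^'n \<Rightarrow> real"
    assume K: "open K" and \<rho>: "0 < \<rho>" and P: "chain K m \<rho> P" and P': "chain K m \<rho> P'"
      and [measurable]: "E \<in> sets borel" "G \<in> sets borel" and GK: "G \<subseteq> K" and cone: "cone_at E G c r \<rho>"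
    note [measurable] = chain_borel[OF P] chain_borel[OF P']
    have EG: "x \<in> G" if "x \<in> E" for x
    proof -
      have "x \<in> seg_dom G (\<rho> *\<^sub>R c)" using cone that r by (auto simp: cone_at_def)
      then have "\<forall>s\<in>{0..1}. x + s *\<^sub>R (\<rho> *\<^sub>R c) \<in> G" by (simp add: seg_dom_def)
      from bspec[OF this, of 0] show ?thesis by simp
    qed
    let ?h = "power_density p G (P m)" and ?h' = "power_density p G (P' m)"
    have e: "real (m - 0) - 1 - \<kappa> + \<kappa> * p = (real m - 1 - \<kappa>) + real CARD('n)" using \<kappa> by simp
    have "(\<integral>\<^sup>+x. indicator E x * (ennreal (P m x powr p) * ennreal (P' 0 x powr p)) \<partial>lborel)
      \<le> (\<integral>\<^sup>+x. ennreal A1 * (?h x * cone_potential c r \<rho> ((real m - 1 - \<kappa>) + real CARD('n)) ?h' x) \<partial>lborel)"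
    proof (rule nn_integral_mono_AE)
      from pot[OF K \<rho> P' _ _ GK cone]
      have "AE x in lborel. x \<in> E \<longrightarrow> ennreal (P' 0 x powr p) \<le>
        ennreal A1 * cone_potential c r \<rho> ((real m - 1 - \<kappa>) + real CARD('n)) ?h' x" unfolding e by simp
      then show "AE x in lborel. indicator E x * (ennreal (P m x powr p) * ennreal (P' 0 x powr p))
        \<le> ennreal A1 * (?h x * cone_potential c r \<rho> ((real m - 1 - \<kappa>) + real CARD('n)) ?h' x)"
      proof eventually_elim
        case (elim x)
        show ?case
        proof (cases "x \<in> E")
          case True
          then have "ennreal (P m x powr p) * ennreal (P' 0 x powr p) \<le>
             ennreal (P m x powr p) * (ennreal A1 * cone_potential c r \<rho> ((real m - 1 - \<kappa>) + real CARD('n)) ?h' x)"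
            using elim by (intro mult_left_mono) auto
          then show ?thesis using True EG[OF True] by (simp add: power_density_def mult_ac)
        qed simp
      qed
    qed
    also have "\<dots> = ennreal A1 * (\<integral>\<^sup>+x. ?h x * cone_potential c r \<rho> ((real m - 1 - \<kappa>) + real CARD('n)) ?h' x \<partial>lborel)"
      by (rule nn_integral_cmult) measurable
    also have "\<dots> \<le> ennreal A1 * (ennreal (1 / ((real m - 1 - \<kappa>) + 1)) * (ennreal (1 / \<rho> ^ CARD('n)) * ((\<integral>\<^sup>+x. ?h x \<partial>lborel) * (\<integral>\<^sup>+x. ?h' x \<partial>lborel))))"
      by (intro mult_left_mono cone_potential_single) (use \<rho> \<kappa> in auto)
    also have "\<dots> = (ennreal A1 * (ennreal (1 / ((real m - 1 - \<kappa>) + 1)) * ennreal (1 / \<rho> ^ CARD('n)))) * ((\<integral>\<^sup>+x. ?h x \<partial>lborel) * (\<integral>\<^sup>+x. ?h' x \<partial>lborel))"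
      by (simp add: mult.assoc)
    also have "ennreal A1 * (ennreal (1 / ((real m - 1 - \<kappa>) + 1)) * ennreal (1 / \<rho> ^ CARD('n))) = ennreal (A / \<rho> ^ CARD('n))"
      unfolding A_def using A1 \<kappa> \<rho> by (subst ennreal_mult[symmetric], simp, simp, subst ennreal_mult[symmetric]) auto
    finally show "(\<integral>\<^sup>+x. indicator E x * (ennreal (P m x powr p) * ennreal (P' 0 x powr p)) \<partial>lborel) \<le>
      ennreal (A / \<rho> ^ CARD('n)) * ((\<integral>\<^sup>+x. ?h x \<partial>lborel) * (\<integral>\<^sup>+x. ?h' x \<partial>lborel))" .
  qed
qed

text \<open>Both factors have derivatives to spare, \<open>m - i\<close> and \<open>m - i'\<close>,
  and together at least \<open>m\<close>. So d/p can be shared out with each share strictly below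
  what its factor can afford, and the shares times \<open>p\<close> add up to d as
  \<open>cone_potential_product\<close> requires.\<close>

lemma middle_order_product:
  fixes c :: "real^'n"
  assumes p: "1 \<le> p" and r: "0 < r" and ball: "\<And>b. b \<in> ball c r \<Longrightarrow> norm b \<le> 1"
    and mp: "real CARD('n) / p < real m" and i: "i < m" and i': "i' < m" and ii: "i + i' \<le> m"
  shows "\<exists>A\<ge>0. \<forall>K \<rho> P P' E G. open K \<longrightarrow> 0 < \<rho> \<longrightarrow> chain K m \<rho> P \<longrightarrow> chain K m \<rho> P' \<longrightarrow> E \<in> sets borel \<longrightarrow> G \<in> sets borel \<longrightarrow> G \<subseteq> K \<longrightarrow>
    cone_at E G c r \<rho> \<longrightarrow> (\<integral>\<^sup>+x. indicator E x * (ennreal (P i x powr p) * ennreal (P' i' x powr p)) \<partial>lborel) \<le>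
      ennreal (A / \<rho> ^ CARD('n)) * ((\<integral>\<^sup>+x. power_density p G (P m) x \<partial>lborel) * (\<integral>\<^sup>+x. power_density p G (P' m) x \<partial>lborel))"
proof -
  define \<kappa> where "\<kappa> = real CARD('n) / p"
  have \<kappa>: "0 < \<kappa>" "\<kappa> < real m" "\<kappa> * p = real CARD('n)" using p mp by (auto simp: \<kappa>_def)
  define j k where "j = real (m - i)" and "k = real (m - i')"
  have jk: "0 < j" "0 < k" "real m \<le> j + k" using i i' ii by (auto simp: j_def k_def)
  \<comment> \<open>Shares proportional to the available orders: the common ratio
    \<open>\<kappa> / (j + k)\<close> is below 1 because
    \<open>\<kappa> < m \<le> j + k\<close>.\<close>
  define \<kappa>1 \<kappa>2 where "\<kappa>1 = \<kappa> / (j + k) * j" and "\<kappa>2 = \<kappa> / (j + k) * k"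
  have q: "\<kappa> / (j + k) < 1" "0 < \<kappa> / (j + k)" using \<kappa> jk by (auto simp: divide_less_eq_1)
  have \<kappa>1: "0 \<le> \<kappa>1" "\<kappa>1 < real (m - i)"
    using mult_nonneg_nonneg[OF less_imp_le[OF q(2)] less_imp_le[OF jk(1)]] mult_strict_right_mono[OF q(1) jk(1)]
    by (simp_all only: \<kappa>1_def j_def mult_1)
  have \<kappa>2: "0 \<le> \<kappa>2" "\<kappa>2 < real (m - i')"
    using mult_nonneg_nonneg[OF less_imp_le[OF q(2)] less_imp_le[OF jk(2)]] mult_strict_right_mono[OF q(1) jk(2)]
    by (simp_all only: \<kappa>2_def k_def mult_1)
  have "\<kappa>1 + \<kappa>2 = \<kappa> / (j + k) * (j + k)" unfolding \<kappa>1_def \<kappa>2_def by (rule distrib_left[symmetric])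
  also have "\<dots> = \<kappa>" using jk by simp
  finally have "\<kappa>1 + \<kappa>2 = \<kappa>" .
  then have \<kappa>12: "\<kappa>1 * p + \<kappa>2 * p = real CARD('n)" using \<kappa>(3) by (metis distrib_right)
  obtain A1 where A1: "0 \<le> A1" and pot1: "\<And>K \<rho> P E G. open K \<Longrightarrow> 0 < \<rho> \<Longrightarrow> chain K m \<rho> P \<Longrightarrow> E \<in> sets borel \<Longrightarrow> G \<in> sets borel \<Longrightarrow> G \<subseteq> K \<Longrightarrow>
    cone_at E G c r \<rho> \<Longrightarrow> (AE x in lborel. x \<in> E \<longrightarrow> ennreal (P i x powr p) \<le>
      ennreal A1 * cone_potential c r \<rho> (real (m - i) - 1 - \<kappa>1 + \<kappa>1 * p) (power_density p G (P m)) x)"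
    using chain_power[OF p r ball i \<kappa>1(2)] by blast
  obtain A2 where A2: "0 \<le> A2" and pot2: "\<And>K \<rho> P E G. open K \<Longrightarrow> 0 < \<rho> \<Longrightarrow> chain K m \<rho> P \<Longrightarrow> E \<in> sets borel \<Longrightarrow> G \<in> sets borel \<Longrightarrow> G \<subseteq> K \<Longrightarrow>
    cone_at E G c r \<rho> \<Longrightarrow> (AE x in lborel. x \<in> E \<longrightarrow> ennreal (P i' x powr p) \<le>
      ennreal A2 * cone_potential c r \<rho> (real (m - i') - 1 - \<kappa>2 + \<kappa>2 * p) (power_density p G (P m)) x)"
    using chain_power[OF p r ball i' \<kappa>2(2)] by blast
  define a1 a2 where "a1 = real (m - i) - 1 - \<kappa>1" and "a2 = real (m - i') - 1 - \<kappa>2"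
  have a: "- 1 < a1" "- 1 < a2" using \<kappa>1 \<kappa>2 by (auto simp: a1_def a2_def)
  define B where "B = measure lborel (ball c r)"
  have B: "0 \<le> B" "emeasure lborel (ball c r) = ennreal B"
    unfolding B_def using emeasure_lborel_ball_finite[of c r] emeasure_eq_ennreal_measure[of lborel "ball c r"]
    by (auto simp: less_top)
  define A where "A = (A1 * A2) * ((1 / (a1 + 1)) * (1 / (a2 + 1)) * B)"
  show ?thesis
  proof (intro exI[of _ A] conjI allI impI)
    show "0 \<le> A" unfolding A_def using A1 A2 a B by simp
    fix K \<rho> E G and P P' :: "nat \<Rightarrow> real^'n \<Rightarrow> real"
    assume K: "open K" and \<rho>: "0 < \<rho>" and P: "chain K m \<rho> P" and P': "chain K m \<rho> P'"
      and [measurable]: "E \<in> sets borel" "G \<in> sets borel" and GK: "G \<subseteq> K" and cone: "cone_at E G c r \<rho>"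
    note [measurable] = chain_borel[OF P] chain_borel[OF P']
    let ?h = "power_density p G (P m)" and ?h' = "power_density p G (P' m)"
    let ?W = "cone_potential c r \<rho> (a1 + \<kappa>1 * p) ?h" and ?W' = "cone_potential c r \<rho> (a2 + \<kappa>2 * p) ?h'"
    have "(\<integral>\<^sup>+x. indicator E x * (ennreal (P i x powr p) * ennreal (P' i' x powr p)) \<partial>lborel)
      \<le> (\<integral>\<^sup>+x. ennreal (A1 * A2) * (?W x * ?W' x) \<partial>lborel)"
    proof (rule nn_integral_mono_AE)
      from pot1[OF K \<rho> P _ _ GK cone] pot2[OF K \<rho> P' _ _ GK cone]
      have "AE x in lborel. x \<in> E \<longrightarrow> ennreal (P i x powr p) \<le> ennreal A1 * ?W x"
        "AE x in lborel. x \<in> E \<longrightarrow> ennreal (P' i' x powr p) \<le> ennreal A2 * ?W' x"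
        unfolding a1_def[symmetric] a2_def[symmetric] by simp_all
      then show "AE x in lborel. indicator E x * (ennreal (P i x powr p) * ennreal (P' i' x powr p))
        \<le> ennreal (A1 * A2) * (?W x * ?W' x)"
      proof eventually_elim
        case (elim x)
        show ?case
        proof (cases "x \<in> E")
          case True
          then have "ennreal (P i x powr p) * ennreal (P' i' x powr p) \<le> (ennreal A1 * ?W x) * (ennreal A2 * ?W' x)"
            using elim by (intro mult_mono) auto
          also have "\<dots> = ennreal (A1 * A2) * (?W x * ?W' x)"
            using A1 A2 by (simp add: ennreal_mult mult_ac)
          finally show ?thesis using True by simp
        qed simp
      qed
    qed
    also have "\<dots> = ennreal (A1 * A2) * (\<integral>\<^sup>+x. ?W x * ?W' x \<partial>lborel)"
      by (rule nn_integral_cmult) measurable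
    also have "\<dots> \<le> ennreal (A1 * A2) * (ennreal (1 / (a1 + 1)) * ennreal (1 / (a2 + 1)) * (ennreal (1 / \<rho> ^ CARD('n)) *
      (emeasure lborel (ball c r) * ((\<integral>\<^sup>+x. ?h x \<partial>lborel) * (\<integral>\<^sup>+x. ?h' x \<partial>lborel)))))"
      by (intro mult_left_mono cone_potential_product) (use \<rho> a \<kappa>1 \<kappa>2 \<kappa>12 p in auto)
    also have "\<dots> = (ennreal (A1 * A2) * ennreal (1 / (a1 + 1)) * ennreal (1 / (a2 + 1)) * ennreal (1 / \<rho> ^ CARD('n)) * ennreal B)
        * ((\<integral>\<^sup>+x. ?h x \<partial>lborel) * (\<integral>\<^sup>+x. ?h' x \<partial>lborel))"
      by (simp only: B mult.assoc)
    also have "ennreal (A1 * A2) * ennreal (1 / (a1 + 1)) * ennreal (1 / (a2 + 1)) * ennreal (1 / \<rho> ^ CARD('n)) * ennreal B = ennreal (A / \<rho> ^ CARD('n))"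
    proof -
      have pos: "0 \<le> A1 * A2" "0 \<le> 1 / (a1 + 1)" "0 \<le> 1 / (a2 + 1)" "0 \<le> 1 / \<rho> ^ CARD('n)" using A1 A2 a \<rho> by auto
      have "A / \<rho> ^ CARD('n) = (A1 * A2) * (1 / (a1 + 1)) * (1 / (a2 + 1)) * (1 / \<rho> ^ CARD('n)) * B" by (simp add: A_def)
      then show ?thesis using pos B(1) by (simp only: ennreal_mult mult_nonneg_nonneg)
    qed
    finally show "(\<integral>\<^sup>+x. indicator E x * (ennreal (P i x powr p) * ennreal (P' i' x powr p)) \<partial>lborel) \<le>
      ennreal (A / \<rho> ^ CARD('n)) * ((\<integral>\<^sup>+x. ?h x \<partial>lborel) * (\<integral>\<^sup>+x. ?h' x \<partial>lborel))" .
  qed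
qed

section \<open>The bilinear estimate on a cone, critical case\<close>

fun nest :: "(real^'n) list \<Rightarrow> (real^'n \<Rightarrow> ennreal) \<Rightarrow> real^'n \<Rightarrow> ennreal" where
  "nest [] f x = f x"
| "nest (b # l) f x = (\<integral>\<^sup>+s. indicator {0..1} s * nest l f (x + s *\<^sub>R b) \<partial>lborel)"

text \<open>Complete lines instead of segments: larger than \<open>nest\<close>, but with an exact
  adjoint, and over a basis of directions equal to a multiple of the Lebesgue integral.\<close>

fun line_nest :: "(real^'n) list \<Rightarrow> (real^'n \<Rightarrow> ennreal) \<Rightarrow> real^'n \<Rightarrow> ennreal" where
  "line_nest [] f x = f x"
| "line_nest (b # l) f x = (\<integral>\<^sup>+s. line_nest l f (x + s *\<^sub>R b) \<partial>lborel)"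

text \<open>The parallelepiped spanned at \<open>x\<close> by the vectors of \<open>l\<close> lies
  in \<open>G\<close>; the recursion matches that of \<open>nest\<close>.\<close>

fun reach :: "(real^'n) list \<Rightarrow> (real^'n) set \<Rightarrow> real^'n \<Rightarrow> bool" where
  "reach [] G x \<longleftrightarrow> x \<in> G"
| "reach (b # l) G x \<longleftrightarrow> (\<forall>s\<in>{0..1}. reach l G (x + s *\<^sub>R b))"

lemma reach_mem: "reach l G x \<Longrightarrow> x \<in> G"
proof (induction l arbitrary: x)
  case (Cons b l)
  then have "reach l G (x + 0 *\<^sub>R b)" by (simp only: reach.simps) (rule bspec, assumption, simp)
  then show ?case using Cons.IH by simp
qed simp

lemma nest_borel [measurable]:
  assumes [measurable]: "f \<in> borel_measurable borel"
  shows "nest l f \<in> borel_measurable borel"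
proof (induction l)
  case (Cons b l)
  note [measurable] = Cons
  show ?case by (simp add: nest.simps[abs_def])
qed (use assms in \<open>simp add: nest.simps[abs_def]\<close>)

lemma line_nest_borel [measurable]:
  assumes [measurable]: "f \<in> borel_measurable borel"
  shows "line_nest l f \<in> borel_measurable borel"
proof (induction l)
  case (Cons b l)
  note [measurable] = Cons
  show ?case by (simp add: line_nest.simps[abs_def])
qed (use assms in \<open>simp add: line_nest.simps[abs_def]\<close>)

lemma nest_le_line_nest: "nest l f x \<le> line_nest l f x"
proof (induction l arbitrary: x)
  case (Cons b l)
  show ?case
    unfolding nest.simps line_nest.simps
  proof (rule nn_integral_mono)
    fix s
    show "indicator {0..1} s * nest l f (x + s *\<^sub>R b) \<le> line_nest l f (x + s *\<^sub>R b)"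
      using Cons[of "x + s *\<^sub>R b"] by (auto simp: indicator_def)
  qed
qed simp

lemma line_nest_append: "line_nest (l @ l') f = line_nest l (line_nest l' f)"
proof
  fix x show "line_nest (l @ l') f x = line_nest l (line_nest l' f) x"
    by (induction l arbitrary: x) simp_all
qed

text \<open>One chain inequality for each direction of the list. In contrast to
  \<open>chain_iterate\<close> the direction changes at every step, so no powers of the parameter
  arise.\<close>

lemma chain_nest:
  fixes P :: "nat \<Rightarrow> real^'n \<Rightarrow> real"
  assumes P: "chain K m \<rho> P" and GK: "G \<subseteq> K" and G[measurable]: "G \<in> sets borel"
  shows "i + length l \<le> m \<Longrightarrow> (\<And>b. b \<in> set l \<Longrightarrow> norm b \<le> \<rho>) \<Longrightarrow> AE x in lborel. reach l G x \<longrightarrow>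
    ennreal (P i x) \<le> ennreal (1 + real CARD('n)) ^ length l * nest l (\<lambda>y. indicator G y * ennreal (P m y)) x"
proof (induction l arbitrary: i)
  case Nil
  then show ?case using chain_mono[OF P, of i m] by (intro AE_I2) (auto intro: ennreal_leI)
next
  case (Cons b l)
  note [measurable] = chain_borel[OF P]
  define c where "c = ennreal (1 + real CARD('n))"
  let ?H = "\<lambda>y. indicator G y * ennreal (P m y)"
  have im: "i < m" "norm b \<le> \<rho>" using Cons.prems by auto
  have "AE x in lborel. reach l G x \<longrightarrow> ennreal (P (Suc i) x) \<le> c ^ length l * nest l ?H x"
    unfolding c_def using Cons.prems by (intro Cons.IH) auto
  \<comment> \<open>The induction hypothesis holds at almost every point of space and is used at
    almost every point of the segment that starts at \<open>x\<close>.\<close>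
  from AE_lborel_line[OF this, of b] chain_step[OF P im, folded c_def]
  have "AE x in lborel. reach (b # l) G x \<longrightarrow> ennreal (P i x) \<le> c ^ length (b # l) * nest (b # l) ?H x"
  proof eventually_elim
    case (elim x)
    show ?case
    proof
      assume x: "reach (b # l) G x"
      have "x \<in> seg_dom K b"
        unfolding seg_dom_def
      proof (intro CollectI ballI)
        fix s :: real assume "s \<in> {0..1}"
        then have "reach l G (x + s *\<^sub>R b)" using x by simp
        from reach_mem[OF this] show "x + s *\<^sub>R b \<in> K" using GK by blast
      qed
      then have 1: "ennreal (P i x) \<le> c * (\<integral>\<^sup>+s. indicator {0..1} s * ennreal (P (Suc i) (x + s *\<^sub>R b)) \<partial>lborel)"
        using elim by blast
      have 2: "(\<integral>\<^sup>+s. indicator {0..1} s * ennreal (P (Suc i) (x + s *\<^sub>R b)) \<partial>lborel)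
        \<le> (\<integral>\<^sup>+s. c ^ length l * (indicator {0..1} s * nest l ?H (x + s *\<^sub>R b)) \<partial>lborel)"
      proof (rule nn_integral_mono_AE)
        show "AE s in lborel. indicator {0..1} s * ennreal (P (Suc i) (x + s *\<^sub>R b)) \<le> c ^ length l * (indicator {0..1} s * nest l ?H (x + s *\<^sub>R b))"
          using elim(1)
        proof eventually_elim
          case (elim s)
          then show ?case using x by (cases "s \<in> {0..1}") auto
        qed
      qed
      have 3: "(\<integral>\<^sup>+s. c ^ length l * (indicator {0..1} s * nest l ?H (x + s *\<^sub>R b)) \<partial>lborel) = c ^ length l * nest (b # l) ?H x"
        unfolding nest.simps
      proof (rule nn_integral_cmult)
        have [measurable]: "nest l ?H \<in> borel_measurable borel" by measurable
        show "(\<lambda>s. indicator {0..1} s * nest l ?H (x + s *\<^sub>R b)) \<in> borel_measurable lborel" by measurable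
      qed
      from order_trans[OF 1 mult_left_mono[OF 2[unfolded 3]]]
      show "ennreal (P i x) \<le> c ^ length (b # l) * nest (b # l) ?H x" by (simp add: mult_ac)
    qed
  qed
  then show ?case unfolding c_def .
qed

text \<open>A translation moves one line integral from \<open>g\<close> to \<open>F\<close>, and the
  reflection that this causes is invisible because the lines are complete. The directions are peeled
  off one by one, hence arrive in reverse order.\<close>

lemma line_nest_adjoint:
  fixes F g :: "real^'n \<Rightarrow> ennreal"
  assumes [measurable]: "g \<in> borel_measurable borel"
  shows "F \<in> borel_measurable borel \<Longrightarrow> (\<integral>\<^sup>+x. F x * line_nest l g x \<partial>lborel) = (\<integral>\<^sup>+x. line_nest (rev l) F x * g x \<partial>lborel)"
proof (induction l arbitrary: F)
  case (Cons b l)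
  note [measurable] = Cons.prems
  have refl: "(\<integral>\<^sup>+s. F (x - s *\<^sub>R b) \<partial>lborel) = line_nest [b] F x" for x
  proof -
    have "(\<integral>\<^sup>+s. F (x + s *\<^sub>R b) \<partial>lborel) = ennreal \<bar>- 1\<bar> * (\<integral>\<^sup>+s. F (x + (0 + (- 1) * s) *\<^sub>R b) \<partial>lborel)"
      by (rule nn_integral_real_affine) auto
    then show ?thesis by simp
  qed
  have "(\<integral>\<^sup>+x. F x * line_nest (b # l) g x \<partial>lborel) = (\<integral>\<^sup>+x. \<integral>\<^sup>+s. F x * line_nest l g (x + s *\<^sub>R b) \<partial>lborel \<partial>lborel)"
    by (simp add: nn_integral_cmult)
  also have "\<dots> = (\<integral>\<^sup>+s. \<integral>\<^sup>+x. F x * line_nest l g (x + s *\<^sub>R b) \<partial>lborel \<partial>lborel)"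
    by (rule lborel_pair.Fubini') measurable
  also have "\<dots> = (\<integral>\<^sup>+s. \<integral>\<^sup>+x. F (x - s *\<^sub>R b) * line_nest l g x \<partial>lborel \<partial>lborel)"
  proof (rule nn_integral_cong)
    fix s :: real
    show "(\<integral>\<^sup>+x. F x * line_nest l g (x + s *\<^sub>R b) \<partial>lborel) = (\<integral>\<^sup>+x. F (x - s *\<^sub>R b) * line_nest l g x \<partial>lborel)"
      using nn_integral_translate[of "\<lambda>x. F (x - s *\<^sub>R b) * line_nest l g x" "s *\<^sub>R b"] by simp
  qed
  also have "\<dots> = (\<integral>\<^sup>+x. \<integral>\<^sup>+s. F (x - s *\<^sub>R b) * line_nest l g x \<partial>lborel \<partial>lborel)"
    by (rule lborel_pair.Fubini') measurable
  also have "\<dots> = (\<integral>\<^sup>+x. line_nest [b] F x * line_nest l g x \<partial>lborel)"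
    by (intro nn_integral_cong) (simp only: refl[symmetric], rule nn_integral_multc, measurable)
  also have "\<dots> = (\<integral>\<^sup>+x. line_nest (rev l) (line_nest [b] F) x * g x \<partial>lborel)"
    by (rule Cons.IH) measurable
  finally show ?case by (simp only: rev.simps line_nest_append)
qed simp

section \<open>Line integrals in the directions of a basis\<close>

lemma line_nest_Pi:
  fixes F :: "real^'n \<Rightarrow> ennreal"
  assumes [measurable]: "F \<in> borel_measurable borel"
  shows "distinct bs \<Longrightarrow> line_nest bs F x = (\<integral>\<^sup>+f. F (x + (\<Sum>b\<in>set bs. f b *\<^sub>R b)) \<partial>(\<Pi>\<^sub>M b\<in>set bs. lborel))"
proof (induction bs arbitrary: x)
  case Nil
  show ?case by (simp add: PiM_empty emeasure_count_space nn_integral_count_space_finite)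
next
  case (Cons b bs)
  interpret product_sigma_finite "\<lambda>_::real^'n. lborel :: real measure" by standard
  have b: "finite (set bs)" "b \<notin> set bs" using Cons.prems by auto
  have "line_nest (b # bs) F x = (\<integral>\<^sup>+s. \<integral>\<^sup>+f. F (x + s *\<^sub>R b + (\<Sum>b\<in>set bs. f b *\<^sub>R b)) \<partial>(\<Pi>\<^sub>M b\<in>set bs. lborel) \<partial>lborel)"
    using Cons by simp
  also have "\<dots> = (\<integral>\<^sup>+s. \<integral>\<^sup>+f. F (x + (\<Sum>a\<in>insert b (set bs). (f(b := s)) a *\<^sub>R a)) \<partial>(\<Pi>\<^sub>M b\<in>set bs. lborel) \<partial>lborel)"
  proof (intro nn_integral_cong)
    fix s f
    have "(\<Sum>a\<in>insert b (set bs). (f(b := s)) a *\<^sub>R a) = s *\<^sub>R b + (\<Sum>b\<in>set bs. f b *\<^sub>R b)"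
      using b by (simp, intro sum.cong) auto
    then show "F (x + s *\<^sub>R b + (\<Sum>b\<in>set bs. f b *\<^sub>R b)) = F (x + (\<Sum>a\<in>insert b (set bs). (f(b := s)) a *\<^sub>R a))"
      by (simp only: add.assoc)
  qed
  also have "\<dots> = (\<integral>\<^sup>+f. F (x + (\<Sum>a\<in>insert b (set bs). f a *\<^sub>R a)) \<partial>(\<Pi>\<^sub>M b\<in>insert b (set bs). lborel))"
    by (rule product_nn_integral_insert_rev[OF b, symmetric]) measurable
  finally show ?case by simp
qed

lemma line_nest_basis:
  fixes F :: "real^'n \<Rightarrow> ennreal"
  assumes [measurable]: "F \<in> borel_measurable borel" and bs: "distinct bs" "set bs = Basis"
  shows "line_nest bs F x = (\<integral>\<^sup>+z. F z \<partial>lborel)"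
proof -
  have "(\<integral>\<^sup>+z. F z \<partial>lborel) = (\<integral>\<^sup>+z. F (z + x) \<partial>lborel)"
    by (rule nn_integral_translate[symmetric]) measurable
  also have "\<dots> = (\<integral>\<^sup>+z. F (x + z) \<partial>distr (\<Pi>\<^sub>M b\<in>Basis. lborel) borel (\<lambda>f. \<Sum>b\<in>Basis. f b *\<^sub>R b))"
    unfolding lborel_eq[symmetric] by (simp add: add.commute)
  also have "\<dots> = (\<integral>\<^sup>+f. F (x + (\<Sum>b\<in>Basis. f b *\<^sub>R b)) \<partial>(\<Pi>\<^sub>M b\<in>Basis. lborel))"
    by (rule nn_integral_distr) measurable
  also have "\<dots> = line_nest bs F x" using line_nest_Pi[OF assms(1) bs(1), of x] bs(2) by simp
  finally show ?thesis by simp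
qed

section \<open>Linear images of the standard basis\<close>

lemma line_nest_map:
  assumes "linear A"
  shows "line_nest (map A bs) F (A x) = line_nest bs (\<lambda>z. F (A z)) x"
proof (induction bs arbitrary: x)
  case (Cons b bs)
  have "A x + s *\<^sub>R A b = A (x + s *\<^sub>R b)" for s
    using assms by (simp add: linear_add linear_scale)
  then show ?case using Cons by simp
qed simp

text \<open>The factor is the volume of the preimage of the unit ball divided by the volume of the
  unit ball. It only enters a constant, so the determinant is not brought in.\<close>

lemma linear_nn_integral:
  fixes A :: "real^'n \<Rightarrow> real^'n"
  assumes A: "linear A" "inj A"
  shows "\<exists>c\<ge>0. \<forall>F\<in>borel_measurable borel. (\<integral>\<^sup>+z. F (A z) \<partial>lborel) = ennreal c * (\<integral>\<^sup>+z. F z \<partial>lborel)"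
proof -
  obtain g where g: "linear g" "\<And>x. g (A x) = x" "\<And>x. A (g x) = x"
    using linear_injective_isomorphism[OF A] by blast
  have cont: "continuous_on UNIV A" "continuous_on UNIV g"
    using A(1) g(1) by (auto intro!: linear_continuous_on linear_conv_bounded_linear[THEN iffD1])
  then have [measurable]: "A \<in> borel_measurable borel" by (intro borel_measurable_continuous_onI)
  define B where "B = measure lborel (ball (0::real^'n) 1)"
  have B: "0 < B" "emeasure lborel (ball (0::real^'n) 1) = ennreal B"
    unfolding B_def using emeasure_lborel_ball_finite[of "0::real^'n" 1] emeasure_eq_ennreal_measure[of lborel "ball (0::real^'n) 1"]
    by (auto simp: content_ball_pos less_top)
  let ?N = "{z. norm (A z) < 1}"
  have "bounded ?N"
  proof -
    have "compact (g ` cball 0 1)" by (intro compact_continuous_image continuous_on_subset[OF cont(2)]) auto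
    moreover have "?N \<subseteq> g ` cball 0 1"
    proof
      fix z assume "z \<in> ?N"
      then show "z \<in> g ` cball 0 1" using g(2)[of z] by (intro image_eqI[of _ _ "A z"]) auto
    qed
    ultimately show ?thesis using compact_imp_bounded bounded_subset by blast
  qed
  then have "emeasure lborel ?N < \<infinity>" by (rule emeasure_bounded_finite)
  then obtain n where n: "0 \<le> n" "emeasure lborel ?N = ennreal n" by (cases "emeasure lborel ?N") auto
  show ?thesis
  proof (intro exI[of _ "n / B"] conjI ballI)
    fix F :: "real^'n \<Rightarrow> ennreal" assume [measurable]: "F \<in> borel_measurable borel"
    \<comment> \<open>The uniqueness proof for Haar measure: compare with an auxiliary unit ball and exchange the integrals.\<close>
    let ?i = "\<lambda>v::real^'n. indicator {v. norm v < 1} v :: ennreal"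
    have "(\<integral>\<^sup>+y. ?i y \<partial>lborel) = emeasure lborel (ball (0::real^'n) 1)"
      by (simp add: ball_def dist_norm)
    then have iB: "(\<integral>\<^sup>+y. ?i (y + v) \<partial>lborel) = ennreal B" for v
      using nn_integral_translate[of ?i v] B by simp
    have "(\<integral>\<^sup>+z. F (A z) \<partial>lborel) * ennreal B = (\<integral>\<^sup>+z. F (A z) * (\<integral>\<^sup>+y. ?i (y + - A z) \<partial>lborel) \<partial>lborel)"
      unfolding iB by (rule nn_integral_multc[symmetric]) measurable
    also have "\<dots> = (\<integral>\<^sup>+z. \<integral>\<^sup>+y. F (A z) * ?i (y + - A z) \<partial>lborel \<partial>lborel)"
      by (intro nn_integral_cong nn_integral_cmult[symmetric]) measurable
    also have "\<dots> = (\<integral>\<^sup>+y. \<integral>\<^sup>+z. F (A z) * ?i (y + - A z) \<partial>lborel \<partial>lborel)"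
      by (rule lborel_pair.Fubini') measurable
    also have "\<dots> = (\<integral>\<^sup>+y. \<integral>\<^sup>+z. F (y + A z) * ?i (- A z) \<partial>lborel \<partial>lborel)"
    proof (rule nn_integral_cong)
      fix y
      have "A (z + g y) = y + A z" for z using A(1) g(3) by (simp add: linear_add)
      then show "(\<integral>\<^sup>+z. F (A z) * ?i (y + - A z) \<partial>lborel) = (\<integral>\<^sup>+z. F (y + A z) * ?i (- A z) \<partial>lborel)"
        using nn_integral_translate[of "\<lambda>z. F (A z) * ?i (y + - A z)" "g y"] by simp
    qed
    also have "\<dots> = (\<integral>\<^sup>+z. \<integral>\<^sup>+y. F (y + A z) * ?i (- A z) \<partial>lborel \<partial>lborel)"
      by (rule lborel_pair.Fubini') measurable
    also have "\<dots> = (\<integral>\<^sup>+z. (\<integral>\<^sup>+y. F y \<partial>lborel) * indicator ?N z \<partial>lborel)"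
      by (intro nn_integral_cong) (simp add: nn_integral_multc nn_integral_translate indicator_def)
    also have "\<dots> = (\<integral>\<^sup>+y. F y \<partial>lborel) * ennreal n"
      by (subst nn_integral_cmult) (simp_all add: n)
    finally have eq: "(\<integral>\<^sup>+z. F (A z) \<partial>lborel) * ennreal B = (\<integral>\<^sup>+y. F y \<partial>lborel) * ennreal n" .
    have "(\<integral>\<^sup>+z. F (A z) \<partial>lborel) = (\<integral>\<^sup>+z. F (A z) \<partial>lborel) * (ennreal B * ennreal (1 / B))"
      using B(1) by (simp add: ennreal_mult[symmetric])
    also have "\<dots> = (\<integral>\<^sup>+y. F y \<partial>lborel) * (ennreal n * ennreal (1 / B))"
      unfolding mult.assoc[symmetric] eq ..
    also have "ennreal n * ennreal (1 / B) = ennreal (n / B)" using n B(1) by (simp add: ennreal_mult[symmetric])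
    finally show "(\<integral>\<^sup>+z. F (A z) \<partial>lborel) = ennreal (n / B) * (\<integral>\<^sup>+z. F z \<partial>lborel)" by (simp add: mult.commute)
  qed (use n B in simp)
qed

text \<open>A rank-one perturbation of a small multiple of the identity sends each standard basis
  vector \<open>b\<close> to \<open>c + e *\<^sub>R b\<close>; the critical case requires d linearly
  independent directions inside the cone.\<close>

lemma basis_in_ball:
  fixes c :: "real^'n"
  assumes r: "0 < r"
  shows "\<exists>A :: real^'n \<Rightarrow> real^'n. linear A \<and> inj A \<and> (\<forall>b\<in>Basis. A b \<in> ball c r)"
proof -
  define S where "S = (\<Sum>i\<in>UNIV. c $ i)"
  \<comment> \<open>\<open>A\<close> multiplies the sum of the coordinates by \<open>S + e\<close>,
    so it is singular for at most one positive \<open>e\<close>; of the two candidates one is always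
    admissible.\<close>
  define e where "e = (if S = - (r / 2) then r / 3 else r / 2)"
  have e: "0 < e" "e < r" "S + e \<noteq> 0" using r by (auto simp: e_def)
  define A where "A t = (\<Sum>i\<in>UNIV. t $ i) *\<^sub>R c + e *\<^sub>R t" for t :: "real^'n"
  have lin: "linear A"
    by (rule linearI) (simp_all add: A_def sum.distrib scaleR_add_left scaleR_add_right sum_distrib_left[symmetric])
  have "t = 0" if "A t = 0" for t
  proof -
    let ?s = "\<Sum>i\<in>UNIV. t $ i"
    have "0 = (\<Sum>i\<in>UNIV. A t $ i)" using that by simp
    also have "\<dots> = ?s * S + e * ?s" by (simp add: A_def S_def sum.distrib sum_distrib_left)
    finally have "?s * (S + e) = 0" by (simp add: algebra_simps)
    then have "?s = 0" using e by simp
    then show ?thesis using that e by (simp add: A_def)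
  qed
  then have "inj A" using lin by (simp add: linear_injective_0)
  moreover have "A b \<in> ball c r" if "b \<in> Basis" for b
  proof -
    from that obtain i where b: "b = axis i 1" by (auto simp: Basis_vec_def)
    have "(\<Sum>j\<in>UNIV. b $ j) = (\<Sum>j\<in>UNIV. if j = i then 1 else 0)" unfolding b by (intro sum.cong) (auto simp: axis_def)
    then have "A b = c + e *\<^sub>R b" by (simp add: A_def)
    then show ?thesis using that e by (simp add: dist_norm)
  qed
  ultimately show ?thesis using lin by (intro exI[of _ A] conjI ballI)
qed

text \<open>\<open>\<theta>\<close> is the fraction of the cone length already used. A further step
  gives a position of the same form, whose direction is a convex combination of two vectors of the
  ball, so convexity of the ball keeps the whole parallelepiped inside the cone.\<close>

lemma reach_cone:
  fixes c :: "real^'n"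
  assumes x: "\<And>b. b \<in> ball c r \<Longrightarrow> x \<in> seg_dom G (\<rho> *\<^sub>R b)" and d: "0 < d"
  shows "b0 \<in> ball c r \<Longrightarrow> 0 \<le> \<theta> \<Longrightarrow> \<theta> + real (length l) / d \<le> 1 \<Longrightarrow> set l \<subseteq> ball c r \<Longrightarrow>
    reach (map (\<lambda>w. (\<rho> / d) *\<^sub>R w) l) G (x + (\<theta> * \<rho>) *\<^sub>R b0)"
proof (induction l arbitrary: \<theta> b0)
  case Nil
  from x[OF Nil(1)] have "\<forall>s\<in>{0..1}. x + s *\<^sub>R (\<rho> *\<^sub>R b0) \<in> G" by (simp add: seg_dom_def)
  from bspec[OF this, of \<theta>] Nil show ?case by simp
next
  case (Cons w l)
  have "reach (map (\<lambda>w. (\<rho> / d) *\<^sub>R w) l) G (x + (\<theta> * \<rho>) *\<^sub>R b0 + s *\<^sub>R ((\<rho> / d) *\<^sub>R w))" if s: "s \<in> {0..1}" for s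
  \<comment> \<open>If no length has been used there is no combination to normalize; then the point
    is still \<open>x\<close>.\<close>
  proof (cases "\<theta> + s / d = 0")
    case True
    then have "\<theta> = 0" "s / d = 0" using Cons.prems(2) s d by (auto simp: add_nonneg_eq_0_iff)
    then have "s = 0" using d by simp
    have "reach (map (\<lambda>w. (\<rho> / d) *\<^sub>R w) l) G (x + (0 * \<rho>) *\<^sub>R b0)"
      using Cons.prems d by (intro Cons.IH) (auto simp: divide_le_eq \<open>\<theta> = 0\<close> intro: order_trans)
    then show ?thesis using \<open>\<theta> = 0\<close> \<open>s = 0\<close> by simp
  next
    case False
    define \<theta>' where "\<theta>' = \<theta> + s / d"
    have \<theta>': "0 < \<theta>'" using False Cons.prems(2) s d by (auto simp: \<theta>'_def less_le)
    define b1 where "b1 = (\<theta> / \<theta>') *\<^sub>R b0 + ((s / d) / \<theta>') *\<^sub>R w"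
    have "b1 \<in> ball c r"
      unfolding b1_def
    proof (rule convexD[OF convex_ball])
      have "\<theta> / \<theta>' + s / d / \<theta>' = \<theta>' / \<theta>'" by (simp only: add_divide_distrib \<theta>'_def)
      then show "\<theta> / \<theta>' + s / d / \<theta>' = 1" using \<theta>' by simp
    qed (use Cons.prems s d \<theta>' in auto)
    moreover have "\<theta>' + real (length l) / d \<le> 1"
    proof -
      have "s / d \<le> 1 / d" using s d by (simp add: divide_right_mono)
      then show ?thesis using Cons.prems(3) by (simp add: \<theta>'_def add_divide_distrib)
    qed
    ultimately have "reach (map (\<lambda>w. (\<rho> / d) *\<^sub>R w) l) G (x + (\<theta>' * \<rho>) *\<^sub>R b1)"
      using Cons.prems \<theta>' by (intro Cons.IH) auto
    moreover have "(\<theta>' * \<rho>) *\<^sub>R b1 = (\<theta> * \<rho>) *\<^sub>R b0 + s *\<^sub>R ((\<rho> / d) *\<^sub>R w)"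
      using \<theta>' by (simp add: b1_def scaleR_add_right mult_ac)
    ultimately show ?thesis by (simp add: add.assoc)
  qed
  then show ?case by simp
qed


text \<open>The d directions are split: d - q of them bound \<open>P i\<close>, the other q bound
  \<open>P' i'\<close>. Adjointness moves the line integrals of the second factor onto the first,
  where they complete the basis; the resulting d-fold integral is a multiple of the integral of
  \<open>P m\<close> and no longer depends on \<open>x\<close>, so the product of the two integrals
  remains.\<close>

lemma critical_product:
  fixes c :: "real^'n"
  assumes r: "0 < r" and ball: "\<And>b. b \<in> ball c r \<Longrightarrow> norm b \<le> 1"
    and m: "CARD('n) \<le> m" and ii: "i + i' \<le> m"
  shows "\<exists>A\<ge>0. \<forall>K \<rho> P P' E G. open K \<longrightarrow> 0 < \<rho> \<longrightarrow> chain K m \<rho> P \<longrightarrow> chain K m \<rho> P' \<longrightarrow> E \<in> sets borel \<longrightarrow> G \<in> sets borel \<longrightarrow> G \<subseteq> K \<longrightarrow>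
    cone_at E G c r \<rho> \<longrightarrow> (\<integral>\<^sup>+x. indicator E x * (ennreal (P i x powr 1) * ennreal (P' i' x powr 1)) \<partial>lborel) \<le>
      ennreal (A / \<rho> ^ CARD('n)) * ((\<integral>\<^sup>+x. power_density 1 G (P m) x \<partial>lborel) * (\<integral>\<^sup>+x. power_density 1 G (P' m) x \<partial>lborel))"
proof -
  define d where "d = CARD('n)"
  have d: "0 < d" unfolding d_def by simp
  obtain A :: "real^'n \<Rightarrow> real^'n" where A: "linear A" "inj A" "\<forall>b\<in>Basis. A b \<in> ball c r" using basis_in_ball[OF r] by blast
  obtain cA where cA: "0 \<le> cA" "\<And>F. F \<in> borel_measurable borel \<Longrightarrow> (\<integral>\<^sup>+z. F (A z) \<partial>lborel) = ennreal cA * (\<integral>\<^sup>+z. F z \<partial>lborel)"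
    using linear_nn_integral[OF A(1,2)] by blast
  obtain g where g: "\<And>x. A (g x) = x" using linear_injective_isomorphism[OF A(1,2)] by blast
  obtain bs :: "(real^'n) list" where bs: "distinct bs" "set bs = Basis" using finite_distinct_list[OF finite_Basis] by blast
  have lbs: "length bs = d" using distinct_card[OF bs(1)] bs(2) by (simp add: d_def)
  define ws where "ws = map A bs"
  have ws: "set ws \<subseteq> ball c r" "length ws = d" using A(3) bs lbs by (auto simp: ws_def)
  \<comment> \<open>The second factor has \<open>m - i'\<close> derivatives to spare, which limits
    q. The first then needs \<open>d - q \<le> m - i\<close>, which follows from
    \<open>d \<le> m\<close> and \<open>i + i' \<le> m\<close>.\<close>
  define q where "q = min (m - i') d"
  define C where "C = (1 + real d) ^ d"
  define C' where "C' = real d ^ d * cA"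
  show ?thesis
  proof (intro exI[of _ "C * C'"] conjI allI impI)
    show "0 \<le> C * C'" unfolding C_def C'_def using cA by simp
    fix K \<rho> E G and P P' :: "nat \<Rightarrow> real^'n \<Rightarrow> real"
    assume K: "open K" and \<rho>: "0 < \<rho>" and P: "chain K m \<rho> P" and P': "chain K m \<rho> P'"
      and [measurable]: "E \<in> sets borel" and G[measurable]: "G \<in> sets borel" and GK: "G \<subseteq> K" and cone: "cone_at E G c r \<rho>"
    note [measurable] = chain_borel[OF P] chain_borel[OF P']
    \<comment> \<open>Steps of length \<open>\<rho> / d\<close>, so that d of them together stay
      within the cone of length \<open>\<rho>\<close>.\<close>
    let ?sc = "\<lambda>w. (\<rho> / real d) *\<^sub>R w"
    define l1 where "l1 = map ?sc (drop q ws)"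
    \<comment> \<open>Reversed beforehand: \<open>line_nest_adjoint\<close> reverses the list once
      more, and then \<open>rev l2 @ l1\<close> is the basis in its original order.\<close>
    define l2 where "l2 = map ?sc (rev (take q ws))"
    have l12: "rev l2 @ l1 = map (\<lambda>z. ?sc (A z)) bs"
      unfolding l1_def l2_def rev_map[symmetric] rev_rev_ident map_append[symmetric] append_take_drop_id by (simp add: ws_def)
    have len: "length l1 = d - q" "length l2 = q" using ws by (auto simp: l1_def l2_def q_def)
    have nrm: "norm b \<le> \<rho>" if bl: "b \<in> set l1 \<or> b \<in> set l2" for b
    proof -
      obtain w where w: "b = ?sc w" "w \<in> set ws"
        using bl by (auto simp: l1_def l2_def dest: in_set_takeD in_set_dropD)
      have "norm w \<le> 1" using w(2) ws(1) ball by blast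
      then have "\<rho> / real d * norm w \<le> \<rho> / 1 * 1" using \<rho> d by (intro mult_mono divide_left_mono) auto
      then show ?thesis using w \<rho> by simp
    qed
    have rch: "reach l1 G x" "reach l2 G x" if "x \<in> E" for x
    proof -
      have x: "\<And>b. b \<in> ball c r \<Longrightarrow> x \<in> seg_dom G (\<rho> *\<^sub>R b)" using cone that by (auto simp: cone_at_def)
      have "reach (map ?sc l) G x" if "set l \<subseteq> ball c r" "length l \<le> d" for l
        using reach_cone[of c r x G \<rho> "real d" c 0 l] x that d r by simp
      then show "reach l1 G x" "reach l2 G x"
        unfolding l1_def l2_def using ws set_take_subset[of q ws] set_drop_subset[of q ws] by auto
    qed
    let ?c = "ennreal (1 + real CARD('n))"
    let ?H = "\<lambda>y. indicator G y * ennreal (P m y)" and ?H' = "\<lambda>y. indicator G y * ennreal (P' m y)"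
    have "i + length l1 \<le> m" "i' + length l2 \<le> m" using len ii m by (auto simp: q_def d_def)
    note n1 = chain_nest[OF P GK G this(1)] and n2 = chain_nest[OF P' GK G this(2)]
    have cc: "?c ^ length l1 * ?c ^ length l2 = ennreal C"
    proof -
      have "?c ^ length l1 * ?c ^ length l2 = ?c ^ d" unfolding power_add[symmetric] len by (simp add: q_def)
      also have "\<dots> = ennreal ((1 + real CARD('n)) ^ d)" by (rule ennreal_power) simp
      finally show ?thesis by (simp add: C_def d_def)
    qed
    \<comment> \<open>The combined list is the image of the standard basis under a linear map, so
      the iterated integral is one over the whole space; \<open>cA\<close> comes from
      \<open>A\<close>, and the scaling by \<open>\<rho> / d\<close> gives the rest of the
      factor.\<close>
    have LH: "line_nest (rev l2 @ l1) ?H x = ennreal (C' / \<rho> ^ d) * (\<integral>\<^sup>+z. ?H z \<partial>lborel)" for x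
    proof -
      let ?A = "\<lambda>z. ?sc (A z)"
      have lin: "linear ?A" using A(1) by (rule linear_compose_scale_right)
      have x: "?A (g ((real d / \<rho>) *\<^sub>R x)) = x" using g \<rho> d by simp
      have [measurable]: "A \<in> borel_measurable borel"
        using A(1) by (intro borel_measurable_continuous_onI linear_continuous_on) (simp add: linear_conv_bounded_linear)
      have "line_nest (rev l2 @ l1) ?H x = line_nest (map ?A bs) ?H (?A (g ((real d / \<rho>) *\<^sub>R x)))"
        unfolding l12 x ..
      also have "\<dots> = line_nest bs (\<lambda>z. ?H (?A z)) (g ((real d / \<rho>) *\<^sub>R x))"
        by (rule line_nest_map[OF lin])
      also have "\<dots> = (\<integral>\<^sup>+z. ?H (?A z) \<partial>lborel)"
        by (rule line_nest_basis[OF _ bs]) measurable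
      finally have 1: "line_nest (rev l2 @ l1) ?H x = (\<integral>\<^sup>+z. ?H (?A z) \<partial>lborel)" .
      have "(\<integral>\<^sup>+z. ?H (A z) \<partial>lborel) = ennreal (\<bar>\<rho> / real d\<bar> ^ DIM(real^'n)) * (\<integral>\<^sup>+z. ?H (A (0 + (\<rho> / real d) *\<^sub>R z)) \<partial>lborel)"
        by (rule nn_integral_scale) (use \<rho> d in auto)
      also have "\<bar>\<rho> / real d\<bar> ^ DIM(real^'n) = (\<rho> / real d) ^ d" using \<rho> by (simp add: d_def)
      also have "(\<integral>\<^sup>+z. ?H (A (0 + (\<rho> / real d) *\<^sub>R z)) \<partial>lborel) = (\<integral>\<^sup>+z. ?H (?A z) \<partial>lborel)"
        using A(1) by (simp add: linear_scale)
      also have "(\<integral>\<^sup>+z. ?H (A z) \<partial>lborel) = ennreal cA * (\<integral>\<^sup>+z. ?H z \<partial>lborel)" by (rule cA(2)) measurable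
      finally have 2: "ennreal cA * (\<integral>\<^sup>+z. ?H z \<partial>lborel) = ennreal ((\<rho> / real d) ^ d) * (\<integral>\<^sup>+z. ?H (?A z) \<partial>lborel)" .
      have one: "ennreal ((real d / \<rho>) ^ d) * ennreal ((\<rho> / real d) ^ d) = 1"
        using \<rho> d by (simp add: ennreal_mult[symmetric] power_mult_distrib[symmetric])
      have "(\<integral>\<^sup>+z. ?H (?A z) \<partial>lborel) = ennreal ((real d / \<rho>) ^ d) * (ennreal ((\<rho> / real d) ^ d) * (\<integral>\<^sup>+z. ?H (?A z) \<partial>lborel))"
        unfolding mult.assoc[symmetric] one by simp
      also have "\<dots> = ennreal ((real d / \<rho>) ^ d) * ennreal cA * (\<integral>\<^sup>+z. ?H z \<partial>lborel)" unfolding 2[symmetric] by (simp only: mult.assoc)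
      also have "ennreal ((real d / \<rho>) ^ d) * ennreal cA = ennreal (C' / \<rho> ^ d)"
        using \<rho> cA(1) by (simp add: ennreal_mult[symmetric] C'_def power_divide)
      finally show ?thesis unfolding 1 .
    qed
    have pd: "power_density 1 G (P m) = ?H" "power_density 1 G (P' m) = ?H'"
      using chain_nonneg[OF P] chain_nonneg[OF P'] by (auto simp: power_density_def fun_eq_iff)
    have "(\<integral>\<^sup>+x. indicator E x * (ennreal (P i x powr 1) * ennreal (P' i' x powr 1)) \<partial>lborel)
      \<le> (\<integral>\<^sup>+x. ennreal C * (line_nest l1 ?H x * line_nest l2 ?H' x) \<partial>lborel)"
    proof (rule nn_integral_mono_AE)
      have "AE x in lborel. reach l1 G x \<longrightarrow> ennreal (P i x) \<le> ?c ^ length l1 * nest l1 ?H x"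
        "AE x in lborel. reach l2 G x \<longrightarrow> ennreal (P' i' x) \<le> ?c ^ length l2 * nest l2 ?H' x"
        using n1 n2 nrm by auto
      then show "AE x in lborel. indicator E x * (ennreal (P i x powr 1) * ennreal (P' i' x powr 1))
        \<le> ennreal C * (line_nest l1 ?H x * line_nest l2 ?H' x)"
      proof eventually_elim
        case (elim x)
        show ?case
        proof (cases "x \<in> E")
          case True
          have "ennreal (P i x) * ennreal (P' i' x) \<le> (?c ^ length l1 * line_nest l1 ?H x) * (?c ^ length l2 * line_nest l2 ?H' x)"
            using elim rch[OF True]
            by (intro mult_mono) (auto intro: order_trans[OF _ mult_left_mono[OF nest_le_line_nest]])
          also have "\<dots> = (?c ^ length l1 * ?c ^ length l2) * (line_nest l1 ?H x * line_nest l2 ?H' x)" by (simp only: mult_ac)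
          finally have "ennreal (P i x) * ennreal (P' i' x) \<le> ennreal C * (line_nest l1 ?H x * line_nest l2 ?H' x)"
            unfolding cc .
          then show ?thesis using True chain_nonneg[OF P] chain_nonneg[OF P'] by simp
        qed simp
      qed
    qed
    also have "\<dots> = ennreal C * (\<integral>\<^sup>+x. line_nest l1 ?H x * line_nest l2 ?H' x \<partial>lborel)"
      by (rule nn_integral_cmult) measurable
    also have "(\<integral>\<^sup>+x. line_nest l1 ?H x * line_nest l2 ?H' x \<partial>lborel) = (\<integral>\<^sup>+x. line_nest (rev l2) (line_nest l1 ?H) x * ?H' x \<partial>lborel)"
      by (rule line_nest_adjoint) measurable
    also have "\<dots> = (\<integral>\<^sup>+x. (ennreal (C' / \<rho> ^ d) * (\<integral>\<^sup>+z. ?H z \<partial>lborel)) * ?H' x \<partial>lborel)"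
      unfolding line_nest_append[symmetric] LH ..
    also have "\<dots> = (ennreal (C' / \<rho> ^ d) * (\<integral>\<^sup>+z. ?H z \<partial>lborel)) * (\<integral>\<^sup>+z. ?H' z \<partial>lborel)"
      by (rule nn_integral_cmult) measurable
    also have "ennreal C * \<dots> = (ennreal C * ennreal (C' / \<rho> ^ d)) * ((\<integral>\<^sup>+z. ?H z \<partial>lborel) * (\<integral>\<^sup>+z. ?H' z \<partial>lborel))"
      by (simp only: mult.assoc)
    also have "ennreal C * ennreal (C' / \<rho> ^ d) = ennreal (C * C' / \<rho> ^ CARD('n))"
      using \<rho> cA(1) by (subst ennreal_mult[symmetric]) (auto simp: C_def C'_def d_def)
    finally show "(\<integral>\<^sup>+x. indicator E x * (ennreal (P i x powr 1) * ennreal (P' i' x powr 1)) \<partial>lborel) \<le>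
      ennreal (C * C' / \<rho> ^ CARD('n)) * ((\<integral>\<^sup>+x. power_density 1 G (P m) x \<partial>lborel) * (\<integral>\<^sup>+x. power_density 1 G (P' m) x \<partial>lborel))"
      unfolding pd .
  qed
qed

section \<open>Weighted estimates for products of derivatives\<close>

text \<open>For p > 1 the two orders are either both below \<open>m\<close>, or one factor is of top
  order and the other undifferentiated; the last case is the mirror image of the second.\<close>

lemma local_product:
  fixes c :: "real^'n"
  assumes p: "1 \<le> p" and r: "0 < r" and ball: "\<And>b. b \<in> ball c r \<Longrightarrow> norm b \<le> 1"
    and m: "1 < p \<and> real CARD('n) / p < real m \<or> p = 1 \<and> CARD('n) \<le> m" and ii: "i + i' \<le> m"
  shows "\<exists>A\<ge>0. \<forall>K \<rho> P P' E G. open K \<longrightarrow> 0 < \<rho> \<longrightarrow> chain K m \<rho> P \<longrightarrow> chain K m \<rho> P' \<longrightarrow> E \<in> sets borel \<longrightarrow> G \<in> sets borel \<longrightarrow> G \<subseteq> K \<longrightarrow>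
    cone_at E G c r \<rho> \<longrightarrow> (\<integral>\<^sup>+x. indicator E x * (ennreal (P i x powr p) * ennreal (P' i' x powr p)) \<partial>lborel) \<le>
      ennreal (A / \<rho> ^ CARD('n)) * ((\<integral>\<^sup>+x. power_density p G (P m) x \<partial>lborel) * (\<integral>\<^sup>+x. power_density p G (P' m) x \<partial>lborel))"
proof (cases "p = 1")
  case True
  then have "CARD('n) \<le> m" using m by auto
  from critical_product[OF r ball this ii] show ?thesis unfolding True .
next
  case False
  then have mp: "real CARD('n) / p < real m" using m by auto
  consider "i < m \<and> i' < m" | "i = m \<and> i' = 0" | "i = 0 \<and> i' = m" using ii by linarith
  then show ?thesis
  proof cases
    case 1
    then show ?thesis using middle_order_product[OF p r ball mp _ _ ii] by simp
  next
    case 2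
    then show ?thesis using top_order_product[OF p r ball mp] by simp
  next
    case 3
    obtain A where A: "0 \<le> A" "\<And>K \<rho> P P' E G. open K \<Longrightarrow> 0 < \<rho> \<Longrightarrow> chain K m \<rho> P \<Longrightarrow> chain K m \<rho> P' \<Longrightarrow> E \<in> sets borel \<Longrightarrow> G \<in> sets borel \<Longrightarrow> G \<subseteq> K \<Longrightarrow>
       cone_at E G c r \<rho> \<Longrightarrow> (\<integral>\<^sup>+x. indicator E x * (ennreal (P m x powr p) * ennreal (P' 0 x powr p)) \<partial>lborel) \<le>
       ennreal (A / \<rho> ^ CARD('n)) * ((\<integral>\<^sup>+x. power_density p G (P m) x \<partial>lborel) * (\<integral>\<^sup>+x. power_density p G (P' m) x \<partial>lborel))"
      using top_order_product[OF p r ball mp] by blast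
    show ?thesis
    proof (intro exI[of _ A] conjI allI impI)
      fix K \<rho> E G and P P' :: "nat \<Rightarrow> real^'n \<Rightarrow> real"
      assume "open K" "0 < \<rho>" "chain K m \<rho> P" "chain K m \<rho> P'" "E \<in> sets borel" "G \<in> sets borel" "G \<subseteq> K" "cone_at E G c r \<rho>"
      from A(2)[OF this(1,2,4,3,5-)]
      show "(\<integral>\<^sup>+x. indicator E x * (ennreal (P i x powr p) * ennreal (P' i' x powr p)) \<partial>lborel) \<le>
       ennreal (A / \<rho> ^ CARD('n)) * ((\<integral>\<^sup>+x. power_density p G (P m) x \<partial>lborel) * (\<integral>\<^sup>+x. power_density p G (P' m) x \<partial>lborel))"
        using 3 by (simp add: mult.commute)
    qed (rule A(1))
  qed
qed

subsection \<open>Families of weak derivatives\<close>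

text \<open>The derivatives are linked by first-order relations only, the form used along segments.
  Borel measurability is imposed beyond order \<open>m\<close> as well, because \<open>chain\<close>
  asks for it at every index.\<close>

definition weak_family :: "(real^'n) set \<Rightarrow> nat \<Rightarrow> (('n \<Rightarrow> nat) \<Rightarrow> real^'n \<Rightarrow> real) \<Rightarrow> bool" where
  "weak_family K m U \<longleftrightarrow> (\<forall>\<alpha>. U \<alpha> \<in> borel_measurable borel) \<and> (\<forall>\<alpha>. mi_order \<alpha> \<le> m \<longrightarrow> loc_int K (U \<alpha>)) \<and>
    (\<forall>\<alpha> i. mi_order \<alpha> < m \<longrightarrow> weak_dir K (axis i 1) (U \<alpha>) (U (mi_inc i \<alpha>)))"

lemma weak_familyD:
  assumes "weak_family K m U"
  shows "U \<alpha> \<in> borel_measurable borel" "mi_order \<alpha> \<le> m \<Longrightarrow> loc_int K (U \<alpha>)"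
    "mi_order \<alpha> < m \<Longrightarrow> weak_dir K (axis i 1) (U \<alpha>) (U (mi_inc i \<alpha>))"
  using assms by (simp_all add: weak_family_def)

lemma dir_deriv_axis: "dir_deriv (axis i 1) \<phi> x = partial_deriv i \<phi> x"
proof -
  have "dir_deriv (axis i 1) \<phi> x = (\<Sum>j\<in>UNIV. if j = i then partial_deriv j \<phi> x else 0)"
    by (intro sum.cong) (auto simp: axis_def)
  then show ?thesis by simp
qed

lemma weak_dir_sum:
  assumes f: "loc_int U f" and g: "\<And>i. loc_int U (g i)" and w: "\<And>i. weak_dir U (axis i 1) f (g i)"
  shows "weak_dir U b f (\<lambda>x. \<Sum>i\<in>UNIV. b $ i * g i x)"
  unfolding weak_dir_def
proof
  fix \<phi> assume \<phi>: "\<phi> \<in> test_functions U"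
  have i1: "integrable lborel (\<lambda>x. f x * partial_deriv i \<phi> x)" for i
    by (rule loc_int_test[OF f test_functions_partial_deriv[OF \<phi>]])
  have i2: "integrable lborel (\<lambda>x. g i x * \<phi> x)" for i by (rule loc_int_test[OF g \<phi>])
  have e: "(LINT x|lborel. f x * partial_deriv i \<phi> x) = - (LINT x|lborel. g i x * \<phi> x)" for i
    using w[of i] \<phi> unfolding weak_dir_def dir_deriv_axis by blast
  have "(LINT x|lborel. f x * dir_deriv b \<phi> x) = (LINT x|lborel. (\<Sum>i\<in>UNIV. b $ i * (f x * partial_deriv i \<phi> x)))"
    by (simp add: sum_distrib_left mult_ac)
  also have "\<dots> = (\<Sum>i\<in>UNIV. b $ i * (LINT x|lborel. f x * partial_deriv i \<phi> x))"
    by (subst Bochner_Integration.integral_sum) (auto intro: integrable_mult_right i1)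
  also have "\<dots> = - (\<Sum>i\<in>UNIV. b $ i * (LINT x|lborel. g i x * \<phi> x))" unfolding e by (simp add: sum_negf)
  also have "(\<Sum>i\<in>UNIV. b $ i * (LINT x|lborel. g i x * \<phi> x)) = (LINT x|lborel. (\<Sum>i\<in>UNIV. b $ i * (g i x * \<phi> x)))"
    by (subst Bochner_Integration.integral_sum) (auto intro: integrable_mult_right i2)
  also have "\<dots> = (LINT x|lborel. (\<Sum>i\<in>UNIV. b $ i * g i x) * \<phi> x)"
    by (simp only: sum_distrib_right mult.assoc)
  finally show "(LINT x|lborel. f x * dir_deriv b \<phi> x) = - (LINT x|lborel. (\<Sum>i\<in>UNIV. b $ i * g i x) * \<phi> x)" .
qed

definition jet :: "real \<Rightarrow> (('n \<Rightarrow> nat) \<Rightarrow> real^'n \<Rightarrow> real) \<Rightarrow> nat \<Rightarrow> real^'n \<Rightarrow> real" where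
  "jet \<rho> U i x = (\<Sum>\<alpha> | mi_order \<alpha> \<le> i. \<rho> ^ mi_order \<alpha> * \<bar>U \<alpha> x\<bar>)"

lemma jet_nonneg: "0 \<le> \<rho> \<Longrightarrow> 0 \<le> jet \<rho> U i x"
  unfolding jet_def by (intro sum_nonneg mult_nonneg_nonneg) auto

lemma jet_member:
  assumes "0 \<le> \<rho>"
  shows "\<rho> ^ mi_order \<alpha> * \<bar>U \<alpha> x\<bar> \<le> jet \<rho> U (mi_order \<alpha>) x"
  unfolding jet_def
  by (rule member_le_sum[where f="\<lambda>\<alpha>. \<rho> ^ mi_order \<alpha> * \<bar>U \<alpha> x\<bar>"])
     (use assms finite_mi_order_le in auto)

lemma inj_mi_inc: "inj (mi_inc i)"
proof (rule injI)
  fix \<alpha> \<beta> assume *: "mi_inc i \<alpha> = mi_inc i \<beta>"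
  show "\<alpha> = \<beta>"
  proof
    fix j show "\<alpha> j = \<beta> j" using fun_cong[OF *, of j] by (cases "j = i") (auto simp: mi_inc_def)
  qed
qed

text \<open>For fixed \<open>j\<close> the map \<open>mi_inc j\<close> is injective, so a
  multi-index of the larger jet is counted at most once per coordinate.\<close>

lemma jet_inc_sum:
  fixes U :: "('n::finite \<Rightarrow> nat) \<Rightarrow> real^'n \<Rightarrow> real"
  assumes "0 \<le> \<rho>"
  shows "(\<Sum>\<alpha> | mi_order \<alpha> \<le> i. \<Sum>j\<in>UNIV. \<rho> ^ mi_order (mi_inc j \<alpha>) * \<bar>U (mi_inc j \<alpha>) y\<bar>) \<le> real CARD('n) * jet \<rho> U (Suc i) y"
proof -
  let ?w = "\<lambda>\<alpha>. \<rho> ^ mi_order \<alpha> * \<bar>U \<alpha> y\<bar>"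
  have "(\<Sum>\<alpha> | mi_order \<alpha> \<le> i. \<Sum>j\<in>UNIV. ?w (mi_inc j \<alpha>)) = (\<Sum>j\<in>UNIV. \<Sum>\<alpha> | mi_order \<alpha> \<le> i. ?w (mi_inc j \<alpha>))"
    by (rule sum.swap)
  also have "\<dots> \<le> (\<Sum>j\<in>(UNIV::'n set). jet \<rho> U (Suc i) y)"
  proof (rule sum_mono)
    fix j :: 'n
    have "(\<Sum>\<alpha> | mi_order \<alpha> \<le> i. ?w (mi_inc j \<alpha>)) = sum ?w (mi_inc j ` {\<alpha>. mi_order \<alpha> \<le> i})"
      by (subst sum.reindex) (auto intro: inj_on_subset[OF inj_mi_inc])
    also have "\<dots> \<le> jet \<rho> U (Suc i) y"
      unfolding jet_def using assms by (intro sum_mono2 finite_mi_order_le) auto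
    finally show "(\<Sum>\<alpha> | mi_order \<alpha> \<le> i. ?w (mi_inc j \<alpha>)) \<le> jet \<rho> U (Suc i) y" .
  qed
  finally show ?thesis by simp
qed

text \<open>The increment formula for each derivative in the jet. The bound
  \<open>norm b \<le> \<rho>\<close> converts the component of \<open>b\<close> into the additional
  power of \<open>\<rho>\<close> that the derivative of next order carries in the jet.\<close>

lemma jet_step:
  fixes U :: "('n::finite \<Rightarrow> nat) \<Rightarrow> real^'n \<Rightarrow> real"
  assumes K: "open K" and \<rho>: "0 < \<rho>" and U: "weak_family K m U" and i: "i < m" and b: "norm b \<le> \<rho>" and t: "0 \<le> t" "t \<le> 1"
  shows "AE x in lborel. x \<in> seg_dom K (t *\<^sub>R b) \<longrightarrow> ennreal (jet \<rho> U i x) \<le>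
    ennreal (jet \<rho> U i (x + t *\<^sub>R b)) +
    ennreal (real CARD('n)) * (\<integral>\<^sup>+s. indicator {0..1} s * ennreal (t * jet \<rho> U (Suc i) (x + s *\<^sub>R (t *\<^sub>R b))) \<partial>lborel)"
proof -
  note [measurable] = weak_familyD(1)[OF U]
  let ?A = "{\<alpha> :: 'n \<Rightarrow> nat. mi_order \<alpha> \<le> i}"
  have finA: "finite ?A" by (rule finite_mi_order_le)
  let ?G = "\<lambda>\<alpha> x. \<Sum>j\<in>UNIV. (t *\<^sub>R b) $ j * U (mi_inc j \<alpha>) x"
  have "AE x in lborel. \<forall>\<alpha>\<in>?A. x \<in> seg_dom K (t *\<^sub>R b) \<longrightarrow>
    U \<alpha> (x + t *\<^sub>R b) - U \<alpha> x = (LINT s:{0..1}|lborel. ?G \<alpha> (x + s *\<^sub>R (t *\<^sub>R b))) \<and> set_integrable lborel {0..1} (\<lambda>s. ?G \<alpha> (x + s *\<^sub>R (t *\<^sub>R b)))"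
  proof (subst AE_ball_countable)
    show "countable ?A" using finA by (rule countable_finite)
    show "\<forall>\<alpha>\<in>?A. AE x in lborel. x \<in> seg_dom K (t *\<^sub>R b) \<longrightarrow>
     U \<alpha> (x + t *\<^sub>R b) - U \<alpha> x = (LINT s:{0..1}|lborel. ?G \<alpha> (x + s *\<^sub>R (t *\<^sub>R b))) \<and> set_integrable lborel {0..1} (\<lambda>s. ?G \<alpha> (x + s *\<^sub>R (t *\<^sub>R b)))"
    proof
      fix \<alpha> assume "\<alpha> \<in> ?A"
      then have \<alpha>: "mi_order \<alpha> \<le> m" "mi_order \<alpha> < m" "\<And>j. mi_order (mi_inc j \<alpha>) \<le> m" using i by auto
      show "AE x in lborel. x \<in> seg_dom K (t *\<^sub>R b) \<longrightarrow>
        U \<alpha> (x + t *\<^sub>R b) - U \<alpha> x = (LINT s:{0..1}|lborel. ?G \<alpha> (x + s *\<^sub>R (t *\<^sub>R b))) \<and> set_integrable lborel {0..1} (\<lambda>s. ?G \<alpha> (x + s *\<^sub>R (t *\<^sub>R b)))"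
        by (intro weak_dir_line[OF K] weak_dir_sum loc_int_sum loc_int_cmult weak_familyD[OF U] \<alpha>)
    qed
  qed
  then show ?thesis
  proof eventually_elim
    case (elim x)
    show ?case
    proof
      assume x: "x \<in> seg_dom K (t *\<^sub>R b)"
      let ?y = "\<lambda>s. x + s *\<^sub>R (t *\<^sub>R b)"
      let ?g = "\<lambda>\<alpha> y. \<Sum>j\<in>UNIV. \<rho> ^ mi_order (mi_inc j \<alpha>) * \<bar>U (mi_inc j \<alpha>) y\<bar>"
      have one: "ennreal (\<rho> ^ mi_order \<alpha> * \<bar>U \<alpha> x\<bar>) \<le> ennreal (\<rho> ^ mi_order \<alpha> * \<bar>U \<alpha> (x + t *\<^sub>R b)\<bar>)
         + (\<integral>\<^sup>+s. indicator {0..1} s * ennreal (t * ?g \<alpha> (?y s)) \<partial>lborel)" if \<alpha>: "\<alpha> \<in> ?A" for \<alpha>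
      proof -
        from elim \<alpha> x have e: "U \<alpha> (x + t *\<^sub>R b) - U \<alpha> x = (LINT s:{0..1}|lborel. ?G \<alpha> (?y s))"
          and int: "set_integrable lborel {0..1} (\<lambda>s. ?G \<alpha> (?y s))" by auto
        have "ennreal \<bar>U \<alpha> (x + t *\<^sub>R b) - U \<alpha> x\<bar> \<le> (\<integral>\<^sup>+s. ennreal (norm (indicator {0..1} s *\<^sub>R ?G \<alpha> (?y s))) \<partial>lborel)"
          unfolding e set_lebesgue_integral_def real_norm_def[symmetric]
          using int unfolding set_integrable_def by (rule integral_norm_bound_ennreal)
        then have "ennreal (\<rho> ^ mi_order \<alpha>) * ennreal \<bar>U \<alpha> (x + t *\<^sub>R b) - U \<alpha> x\<bar> \<le>
           ennreal (\<rho> ^ mi_order \<alpha>) * (\<integral>\<^sup>+s. ennreal (norm (indicator {0..1} s *\<^sub>R ?G \<alpha> (?y s))) \<partial>lborel)"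
          by (rule mult_left_mono) simp
        also have "\<dots> = (\<integral>\<^sup>+s. ennreal (\<rho> ^ mi_order \<alpha>) * ennreal (norm (indicator {0..1} s *\<^sub>R ?G \<alpha> (?y s))) \<partial>lborel)"
          by (rule nn_integral_cmult[symmetric]) measurable
        also have "\<dots> \<le> (\<integral>\<^sup>+s. indicator {0..1} s * ennreal (t * ?g \<alpha> (?y s)) \<partial>lborel)"
        proof (rule nn_integral_mono)
          fix s :: real
          have "\<rho> ^ mi_order \<alpha> * \<bar>?G \<alpha> (?y s)\<bar> \<le> \<rho> ^ mi_order \<alpha> * (\<Sum>j\<in>UNIV. \<bar>(t *\<^sub>R b) $ j * U (mi_inc j \<alpha>) (?y s)\<bar>)"
            using \<rho> by (intro mult_left_mono sum_abs) auto
          also have "\<dots> \<le> \<rho> ^ mi_order \<alpha> * (\<Sum>j\<in>UNIV. t * (\<rho> * \<bar>U (mi_inc j \<alpha>) (?y s)\<bar>))"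
          proof (intro mult_left_mono sum_mono)
            fix j
            have "\<bar>b $ j\<bar> \<le> \<rho>" using component_le_norm_cart[of b j] b by linarith
            then have "\<bar>b $ j\<bar> * \<bar>U (mi_inc j \<alpha>) (?y s)\<bar> \<le> \<rho> * \<bar>U (mi_inc j \<alpha>) (?y s)\<bar>" by (rule mult_right_mono) simp
            then have "t * (\<bar>b $ j\<bar> * \<bar>U (mi_inc j \<alpha>) (?y s)\<bar>) \<le> t * (\<rho> * \<bar>U (mi_inc j \<alpha>) (?y s)\<bar>)"
              using t(1) by (rule mult_left_mono)
            then show "\<bar>(t *\<^sub>R b) $ j * U (mi_inc j \<alpha>) (?y s)\<bar> \<le> t * (\<rho> * \<bar>U (mi_inc j \<alpha>) (?y s)\<bar>)"
              using t(1) by (simp only: vector_scaleR_component real_scaleR_def abs_mult abs_of_nonneg mult.assoc)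
          qed (use \<rho> in simp)
          also have "\<dots> = t * ?g \<alpha> (?y s)" by (simp add: sum_distrib_left mult_ac)
          finally have "ennreal (\<rho> ^ mi_order \<alpha> * \<bar>?G \<alpha> (?y s)\<bar>) \<le> ennreal (t * ?g \<alpha> (?y s))" by (rule ennreal_leI)
          then show "ennreal (\<rho> ^ mi_order \<alpha>) * ennreal (norm (indicator {0..1} s *\<^sub>R ?G \<alpha> (?y s))) \<le> indicator {0..1} s * ennreal (t * ?g \<alpha> (?y s))"
            using \<rho> by (cases "s \<in> {0..1}") (auto simp: ennreal_mult[symmetric] simp del: vector_scaleR_component)
        qed
        finally have d: "ennreal (\<rho> ^ mi_order \<alpha> * \<bar>U \<alpha> (x + t *\<^sub>R b) - U \<alpha> x\<bar>) \<le> (\<integral>\<^sup>+s. indicator {0..1} s * ennreal (t * ?g \<alpha> (?y s)) \<partial>lborel)"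
          using \<rho> by (simp add: ennreal_mult)
        have "\<rho> ^ mi_order \<alpha> * \<bar>U \<alpha> x\<bar> \<le> \<rho> ^ mi_order \<alpha> * (\<bar>U \<alpha> (x + t *\<^sub>R b)\<bar> + \<bar>U \<alpha> (x + t *\<^sub>R b) - U \<alpha> x\<bar>)"
          using \<rho> by (intro mult_left_mono) auto
        then have "ennreal (\<rho> ^ mi_order \<alpha> * \<bar>U \<alpha> x\<bar>) \<le> ennreal (\<rho> ^ mi_order \<alpha> * \<bar>U \<alpha> (x + t *\<^sub>R b)\<bar>) + ennreal (\<rho> ^ mi_order \<alpha> * \<bar>U \<alpha> (x + t *\<^sub>R b) - U \<alpha> x\<bar>)"
          using \<rho> by (subst ennreal_plus[symmetric]) (auto simp: distrib_left simp del: ennreal_plus intro!: ennreal_leI)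
        then show ?thesis using d by (meson add_left_mono order_trans)
      qed
      have "ennreal (jet \<rho> U i x) = (\<Sum>\<alpha>\<in>?A. ennreal (\<rho> ^ mi_order \<alpha> * \<bar>U \<alpha> x\<bar>))"
        unfolding jet_def using \<rho> by (subst sum_ennreal) auto
      also have "\<dots> \<le> (\<Sum>\<alpha>\<in>?A. ennreal (\<rho> ^ mi_order \<alpha> * \<bar>U \<alpha> (x + t *\<^sub>R b)\<bar>) + (\<integral>\<^sup>+s. indicator {0..1} s * ennreal (t * ?g \<alpha> (?y s)) \<partial>lborel))"
        by (rule sum_mono) (rule one)
      also have "\<dots> = ennreal (jet \<rho> U i (x + t *\<^sub>R b)) + (\<Sum>\<alpha>\<in>?A. \<integral>\<^sup>+s. indicator {0..1} s * ennreal (t * ?g \<alpha> (?y s)) \<partial>lborel)"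
        unfolding jet_def sum.distrib using \<rho> by (subst sum_ennreal) auto
      also have "(\<Sum>\<alpha>\<in>?A. \<integral>\<^sup>+s. indicator {0..1} s * ennreal (t * ?g \<alpha> (?y s)) \<partial>lborel) = (\<integral>\<^sup>+s. (\<Sum>\<alpha>\<in>?A. indicator {0..1} s * ennreal (t * ?g \<alpha> (?y s))) \<partial>lborel)"
        by (rule nn_integral_sum[symmetric]) measurable
      finally have 1: "ennreal (jet \<rho> U i x) \<le> ennreal (jet \<rho> U i (x + t *\<^sub>R b)) + (\<integral>\<^sup>+s. (\<Sum>\<alpha>\<in>?A. indicator {0..1} s * ennreal (t * ?g \<alpha> (?y s))) \<partial>lborel)" .
      have [measurable]: "jet \<rho> U (Suc i) \<in> borel_measurable borel" unfolding jet_def[abs_def] by measurable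
      have "(\<integral>\<^sup>+s. (\<Sum>\<alpha>\<in>?A. indicator {0..1} s * ennreal (t * ?g \<alpha> (?y s))) \<partial>lborel) \<le>
        (\<integral>\<^sup>+s. ennreal (real CARD('n)) * (indicator {0..1} s * ennreal (t * jet \<rho> U (Suc i) (?y s))) \<partial>lborel)"
      proof (rule nn_integral_mono)
        fix s :: real
        have g0: "0 \<le> t * ?g \<alpha> (?y s)" for \<alpha> using \<rho> t by (intro mult_nonneg_nonneg sum_nonneg) auto
        have "(\<Sum>\<alpha>\<in>?A. indicator {0..1} s * ennreal (t * ?g \<alpha> (?y s))) = indicator {0..1} s * ennreal (\<Sum>\<alpha>\<in>?A. t * ?g \<alpha> (?y s))"
          using g0 by (simp add: sum_distrib_left[symmetric] sum_ennreal)
        also have "\<dots> \<le> indicator {0..1} s * ennreal (real CARD('n) * (t * jet \<rho> U (Suc i) (?y s)))"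
        proof (intro mult_left_mono ennreal_leI)
          have "t * (\<Sum>\<alpha>\<in>?A. ?g \<alpha> (?y s)) \<le> t * (real CARD('n) * jet \<rho> U (Suc i) (?y s))"
            using \<rho> t by (intro mult_left_mono jet_inc_sum) auto
          then show "(\<Sum>\<alpha>\<in>?A. t * ?g \<alpha> (?y s)) \<le> real CARD('n) * (t * jet \<rho> U (Suc i) (?y s))"
            by (simp add: sum_distrib_left mult_ac)
        qed simp
        also have "\<dots> = ennreal (real CARD('n)) * (indicator {0..1} s * ennreal (t * jet \<rho> U (Suc i) (?y s)))"
          using t jet_nonneg[of \<rho> U "Suc i" "?y s"] \<rho> by (subst ennreal_mult) (auto simp: mult_ac)
        finally show "(\<Sum>\<alpha>\<in>?A. indicator {0..1} s * ennreal (t * ?g \<alpha> (?y s))) \<le> ennreal (real CARD('n)) * (indicator {0..1} s * ennreal (t * jet \<rho> U (Suc i) (?y s)))" .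
      qed
      also have "\<dots> = ennreal (real CARD('n)) * (\<integral>\<^sup>+s. indicator {0..1} s * ennreal (t * jet \<rho> U (Suc i) (?y s)) \<partial>lborel)"
        by (rule nn_integral_cmult) measurable
      finally show "ennreal (jet \<rho> U i x) \<le> ennreal (jet \<rho> U i (x + t *\<^sub>R b)) +
        ennreal (real CARD('n)) * (\<integral>\<^sup>+s. indicator {0..1} s * ennreal (t * jet \<rho> U (Suc i) (x + s *\<^sub>R (t *\<^sub>R b))) \<partial>lborel)"
        using 1 by (meson add_left_mono order_trans)
    qed
  qed
qed

lemma jet_mono: "0 \<le> \<rho> \<Longrightarrow> jet \<rho> U i x \<le> jet \<rho> U (Suc i) x"
  unfolding jet_def by (intro sum_mono2 finite_mi_order_le) auto

text \<open>The increment formula leaves the jet at the end point of the segment as a pointwise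
  value. Letting the end point run over \<open>x + t *\<^sub>R b\<close> and averaging over
  \<open>t\<close> turns it into an integral too; the end points contribute the 1 and the increments
  the dimension in the constant.\<close>

lemma jet_chain:
  fixes U :: "('n::finite \<Rightarrow> nat) \<Rightarrow> real^'n \<Rightarrow> real"
  assumes K: "open K" and \<rho>: "0 < \<rho>" and U: "weak_family K m U"
  shows "chain K m \<rho> (jet \<rho> U)"
  unfolding chain_def
proof (intro conjI allI impI)
  note [measurable] = weak_familyD(1)[OF U]
  show [measurable]: "jet \<rho> U i \<in> borel_measurable borel" for i unfolding jet_def[abs_def] by measurable
  show "0 \<le> jet \<rho> U i x" for i x using \<rho> by (intro jet_nonneg) simp
  show "jet \<rho> U i x \<le> jet \<rho> U (Suc i) x" for i x using \<rho> by (intro jet_mono) simp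
  fix i and b :: "real^'n" assume i: "i < m" and b: "norm b \<le> \<rho>"
  have V[measurable]: "seg_dom K b \<in> sets borel" by (intro borel_open open_seg_dom K)
  define d where "d = ennreal (real CARD('n))"
  define J where "J x = (\<integral>\<^sup>+s. indicator {0..1} s * ennreal (jet \<rho> U (Suc i) (x + s *\<^sub>R b)) \<partial>lborel)" for x
  have [measurable]: "J \<in> borel_measurable borel" unfolding J_def by measurable
  have "AE t in lborel. AE x in lborel. x \<in> seg_dom K b \<and> t \<in> {0..1::real} \<longrightarrow>
     ennreal (jet \<rho> U i x) \<le> ennreal (jet \<rho> U (Suc i) (x + t *\<^sub>R b)) + d * J x"
  proof (rule AE_I2)
    fix t :: real
    show "AE x in lborel. x \<in> seg_dom K b \<and> t \<in> {0..1} \<longrightarrow>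
     ennreal (jet \<rho> U i x) \<le> ennreal (jet \<rho> U (Suc i) (x + t *\<^sub>R b)) + d * J x"
    proof (cases "t \<in> {0..1}")
      case True
      then have "0 \<le> t" "t \<le> 1" by auto
      from jet_step[OF K \<rho> U i b this] show ?thesis
      proof eventually_elim
        case (elim x)
        show ?case
        proof
          assume x: "x \<in> seg_dom K b \<and> t \<in> {0..1}"
          have "x \<in> seg_dom K (t *\<^sub>R b)"
            unfolding seg_dom_def
          proof (intro CollectI ballI)
            fix s :: real assume "s \<in> {0..1}"
            then have "s * t \<in> {0..1}" using x by (auto intro: mult_le_one)
            moreover have "\<forall>r\<in>{0..1}. x + r *\<^sub>R b \<in> K" using x by (simp add: seg_dom_def)
            ultimately show "x + s *\<^sub>R (t *\<^sub>R b) \<in> K" by (metis scaleR_scaleR)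
          qed
          with elim have 1: "ennreal (jet \<rho> U i x) \<le> ennreal (jet \<rho> U i (x + t *\<^sub>R b)) +
            d * (\<integral>\<^sup>+s. indicator {0..1} s * ennreal (t * jet \<rho> U (Suc i) (x + s *\<^sub>R (t *\<^sub>R b))) \<partial>lborel)"
            unfolding d_def by blast
          \<comment> \<open>The segment to \<open>x + t *\<^sub>R b\<close> is the initial part of
            the full one, and the factor \<open>t\<close> is the Jacobian; so the bound
            \<open>J x\<close> is independent of \<open>t\<close>.\<close>
          have 2: "(\<integral>\<^sup>+s. indicator {0..1} s * ennreal (t * jet \<rho> U (Suc i) (x + s *\<^sub>R (t *\<^sub>R b))) \<partial>lborel) \<le> J x"
          proof (cases "t = 0")
            case False
            then have t: "0 < t" using x by auto
            have "(\<integral>\<^sup>+s. indicator {0..1} s * ennreal (t * jet \<rho> U (Suc i) (x + s *\<^sub>R (t *\<^sub>R b))) \<partial>lborel)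
              = (\<integral>\<^sup>+s. ennreal t * (indicator {0..1} s * ennreal (jet \<rho> U (Suc i) (x + (0 + s * t) *\<^sub>R b))) \<partial>lborel)"
              using t jet_nonneg[of \<rho> U] \<rho> by (intro nn_integral_cong) (simp add: ennreal_mult mult_ac)
            also have "\<dots> = ennreal t * (\<integral>\<^sup>+s. indicator {0..1} s * ennreal (jet \<rho> U (Suc i) (x + (0 + s * t) *\<^sub>R b)) \<partial>lborel)"
              by (rule nn_integral_cmult) measurable
            also have "\<dots> = (\<integral>\<^sup>+r. indicator {0..0 + t} r * ennreal (jet \<rho> U (Suc i) (x + r *\<^sub>R b)) \<partial>lborel)"
              by (rule nn_segment_reparam[OF t]) measurable
            also have "\<dots> \<le> J x" unfolding J_def using x by (intro nn_integral_mono mult_right_mono) (auto simp: indicator_def)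
            finally show ?thesis .
          qed simp
          have 3: "ennreal (jet \<rho> U i (x + t *\<^sub>R b)) \<le> ennreal (jet \<rho> U (Suc i) (x + t *\<^sub>R b))"
            using \<rho> by (intro ennreal_leI jet_mono) simp
          show "ennreal (jet \<rho> U i x) \<le> ennreal (jet \<rho> U (Suc i) (x + t *\<^sub>R b)) + d * J x"
            by (rule order_trans[OF 1 add_mono[OF 3 mult_left_mono[OF 2]]]) simp
        qed
      qed
    next
      case False
      then show ?thesis by (intro AE_I2) blast
    qed
  qed
  then have "AE x in lborel. AE t in lborel. x \<in> seg_dom K b \<and> t \<in> {0..1::real} \<longrightarrow>
     ennreal (jet \<rho> U i x) \<le> ennreal (jet \<rho> U (Suc i) (x + t *\<^sub>R b)) + d * J x"
  proof (subst lborel_pair.AE_commute)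
    show "{z \<in> space (lborel \<Otimes>\<^sub>M lborel). fst z \<in> seg_dom K b \<and> snd z \<in> {0..1::real} \<longrightarrow>
     ennreal (jet \<rho> U i (fst z)) \<le> ennreal (jet \<rho> U (Suc i) (fst z + snd z *\<^sub>R b)) + d * J (fst z)} \<in> sets (lborel \<Otimes>\<^sub>M lborel)"
      by measurable
  qed
  then show "AE x in lborel. x \<in> seg_dom K b \<longrightarrow> ennreal (jet \<rho> U i x) \<le>
    ennreal (1 + real CARD('n)) * (\<integral>\<^sup>+s. indicator {0..1} s * ennreal (jet \<rho> U (Suc i) (x + s *\<^sub>R b)) \<partial>lborel)"
  proof eventually_elim
    case (elim x)
    show ?case
    proof
      assume x: "x \<in> seg_dom K b"
      have "ennreal (jet \<rho> U i x) = (\<integral>\<^sup>+t. ennreal (jet \<rho> U i x) * indicator {0..1::real} t \<partial>lborel)"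
        by (subst nn_integral_cmult_indicator) simp_all
      also have "\<dots> \<le> (\<integral>\<^sup>+t. indicator {0..1} t * ennreal (jet \<rho> U (Suc i) (x + t *\<^sub>R b)) + (d * J x) * indicator {0..1} t \<partial>lborel)"
      proof (rule nn_integral_mono_AE)
        show "AE t in lborel. ennreal (jet \<rho> U i x) * indicator {0..1} t \<le> indicator {0..1} t * ennreal (jet \<rho> U (Suc i) (x + t *\<^sub>R b)) + (d * J x) * indicator {0..1} t"
          using elim
        proof eventually_elim
          case (elim t)
          then show ?case using x by (cases "t \<in> {0..1}") auto
        qed
      qed
      also have "\<dots> = J x + d * J x"
        by (subst nn_integral_add) (simp_all add: J_def[symmetric] nn_integral_cmult_indicator)
      also have "\<dots> = ennreal (1 + real CARD('n)) * J x" by (simp add: d_def distrib_right)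
      finally show "ennreal (jet \<rho> U i x) \<le> ennreal (1 + real CARD('n)) * (\<integral>\<^sup>+s. indicator {0..1} s * ennreal (jet \<rho> U (Suc i) (x + s *\<^sub>R b)) \<partial>lborel)"
        unfolding J_def .
    qed
  qed
qed

subsection \<open>Geometry of the cone\<close>

text \<open>Here \<open>k\<close> is the cosine of the opening angle. The form without division
  covers acute and obtuse angles alike, and the strict inequality excludes the vertex.\<close>

definition open_cone :: "real^'n \<Rightarrow> real \<Rightarrow> (real^'n) set" where
  "open_cone e k = {x. k * norm x < x \<bullet> e \<and> norm x < 1}"

lemma open_open_cone: "open (open_cone e k)"
  unfolding open_cone_def by (intro open_Collect_conj open_Collect_less continuous_intros)

text \<open>A vector \<open>z\<close> near the axis satisfies
  \<open>\<bar>k\<bar> * norm z \<le> z \<bullet> e\<close>. Adding a multiple of it raises the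
  right-hand side of the cone inequality at least as much as it can change the left-hand one, also
  for negative \<open>k\<close>, when the cone is not convex. The radius is chosen so that
  \<open>\<bar>k\<bar> + \<delta> \<le> 1 - \<delta>\<close>.\<close>

lemma cone_step:
  fixes e x z :: "real^'n"
  assumes e: "norm e = 1" and k: "\<bar>k\<bar> < 1" and z: "norm (z - e) \<le> (1 - \<bar>k\<bar>) / 2" and x: "k * norm x < x \<bullet> e" and s: "0 \<le> s"
  shows "k * norm (x + s *\<^sub>R z) < (x + s *\<^sub>R z) \<bullet> e"
proof -
  have "z \<bullet> e = 1 + (z - e) \<bullet> e" using e by (simp add: inner_diff_left dot_square_norm)
  moreover have "\<bar>(z - e) \<bullet> e\<bar> \<le> norm (z - e)" using Cauchy_Schwarz_ineq2[of "z - e" e] e by simp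
  ultimately have ze: "1 - norm (z - e) \<le> z \<bullet> e" by linarith
  have "norm z \<le> 1 + norm (z - e)" using norm_triangle_ineq[of e "z - e"] e by simp
  then have "\<bar>k\<bar> * norm z \<le> \<bar>k\<bar> * (1 + norm (z - e))" by (rule mult_left_mono) simp
  also have "\<dots> \<le> \<bar>k\<bar> + 1 * norm (z - e)"
    using k mult_right_mono[of "\<bar>k\<bar>" 1 "norm (z - e)"] by (simp add: distrib_left)
  also have "\<dots> \<le> 1 - norm (z - e)" using z by (simp add: field_simps)
  finally have zk: "\<bar>k\<bar> * norm z \<le> z \<bullet> e" using ze by linarith
  then have szk: "s * (\<bar>k\<bar> * norm z) \<le> s * (z \<bullet> e)" using s by (rule mult_left_mono)
  have "k * (norm (x + s *\<^sub>R z) - norm x) \<le> \<bar>k\<bar> * \<bar>norm (x + s *\<^sub>R z) - norm x\<bar>"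
    by (metis abs_ge_self abs_mult)
  also have "\<dots> \<le> \<bar>k\<bar> * norm (s *\<^sub>R z)"
    using norm_triangle_ineq3[of "x + s *\<^sub>R z" x] by (intro mult_left_mono) auto
  also have "\<dots> = s * (\<bar>k\<bar> * norm z)" using s by simp
  finally have "k * norm (x + s *\<^sub>R z) \<le> k * norm x + s * (\<bar>k\<bar> * norm z)" by (simp add: algebra_simps)
  then show ?thesis using szk x by (simp add: inner_add_left)
qed

text \<open>From a point near direction \<open>\<xi>\<close>, stepping towards \<open>- \<xi> + e / 4\<close> decreases the norm and
  stays inside, so neither the lateral surface nor the spherical cap is met.\<close>

lemma cone_segments:
  fixes e :: "real^'n"
  assumes e: "norm e = 1" and k: "\<bar>k\<bar> < 1"
  shows "\<exists>\<mu> r. 0 < \<mu> \<and> 0 < r \<and> (\<forall>\<xi>. norm \<xi> = 1 \<longrightarrow>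
    (\<forall>b\<in>ball ((1/2) *\<^sub>R (- \<xi> + (1/4) *\<^sub>R e)) r. norm b \<le> 1 \<and>
      (\<forall>x\<in>open_cone e k. \<forall>\<rho> s. dist (x /\<^sub>R norm x) \<xi> < \<mu> \<longrightarrow> 0 < \<rho> \<longrightarrow> \<rho> \<le> norm x \<longrightarrow> s \<in> {0..1} \<longrightarrow>
        x + s *\<^sub>R (\<rho> *\<^sub>R b) \<in> open_cone e k \<and> norm x / 4 \<le> norm (x + s *\<^sub>R (\<rho> *\<^sub>R b)) \<and>
        norm (x + s *\<^sub>R (\<rho> *\<^sub>R b)) \<le> norm x)))"
proof -
  define \<delta> where "\<delta> = (1 - \<bar>k\<bar>) / 2"
  have \<delta>: "0 < \<delta>" "\<delta> \<le> 1" using k by (auto simp: \<delta>_def)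
  \<comment> \<open>Two errors below \<open>\<mu>\<close> enter the vector \<open>z\<close> below
    with a factor 4, hence the divisor 8. The ball has radius \<open>\<mu> / 2\<close> because its
    centre carries the factor 1/2.\<close>
  define \<mu> where "\<mu> = \<delta> / 8"
  have \<mu>: "0 < \<mu>" "\<mu> \<le> 1/8" using \<delta> by (auto simp: \<mu>_def)
  show ?thesis
  proof (rule exI[of _ \<mu>], rule exI[of _ "\<mu> / 2"], intro conjI allI impI ballI)
    show "0 < \<mu>" "0 < \<mu> / 2" using \<mu> by auto
    fix \<xi> b :: "real^'n" assume \<xi>: "norm \<xi> = 1" and b: "b \<in> ball ((1/2) *\<^sub>R (- \<xi> + (1/4) *\<^sub>R e)) (\<mu> / 2)"
    define w where "w = 2 *\<^sub>R b - (- \<xi> + (1/4) *\<^sub>R e)"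
    have bw: "b = (1/2) *\<^sub>R (- \<xi> + (1/4) *\<^sub>R e + w)" by (simp add: w_def)
    have "dist ((1/2) *\<^sub>R (- \<xi> + (1/4) *\<^sub>R e)) b = norm w / 2"
      unfolding bw dist_norm by (simp add: algebra_simps norm_minus_commute flip: scaleR_minus_right)
    then have w: "norm w < \<mu>" using b by simp
    have "norm (- \<xi> + (1/4) *\<^sub>R e + w) \<le> norm \<xi> + norm ((1/4) *\<^sub>R e) + norm w"
      using norm_triangle_ineq[of "- \<xi> + (1/4) *\<^sub>R e" w] norm_triangle_ineq[of "- \<xi>" "(1/4) *\<^sub>R e"] by simp
    then show "norm b \<le> 1" unfolding bw using \<xi> e w \<mu> by simp
    fix x \<rho> and s :: real
    assume x: "x \<in> open_cone e k" and dx: "dist (x /\<^sub>R norm x) \<xi> < \<mu>" and \<rho>: "0 < \<rho>" "\<rho> \<le> norm x" and s: "s \<in> {0..1}"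
    have nx: "0 < norm x" using \<rho> by linarith
    define t where "t = s * \<rho> / (2 * norm x)"
    have t: "0 \<le> t" "t \<le> 1/2"
    proof -
      show "0 \<le> t" using s \<rho> nx by (simp add: t_def)
      have "s * \<rho> \<le> 1 * norm x" using s \<rho> by (intro mult_mono) auto
      then show "t \<le> 1/2" using nx by (simp add: t_def field_simps)
    qed
    \<comment> \<open>The deviations of \<open>x\<close> from direction \<open>\<xi>\<close> and of
      \<open>b\<close> from the centre are absorbed into a perturbation \<open>z\<close> of the
      axis. The new point is then \<open>(1 - t) *\<^sub>R x\<close> plus a nonnegative multiple of
      \<open>z\<close>: a contraction followed by a \<open>cone_step\<close>.\<close>
    define z where "z = e + 4 *\<^sub>R ((x /\<^sub>R norm x - \<xi>) + w)"
    have ze: "norm (z - e) \<le> \<delta>"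
    proof -
      have "norm (z - e) = 4 * norm ((x /\<^sub>R norm x - \<xi>) + w)" by (simp add: z_def)
      also have "\<dots> \<le> 4 * (norm (x /\<^sub>R norm x - \<xi>) + norm w)" by (simp only: mult_le_cancel_left_pos zero_less_numeral norm_triangle_ineq)
      also have "\<dots> \<le> 4 * (\<mu> + \<mu>)" using dx w by (simp add: dist_norm)
      also have "\<dots> = \<delta>" by (simp add: \<mu>_def)
      finally show ?thesis .
    qed
    have nz: "norm z \<le> 2" using norm_triangle_ineq[of e "z - e"] e ze \<delta> by simp
    have eq: "x + s *\<^sub>R (\<rho> *\<^sub>R b) = (1 - t) *\<^sub>R x + (t * norm x / 4) *\<^sub>R z"
    proof -
      have "s * \<rho> = t * (2 * norm x)" using nx by (simp add: t_def)
      then have "x + s *\<^sub>R (\<rho> *\<^sub>R b) = x + (t * norm x) *\<^sub>R (2 *\<^sub>R b)" by (simp add: mult_ac)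
      also have "2 *\<^sub>R b = - (x /\<^sub>R norm x) + (1/4) *\<^sub>R z" unfolding bw z_def by (simp add: algebra_simps)
      also have "x + (t * norm x) *\<^sub>R (- (x /\<^sub>R norm x) + (1/4) *\<^sub>R z) = x - (t * norm x) *\<^sub>R (x /\<^sub>R norm x) + (t * norm x / 4) *\<^sub>R z"
        by (simp add: scaleR_add_right scaleR_diff_right)
      also have "(t * norm x) *\<^sub>R (x /\<^sub>R norm x) = t *\<^sub>R x" using nx by simp
      finally show ?thesis by (simp add: algebra_simps)
    qed
    have n1: "norm ((1 - t) *\<^sub>R x) = (1 - t) * norm x" using t by simp
    have n2: "norm ((t * norm x / 4) *\<^sub>R z) \<le> (t / 2) * norm x"
    proof -
      have "norm ((t * norm x / 4) *\<^sub>R z) = (t * norm x / 4) * norm z" using t nx by simp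
      also have "\<dots> \<le> (t * norm x / 4) * 2" using nz t nx by (intro mult_left_mono) auto
      finally show ?thesis by simp
    qed
    have th: "(t / 2) * norm x \<le> t * norm x" using t nx by simp
    have up: "norm (x + s *\<^sub>R (\<rho> *\<^sub>R b)) \<le> norm x"
      unfolding eq using norm_triangle_ineq[of "(1 - t) *\<^sub>R x" "(t * norm x / 4) *\<^sub>R z"] n1 n2 th by (simp add: algebra_simps)
    have "norm ((1 - t) *\<^sub>R x) - norm ((t * norm x / 4) *\<^sub>R z) \<le> norm ((1 - t) *\<^sub>R x + (t * norm x / 4) *\<^sub>R z)"
      using norm_triangle_ineq4[of "(1 - t) *\<^sub>R x + (t * norm x / 4) *\<^sub>R z" "(t * norm x / 4) *\<^sub>R z"] by simp
    then have "(1 - t) * norm x - (t / 2) * norm x \<le> norm (x + s *\<^sub>R (\<rho> *\<^sub>R b))" unfolding eq using n1 n2 by linarith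
    moreover have "(1/4) * norm x \<le> (1 - t - t / 2) * norm x" using t nx by (intro mult_right_mono) auto
    ultimately show "norm x / 4 \<le> norm (x + s *\<^sub>R (\<rho> *\<^sub>R b))" by (simp add: algebra_simps)
    show "norm (x + s *\<^sub>R (\<rho> *\<^sub>R b)) \<le> norm x" by (rule up)
    have "(1 - t) * (k * norm x) < (1 - t) * (x \<bullet> e)" using x t by (intro mult_strict_left_mono) (auto simp: open_cone_def)
    then have "k * norm ((1 - t) *\<^sub>R x) < ((1 - t) *\<^sub>R x) \<bullet> e" unfolding n1 by (simp add: mult_ac)
    from cone_step[OF e k ze[unfolded \<delta>_def] this, of "t * norm x / 4"]
    have "k * norm (x + s *\<^sub>R (\<rho> *\<^sub>R b)) < (x + s *\<^sub>R (\<rho> *\<^sub>R b)) \<bullet> e" unfolding eq using t nx by simp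
    moreover have "norm (x + s *\<^sub>R (\<rho> *\<^sub>R b)) < 1" using up x by (simp add: open_cone_def)
    ultimately show "x + s *\<^sub>R (\<rho> *\<^sub>R b) \<in> open_cone e k" by (simp add: open_cone_def)
  qed
qed

subsection \<open>Summation over dyadic shells\<close>

definition weight_density :: "real \<Rightarrow> real \<Rightarrow> (('n::finite \<Rightarrow> nat) \<Rightarrow> real^'n \<Rightarrow> real) \<Rightarrow> ('n \<Rightarrow> nat) \<Rightarrow> real^'n \<Rightarrow> ennreal" where
  "weight_density a p U \<alpha> x = ennreal (\<bar>norm x powr (real (mi_order \<alpha>) - a) * U \<alpha> x\<bar> powr p)"

definition weight_energy :: "nat \<Rightarrow> real \<Rightarrow> real \<Rightarrow> (real^'n) set \<Rightarrow> (('n::finite \<Rightarrow> nat) \<Rightarrow> real^'n \<Rightarrow> real) \<Rightarrow> ennreal" where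
  "weight_energy m a p K U = (\<Sum>\<alpha> | mi_order \<alpha> \<le> m. \<integral>\<^sup>+x. indicator K x * weight_density a p U \<alpha> x \<partial>lborel)"

text \<open>Quantities of comparable size have comparable powers, with a constant independent of the
  scale; \<open>\<bar>t\<bar>\<close> covers both signs of the exponent.\<close>

lemma powr_compare:
  fixes x \<rho> q t :: real
  assumes "0 < \<rho>" "\<rho> \<le> q * x" "x \<le> q * \<rho>" "1 \<le> q"
  shows "x powr t \<le> q powr \<bar>t\<bar> * \<rho> powr t" "\<rho> powr t \<le> q powr \<bar>t\<bar> * x powr t"
proof -
  have x: "0 < x" using assms by (metis less_le_trans zero_less_mult_pos zero_less_one)
  have *: "u powr t \<le> q powr \<bar>t\<bar> * v powr t" if "0 < u" "0 < v" "u \<le> q * v" "v \<le> q * u" for u v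
  proof (cases "0 \<le> t")
    case True
    have "u powr t \<le> (q * v) powr t" using that True by (intro powr_mono2) auto
    then show ?thesis using True by (simp add: powr_mult)
  next
    case False
    have "(q * u) powr t \<le> v powr t" using that False assms by (intro powr_mono2') auto
    then have "q powr t * u powr t \<le> v powr t" by (simp add: powr_mult)
    then have "q powr (- t) * (q powr t * u powr t) \<le> q powr (- t) * v powr t" by (rule mult_left_mono) simp
    moreover have "q powr (- t) * q powr t = 1" using assms by (simp add: powr_add[symmetric])
    ultimately show ?thesis using False by (simp add: mult.assoc[symmetric])
  qed
  show "x powr t \<le> q powr \<bar>t\<bar> * \<rho> powr t" using * assms x by blast
  show "\<rho> powr t \<le> q powr \<bar>t\<bar> * x powr t" using * assms x by blast
qed

lemma sum_powr_le:
  fixes y :: "'a \<Rightarrow> real"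
  assumes fin: "finite S" and y: "\<And>i. i \<in> S \<Longrightarrow> 0 \<le> y i" and p: "0 \<le> p"
  shows "(\<Sum>i\<in>S. y i) powr p \<le> real (card S) powr p * (\<Sum>i\<in>S. y i powr p)"
proof (cases "S = {}")
  case False
  define M where "M = Max (y ` S)"
  have "M \<in> y ` S" unfolding M_def using fin False by (intro Max_in) auto
  then obtain j where j: "j \<in> S" "M = y j" by auto
  have "y i \<le> M" if "i \<in> S" for i unfolding M_def using fin that by simp
  then have "(\<Sum>i\<in>S. y i) \<le> real (card S) * M" by (intro sum_bounded_above[where 'a=real, simplified]) auto
  then have "(\<Sum>i\<in>S. y i) powr p \<le> (real (card S) * M) powr p" using p y by (intro powr_mono2 sum_nonneg) auto
  also have "\<dots> = real (card S) powr p * M powr p" by (simp add: powr_mult)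
  also have "\<dots> \<le> real (card S) powr p * (\<Sum>i\<in>S. y i powr p)"
    unfolding j(2) using j(1) fin by (intro mult_left_mono member_le_sum) auto
  finally show ?thesis .
qed simp

text \<open>Depth \<open>j = 1\<close> tiles the punctured unit ball. Depth 3 leaves room for the
  segments that start in the shell of depth 1, since along them the norm drops by a factor of at
  most 4.\<close>

definition shell :: "nat \<Rightarrow> nat \<Rightarrow> (real^'n) set" where
  "shell n j = {x. (1/2) ^ (n + j) \<le> norm x \<and> norm x < (1/2) ^ n}"

lemma shell_borel [measurable]: "shell n j \<in> sets borel"
  unfolding shell_def by measurable

lemma shell_exists:
  assumes "0 < norm x" "norm x < 1"
  shows "\<exists>n. x \<in> shell n 1"
proof -
  obtain N where N: "(1/2 :: real) ^ N < norm x" using real_arch_pow_inv[OF assms(1), of "1/2"] by auto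
  define n where "n = (LEAST n. (1/2 :: real) ^ n \<le> norm x)"
  have n: "(1/2 :: real) ^ n \<le> norm x" unfolding n_def by (rule LeastI[of _ N]) (use N in simp)
  then obtain l where l: "n = Suc l" using assms(2) by (cases n) auto
  then have "\<not> (1/2 :: real) ^ l \<le> norm x" using not_less_Least[of l "\<lambda>n. (1/2 :: real) ^ n \<le> norm x"] n_def by simp
  then show ?thesis using n l by (intro exI[of _ l]) (auto simp: shell_def)
qed

lemma shell_overlap: "(\<Sum>n. indicator (shell n 3) x :: ennreal) \<le> 3"
proof (cases "0 < norm x \<and> norm x < 1")
  case True
  then obtain l where l: "x \<in> shell l 1" using shell_exists by blast
  have *: "n \<in> {l - 2..l}" if "x \<in> shell n 3" for n
  proof -
    have "(1/2 :: real) ^ (n + 3) < (1/2) ^ l" "(1/2 :: real) ^ (l + 1) < (1/2) ^ n"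
      using that l unfolding shell_def mem_Collect_eq by linarith+
    moreover have "(1/2 :: real) ^ v \<le> (1/2) ^ u" if "u \<le> v" for u v
      using that by (intro power_decreasing) auto
    ultimately have "l < n + 3" "n < l + 1" by (meson not_less)+
    then show ?thesis by auto
  qed
  have "(\<Sum>n. indicator (shell n 3) x :: ennreal) = (\<Sum>n\<in>{l - 2..l}. indicator (shell n 3) x)"
    by (rule suminf_finite) (use * in \<open>auto simp: indicator_def\<close>)
  also have "\<dots> \<le> of_nat (card {l - 2..l}) * 1" by (rule sum_bounded_above) (simp add: indicator_def)
  also have "\<dots> \<le> of_nat 3 * 1" by (intro mult_right_mono of_nat_mono) auto
  finally show ?thesis by simp
next
  case False
  have "x \<notin> shell n 3" for n
  proof
    assume "x \<in> shell n 3"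
    then have "0 < norm x" "norm x < 1"
      unfolding shell_def using less_le_trans[of 0 "(1/2::real) ^ (n + 3)" "norm x"] less_le_trans[of "norm x" "(1/2::real) ^ n" 1] power_le_one[of "1/2 :: real" n] by auto
    then show False using False by simp
  qed
  then have "(\<lambda>n. indicator (shell n 3) x :: ennreal) = (\<lambda>n. 0)" by (auto simp: indicator_def)
  then show ?thesis by (simp only: suminf_zero zero_le)
qed

text \<open>The powers of \<open>\<rho>\<close> on one shell: the weight against the jets leaves
  \<open>\<rho> powr (- (a * p))\<close>, the local estimate costs d powers of
  \<open>\<rho>\<close>, and each of the two energies pays \<open>\<rho> powr (a * p)\<close>. The
  result has exponent \<open>a * p - d \<ge> 0\<close>, hence is at most 1 as
  \<open>\<rho> \<le> 1\<close>.\<close>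

lemma weighted_product:
  fixes e :: "real^'n"
  assumes e: "norm e = 1" and k: "\<bar>k\<bar> < 1" and p: "1 \<le> p" and a: "real CARD('n) / p \<le> a"
    and m: "1 < p \<and> real CARD('n) / p < real m \<or> p = 1 \<and> CARD('n) \<le> m" and ii: "i + i' \<le> m"
  shows "\<exists>C\<ge>0. \<forall>U V \<alpha> \<beta>. weak_family (open_cone e k) m U \<longrightarrow> weak_family (open_cone e k) m V \<longrightarrow> mi_order \<alpha> = i \<longrightarrow> mi_order \<beta> = i' \<longrightarrow>
    (\<integral>\<^sup>+x. indicator (open_cone e k) x * ennreal (\<bar>norm x powr (real (i + i') - a) * (U \<alpha> x * V \<beta> x)\<bar> powr p) \<partial>lborel)
     \<le> ennreal C * (weight_energy m a p (open_cone e k) U * weight_energy m a p (open_cone e k) V)"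
proof -
  let ?K = "open_cone e k"
  have K: "open ?K" by (rule open_open_cone)
  then have [measurable]: "?K \<in> sets borel" by (rule borel_open)
  from cone_segments[OF e k] obtain \<mu> r where \<mu>: "0 < \<mu>" "0 < r" and seg0: "\<forall>\<xi>. norm \<xi> = 1 \<longrightarrow>
    (\<forall>b\<in>ball ((1/2) *\<^sub>R (- \<xi> + (1/4) *\<^sub>R e)) r. norm b \<le> 1 \<and>
      (\<forall>x\<in>?K. \<forall>\<rho> s. dist (x /\<^sub>R norm x) \<xi> < \<mu> \<longrightarrow> 0 < \<rho> \<longrightarrow> \<rho> \<le> norm x \<longrightarrow> s \<in> {0..1} \<longrightarrow>
        x + s *\<^sub>R (\<rho> *\<^sub>R b) \<in> ?K \<and> norm x / 4 \<le> norm (x + s *\<^sub>R (\<rho> *\<^sub>R b)) \<and>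
        norm (x + s *\<^sub>R (\<rho> *\<^sub>R b)) \<le> norm x))"
    by (elim exE conjE)
  note seg = seg0[THEN spec, THEN mp, THEN bspec]
  \<comment> \<open>The admissible directions depend on \<open>\<xi>\<close>, and so do the
    constants of \<open>local_product\<close>; finitely many \<open>\<xi>\<close> suffice for all
    points.\<close>
  obtain X where X: "finite X" "X \<subseteq> sphere 0 1" "sphere (0::real^'n) 1 \<subseteq> (\<Union>\<xi>\<in>X. ball \<xi> \<mu>)"
  proof (rule compactE_image[OF compact_sphere, of "sphere 0 1" "\<lambda>\<xi>. ball \<xi> \<mu>"])
    show "sphere (0::real^'n) 1 \<subseteq> (\<Union>\<xi>\<in>sphere 0 1. ball \<xi> \<mu>)" using \<mu> by force
  qed (auto intro: that)
  let ?c = "\<lambda>\<xi>. (1/2) *\<^sub>R (- \<xi> + (1/4) *\<^sub>R e)"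
  let ?Q = "\<lambda>\<xi> A. \<forall>K \<rho> P P' E G. open K \<longrightarrow> 0 < \<rho> \<longrightarrow> chain K m \<rho> P \<longrightarrow> chain K m \<rho> P' \<longrightarrow> E \<in> sets borel \<longrightarrow> G \<in> sets borel \<longrightarrow> G \<subseteq> K \<longrightarrow>
    cone_at E G (?c \<xi>) r \<rho> \<longrightarrow> (\<integral>\<^sup>+x. indicator E x * (ennreal (P i x powr p) * ennreal (P' i' x powr p)) \<partial>lborel) \<le>
      ennreal (A / \<rho> ^ CARD('n)) * ((\<integral>\<^sup>+x. power_density p G (P m) x \<partial>lborel) * (\<integral>\<^sup>+x. power_density p G (P' m) x \<partial>lborel))"
  have "\<forall>\<xi>\<in>X. \<exists>A. 0 \<le> A \<and> ?Q \<xi> A"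
  proof
    fix \<xi> assume \<xi>: "\<xi> \<in> X"
    show "\<exists>A. 0 \<le> A \<and> ?Q \<xi> A"
    proof (rule local_product[OF p \<mu>(2) _ m ii])
      fix b assume b: "b \<in> ball (?c \<xi>) r"
      have "norm \<xi> = 1" using \<xi> X(2) by auto
      from seg[OF this b] show "norm b \<le> 1" by (rule conjunct1)
    qed
  qed
  from bchoice[OF this] obtain A where A': "\<forall>\<xi>\<in>X. 0 \<le> A \<xi> \<and> ?Q \<xi> (A \<xi>)" ..
  have A0: "0 \<le> A \<xi>" if "\<xi> \<in> X" for \<xi> using bspec[OF A' that] by (rule conjunct1)
  note A = bspec[OF A', THEN conjunct2, rule_format]
  define AA where "AA = (\<Sum>\<xi>\<in>X. A \<xi>)"
  have AA: "0 \<le> AA" unfolding AA_def using A0 by (intro sum_nonneg) auto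
  let ?S = "{\<alpha> :: 'n \<Rightarrow> nat. mi_order \<alpha> \<le> m}"
  \<comment> \<open>The first factor comes from \<open>sum_powr_le\<close>, the second from
    comparing \<open>norm x\<close> with \<open>\<rho> n\<close> up to a factor 4 on a shell of
    depth 3.\<close>
  define N where "N = real (card ?S) powr p * (4 powr (real m + \<bar>a\<bar>)) powr p"
  have N: "0 \<le> N" by (simp add: N_def)
  define B where "B = (2 powr \<bar>real (i + i') - a\<bar>) powr p"
  have B: "0 \<le> B" by (simp add: B_def)
  define C where "C = 3 * (B * AA * N * N)"
  have C1: "0 \<le> B * AA * N * N" using B AA N by simp
  show ?thesis
  proof (intro exI[of _ C] conjI allI impI)
    show "0 \<le> C" unfolding C_def using C1 by simp
    fix U V :: "('n \<Rightarrow> nat) \<Rightarrow> real^'n \<Rightarrow> real" and \<alpha> \<beta> :: "'n \<Rightarrow> nat"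
    assume U: "weak_family ?K m U" and V: "weak_family ?K m V" and \<alpha>: "mi_order \<alpha> = i" and \<beta>: "mi_order \<beta> = i'"
    note [measurable] = weak_familyD(1)[OF U] weak_familyD(1)[OF V]
    have [measurable]: "weight_density a p W \<gamma> \<in> borel_measurable borel" if "weak_family ?K m W" for W \<gamma>
    proof -
      note [measurable] = weak_familyD(1)[OF that]
      show ?thesis unfolding weight_density_def[abs_def] by measurable
    qed
    note [measurable] = this[OF U] this[OF V]
    define \<rho> where "\<rho> n = (1/2 :: real) ^ (n + 1)" for n :: nat
    have \<rho>1: "\<rho> n \<le> 1" for n unfolding \<rho>_def by (rule power_le_one) auto
    have \<rho>: "0 < \<rho> n" "\<rho> n \<le> 1" for n using \<rho>1[of n] by (simp_all add: \<rho>_def)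
    define E where "E n \<xi> = {x \<in> space borel. x \<in> ?K \<and> x \<in> shell n 1 \<and> dist (x /\<^sub>R norm x) \<xi> < \<mu>}" for n and \<xi> :: "real^'n"
    have [measurable]: "E n \<xi> \<in> sets borel" for n \<xi> unfolding E_def by measurable
    define G where "G n = ?K \<inter> shell n 3" for n
    have [measurable]: "G n \<in> sets borel" for n unfolding G_def by measurable
    let ?f = "\<lambda>x. ennreal (\<bar>norm x powr (real (i + i') - a) * (U \<alpha> x * V \<beta> x)\<bar> powr p)"
    define en where "en W n = (\<Sum>\<gamma>\<in>?S. \<integral>\<^sup>+x. indicator (G n) x * weight_density a p W \<gamma> x \<partial>lborel)" for W and n :: nat
    have shell_bounds: "\<rho> n \<le> norm x" "norm x \<le> 2 * \<rho> n" if "x \<in> shell n 1" for n x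
      using that by (auto simp: shell_def \<rho>_def)
    have cone: "cone_at (E n \<xi>) (G n) (?c \<xi>) r (\<rho> n)" if \<xi>: "\<xi> \<in> X" for n \<xi>
      unfolding cone_at_def
    proof (intro ballI)
      fix x b assume x: "x \<in> E n \<xi>" and b: "b \<in> ball (?c \<xi>) r"
      have xs: "x \<in> ?K" "x \<in> shell n 1" "dist (x /\<^sub>R norm x) \<xi> < \<mu>" using x by (auto simp: E_def)
      show "x \<in> seg_dom (G n) (\<rho> n *\<^sub>R b)"
        unfolding seg_dom_def
      proof (intro CollectI ballI)
        fix s :: real assume s: "s \<in> {0..1}"
        have "norm \<xi> = 1" using \<xi> X(2) by auto
        note seg[OF this b, THEN conjunct2, THEN bspec, OF xs(1), THEN spec, THEN spec, THEN mp, THEN mp, THEN mp, THEN mp,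
            OF xs(3) \<rho>(1)[of n] shell_bounds(1)[OF xs(2)] s]
        then have y: "x + s *\<^sub>R (\<rho> n *\<^sub>R b) \<in> ?K" "norm x / 4 \<le> norm (x + s *\<^sub>R (\<rho> n *\<^sub>R b))" "norm (x + s *\<^sub>R (\<rho> n *\<^sub>R b)) \<le> norm x"
          by simp_all
        \<comment> \<open>This is where depth 3 comes from: one dyadic step for the shell itself and
          two for the factor 4.\<close>
        have "(1/2 :: real) ^ (n + 3) = (1/2) ^ (n + 1) / 4" by (simp add: power_add power3_eq_cube)
        also have "\<dots> \<le> norm x / 4" using xs(2) by (simp add: shell_def)
        finally have "(1/2 :: real) ^ (n + 3) \<le> norm (x + s *\<^sub>R (\<rho> n *\<^sub>R b))" using y(2) by linarith
        moreover have "norm (x + s *\<^sub>R (\<rho> n *\<^sub>R b)) < (1/2) ^ n" using y(3) xs(2) by (simp add: shell_def)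
        ultimately show "x + s *\<^sub>R (\<rho> n *\<^sub>R b) \<in> G n" using y(1) by (simp add: G_def shell_def)
      qed
    qed
    have dens: "(\<integral>\<^sup>+x. power_density p (G n) (jet (\<rho> n) W m) x \<partial>lborel) \<le> ennreal (N * \<rho> n powr (a * p)) * en W n"
      if W: "weak_family ?K m W" for W n
    proof -
      note [measurable] = weak_familyD(1)[OF W] \<open>\<And>W \<gamma>. weak_family ?K m W \<Longrightarrow> weight_density a p W \<gamma> \<in> borel_measurable borel\<close>[OF W]
      have "(\<integral>\<^sup>+x. power_density p (G n) (jet (\<rho> n) W m) x \<partial>lborel) \<le>
        (\<integral>\<^sup>+x. ennreal (N * \<rho> n powr (a * p)) * (\<Sum>\<gamma>\<in>?S. indicator (G n) x * weight_density a p W \<gamma> x) \<partial>lborel)"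
      proof (rule nn_integral_mono)
        fix x
        show "power_density p (G n) (jet (\<rho> n) W m) x \<le> ennreal (N * \<rho> n powr (a * p)) * (\<Sum>\<gamma>\<in>?S. indicator (G n) x * weight_density a p W \<gamma> x)"
        proof (cases "x \<in> G n")
          case True
          then have sx: "(1/2) ^ (n + 3) \<le> norm x" "norm x < (1/2 :: real) ^ n" by (auto simp: G_def shell_def)
          have b1: "\<rho> n \<le> 4 * norm x" using sx(1) by (simp add: \<rho>_def power_add power3_eq_cube)
          have "norm x < 2 * \<rho> n" using sx(2) by (simp add: \<rho>_def)
          then have b2: "norm x \<le> 4 * \<rho> n" using \<rho>(1)[of n] by linarith
          have trm: "(\<rho> n ^ mi_order \<gamma> * \<bar>W \<gamma> x\<bar>) powr p \<le> (4 powr (real m + \<bar>a\<bar>)) powr p * (\<rho> n powr (a * p) * \<bar>norm x powr (real (mi_order \<gamma>) - a) * W \<gamma> x\<bar> powr p)"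
            if \<gamma>: "\<gamma> \<in> ?S" for \<gamma>
          proof -
            have "\<rho> n ^ mi_order \<gamma> = \<rho> n powr a * \<rho> n powr (real (mi_order \<gamma>) - a)"
              using \<rho>(1)[of n] by (simp add: powr_add[symmetric] powr_realpow)
            also have "\<dots> \<le> \<rho> n powr a * (4 powr \<bar>real (mi_order \<gamma>) - a\<bar> * norm x powr (real (mi_order \<gamma>) - a))"
              by (intro mult_left_mono powr_compare(2)) (use \<rho>(1) b1 b2 in auto)
            also have "\<dots> \<le> \<rho> n powr a * (4 powr (real m + \<bar>a\<bar>) * norm x powr (real (mi_order \<gamma>) - a))"
              using \<gamma> by (intro mult_left_mono mult_right_mono powr_mono) auto
            finally have "\<rho> n ^ mi_order \<gamma> * \<bar>W \<gamma> x\<bar> \<le> \<rho> n powr a * (4 powr (real m + \<bar>a\<bar>) * norm x powr (real (mi_order \<gamma>) - a)) * \<bar>W \<gamma> x\<bar>"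
              by (rule mult_right_mono) simp
            also have "\<dots> = 4 powr (real m + \<bar>a\<bar>) * (\<rho> n powr a * \<bar>norm x powr (real (mi_order \<gamma>) - a) * W \<gamma> x\<bar>)"
              by (simp add: abs_mult mult_ac)
            finally have "(\<rho> n ^ mi_order \<gamma> * \<bar>W \<gamma> x\<bar>) powr p \<le> (4 powr (real m + \<bar>a\<bar>) * (\<rho> n powr a * \<bar>norm x powr (real (mi_order \<gamma>) - a) * W \<gamma> x\<bar>)) powr p"
              using \<rho>(1)[of n] p by (intro powr_mono2) auto
            also have "\<dots> = (4 powr (real m + \<bar>a\<bar>)) powr p * (\<rho> n powr (a * p) * \<bar>norm x powr (real (mi_order \<gamma>) - a) * W \<gamma> x\<bar> powr p)"
              by (simp only: powr_mult powr_powr)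
            finally show ?thesis .
          qed
          have "jet (\<rho> n) W m x powr p \<le> real (card ?S) powr p * (\<Sum>\<gamma>\<in>?S. (\<rho> n ^ mi_order \<gamma> * \<bar>W \<gamma> x\<bar>) powr p)"
            unfolding jet_def by (rule sum_powr_le[OF finite_mi_order_le]) (use \<rho>(1)[of n] p in auto)
          also have "\<dots> \<le> real (card ?S) powr p * (\<Sum>\<gamma>\<in>?S. (4 powr (real m + \<bar>a\<bar>)) powr p * (\<rho> n powr (a * p) * \<bar>norm x powr (real (mi_order \<gamma>) - a) * W \<gamma> x\<bar> powr p))"
            by (intro mult_left_mono sum_mono trm) auto
          also have "\<dots> = (N * \<rho> n powr (a * p)) * (\<Sum>\<gamma>\<in>?S. \<bar>norm x powr (real (mi_order \<gamma>) - a) * W \<gamma> x\<bar> powr p)"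
            by (simp add: N_def sum_distrib_left mult_ac)
          finally have "ennreal (jet (\<rho> n) W m x powr p) \<le> ennreal ((N * \<rho> n powr (a * p)) * (\<Sum>\<gamma>\<in>?S. \<bar>norm x powr (real (mi_order \<gamma>) - a) * W \<gamma> x\<bar> powr p))"
            by (rule ennreal_leI)
          also have "\<dots> = ennreal (N * \<rho> n powr (a * p)) * (\<Sum>\<gamma>\<in>?S. weight_density a p W \<gamma> x)"
            unfolding weight_density_def using N by (subst ennreal_mult) (auto intro: sum_nonneg simp: sum_ennreal)
          finally show ?thesis using True by (simp add: power_density_def)
        qed (simp add: power_density_def)
      qed
      also have "\<dots> = ennreal (N * \<rho> n powr (a * p)) * en W n"
        unfolding en_def by (subst nn_integral_cmult) (simp_all add: nn_integral_sum)
      finally show ?thesis .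
    qed
    have piece: "(\<integral>\<^sup>+x. indicator (E n \<xi>) x * ?f x \<partial>lborel) \<le> ennreal (B * A \<xi> * N * N) * (en U n * en V n)" if \<xi>: "\<xi> \<in> X" for n \<xi>
    proof -
      let ?P = "jet (\<rho> n) U" and ?P' = "jet (\<rho> n) V"
      have [measurable]: "?P i \<in> borel_measurable borel" "?P' i' \<in> borel_measurable borel" unfolding jet_def[abs_def] by measurable
      have "(\<integral>\<^sup>+x. indicator (E n \<xi>) x * ?f x \<partial>lborel) \<le> (\<integral>\<^sup>+x. ennreal (B * \<rho> n powr (- (a * p))) * (indicator (E n \<xi>) x * (ennreal (?P i x powr p) * ennreal (?P' i' x powr p))) \<partial>lborel)"
      proof (rule nn_integral_mono)
        fix x
        show "indicator (E n \<xi>) x * ?f x \<le> ennreal (B * \<rho> n powr (- (a * p))) * (indicator (E n \<xi>) x * (ennreal (?P i x powr p) * ennreal (?P' i' x powr p)))"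
        proof (cases "x \<in> E n \<xi>")
          case True
          then have sb: "\<rho> n \<le> norm x" "norm x \<le> 2 * \<rho> n" using shell_bounds by (auto simp: E_def)
          let ?t = "real (i + i') - a"
          have ja: "\<rho> n ^ i * \<bar>U \<alpha> x\<bar> \<le> ?P i x" using jet_member[of "\<rho> n" \<alpha> U x] \<rho>(1)[of n] \<alpha> by simp
          have jb: "\<rho> n ^ i' * \<bar>V \<beta> x\<bar> \<le> ?P' i' x" using jet_member[of "\<rho> n" \<beta> V x] \<rho>(1)[of n] \<beta> by simp
          have "norm x powr ?t \<le> 2 powr \<bar>?t\<bar> * \<rho> n powr ?t"
            by (rule powr_compare(1)) (use \<rho>(1)[of n] sb in auto)
          also have "\<rho> n powr ?t = \<rho> n powr (- a) * (\<rho> n ^ i * \<rho> n ^ i')"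
            using \<rho>(1)[of n] by (simp add: powr_diff powr_minus powr_realpow[symmetric] powr_add divide_inverse mult_ac)
          finally have "norm x powr ?t * (\<bar>U \<alpha> x\<bar> * \<bar>V \<beta> x\<bar>) \<le> (2 powr \<bar>?t\<bar> * (\<rho> n powr (- a) * (\<rho> n ^ i * \<rho> n ^ i'))) * (\<bar>U \<alpha> x\<bar> * \<bar>V \<beta> x\<bar>)"
            by (rule mult_right_mono) simp
          also have "\<dots> = (2 powr \<bar>?t\<bar> * \<rho> n powr (- a)) * ((\<rho> n ^ i * \<bar>U \<alpha> x\<bar>) * (\<rho> n ^ i' * \<bar>V \<beta> x\<bar>))" by (simp add: mult_ac)
          also have "\<dots> \<le> (2 powr \<bar>?t\<bar> * \<rho> n powr (- a)) * (?P i x * ?P' i' x)"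
            using \<rho>(1)[of n] ja jb by (intro mult_left_mono mult_mono) (auto intro: jet_nonneg)
          finally have "\<bar>norm x powr ?t * (U \<alpha> x * V \<beta> x)\<bar> \<le> (2 powr \<bar>?t\<bar> * \<rho> n powr (- a)) * (?P i x * ?P' i' x)"
            by (simp add: abs_mult)
          then have "\<bar>norm x powr ?t * (U \<alpha> x * V \<beta> x)\<bar> powr p \<le> ((2 powr \<bar>?t\<bar> * \<rho> n powr (- a)) * (?P i x * ?P' i' x)) powr p"
            using p by (intro powr_mono2) auto
          also have "\<dots> = (B * \<rho> n powr (- (a * p))) * (?P i x powr p * ?P' i' x powr p)"
            unfolding B_def powr_mult powr_powr by simp
          finally have "?f x \<le> ennreal ((B * \<rho> n powr (- (a * p))) * (?P i x powr p * ?P' i' x powr p))" by (rule ennreal_leI)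
          also have "\<dots> = ennreal (B * \<rho> n powr (- (a * p))) * (ennreal (?P i x powr p) * ennreal (?P' i' x powr p))"
            using B by (simp add: ennreal_mult)
          finally show ?thesis using True by simp
        qed simp
      qed
      also have "\<dots> = ennreal (B * \<rho> n powr (- (a * p))) * (\<integral>\<^sup>+x. indicator (E n \<xi>) x * (ennreal (?P i x powr p) * ennreal (?P' i' x powr p)) \<partial>lborel)"
        by (rule nn_integral_cmult) measurable
      also have "\<dots> \<le> ennreal (B * \<rho> n powr (- (a * p))) * (ennreal (A \<xi> / \<rho> n ^ CARD('n)) * ((\<integral>\<^sup>+x. power_density p (G n) (?P m) x \<partial>lborel) * (\<integral>\<^sup>+x. power_density p (G n) (?P' m) x \<partial>lborel)))"
        by (intro mult_left_mono A[OF \<xi> K] jet_chain K U V cone \<xi> \<rho>) (auto simp: G_def)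
      also have "\<dots> \<le> ennreal (B * \<rho> n powr (- (a * p))) * (ennreal (A \<xi> / \<rho> n ^ CARD('n)) * ((ennreal (N * \<rho> n powr (a * p)) * en U n) * (ennreal (N * \<rho> n powr (a * p)) * en V n)))"
        by (intro mult_left_mono mult_mono dens U V) auto
      also have "\<dots> = (ennreal (B * \<rho> n powr (- (a * p))) * ennreal (A \<xi> / \<rho> n ^ CARD('n)) * ennreal (N * \<rho> n powr (a * p)) * ennreal (N * \<rho> n powr (a * p))) * (en U n * en V n)"
        by (simp only: mult_ac)
      also have "\<dots> \<le> ennreal (B * A \<xi> * N * N) * (en U n * en V n)"
      proof (rule mult_right_mono)
        \<comment> \<open>The only place where the lower bound for \<open>a\<close> enters.\<close>
        have "\<rho> n powr (a * p) \<le> \<rho> n powr real CARD('n)"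
          using \<rho>[of n] a p by (intro powr_mono') (auto simp: divide_le_eq)
        then have "\<rho> n powr (a * p) \<le> \<rho> n ^ CARD('n)" using \<rho>(1)[of n] by (simp add: powr_realpow)
        then have le1: "\<rho> n powr (a * p) / \<rho> n ^ CARD('n) \<le> 1" using \<rho>(1)[of n] by (simp add: divide_le_eq_1)
        have "(B * \<rho> n powr (- (a * p))) * (A \<xi> / \<rho> n ^ CARD('n)) * (N * \<rho> n powr (a * p)) * (N * \<rho> n powr (a * p))
          = (B * A \<xi> * N * N) * (\<rho> n powr (- (a * p)) * \<rho> n powr (a * p)) * (\<rho> n powr (a * p) / \<rho> n ^ CARD('n))" by (simp add: mult_ac)
        also have "\<rho> n powr (- (a * p)) * \<rho> n powr (a * p) = 1" using \<rho>(1)[of n] by (simp add: powr_add[symmetric])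
        also have "(B * A \<xi> * N * N) * 1 * (\<rho> n powr (a * p) / \<rho> n ^ CARD('n)) \<le> (B * A \<xi> * N * N) * 1 * 1"
          using B A0[OF \<xi>] N by (intro mult_left_mono le1) auto
        finally have fin: "(B * \<rho> n powr (- (a * p))) * (A \<xi> / \<rho> n ^ CARD('n)) * (N * \<rho> n powr (a * p)) * (N * \<rho> n powr (a * p)) \<le> B * A \<xi> * N * N" by simp
        have pos: "0 \<le> B * \<rho> n powr (- (a * p))" "0 \<le> A \<xi> / \<rho> n ^ CARD('n)" "0 \<le> N * \<rho> n powr (a * p)"
          using B N A0[OF \<xi>] \<rho>(1)[of n] by auto
        have "ennreal (B * \<rho> n powr (- (a * p))) * ennreal (A \<xi> / \<rho> n ^ CARD('n)) * ennreal (N * \<rho> n powr (a * p)) * ennreal (N * \<rho> n powr (a * p))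
          = ennreal ((B * \<rho> n powr (- (a * p))) * (A \<xi> / \<rho> n ^ CARD('n)) * (N * \<rho> n powr (a * p)) * (N * \<rho> n powr (a * p)))"
          using pos by (simp only: ennreal_mult mult_nonneg_nonneg)
        also have "\<dots> \<le> ennreal (B * A \<xi> * N * N)" using fin by (rule ennreal_leI)
        finally show "ennreal (B * \<rho> n powr (- (a * p))) * ennreal (A \<xi> / \<rho> n ^ CARD('n)) * ennreal (N * \<rho> n powr (a * p)) * ennreal (N * \<rho> n powr (a * p)) \<le> ennreal (B * A \<xi> * N * N)" .
      qed simp
      finally show ?thesis .
    qed
    \<comment> \<open>In the sum over the shells one energy is replaced by its total, while the
      other is summed; bounded overlap of the enlarged shells makes that sum at most three times the
      energy.\<close>
    have enle: "en V n \<le> weight_energy m a p ?K V" for n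
      unfolding en_def weight_energy_def by (intro sum_mono nn_integral_mono mult_right_mono) (auto simp: G_def indicator_def)
    have cover: "indicator ?K x * ?f x \<le> (\<Sum>n. \<Sum>\<xi>\<in>X. indicator (E n \<xi>) x * ?f x)" for x
    proof (cases "x \<in> ?K")
      case True
      then have nx: "0 < norm x" "norm x < 1" by (auto simp: open_cone_def)
      then obtain n where n: "x \<in> shell n 1" using shell_exists by blast
      have "x /\<^sub>R norm x \<in> sphere 0 1" using nx by simp
      from subsetD[OF X(3) this] obtain \<xi> where \<xi>: "\<xi> \<in> X" "dist (x /\<^sub>R norm x) \<xi> < \<mu>"
        by (auto simp only: UN_iff mem_ball dist_commute)
      have "indicator ?K x * ?f x = indicator (E n \<xi>) x * ?f x" using True n \<xi> by (simp add: E_def)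
      also have "\<dots> \<le> (\<Sum>\<xi>\<in>X. indicator (E n \<xi>) x * ?f x)"
        using \<xi>(1) X(1) by (intro member_le_sum) auto
      also have "\<dots> = (\<Sum>n\<in>{n}. \<Sum>\<xi>\<in>X. indicator (E n \<xi>) x * ?f x)" by simp
      also have "\<dots> \<le> (\<Sum>n. \<Sum>\<xi>\<in>X. indicator (E n \<xi>) x * ?f x)" by (intro sum_le_suminf) auto
      finally show ?thesis .
    qed simp
    have "(\<integral>\<^sup>+x. indicator ?K x * ?f x \<partial>lborel) \<le> (\<integral>\<^sup>+x. (\<Sum>n. \<Sum>\<xi>\<in>X. indicator (E n \<xi>) x * ?f x) \<partial>lborel)"
      by (rule nn_integral_mono) (rule cover)
    also have "\<dots> = (\<Sum>n. \<Sum>\<xi>\<in>X. \<integral>\<^sup>+x. indicator (E n \<xi>) x * ?f x \<partial>lborel)"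
      by (subst nn_integral_suminf) (auto simp: nn_integral_sum)
    also have "\<dots> \<le> (\<Sum>n. ennreal (B * AA * N * N) * weight_energy m a p ?K V * en U n)"
    proof (intro suminf_le)
      fix n
      have "(\<Sum>\<xi>\<in>X. \<integral>\<^sup>+x. indicator (E n \<xi>) x * ?f x \<partial>lborel) \<le> (\<Sum>\<xi>\<in>X. ennreal (B * A \<xi> * N * N) * (en U n * en V n))"
        by (intro sum_mono piece)
      also have "\<dots> = ennreal (B * AA * N * N) * (en U n * en V n)"
      proof -
        have "(\<Sum>\<xi>\<in>X. ennreal (B * A \<xi> * N * N)) = ennreal (\<Sum>\<xi>\<in>X. B * A \<xi> * N * N)"
          using B N A0 by (intro sum_ennreal) auto
        also have "(\<Sum>\<xi>\<in>X. B * A \<xi> * N * N) = B * AA * N * N" by (simp add: AA_def sum_distrib_left sum_distrib_right)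
        finally show ?thesis by (simp add: sum_distrib_right[symmetric])
      qed
      also have "\<dots> \<le> ennreal (B * AA * N * N) * (en U n * weight_energy m a p ?K V)"
        by (intro mult_left_mono enle) auto
      finally show "(\<Sum>\<xi>\<in>X. \<integral>\<^sup>+x. indicator (E n \<xi>) x * ?f x \<partial>lborel) \<le> ennreal (B * AA * N * N) * weight_energy m a p ?K V * en U n"
        by (simp only: mult_ac)
    qed auto
    also have "\<dots> = ennreal (B * AA * N * N) * weight_energy m a p ?K V * (\<Sum>n. en U n)"
      by (rule ennreal_suminf_cmult)
    also have "\<dots> \<le> ennreal (B * AA * N * N) * weight_energy m a p ?K V * (3 * weight_energy m a p ?K U)"
    proof (rule mult_left_mono)
      have "(\<Sum>n. en U n) = (\<Sum>\<gamma>\<in>?S. \<Sum>n. \<integral>\<^sup>+x. indicator (G n) x * weight_density a p U \<gamma> x \<partial>lborel)"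
        unfolding en_def by (rule suminf_sum) auto
      also have "\<dots> = (\<Sum>\<gamma>\<in>?S. \<integral>\<^sup>+x. (\<Sum>n. indicator (G n) x * weight_density a p U \<gamma> x) \<partial>lborel)"
        by (intro sum.cong refl nn_integral_suminf[symmetric]) measurable
      also have "\<dots> \<le> (\<Sum>\<gamma>\<in>?S. \<integral>\<^sup>+x. 3 * (indicator ?K x * weight_density a p U \<gamma> x) \<partial>lborel)"
      proof (intro sum_mono nn_integral_mono)
        fix \<gamma> x
        have "(\<Sum>n. indicator (G n) x * weight_density a p U \<gamma> x) = (\<Sum>n. (indicator ?K x * weight_density a p U \<gamma> x) * indicator (shell n 3) x)"
          by (intro suminf_cong) (auto simp: G_def indicator_def)
        also have "\<dots> = (indicator ?K x * weight_density a p U \<gamma> x) * (\<Sum>n. indicator (shell n 3) x)"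
          by (rule ennreal_suminf_cmult)
        also have "\<dots> \<le> (indicator ?K x * weight_density a p U \<gamma> x) * 3"
          by (intro mult_left_mono shell_overlap) auto
        finally show "(\<Sum>n. indicator (G n) x * weight_density a p U \<gamma> x) \<le> 3 * (indicator ?K x * weight_density a p U \<gamma> x)"
          by (simp only: mult.commute)
      qed
      also have "\<dots> = 3 * weight_energy m a p ?K U"
        unfolding weight_energy_def sum_distrib_left
        by (intro sum.cong refl nn_integral_cmult) measurable
      finally show "(\<Sum>n. en U n) \<le> 3 * weight_energy m a p ?K U" .
    qed simp
    also have "\<dots> = (3 * ennreal (B * AA * N * N)) * (weight_energy m a p ?K U * weight_energy m a p ?K V)"
      by (simp only: mult_ac)
    also have "3 * ennreal (B * AA * N * N) = ennreal C" unfolding C_def using C1 by (simp add: ennreal_mult)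
    finally show "(\<integral>\<^sup>+x. indicator ?K x * ?f x \<partial>lborel) \<le> ennreal C * (weight_energy m a p ?K U * weight_energy m a p ?K V)" .
  qed
qed

section \<open>Kondratiev spaces on the cone\<close>

subsection \<open>Borel representatives\<close>

text \<open>The definitions refer to Lebesgue measurable functions on \<open>K\<close>, whereas Fubini's theorem is
  applied to products of the Borel measure; hence the passage to Borel representatives.\<close>

definition borel_rep :: "(real^'n) set \<Rightarrow> (real^'n \<Rightarrow> real) \<Rightarrow> (real^'n \<Rightarrow> real) \<Rightarrow> bool" where
  "borel_rep K g h \<longleftrightarrow> h \<in> borel_measurable borel \<and> (\<forall>x. x \<notin> K \<longrightarrow> h x = 0) \<and>
    g \<in> borel_measurable (lebesgue_on K) \<and> (AE x in lborel. x \<in> K \<longrightarrow> g x = h x)"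

lemma open_lebesgue: "open K \<Longrightarrow> K \<in> sets lebesgue"
  by (simp add: borel_open)

lemma borel_rep_exists:
  assumes K: "open K" and g: "g \<in> borel_measurable (lebesgue_on K)"
  shows "\<exists>h. borel_rep K g h"
proof -
  have [measurable]: "K \<in> sets borel" using K by (rule borel_open)
  have "(\<lambda>x. if x \<in> K then g x else 0) \<in> borel_measurable lebesgue"
    using g open_lebesgue[OF K] by (simp add: borel_measurable_if)
  from completion_ex_borel_measurable_real[OF this]
  obtain h where h: "h \<in> borel_measurable lborel" "AE x in lborel. (if x \<in> K then g x else 0) = h x" by blast
  have [measurable]: "h \<in> borel_measurable borel" using h by simp
  have "(\<lambda>x. indicator K x * h x) \<in> borel_measurable borel" by measurable
  moreover have "AE x in lborel. x \<in> K \<longrightarrow> g x = indicator K x * h x"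
    using h(2) by eventually_elim auto
  ultimately have "borel_rep K g (\<lambda>x. indicator K x * h x)" unfolding borel_rep_def using g by auto
  then show ?thesis by blast
qed

lemma borel_rep_self:
  assumes "h \<in> borel_measurable borel" "\<And>x. x \<notin> K \<Longrightarrow> h x = 0"
  shows "borel_rep K h h"
  unfolding borel_rep_def using assms
  by (auto intro!: measurable_restrict_space1 measurable_completion)

lemma borel_rep_AE:
  assumes "borel_rep K g h"
  shows "AE x in lebesgue. x \<in> K \<longrightarrow> g x = h x"
  using assms unfolding borel_rep_def by (auto intro: AE_completion)

lemma borel_rep_cong:
  assumes "borel_rep K g h" "g' \<in> borel_measurable (lebesgue_on K)" "AE x in lborel. x \<in> K \<longrightarrow> g' x = g x"
  shows "borel_rep K g' h"
proof -
  have "AE x in lborel. x \<in> K \<longrightarrow> g x = h x" using assms(1) by (simp add: borel_rep_def)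
  with assms(3) have "AE x in lborel. x \<in> K \<longrightarrow> g' x = h x" by eventually_elim auto
  then show ?thesis using assms by (simp add: borel_rep_def)
qed

lemma borel_rep_mult:
  assumes "borel_rep K g h" "borel_rep K g' h'"
  shows "borel_rep K (\<lambda>x. g x * g' x) (\<lambda>x. h x * h' x)"
proof -
  have "AE x in lborel. x \<in> K \<longrightarrow> g x = h x" "AE x in lborel. x \<in> K \<longrightarrow> g' x = h' x"
    using assms by (simp_all add: borel_rep_def)
  then have "AE x in lborel. x \<in> K \<longrightarrow> g x * g' x = h x * h' x" by eventually_elim auto
  then show ?thesis using assms by (auto simp: borel_rep_def)
qed

lemma borel_rep_integral:
  fixes \<psi> :: "real^'n \<Rightarrow> real"
  assumes K: "open K" and r: "borel_rep K g h" and \<psi>: "\<psi> \<in> borel_measurable borel"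
  shows "(LINT x|lebesgue_on K. g x * \<psi> x) = (LINT x|lborel. h x * \<psi> x)"
proof -
  have [measurable]: "h \<in> borel_measurable borel" "\<psi> \<in> borel_measurable borel" using r \<psi> by (auto simp: borel_rep_def)
  have hp: "(\<lambda>x. h x * \<psi> x) \<in> borel_measurable lborel" by simp
  have gm: "(\<lambda>x. g x * \<psi> x) \<in> borel_measurable (lebesgue_on K)"
    using r \<psi> by (intro borel_measurable_times) (auto simp: borel_rep_def intro!: measurable_restrict_space1 measurable_completion)
  have "(LINT x|lebesgue_on K. g x * \<psi> x) = (LINT x|lebesgue. indicator K x *\<^sub>R (g x * \<psi> x))"
    using open_lebesgue[OF K] by (intro integral_restrict_space) simp
  also have "\<dots> = (LINT x|lebesgue. h x * \<psi> x)"
  proof (rule integral_cong_AE)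
    show "(\<lambda>x. indicator K x *\<^sub>R (g x * \<psi> x)) \<in> borel_measurable lebesgue"
      using gm open_lebesgue[OF K] by (simp add: borel_measurable_restrict_space_iff)
    show "(\<lambda>x. h x * \<psi> x) \<in> borel_measurable lebesgue" using hp by (rule measurable_completion)
    show "AE x in lebesgue. indicator K x *\<^sub>R (g x * \<psi> x) = h x * \<psi> x"
      using borel_rep_AE[OF r]
    proof eventually_elim
      case (elim x)
      then show ?case using r by (cases "x \<in> K") (auto simp: borel_rep_def)
    qed
  qed
  also have "\<dots> = (LINT x|lborel. h x * \<psi> x)" using hp by (rule integral_completion)
  finally show ?thesis .
qed

lemma borel_rep_nn_integral:
  assumes K: "open K" and r: "borel_rep K g h" and F: "case_prod F \<in> borel_measurable (borel \<Otimes>\<^sub>M borel)"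
  shows "(\<integral>\<^sup>+x. F x (g x) \<partial>lebesgue_on K) = (\<integral>\<^sup>+x. indicator K x * F x (h x) \<partial>lborel)"
proof -
  have [measurable]: "h \<in> borel_measurable borel" "K \<in> sets borel" using r K by (auto simp: borel_rep_def borel_open)
  have Fh: "(\<lambda>x. indicator K x * F x (h x)) \<in> borel_measurable lborel" using F by measurable
  have "(\<integral>\<^sup>+x. F x (g x) \<partial>lebesgue_on K) = (\<integral>\<^sup>+x. F x (g x) * indicator K x \<partial>lebesgue)"
    using open_lebesgue[OF K] by (intro nn_integral_restrict_space) simp
  also have "\<dots> = (\<integral>\<^sup>+x. indicator K x * F x (h x) \<partial>lebesgue)"
  proof (rule nn_integral_cong_AE)
    show "AE x in lebesgue. F x (g x) * indicator K x = indicator K x * F x (h x)"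
      using borel_rep_AE[OF r]
    proof eventually_elim
      case (elim x)
      then show ?case by (cases "x \<in> K") auto
    qed
  qed
  also have "\<dots> = (\<integral>\<^sup>+x. indicator K x * F x (h x) \<partial>lborel)"
    using Fh by (simp add: nn_integral_completion)
  finally show ?thesis .
qed

lemma borel_rep_loc_int:
  assumes K: "open K" and r: "borel_rep K g h"
  shows "locally_integrable K g \<longleftrightarrow> loc_int K h"
proof -
  have [measurable]: "h \<in> borel_measurable borel" using r by (simp add: borel_rep_def)
  have gm: "(\<lambda>x. indicator K x *\<^sub>R g x) \<in> borel_measurable lebesgue"
    using r open_lebesgue[OF K] by (simp add: borel_measurable_restrict_space_iff borel_rep_def)
  have "integrable (lebesgue_on C) g \<longleftrightarrow> set_integrable lborel C h" if C: "compact C" "C \<subseteq> K" for C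
  proof -
    have Cb[measurable]: "C \<in> sets borel" using C by (simp add: borel_closed compact_imp_closed)
    have Cl: "C \<in> sets lebesgue" using Cb by simp
    have "integrable (lebesgue_on C) g \<longleftrightarrow> integrable lebesgue (\<lambda>x. indicator C x *\<^sub>R g x)"
      using Cl by (intro integrable_restrict_space) simp
    also have "\<dots> \<longleftrightarrow> integrable lebesgue (\<lambda>x. indicator C x *\<^sub>R h x)"
    proof (rule integrable_cong_AE)
      have "(\<lambda>x. indicator C x *\<^sub>R (indicator K x *\<^sub>R g x)) \<in> borel_measurable lebesgue"
        by (rule borel_measurable_scaleR[OF borel_measurable_indicator[OF Cl] gm])
      moreover have "indicator C x *\<^sub>R (indicator K x *\<^sub>R g x) = indicator C x *\<^sub>R g x" for x
        using C(2) by (cases "x \<in> C") auto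
      ultimately show "(\<lambda>x. indicator C x *\<^sub>R g x) \<in> borel_measurable lebesgue" by (simp only:)
      show "(\<lambda>x. indicator C x *\<^sub>R h x) \<in> borel_measurable lebesgue"
        by (rule measurable_completion) simp
      show "AE x in lebesgue. indicator C x *\<^sub>R g x = indicator C x *\<^sub>R h x"
        using borel_rep_AE[OF r] by eventually_elim (use C(2) in \<open>auto simp: indicator_def\<close>)
    qed
    also have "\<dots> \<longleftrightarrow> integrable lborel (\<lambda>x. indicator C x *\<^sub>R h x)"
      by (rule integrable_completion) simp
    finally show ?thesis unfolding set_integrable_def .
  qed
  then show ?thesis using r unfolding locally_integrable_def loc_int_def borel_rep_def by auto
qed

subsection \<open>Uniqueness of weak derivatives\<close>

lemma has_weak_deriv_rep:
  assumes K: "open K" and u: "borel_rep K u u'" and g: "borel_rep K g g'"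
  shows "has_weak_deriv K \<alpha> u g \<longleftrightarrow> loc_int K u' \<and> loc_int K g' \<and>
    (\<forall>\<phi>\<in>test_functions K. (LINT x|lborel. u' x * multi_deriv \<alpha> \<phi> x) = (-1) ^ mi_order \<alpha> * (LINT x|lborel. g' x * \<phi> x))"
proof -
  have "\<phi> \<in> borel_measurable borel" "multi_deriv \<alpha> \<phi> \<in> borel_measurable borel" if "\<phi> \<in> test_functions K" for \<phi>
    using test_functionsD(1)[OF that] smooth_multi_deriv by (auto intro: smooth_borel)
  then show ?thesis
    unfolding has_weak_deriv_def borel_rep_loc_int[OF K u] borel_rep_loc_int[OF K g]
    using borel_rep_integral[OF K u] borel_rep_integral[OF K g] by auto
qed

lemma has_weak_deriv_measurable:
  assumes "has_weak_deriv K \<alpha> u g"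
  shows "u \<in> borel_measurable (lebesgue_on K)" "g \<in> borel_measurable (lebesgue_on K)"
  using assms unfolding has_weak_deriv_def locally_integrable_def by auto

lemma weak_deriv_unique:
  assumes K: "open K" and g1: "has_weak_deriv K \<alpha> u g1" and g2: "has_weak_deriv K \<alpha> u g2"
  shows "AE x in lborel. x \<in> K \<longrightarrow> g1 x = g2 x"
proof -
  obtain u' where u': "borel_rep K u u'" using borel_rep_exists[OF K has_weak_deriv_measurable(1)[OF g1]] by blast
  obtain h1 where h1: "borel_rep K g1 h1" using borel_rep_exists[OF K has_weak_deriv_measurable(2)[OF g1]] by blast
  obtain h2 where h2: "borel_rep K g2 h2" using borel_rep_exists[OF K has_weak_deriv_measurable(2)[OF g2]] by blast
  note w1 = g1[unfolded has_weak_deriv_rep[OF K u' h1]] and w2 = g2[unfolded has_weak_deriv_rep[OF K u' h2]]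
  have "AE x in lborel. x \<in> K \<longrightarrow> h1 x - h2 x = 0"
  proof (rule fundamental_lemma[OF K])
    show "loc_int K (\<lambda>x. h1 x - h2 x)" using w1 w2 by (intro loc_int_diff) auto
    fix \<phi> assume \<phi>: "\<phi> \<in> test_functions K"
    have "integrable lborel (\<lambda>x. h1 x * \<phi> x)" "integrable lborel (\<lambda>x. h2 x * \<phi> x)"
      using w1 w2 \<phi> by (auto intro: loc_int_test)
    moreover have "(-1) ^ mi_order \<alpha> * (LINT x|lborel. h1 x * \<phi> x) = (-1) ^ mi_order \<alpha> * (LINT x|lborel. h2 x * \<phi> x)"
      using w1 w2 \<phi> by (metis (no_types, lifting))
    then have "(LINT x|lborel. h1 x * \<phi> x) = (LINT x|lborel. h2 x * \<phi> x)" by simp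
    ultimately show "(LINT x|lborel. (h1 x - h2 x) * \<phi> x) = 0" by (simp add: left_diff_distrib)
  qed
  moreover have "AE x in lborel. x \<in> K \<longrightarrow> g1 x = h1 x" "AE x in lborel. x \<in> K \<longrightarrow> g2 x = h2 x"
    using h1 h2 by (simp_all add: borel_rep_def)
  ultimately show ?thesis by eventually_elim auto
qed

lemma weak_deriv_rep:
  assumes K: "open K" and g: "has_weak_deriv K \<alpha> u g" and h: "borel_rep K g h"
  shows "borel_rep K (weak_deriv K \<alpha> u) h" "has_weak_deriv K \<alpha> u (weak_deriv K \<alpha> u)"
proof -
  show w: "has_weak_deriv K \<alpha> u (weak_deriv K \<alpha> u)"
    unfolding weak_deriv_def by (rule someI[of "has_weak_deriv K \<alpha> u", OF g])
  show "borel_rep K (weak_deriv K \<alpha> u) h"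
    by (rule borel_rep_cong[OF h has_weak_deriv_measurable(2)[OF w] weak_deriv_unique[OF K w g]])
qed

lemma kondratiev_energy_rep:
  fixes K :: "(real^'n) set"
  assumes K: "open K" and r: "\<And>\<alpha>. mi_order \<alpha> \<le> m \<Longrightarrow> borel_rep K (weak_deriv K \<alpha> u) (U \<alpha>)"
  shows "kondratiev_energy m a p K u = weight_energy m a p K U"
  unfolding kondratiev_energy_def weight_energy_def
proof (rule sum.cong[OF refl])
  fix \<alpha> :: "'n \<Rightarrow> nat" assume "\<alpha> \<in> {\<alpha>. mi_order \<alpha> \<le> m}"
  then have r': "borel_rep K (weak_deriv K \<alpha> u) (U \<alpha>)" using r by simp
  show "(\<integral>\<^sup>+x. ennreal (\<bar>norm x powr (real (mi_order \<alpha>) - a) * weak_deriv K \<alpha> u x\<bar> powr p) \<partial>lebesgue_on K) =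
    (\<integral>\<^sup>+x. indicator K x * weight_density a p U \<alpha> x \<partial>lborel)"
    unfolding weight_density_def
    by (rule borel_rep_nn_integral[OF K r', of "\<lambda>x y. ennreal (\<bar>norm x powr (real (mi_order \<alpha>) - a) * y\<bar> powr p)"]) measurable
qed

text \<open>Each weak derivative is defined on its own from \<open>u\<close>. Comparing the one of
  order \<open>\<alpha>\<close>, tested with a partial derivative, and the one of order
  \<open>mi_inc i \<alpha>\<close>, tested with the function itself, yields the first-order
  relations.\<close>

lemma space_weak_family:
  fixes K :: "(real^'n) set"
  assumes K: "open K" and u: "u \<in> kondratiev_space m a p K"
  shows "\<exists>U. weak_family K m U \<and> borel_rep K u (U (\<lambda>_. 0)) \<and> weight_energy m a p K U = kondratiev_energy m a p K u"
proof -
  have ex: "\<exists>g. has_weak_deriv K \<alpha> u g" if "mi_order \<alpha> \<le> m" for \<alpha> using u that by (auto simp: kondratiev_space_def)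
  have wd: "has_weak_deriv K \<alpha> u (weak_deriv K \<alpha> u)" if "mi_order \<alpha> \<le> m" for \<alpha>
    unfolding weak_deriv_def by (rule someI_ex[of "has_weak_deriv K \<alpha> u", OF ex[OF that]])
  \<comment> \<open>Beyond order \<open>m\<close> nothing is known about weak derivatives, and the
    family is continued by zero.\<close>
  define U where "U \<alpha> = (if mi_order \<alpha> \<le> m then (SOME h. borel_rep K (weak_deriv K \<alpha> u) h) else (\<lambda>_. 0))" for \<alpha>
  have rep: "borel_rep K (weak_deriv K \<alpha> u) (U \<alpha>)" if "mi_order \<alpha> \<le> m" for \<alpha>
    unfolding U_def using that someI_ex[OF borel_rep_exists[OF K has_weak_deriv_measurable(2)[OF wd[OF that]]]] by simp
  obtain u' where u': "borel_rep K u u'" using borel_rep_exists[OF K has_weak_deriv_measurable(1)[OF wd[of "\<lambda>_. 0"]]] by auto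

  have "weak_family K m U"
    unfolding weak_family_def
  proof (intro conjI allI impI)
    fix \<alpha>
    show "U \<alpha> \<in> borel_measurable borel"
      using rep[of \<alpha>] by (cases "mi_order \<alpha> \<le> m") (auto simp: borel_rep_def U_def)
    show "loc_int K (U \<alpha>)" if "mi_order \<alpha> \<le> m" using wd[OF that, unfolded has_weak_deriv_rep[OF K u' rep[OF that]]] by blast
    fix i assume \<alpha>: "mi_order \<alpha> < m"
    then have \<alpha>1: "mi_order \<alpha> \<le> m" "mi_order (mi_inc i \<alpha>) \<le> m" by auto
    show "weak_dir K (axis i 1) (U \<alpha>) (U (mi_inc i \<alpha>))"
      unfolding weak_dir_def dir_deriv_axis
    proof
      fix \<phi> assume \<phi>: "\<phi> \<in> test_functions K"
      have 1: "(LINT x|lborel. u' x * multi_deriv \<alpha> (partial_deriv i \<phi>) x) = (-1) ^ mi_order \<alpha> * (LINT x|lborel. U \<alpha> x * partial_deriv i \<phi> x)"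
        using wd[OF \<alpha>1(1), unfolded has_weak_deriv_rep[OF K u' rep[OF \<alpha>1(1)]]] test_functions_partial_deriv[OF \<phi>] by blast
      have 2: "(LINT x|lborel. u' x * multi_deriv (mi_inc i \<alpha>) \<phi> x) = (-1) ^ mi_order (mi_inc i \<alpha>) * (LINT x|lborel. U (mi_inc i \<alpha>) x * \<phi> x)"
        using wd[OF \<alpha>1(2), unfolded has_weak_deriv_rep[OF K u' rep[OF \<alpha>1(2)]]] \<phi> by blast
      have "(-1 :: real) ^ mi_order \<alpha> * (LINT x|lborel. U \<alpha> x * partial_deriv i \<phi> x) = (-1) ^ mi_order \<alpha> * (- (LINT x|lborel. U (mi_inc i \<alpha>) x * \<phi> x))"
        using 1 2 unfolding multi_deriv_inc(2)[OF test_functionsD(1)[OF \<phi>]] by simp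
      then show "(LINT x|lborel. U \<alpha> x * partial_deriv i \<phi> x) = - (LINT x|lborel. U (mi_inc i \<alpha>) x * \<phi> x)"
        by (simp only: mult_cancel_left) simp
    qed
  qed
  moreover have "borel_rep K u (U (\<lambda>_. 0))"
  proof (rule borel_rep_cong[OF rep])
    have l: "locally_integrable K u" using wd[of "\<lambda>_. 0"] by (simp add: has_weak_deriv_def)
    have "has_weak_deriv K (\<lambda>_. 0) u u" unfolding has_weak_deriv_def using l by (simp add: multi_deriv_zero)
    from weak_deriv_unique[OF K this wd[of "\<lambda>_. 0"]]
    show "AE x in lborel. x \<in> K \<longrightarrow> u x = weak_deriv K (\<lambda>_. 0) u x" by simp
    show "u \<in> borel_measurable (lebesgue_on K)" using l by (simp add: locally_integrable_def)
  qed simp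
  moreover have "weight_energy m a p K U = kondratiev_energy m a p K u"
    by (rule kondratiev_energy_rep[OF K rep, symmetric])
  ultimately show ?thesis by blast
qed

subsection \<open>The Leibniz rule\<close>

text \<open>Only the shape of the rule matters: the orders of each pair add up to that of
  \<open>\<alpha>\<close>, and binomial coefficients appear as repetitions in the list. The list
  depends on \<open>\<alpha>\<close> alone, so that it yields constants independent of the
  functions.\<close>

lemma weak_leibniz:
  fixes \<alpha> :: "'n::finite \<Rightarrow> nat"
  shows "\<exists>L. (\<forall>(\<beta>, \<gamma>)\<in>set L. mi_order \<beta> + mi_order \<gamma> = mi_order \<alpha>) \<and>
    (\<forall>K m U V. open K \<longrightarrow> weak_family K m U \<longrightarrow> weak_family K m V \<longrightarrow>
      (\<forall>\<beta> \<gamma>. mi_order \<beta> + mi_order \<gamma> \<le> m \<longrightarrow> loc_int K (\<lambda>x. U \<beta> x * V \<gamma> x)) \<longrightarrow> mi_order \<alpha> \<le> m \<longrightarrow>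
      (\<forall>\<phi>\<in>test_functions K. (LINT x|lborel. U (\<lambda>_. 0) x * V (\<lambda>_. 0) x * multi_deriv \<alpha> \<phi> x) =
        (-1) ^ mi_order \<alpha> * (LINT x|lborel. (\<Sum>(\<beta>, \<gamma>)\<leftarrow>L. U \<beta> x * V \<gamma> x) * \<phi> x)))"
    (is "\<exists>L. ?ord \<alpha> L \<and> (\<forall>K m U V. ?A K m U V \<alpha> L)")
proof (induction \<alpha> rule: mi_induct)
  case zero
  show ?case by (intro exI[of _ "[(\<lambda>_. 0, \<lambda>_. 0)]"]) (simp add: multi_deriv_zero)
next
  case (inc i \<alpha>)
  then obtain L where ord: "?ord \<alpha> L" and L: "\<forall>K m U V. ?A K m U V \<alpha> L" by (elim exE conjE)
  let ?L = "map (\<lambda>(\<beta>, \<gamma>). (mi_inc i \<beta>, \<gamma>)) L @ map (\<lambda>(\<beta>, \<gamma>). (\<beta>, mi_inc i \<gamma>)) L"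
  have ord': "?ord (mi_inc i \<alpha>) ?L" using ord by auto
  have "?A K m U V (mi_inc i \<alpha>) ?L" for K m U V
  proof (intro impI ballI)
    fix \<phi> assume K: "open K" and U: "weak_family K m U" and V: "weak_family K m V"
      and UV: "\<forall>\<beta> \<gamma>. mi_order \<beta> + mi_order \<gamma> \<le> m \<longrightarrow> loc_int K (\<lambda>x. U \<beta> x * V \<gamma> x)"
      and \<alpha>: "mi_order (mi_inc i \<alpha>) \<le> m" and \<phi>: "\<phi> \<in> test_functions K"
    have \<alpha>': "mi_order \<alpha> \<le> m" "mi_order \<alpha> < m" using \<alpha> by auto
    let ?S = "\<lambda>L x. \<Sum>(\<beta>, \<gamma>)\<leftarrow>L. U \<beta> x * V \<gamma> x"
    have pd: "partial_deriv i \<phi> \<in> test_functions K" by (rule test_functions_partial_deriv[OF \<phi>])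
    have IH: "(LINT x|lborel. U (\<lambda>_. 0) x * V (\<lambda>_. 0) x * multi_deriv \<alpha> (partial_deriv i \<phi>) x) =
        (-1) ^ mi_order \<alpha> * (LINT x|lborel. ?S L x * partial_deriv i \<phi> x)"
      using L[rule_format, OF K U V UV[rule_format] \<alpha>'(1) pd] .
    \<comment> \<open>Integrability is carried through the induction along with the identity, so
      that the integrals of the sums may be split.\<close>
    have main: "\<forall>(\<beta>, \<gamma>)\<in>set l. mi_order \<beta> + mi_order \<gamma> < m \<Longrightarrow>
        integrable lborel (\<lambda>x. ?S l x * partial_deriv i \<phi> x) \<and>
        integrable lborel (\<lambda>x. ?S (map (\<lambda>(\<beta>, \<gamma>). (mi_inc i \<beta>, \<gamma>)) l) x * \<phi> x + ?S (map (\<lambda>(\<beta>, \<gamma>). (\<beta>, mi_inc i \<gamma>)) l) x * \<phi> x) \<and>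
        (LINT x|lborel. ?S l x * partial_deriv i \<phi> x) =
        - (LINT x|lborel. ?S (map (\<lambda>(\<beta>, \<gamma>). (mi_inc i \<beta>, \<gamma>)) l) x * \<phi> x + ?S (map (\<lambda>(\<beta>, \<gamma>). (\<beta>, mi_inc i \<gamma>)) l) x * \<phi> x)" for l
    proof (induction l)
      case (Cons bg l)
      obtain \<beta> \<gamma> where bg: "bg = (\<beta>, \<gamma>)" by (cases bg)
      have o: "mi_order \<beta> + mi_order \<gamma> < m" "mi_order \<beta> < m" "mi_order \<gamma> < m" using Cons.prems bg by auto
      have l1: "loc_int K (\<lambda>x. U \<beta> x * V \<gamma> x)" "loc_int K (\<lambda>x. U (mi_inc i \<beta>) x * V \<gamma> x)" "loc_int K (\<lambda>x. U \<beta> x * V (mi_inc i \<gamma>) x)"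
        using UV o by auto
      have l2: "loc_int K (\<lambda>x. U (mi_inc i \<beta>) x * V \<gamma> x + U \<beta> x * V (mi_inc i \<gamma>) x)" by (rule loc_int_add[OF l1(2,3)])
      have "weak_dir K (axis i 1) (\<lambda>x. U \<beta> x * V \<gamma> x) (\<lambda>x. U (mi_inc i \<beta>) x * V \<gamma> x + U \<beta> x * V (mi_inc i \<gamma>) x)"
        by (rule weak_dir_mult[OF K _ _ _ _ _ _ l1(1) l2])
           (use o in \<open>auto intro: weak_familyD(2,3)[OF U] weak_familyD(2,3)[OF V]\<close>)
      then have w: "(LINT x|lborel. U \<beta> x * V \<gamma> x * partial_deriv i \<phi> x) = - (LINT x|lborel. (U (mi_inc i \<beta>) x * V \<gamma> x + U \<beta> x * V (mi_inc i \<gamma>) x) * \<phi> x)"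
        unfolding weak_dir_def dir_deriv_axis using \<phi> by blast
      let ?R = "\<lambda>l x. ?S (map (\<lambda>(\<beta>, \<gamma>). (mi_inc i \<beta>, \<gamma>)) l) x * \<phi> x + ?S (map (\<lambda>(\<beta>, \<gamma>). (\<beta>, mi_inc i \<gamma>)) l) x * \<phi> x"
      have IHl: "integrable lborel (\<lambda>x. ?S l x * partial_deriv i \<phi> x)" "integrable lborel (?R l)"
        "(LINT x|lborel. ?S l x * partial_deriv i \<phi> x) = - (LINT x|lborel. ?R l x)"
        using Cons by auto
      note i1 = loc_int_test[OF l1(1) pd] and i2 = loc_int_test[OF l2 \<phi>]
      have e1: "?S (bg # l) x * partial_deriv i \<phi> x = U \<beta> x * V \<gamma> x * partial_deriv i \<phi> x + ?S l x * partial_deriv i \<phi> x" for x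
        by (simp add: bg distrib_right)
      have e2: "?R (bg # l) x = (U (mi_inc i \<beta>) x * V \<gamma> x + U \<beta> x * V (mi_inc i \<gamma>) x) * \<phi> x + ?R l x" for x
        by (simp add: bg distrib_right)
      have j1: "integrable lborel (\<lambda>x. ?S (bg # l) x * partial_deriv i \<phi> x)"
        unfolding e1 by (rule Bochner_Integration.integrable_add[OF i1 IHl(1)])
      have j2: "integrable lborel (?R (bg # l))"
        unfolding e2 by (rule Bochner_Integration.integrable_add[OF i2 IHl(2)])
      have "(LINT x|lborel. ?S (bg # l) x * partial_deriv i \<phi> x) =
         (LINT x|lborel. U \<beta> x * V \<gamma> x * partial_deriv i \<phi> x) + (LINT x|lborel. ?S l x * partial_deriv i \<phi> x)"
        unfolding e1 by (rule Bochner_Integration.integral_add[OF i1 IHl(1)])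
      moreover have "(LINT x|lborel. ?R (bg # l) x) =
         (LINT x|lborel. (U (mi_inc i \<beta>) x * V \<gamma> x + U \<beta> x * V (mi_inc i \<gamma>) x) * \<phi> x) + (LINT x|lborel. ?R l x)"
        unfolding e2 by (rule Bochner_Integration.integral_add[OF i2 IHl(2)])
      ultimately have "(LINT x|lborel. ?S (bg # l) x * partial_deriv i \<phi> x) = - (LINT x|lborel. ?R (bg # l) x)"
        using w IHl(3) by linarith
      with j1 j2 show ?case by blast
    qed simp
    have "\<forall>(\<beta>, \<gamma>)\<in>set L. mi_order \<beta> + mi_order \<gamma> < m" using ord \<alpha>'(2) by auto
    from main[OF this]
    have "(LINT x|lborel. ?S L x * partial_deriv i \<phi> x) = - (LINT x|lborel. ?S ?L x * \<phi> x)"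
      by (simp add: distrib_right)
    then show "(LINT x|lborel. U (\<lambda>_. 0) x * V (\<lambda>_. 0) x * multi_deriv (mi_inc i \<alpha>) \<phi> x) =
      (-1) ^ mi_order (mi_inc i \<alpha>) * (LINT x|lborel. ?S ?L x * \<phi> x)"
      unfolding multi_deriv_inc(2)[OF test_functionsD(1)[OF \<phi>]] IH by simp
  qed
  with ord' show ?case by (intro exI[of _ ?L] conjI allI)
qed

subsection \<open>Sufficiency\<close>

lemma uniform_constant:
  fixes P :: "'a \<Rightarrow> real \<Rightarrow> bool"
  assumes "finite S" "\<And>s. s \<in> S \<Longrightarrow> \<exists>C\<ge>0. P s C" and mono: "\<And>s C D. P s C \<Longrightarrow> C \<le> D \<Longrightarrow> P s D"
  shows "\<exists>C\<ge>0. \<forall>s\<in>S. P s C"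
  using assms(1,2)
proof (induction S rule: finite_induct)
  case (insert s S)
  have "\<exists>C\<ge>0. \<forall>s\<in>S. P s C" by (rule insert.IH) (rule insert.prems, simp)
  then obtain C where C: "0 \<le> C" "\<forall>s\<in>S. P s C" by (elim exE conjE)
  have "\<exists>C\<ge>0. P s C" by (rule insert.prems) simp
  then obtain D where D: "0 \<le> D" "P s D" by (elim exE conjE)
  have "P s (C + D)" using mono[OF D(2), of "C + D"] C(1) by simp
  moreover have "\<forall>r\<in>S. P r (C + D)" using mono[OF C(2)[rule_format], of _ "C + D"] D(1) by simp
  ultimately show ?case using C(1) D(1) by (intro exI[of _ "C + D"]) simp
qed (intro exI[of _ 0], simp)

text \<open>A compact subset of \<open>K\<close> stays away from the origin, so the weight has a
  positive minimum there, and \<open>\<bar>f\<bar> \<le> 1 + \<bar>f\<bar> powr p\<close> reduces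
  integrability to the weighted integral.\<close>

lemma weighted_integrable_loc_int:
  fixes f :: "real^'n \<Rightarrow> real"
  assumes [measurable]: "f \<in> borel_measurable borel" and p: "1 \<le> p" and K: "open K" "0 \<notin> K"
    and fin: "(\<integral>\<^sup>+x. indicator K x * ennreal (\<bar>norm x powr s * f x\<bar> powr p) \<partial>lborel) < \<infinity>"
  shows "loc_int K f"
  unfolding loc_int_def
proof (intro conjI allI impI)
  have [measurable]: "K \<in> sets borel" using K by (simp add: borel_open)
  fix C assume C: "compact C" "C \<subseteq> K"
  then have Cb[measurable]: "C \<in> sets borel" by (simp add: borel_closed compact_imp_closed)
  have "\<exists>\<delta>>0. \<forall>x\<in>C. \<delta> \<le> norm x powr s"
  proof (cases "C = {}")
    case False
    have "0 \<notin> C" using C K by auto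
    then have "continuous_on C (\<lambda>x. norm x powr s)" by (intro continuous_intros) auto
    from continuous_attains_inf[OF C(1) False this] obtain y where y: "y \<in> C" "\<forall>x\<in>C. norm y powr s \<le> norm x powr s" by blast
    then show ?thesis using \<open>0 \<notin> C\<close> by (intro exI[of _ "norm y powr s"]) auto
  qed (auto intro: exI[of _ 1])
  then obtain \<delta> where \<delta>: "0 < \<delta>" "\<And>x. x \<in> C \<Longrightarrow> \<delta> \<le> norm x powr s" by blast
  have "integrable lborel (\<lambda>x. indicator C x * f x)"
  proof (rule integrableI_bounded)
    have pt: "ennreal (norm (indicator C x * f x)) \<le> indicator C x + ennreal (\<delta> powr - p) * (indicator K x * ennreal (\<bar>norm x powr s * f x\<bar> powr p))" for x
    proof (cases "x \<in> C")
      case True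
      have f1: "\<bar>f x\<bar> \<le> 1 + \<bar>f x\<bar> powr p"
      proof (cases "\<bar>f x\<bar> \<le> 1")
        case False
        then have "\<bar>f x\<bar> powr 1 \<le> \<bar>f x\<bar> powr p" using p by (intro powr_mono) auto
        then show ?thesis using False by simp
      next
        case True
        then show ?thesis using powr_ge_zero[of "\<bar>f x\<bar>" p] by linarith
      qed
      have f2: "\<bar>f x\<bar> powr p \<le> \<delta> powr - p * \<bar>norm x powr s * f x\<bar> powr p"
      proof -
        have "\<delta> * \<bar>f x\<bar> \<le> \<bar>norm x powr s * f x\<bar>" using \<delta>(2)[OF True] by (simp add: abs_mult mult_right_mono)
        then have "(\<delta> * \<bar>f x\<bar>) powr p \<le> \<bar>norm x powr s * f x\<bar> powr p" using \<delta> p by (intro powr_mono2) auto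
        then have "\<delta> powr p * \<bar>f x\<bar> powr p \<le> \<bar>norm x powr s * f x\<bar> powr p" using \<delta> by (simp add: powr_mult)
        then show ?thesis using \<delta>(1) by (simp add: powr_minus field_simps)
      qed
      have "ennreal \<bar>f x\<bar> \<le> ennreal (1 + \<delta> powr - p * \<bar>norm x powr s * f x\<bar> powr p)"
        by (rule ennreal_leI) (use f1 f2 in linarith)
      also have "\<dots> = 1 + ennreal (\<delta> powr - p) * ennreal (\<bar>norm x powr s * f x\<bar> powr p)"
        by (subst ennreal_plus) (simp_all add: ennreal_mult')
      finally show ?thesis using True C by (auto simp: indicator_def)
    qed simp
    have "(\<integral>\<^sup>+x. ennreal (norm (indicator C x * f x)) \<partial>lborel) \<le>
      (\<integral>\<^sup>+x. indicator C x + ennreal (\<delta> powr - p) * (indicator K x * ennreal (\<bar>norm x powr s * f x\<bar> powr p)) \<partial>lborel)"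
      by (intro nn_integral_mono pt)
    also have "\<dots> = emeasure lborel C + ennreal (\<delta> powr - p) * (\<integral>\<^sup>+x. indicator K x * ennreal (\<bar>norm x powr s * f x\<bar> powr p) \<partial>lborel)"
      by (simp add: nn_integral_add nn_integral_cmult)
    also have "\<dots> < \<infinity>"
      using fin emeasure_compact_finite[OF C(1)] by (simp add: ennreal_mult_less_top)
    finally show "(\<integral>\<^sup>+x. ennreal (norm (indicator C x * f x)) \<partial>lborel) < \<infinity>" .
  qed simp
  then show "set_integrable lborel C f" by (simp add: set_integrable_def)
qed simp

lemma open_cone_nonzero: "0 \<notin> open_cone e k"
  by (simp add: open_cone_def)

lemma weighted_product_uniform:
  fixes e :: "real^'n"
  assumes e: "norm e = 1" and k: "\<bar>k\<bar> < 1" and p: "1 \<le> p" and a: "real CARD('n) / p \<le> a"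
    and m: "1 < p \<and> real CARD('n) / p < real m \<or> p = 1 \<and> CARD('n) \<le> m"
  shows "\<exists>C\<ge>0. \<forall>U V \<alpha> \<beta>. weak_family (open_cone e k) m U \<longrightarrow> weak_family (open_cone e k) m V \<longrightarrow> mi_order \<alpha> + mi_order \<beta> \<le> m \<longrightarrow>
    (\<integral>\<^sup>+x. indicator (open_cone e k) x * ennreal (\<bar>norm x powr (real (mi_order \<alpha> + mi_order \<beta>) - a) * (U \<alpha> x * V \<beta> x)\<bar> powr p) \<partial>lborel)
     \<le> ennreal C * (weight_energy m a p (open_cone e k) U * weight_energy m a p (open_cone e k) V)"
proof -
  let ?S = "{(i, i'). i + i' \<le> m}"
  let ?P = "\<lambda>s C. \<forall>U V \<alpha> \<beta>. weak_family (open_cone e k) m U \<longrightarrow> weak_family (open_cone e k) m V \<longrightarrow> mi_order \<alpha> = fst s \<longrightarrow> mi_order \<beta> = snd s \<longrightarrow>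
    (\<integral>\<^sup>+x. indicator (open_cone e k) x * ennreal (\<bar>norm x powr (real (fst s + snd s) - a) * (U \<alpha> x * V \<beta> x)\<bar> powr p) \<partial>lborel)
     \<le> ennreal C * (weight_energy m a p (open_cone e k) U * weight_energy m a p (open_cone e k) V)"
  have "finite ?S" by (rule finite_subset[of _ "{..m} \<times> {..m}"]) auto
  then have "\<exists>C\<ge>0. \<forall>s\<in>?S. ?P s C"
  proof (rule uniform_constant)
    fix s assume "s \<in> ?S"
    then have "fst s + snd s \<le> m" by auto
    from weighted_product[OF e k p a m this] show "\<exists>C\<ge>0. ?P s C" .
  next
    fix s and C D :: real assume PC: "?P s C" and CD: "C \<le> D"
    show "?P s D"
    proof (intro allI impI, goal_cases)
      case (1 U V \<alpha> \<beta>)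
      show ?case
        by (rule order_trans[OF PC[rule_format, OF 1] mult_right_mono]) (simp_all add: CD ennreal_leI)
    qed
  qed
  then obtain C where C: "0 \<le> C" "\<forall>s\<in>?S. ?P s C" by (elim exE conjE)
  show ?thesis
  proof (intro exI[of _ C] conjI allI impI, goal_cases)
    case (2 U V \<alpha> \<beta>)
    then have "(mi_order \<alpha>, mi_order \<beta>) \<in> ?S" by simp
    from C(2)[rule_format, OF this, of U V \<alpha> \<beta>] 2 show ?case by simp
  qed (rule C(1))
qed

lemma sum_list_powr_density:
  fixes f :: "'a \<Rightarrow> real"
  assumes p: "0 \<le> p" and w: "0 \<le> w"
  shows "\<bar>w * (\<Sum>s\<leftarrow>l. f s)\<bar> powr p \<le> real (length l) powr p * (\<Sum>j<length l. \<bar>w * f (l ! j)\<bar> powr p)"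
proof -
  have "\<bar>w * (\<Sum>s\<leftarrow>l. f s)\<bar> \<le> (\<Sum>j<length l. \<bar>w * f (l ! j)\<bar>)"
    unfolding sum_list_sum_nth by (simp add: sum_distrib_left atLeast0LessThan)
  then have "\<bar>w * (\<Sum>s\<leftarrow>l. f s)\<bar> powr p \<le> (\<Sum>j<length l. \<bar>w * f (l ! j)\<bar>) powr p"
    using p by (intro powr_mono2) auto
  also have "\<dots> \<le> real (card {..<length l}) powr p * (\<Sum>j<length l. \<bar>w * f (l ! j)\<bar> powr p)"
    by (rule sum_powr_le) (simp_all add: p)
  finally show ?thesis by simp
qed

text \<open>The bilinear estimate is used twice: it first makes all products of derivatives locally
  integrable, which admits the Leibniz rule, and then bounds the energy of the derivatives so
  obtained.\<close>

lemma open_cone_product: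
  fixes e :: "real^'n"
  assumes e: "norm e = 1" and k: "\<bar>k\<bar> < 1" and p: "1 \<le> p" and a: "real CARD('n) / p \<le> a"
    and m: "1 < p \<and> real CARD('n) / p < real m \<or> p = 1 \<and> CARD('n) \<le> m"
  defines "K \<equiv> open_cone e k"
  shows "\<exists>C\<ge>0. \<forall>u\<in>kondratiev_space m a p K. \<forall>v\<in>kondratiev_space m a p K.
    (\<lambda>x. u x * v x) \<in> kondratiev_space m a p K \<and>
    kondratiev_energy m a p K (\<lambda>x. u x * v x) \<le> ennreal C * (kondratiev_energy m a p K u * kondratiev_energy m a p K v)"
proof -
  have K: "open K" "0 \<notin> K" unfolding K_def by (rule open_open_cone, rule open_cone_nonzero)
  then have [measurable]: "K \<in> sets borel" by (simp add: borel_open)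
  obtain C0 where C0: "0 \<le> C0" and C: "\<And>U V \<alpha> \<beta>. weak_family K m U \<Longrightarrow> weak_family K m V \<Longrightarrow> mi_order \<alpha> + mi_order \<beta> \<le> m \<Longrightarrow>
    (\<integral>\<^sup>+x. indicator K x * ennreal (\<bar>norm x powr (real (mi_order \<alpha> + mi_order \<beta>) - a) * (U \<alpha> x * V \<beta> x)\<bar> powr p) \<partial>lborel)
     \<le> ennreal C0 * (weight_energy m a p K U * weight_energy m a p K V)"
    using weighted_product_uniform[OF e k p a m] unfolding K_def[symmetric] by blast
  from choice[OF allI[OF weak_leibniz]] obtain L where L0: "\<forall>\<alpha>::'n \<Rightarrow> nat. (\<forall>(\<beta>, \<gamma>)\<in>set (L \<alpha>). mi_order \<beta> + mi_order \<gamma> = mi_order \<alpha>) \<and>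
    (\<forall>K m U V. open K \<longrightarrow> weak_family K m U \<longrightarrow> weak_family K m V \<longrightarrow>
      (\<forall>\<beta> \<gamma>. mi_order \<beta> + mi_order \<gamma> \<le> m \<longrightarrow> loc_int K (\<lambda>x. U \<beta> x * V \<gamma> x)) \<longrightarrow> mi_order \<alpha> \<le> m \<longrightarrow>
      (\<forall>\<phi>\<in>test_functions K. (LINT x|lborel. U (\<lambda>_. 0) x * V (\<lambda>_. 0) x * multi_deriv \<alpha> \<phi> x) =
        (-1) ^ mi_order \<alpha> * (LINT x|lborel. (\<Sum>(\<beta>, \<gamma>)\<leftarrow>L \<alpha>. U \<beta> x * V \<gamma> x) * \<phi> x)))" ..
  have Lord: "mi_order (fst s) + mi_order (snd s) = mi_order \<alpha>" if "s \<in> set (L \<alpha>)" for s \<alpha>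
    using L0[rule_format, of \<alpha>] that by (cases s) auto
  define B where "B \<alpha> = real (length (L \<alpha>)) powr p * (real (length (L \<alpha>)) * C0)" for \<alpha>
  have B: "0 \<le> B \<alpha>" for \<alpha> unfolding B_def using C0 by simp
  define C1 where "C1 = (\<Sum>\<alpha> | mi_order \<alpha> \<le> m. B \<alpha>)"
  show ?thesis
  proof (rule exI[of _ C1], intro conjI ballI)
    show "0 \<le> C1" unfolding C1_def by (intro sum_nonneg B)
    fix u v assume u: "u \<in> kondratiev_space m a p K" and v: "v \<in> kondratiev_space m a p K"
    obtain U where U: "weak_family K m U" "borel_rep K u (U (\<lambda>_. 0))" "weight_energy m a p K U = kondratiev_energy m a p K u"
      using space_weak_family[OF K(1) u] by (elim exE conjE)
    obtain V where V: "weak_family K m V" "borel_rep K v (V (\<lambda>_. 0))" "weight_energy m a p K V = kondratiev_energy m a p K v"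
      using space_weak_family[OF K(1) v] by (elim exE conjE)
    have [measurable]: "U \<alpha> \<in> borel_measurable borel" "V \<alpha> \<in> borel_measurable borel" for \<alpha>
      using weak_familyD(1)[OF U(1)] weak_familyD(1)[OF V(1)] by auto
    define E where "E = kondratiev_energy m a p K u * kondratiev_energy m a p K v"
    have E: "E < \<infinity>" using u v by (simp add: E_def kondratiev_space_def ennreal_mult_less_top)
    have pair: "(\<integral>\<^sup>+x. indicator K x * ennreal (\<bar>norm x powr (real (mi_order \<beta> + mi_order \<gamma>) - a) * (U \<beta> x * V \<gamma> x)\<bar> powr p) \<partial>lborel) \<le> ennreal C0 * E"
      if "mi_order \<beta> + mi_order \<gamma> \<le> m" for \<beta> \<gamma>
      using C[OF U(1) V(1) that] unfolding U(3) V(3) E_def .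
    have UV: "loc_int K (\<lambda>x. U \<beta> x * V \<gamma> x)" if "mi_order \<beta> + mi_order \<gamma> \<le> m" for \<beta> \<gamma>
    proof (rule weighted_integrable_loc_int[OF _ p K])
      show "(\<integral>\<^sup>+x. indicator K x * ennreal (\<bar>norm x powr (real (mi_order \<beta> + mi_order \<gamma>) - a) * (U \<beta> x * V \<gamma> x)\<bar> powr p) \<partial>lborel) < \<infinity>"
        by (rule order_le_less_trans[OF pair[OF that]]) (use E in \<open>simp add: ennreal_mult_less_top\<close>)
    qed simp
    define S where "S \<alpha> x = (\<Sum>(\<beta>, \<gamma>)\<leftarrow>L \<alpha>. U \<beta> x * V \<gamma> x)" for \<alpha> x
    \<comment> \<open>Cut off outside \<open>K\<close>, so that the candidate derivative is its own
      Borel representative.\<close>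
    define D where "D \<alpha> x = indicator K x * S \<alpha> x" for \<alpha> x
    have Sm[measurable]: "S \<alpha> \<in> borel_measurable borel" for \<alpha>
      unfolding S_def sum_list_sum_nth by (simp add: case_prod_beta)
    have Dm[measurable]: "D \<alpha> \<in> borel_measurable borel" for \<alpha> unfolding D_def by measurable
    have dens: "(\<integral>\<^sup>+x. indicator K x * weight_density a p D \<alpha> x \<partial>lborel) \<le> ennreal (B \<alpha>) * E" if \<alpha>: "mi_order \<alpha> \<le> m" for \<alpha>
    proof -
      let ?n = "length (L \<alpha>)" and ?w = "\<lambda>x. norm x powr (real (mi_order \<alpha>) - a)"
      let ?f = "\<lambda>j x. ennreal (\<bar>?w x * (U (fst (L \<alpha> ! j)) x * V (snd (L \<alpha> ! j)) x)\<bar> powr p)"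
      have pt: "indicator K x * weight_density a p D \<alpha> x \<le> ennreal (real ?n powr p) * (\<Sum>j<?n. indicator K x * ?f j x)" for x
      proof (cases "x \<in> K")
        case True
        have "\<bar>?w x * S \<alpha> x\<bar> powr p \<le> real ?n powr p * (\<Sum>j<?n. \<bar>?w x * (U (fst (L \<alpha> ! j)) x * V (snd (L \<alpha> ! j)) x)\<bar> powr p)"
          unfolding S_def case_prod_beta by (rule sum_list_powr_density) (use p in simp_all)
        then have "ennreal (\<bar>?w x * S \<alpha> x\<bar> powr p) \<le> ennreal (real ?n powr p * (\<Sum>j<?n. \<bar>?w x * (U (fst (L \<alpha> ! j)) x * V (snd (L \<alpha> ! j)) x)\<bar> powr p))"
          by (rule ennreal_leI)
        then show ?thesis using True by (simp add: weight_density_def D_def ennreal_mult' sum_nonneg)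
      qed simp
      have "(\<integral>\<^sup>+x. indicator K x * weight_density a p D \<alpha> x \<partial>lborel) \<le> (\<integral>\<^sup>+x. ennreal (real ?n powr p) * (\<Sum>j<?n. indicator K x * ?f j x) \<partial>lborel)"
        by (intro nn_integral_mono pt)
      also have "\<dots> = ennreal (real ?n powr p) * (\<Sum>j<?n. \<integral>\<^sup>+x. indicator K x * ?f j x \<partial>lborel)"
      proof -
        have fm: "(\<lambda>x. indicator K x * ?f j x) \<in> borel_measurable lborel" for j by measurable
        show ?thesis
          by (rule trans[OF nn_integral_cmult[OF borel_measurable_sum[OF fm]] arg_cong[OF nn_integral_sum[OF fm], where f = "\<lambda>t. ennreal (real ?n powr p) * t"]])
      qed
      also have "\<dots> \<le> ennreal (real ?n powr p) * (\<Sum>j<?n. ennreal C0 * E)"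
      proof (intro mult_left_mono sum_mono)
        fix j assume "j \<in> {..<?n}"
        then have "L \<alpha> ! j \<in> set (L \<alpha>)" by simp
        from Lord[OF this] pair[of "fst (L \<alpha> ! j)" "snd (L \<alpha> ! j)"] \<alpha>
        show "(\<integral>\<^sup>+x. indicator K x * ?f j x \<partial>lborel) \<le> ennreal C0 * E" by simp
      qed simp
      also have "\<dots> = ennreal (B \<alpha>) * E"
        unfolding B_def using C0 by (simp add: ennreal_mult' ennreal_of_nat_eq_real_of_nat mult.assoc)
      finally show ?thesis .
    qed
    have repD: "borel_rep K (D \<alpha>) (D \<alpha>)" for \<alpha> by (rule borel_rep_self[OF Dm]) (simp add: D_def)
    have repuv: "borel_rep K (\<lambda>x. u x * v x) (\<lambda>x. U (\<lambda>_. 0) x * V (\<lambda>_. 0) x)" by (rule borel_rep_mult[OF U(2) V(2)])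
    have wd: "has_weak_deriv K \<alpha> (\<lambda>x. u x * v x) (D \<alpha>)" if \<alpha>: "mi_order \<alpha> \<le> m" for \<alpha>
      unfolding has_weak_deriv_rep[OF K(1) repuv repD]
    proof (intro conjI ballI)
      show "loc_int K (\<lambda>x. U (\<lambda>_. 0) x * V (\<lambda>_. 0) x)" by (rule UV) (simp add: mi_order_def)
      show "loc_int K (D \<alpha>)"
      proof (rule weighted_integrable_loc_int[OF Dm p K])
        show "(\<integral>\<^sup>+x. indicator K x * ennreal (\<bar>norm x powr (real (mi_order \<alpha>) - a) * D \<alpha> x\<bar> powr p) \<partial>lborel) < \<infinity>"
          by (rule order_le_less_trans[OF dens[OF \<alpha>, unfolded weight_density_def]]) (use E in \<open>simp add: ennreal_mult_less_top\<close>)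
      qed
      fix \<phi> assume \<phi>: "\<phi> \<in> test_functions K"
      obtain C where "C \<subseteq> K" "\<forall>x. x \<notin> C \<longrightarrow> \<phi> x = 0" using test_functionsD(2)[OF \<phi>] by blast
      then have "D \<alpha> x * \<phi> x = S \<alpha> x * \<phi> x" for x by (cases "x \<in> K") (auto simp: D_def)
      moreover have "(LINT x|lborel. U (\<lambda>_. 0) x * V (\<lambda>_. 0) x * multi_deriv \<alpha> \<phi> x) = (-1) ^ mi_order \<alpha> * (LINT x|lborel. S \<alpha> x * \<phi> x)"
        unfolding S_def by (rule conjunct2[OF L0[rule_format, of \<alpha>], rule_format, OF K(1) U(1) V(1) UV \<alpha> \<phi>])
      ultimately show "(LINT x|lborel. U (\<lambda>_. 0) x * V (\<lambda>_. 0) x * multi_deriv \<alpha> \<phi> x) = (-1) ^ mi_order \<alpha> * (LINT x|lborel. D \<alpha> x * \<phi> x)" by (simp only:)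
    qed
    have "kondratiev_energy m a p K (\<lambda>x. u x * v x) = weight_energy m a p K D"
      by (rule kondratiev_energy_rep[OF K(1) weak_deriv_rep(1)[OF K(1) wd repD]])
    also have "\<dots> \<le> (\<Sum>\<alpha> | mi_order \<alpha> \<le> m. ennreal (B \<alpha>) * E)"
      unfolding weight_energy_def by (intro sum_mono dens) simp
    also have "\<dots> = ennreal C1 * E"
      unfolding C1_def sum_distrib_right[symmetric] using B by simp
    finally have en: "kondratiev_energy m a p K (\<lambda>x. u x * v x) \<le> ennreal C1 * E" .
    then show "kondratiev_energy m a p K (\<lambda>x. u x * v x) \<le> ennreal C1 * (kondratiev_energy m a p K u * kondratiev_energy m a p K v)"
      by (simp only: E_def)
    show "(\<lambda>x. u x * v x) \<in> kondratiev_space m a p K"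
      unfolding kondratiev_space_def
    proof (intro CollectI conjI allI impI)
      show "(\<lambda>x. u x * v x) \<in> borel_measurable (lebesgue_on K)" using repuv by (simp add: borel_rep_def)
      show "kondratiev_energy m a p K (\<lambda>x. u x * v x) < \<infinity>"
        by (rule order_le_less_trans[OF en]) (use E in \<open>simp add: ennreal_mult_less_top\<close>)
      show "\<exists>g. has_weak_deriv K \<alpha> (\<lambda>x. u x * v x) g" if "mi_order \<alpha> \<le> m" for \<alpha>
        by (rule exI) (rule wd[OF that])
    qed
  qed
qed

lemma open_cone_algebra:
  fixes e :: "real^'n"
  assumes "norm e = 1" "\<bar>k\<bar> < 1" and p: "1 \<le> p" and "real CARD('n) / p \<le> a"
    and "1 < p \<and> real CARD('n) / p < real m \<or> p = 1 \<and> CARD('n) \<le> m"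
  shows "kondratiev_algebra m a p (open_cone e k)"
proof -
  let ?E = "kondratiev_energy m a p (open_cone e k)" and ?X = "kondratiev_space m a p (open_cone e k)"
  obtain C where C: "0 \<le> C" and uv: "\<And>u v. u \<in> ?X \<Longrightarrow> v \<in> ?X \<Longrightarrow> (\<lambda>x. u x * v x) \<in> ?X \<and> ?E (\<lambda>x. u x * v x) \<le> ennreal C * (?E u * ?E v)"
    using open_cone_product[OF assms] by blast
  show ?thesis
    unfolding kondratiev_algebra_def
  proof (intro exI[of _ "C powr (1 / p)"] ballI conjI)
    fix u v assume u: "u \<in> ?X" and v: "v \<in> ?X"
    show "(\<lambda>x. u x * v x) \<in> ?X" using uv[OF u v] by simp
    have "?E u < \<infinity>" "?E v < \<infinity>" using u v by (simp_all add: kondratiev_space_def)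
    then have "enn2real (?E (\<lambda>x. u x * v x)) \<le> enn2real (ennreal C * (?E u * ?E v))"
      using uv[OF u v] by (intro enn2real_mono) (auto simp: ennreal_mult_less_top)
    also have "\<dots> = C * (enn2real (?E u) * enn2real (?E v))" using C by (simp add: enn2real_mult)
    finally have "enn2real (?E (\<lambda>x. u x * v x)) powr (1 / p) \<le> (C * (enn2real (?E u) * enn2real (?E v))) powr (1 / p)"
      using p by (intro powr_mono2) auto
    then show "kondratiev_norm m a p (open_cone e k) (\<lambda>x. u x * v x) \<le>
       C powr (1 / p) * kondratiev_norm m a p (open_cone e k) u * kondratiev_norm m a p (open_cone e k) v"
      unfolding kondratiev_norm_def using C by (simp add: powr_mult mult.assoc)
  qed
qed

section \<open>Necessity\<close>

subsection \<open>Test functions in Kondratiev spaces\<close>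

lemma smooth_loc_int: "smooth f \<Longrightarrow> loc_int U f"
  unfolding loc_int_def set_integrable_def
  by (intro conjI allI impI smooth_borel borel_integrable_compact smooth_continuous)

text \<open>For smooth functions the increment formula on segments is the fundamental theorem of
  calculus; \<open>line_weak_dir\<close> converts it into integration by parts.\<close>

lemma smooth_weak_dir:
  assumes f: "smooth f" and U: "open U"
  shows "weak_dir U b f (dir_deriv b f)"
proof (rule line_weak_dir[OF U smooth_loc_int[OF f] smooth_loc_int[OF smooth_dir_deriv[OF f]]])
  fix t :: real
  have "t * (LINT s:{0..1}|lborel. dir_deriv b f (x + s *\<^sub>R (t *\<^sub>R b))) = f (x + t *\<^sub>R b) - f x" for x
  proof -
    have "dir_deriv (- (t *\<^sub>R b)) f y = (- t) * dir_deriv b f y" for y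
      by (simp add: sum_distrib_left sum_negf mult.assoc)
    then have "(- t) * (LINT s:{0..1}|lborel. dir_deriv b f (x - s *\<^sub>R (- (t *\<^sub>R b)))) = f x - f (x - (- (t *\<^sub>R b)))"
      using seg_avg_dir_deriv[OF f, of "- (t *\<^sub>R b)" x] by (simp only: set_integral_mult_right)
    then show ?thesis by simp
  qed
  then show "AE x in lborel. x \<in> seg_dom U (t *\<^sub>R b) \<longrightarrow>
      f (x + t *\<^sub>R b) - f x = t * (LINT s:{0..1}|lborel. dir_deriv b f (x + s *\<^sub>R (t *\<^sub>R b)))" by simp
qed

lemma test_borel_rep:
  assumes "w \<in> test_functions K"
  shows "borel_rep K w w"
proof (rule borel_rep_self)
  show "w \<in> borel_measurable borel" by (rule smooth_borel[OF test_functionsD(1)[OF assms]])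
  show "w x = 0" if "x \<notin> K" for x using test_functionsD(2)[OF assms] that by blast
qed

lemma test_has_weak_deriv:
  assumes K: "open K" and w: "w \<in> test_functions K"
  shows "has_weak_deriv K \<alpha> w (multi_deriv \<alpha> w)"
proof -
  have s: "smooth w" by (rule test_functionsD(1)[OF w])
  have "(LINT x|lborel. w x * multi_deriv \<alpha> \<phi> x) = (-1) ^ mi_order \<alpha> * (LINT x|lborel. multi_deriv \<alpha> w x * \<phi> x)"
    if "\<phi> \<in> test_functions K" for \<phi>
    using that
  proof (induction \<alpha> arbitrary: \<phi> rule: mi_induct)
    case (inc i \<alpha>)
    have "(LINT x|lborel. w x * multi_deriv (mi_inc i \<alpha>) \<phi> x) = (-1) ^ mi_order \<alpha> * (LINT x|lborel. multi_deriv \<alpha> w x * partial_deriv i \<phi> x)"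
      unfolding multi_deriv_inc(2)[OF test_functionsD(1)[OF inc.prems]]
      by (rule inc.IH[OF test_functions_partial_deriv[OF inc.prems]])
    moreover have "(LINT x|lborel. multi_deriv \<alpha> w x * partial_deriv i \<phi> x) = - (LINT x|lborel. partial_deriv i (multi_deriv \<alpha> w) x * \<phi> x)"
      using smooth_weak_dir[OF smooth_multi_deriv[OF s] K, of "axis i 1" \<alpha>] inc.prems
      unfolding weak_dir_def dir_deriv_axis by blast
    ultimately show ?case unfolding multi_deriv_inc(1)[OF s] by simp
  qed (simp add: multi_deriv_zero)
  then show ?thesis
    unfolding has_weak_deriv_rep[OF K test_borel_rep[OF w] test_borel_rep[OF test_functions_multi_deriv[OF w]]]
    using smooth_loc_int s smooth_multi_deriv by blast
qed

section \<open>Finite energy of test functions\<close>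

lemma test_energy:
  assumes K: "open K" and w: "w \<in> test_functions K"
  shows "kondratiev_energy m a p K w = weight_energy m a p K (\<lambda>\<alpha>. multi_deriv \<alpha> w)"
  by (rule kondratiev_energy_rep[OF K])
     (rule weak_deriv_rep(1)[OF K test_has_weak_deriv[OF K w] test_borel_rep[OF test_functions_multi_deriv[OF w]]])

lemma powr_bounded_compact:
  fixes C :: "(real^'n) set"
  assumes "compact C" "0 \<notin> C"
  shows "\<exists>W\<ge>0. \<forall>x\<in>C. norm x powr s \<le> W"
proof -
  have "continuous_on C (\<lambda>x. norm x powr s)" using assms by (intro continuous_intros) auto
  then have "bounded ((\<lambda>x. norm x powr s) ` C)" using assms(1) by (intro compact_imp_bounded compact_continuous_image)
  then obtain B where "\<forall>x\<in>C. norm x powr s \<le> B" by (auto simp: bounded_iff)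
  then show ?thesis by (intro exI[of _ "max B 0"]) auto
qed

lemma test_density_bound:
  fixes w :: "real^'n \<Rightarrow> real"
  assumes w: "smooth w" "closed C" "\<And>x. x \<notin> C \<Longrightarrow> w x = 0" and p: "0 \<le> p" and W: "\<forall>x\<in>C. norm x powr (real (mi_order \<alpha>) - a) \<le> W"
  shows "(\<integral>\<^sup>+x. indicator K x * weight_density a p (\<lambda>\<alpha>. multi_deriv \<alpha> w) \<alpha> x \<partial>lborel) \<le> ennreal (W powr p) * (\<integral>\<^sup>+x. ennreal (\<bar>multi_deriv \<alpha> w x\<bar> powr p) \<partial>lborel)"
proof -
  have [measurable]: "multi_deriv \<alpha> w \<in> borel_measurable borel" by (rule smooth_borel[OF smooth_multi_deriv[OF w(1)]])
  have pt: "indicator K x * weight_density a p (\<lambda>\<alpha>. multi_deriv \<alpha> w) \<alpha> x \<le> ennreal (W powr p) * ennreal (\<bar>multi_deriv \<alpha> w x\<bar> powr p)" for x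
  proof (cases "x \<in> C")
    case True
    let ?n = "norm x powr (real (mi_order \<alpha>) - a)"
    have "\<bar>?n * multi_deriv \<alpha> w x\<bar> powr p = ?n powr p * \<bar>multi_deriv \<alpha> w x\<bar> powr p"
      by (simp add: abs_mult powr_mult)
    also have "\<dots> \<le> W powr p * \<bar>multi_deriv \<alpha> w x\<bar> powr p"
      using W True p by (intro mult_right_mono powr_mono2) auto
    finally have "weight_density a p (\<lambda>\<alpha>. multi_deriv \<alpha> w) \<alpha> x \<le> ennreal (W powr p * \<bar>multi_deriv \<alpha> w x\<bar> powr p)"
      unfolding weight_density_def by (rule ennreal_leI)
    then show ?thesis by (simp add: ennreal_mult' indicator_def)
  next
    case False
    then have "multi_deriv \<alpha> w x = 0" using multi_deriv_zero_outside[OF w] by blast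
    then show ?thesis by (simp add: weight_density_def)
  qed
  have "(\<integral>\<^sup>+x. indicator K x * weight_density a p (\<lambda>\<alpha>. multi_deriv \<alpha> w) \<alpha> x \<partial>lborel) \<le> (\<integral>\<^sup>+x. ennreal (W powr p) * ennreal (\<bar>multi_deriv \<alpha> w x\<bar> powr p) \<partial>lborel)"
    by (intro nn_integral_mono pt)
  also have "\<dots> = ennreal (W powr p) * (\<integral>\<^sup>+x. ennreal (\<bar>multi_deriv \<alpha> w x\<bar> powr p) \<partial>lborel)"
    by (rule nn_integral_cmult) measurable
  finally show ?thesis .
qed

lemma test_powr_integral_finite:
  fixes w :: "real^'n \<Rightarrow> real"
  assumes w: "w \<in> test_functions U" and p: "0 \<le> p"
  shows "(\<integral>\<^sup>+x. ennreal (\<bar>w x\<bar> powr p) \<partial>lborel) < \<infinity>"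
proof -
  obtain C where C: "compact C" "\<forall>x. x \<notin> C \<longrightarrow> w x = 0" using test_functionsD(2)[OF w] by blast
  have Cb[measurable]: "C \<in> sets borel" using C(1) by (simp add: borel_closed compact_imp_closed)
  obtain M where M: "0 \<le> M" "\<And>x. \<bar>w x\<bar> \<le> M" using test_functions_bounded[OF w] by blast
  have pt: "ennreal (\<bar>w x\<bar> powr p) \<le> ennreal (M powr p) * indicator C x" for x
    using C(2) M p by (cases "x \<in> C") (auto intro!: ennreal_leI powr_mono2)
  have "(\<integral>\<^sup>+x. ennreal (\<bar>w x\<bar> powr p) \<partial>lborel) \<le> (\<integral>\<^sup>+x. ennreal (M powr p) * indicator C x \<partial>lborel)"
    by (intro nn_integral_mono pt)
  also have "\<dots> = ennreal (M powr p) * emeasure lborel C" by (simp add: nn_integral_cmult)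
  also have "\<dots> < \<infinity>" using emeasure_compact_finite[OF C(1)] by (simp add: ennreal_mult_less_top)
  finally show ?thesis .
qed

lemma test_space:
  fixes w :: "real^'n \<Rightarrow> real"
  assumes K: "open K" "0 \<notin> K" and p: "0 \<le> p" and w: "w \<in> test_functions K"
  shows "w \<in> kondratiev_space m a p K"
proof -
  obtain C where C: "compact C" "C \<subseteq> K" "\<forall>x. x \<notin> C \<longrightarrow> w x = 0" using test_functionsD(2)[OF w] by blast
  have fin: "(\<integral>\<^sup>+x. indicator K x * weight_density a p (\<lambda>\<alpha>. multi_deriv \<alpha> w) \<alpha> x \<partial>lborel) < \<infinity>" for \<alpha>
  proof -
    have "0 \<notin> C" using C(2) K(2) by auto
    from powr_bounded_compact[OF C(1) this] obtain W where W: "\<forall>x\<in>C. norm x powr (real (mi_order \<alpha>) - a) \<le> W" by blast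
    show ?thesis
      by (rule order_le_less_trans[OF test_density_bound[OF test_functionsD(1)[OF w] compact_imp_closed[OF C(1)] _ p W]])
         (use C(3) test_powr_integral_finite[OF test_functions_multi_deriv[OF w] p] in \<open>auto simp: ennreal_mult_less_top\<close>)
  qed
  then have "kondratiev_energy m a p K w < \<infinity>"
    unfolding test_energy[OF K(1) w] weight_energy_def
    by (simp add: less_top[symmetric] finite_mi_order_le)
  then show ?thesis
    using test_borel_rep[OF w] test_has_weak_deriv[OF K(1) w] by (auto simp: kondratiev_space_def borel_rep_def)
qed

subsection \<open>Plateaus of small energy\<close>

text \<open>Powers of a function equal to 1 near a point keep a fixed positive amount of energy,
  but in an algebra the powers of an element of small norm tend to 0.\<close>

lemma algebra_plateau:
  fixes K :: "(real^'n) set"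
  assumes alg: "kondratiev_algebra m a p K" and K: "open K" "0 \<notin> K" and p: "1 \<le> p"
  shows "\<exists>\<epsilon>>0. \<forall>w\<in>test_functions K. \<forall>B. open B \<longrightarrow> B \<noteq> {} \<longrightarrow> B \<subseteq> K \<longrightarrow> (\<forall>x\<in>B. w x = 1) \<longrightarrow> \<epsilon> \<le> kondratiev_energy m a p K w"
proof -
  let ?N = "kondratiev_norm m a p K" and ?E = "kondratiev_energy m a p K" and ?X = "kondratiev_space m a p K"
  obtain c0 where c0: "\<And>u v. u \<in> ?X \<Longrightarrow> v \<in> ?X \<Longrightarrow> ?N (\<lambda>x. u x * v x) \<le> c0 * ?N u * ?N v"
    using alg unfolding kondratiev_algebra_def by blast
  \<comment> \<open>The constant of the algebra could be small or negative; raising it to at least 1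
    allows division by it.\<close>
  define c where "c = max c0 1"
  have N0: "0 \<le> ?N u" for u by (simp add: kondratiev_norm_def)
  have c1: "1 \<le> c" by (simp add: c_def)
  have c: "?N (\<lambda>x. u x * v x) \<le> c * ?N u * ?N v" if "u \<in> ?X" "v \<in> ?X" for u v
    using c0[OF that] mult_right_mono[of c0 c "?N u * ?N v"] N0 by (simp add: c_def mult.assoc)
  \<comment> \<open>Energy below \<open>r\<close> means norm at most 1/(2c), so that every further
    multiplication by \<open>w\<close> at least halves the bound for the norm.\<close>
  define r where "r = (1 / (2 * c)) powr p"
  have r: "0 < r" using c1 by (simp add: r_def)
  have False if w: "w \<in> test_functions K" and B: "open B" "B \<noteq> {}" "B \<subseteq> K" "\<forall>x\<in>B. w x = 1" and less: "?E w < ennreal r" for w B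
  proof -
    have [measurable]: "B \<in> sets borel" using B by (simp add: borel_open)
    have wk: "(\<lambda>x. w x ^ Suc k) \<in> test_functions K" for k
    proof -
      obtain C where C: "compact C" "C \<subseteq> K" "\<forall>x. x \<notin> C \<longrightarrow> w x = 0" using test_functionsD(2)[OF w] by blast
      show ?thesis
        by (rule test_functionsI[OF smooth_power[OF test_functionsD(1)[OF w]] C(1,2)]) (use C(3) in auto)
    qed
    have X: "(\<lambda>x. w x ^ Suc k) \<in> ?X" for k by (rule test_space[OF K _ wk]) (use p in simp)
    have wX: "w \<in> ?X" by (rule test_space[OF K _ w]) (use p in simp)
    have "enn2real (?E w) \<le> r" using less r by (simp add: enn2real_leI)
    then have "?N w \<le> r powr (1 / p)" unfolding kondratiev_norm_def using p by (intro powr_mono2) auto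
    also have "\<dots> = 1 / (2 * c)" unfolding r_def powr_powr using p c1 by simp
    finally have Nw: "c * ?N w \<le> 1 / 2" using c1 by (simp add: field_simps)
    have Npow: "?N (\<lambda>x. w x ^ Suc k) \<le> (1 / 2) ^ k * ?N w" for k
    proof (induction k)
      case (Suc k)
      have "?N (\<lambda>x. w x ^ Suc (Suc k)) = ?N (\<lambda>x. w x * w x ^ Suc k)" by simp
      also have "\<dots> \<le> c * ?N w * ?N (\<lambda>x. w x ^ Suc k)" by (rule c[OF wX X])
      also have "\<dots> \<le> 1 / 2 * ((1 / 2) ^ k * ?N w)" by (intro mult_mono Nw Suc N0) simp
      finally show ?case by simp
    qed simp
    \<comment> \<open>The part of the undifferentiated term that lives on \<open>B\<close>. It is
      the same for all powers of \<open>w\<close>, since these are all 1 there.\<close>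
    define \<mu> where "\<mu> = (\<integral>\<^sup>+x. indicator B x * ennreal ((norm x powr - a) powr p) \<partial>lborel)"
    have \<mu>E: "\<mu> \<le> ?E (\<lambda>x. w x ^ Suc k)" for k
    proof -
      have "indicator B x * ennreal ((norm x powr - a) powr p) \<le> indicator K x * weight_density a p (\<lambda>\<alpha>. multi_deriv \<alpha> (\<lambda>x. w x ^ Suc k)) (\<lambda>_. 0) x" for x
        using subsetD[OF B(3), of x] B(4) by (cases "x \<in> B") (simp_all add: weight_density_def multi_deriv_zero)
      then have "\<mu> \<le> (\<integral>\<^sup>+x. indicator K x * weight_density a p (\<lambda>\<alpha>. multi_deriv \<alpha> (\<lambda>x. w x ^ Suc k)) (\<lambda>_. 0) x \<partial>lborel)"
        unfolding \<mu>_def by (intro nn_integral_mono)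
      also have "\<dots> \<le> ?E (\<lambda>x. w x ^ Suc k)"
        unfolding test_energy[OF K(1) wk] weight_energy_def
        by (rule member_le_sum[where f = "\<lambda>\<alpha>. \<integral>\<^sup>+x. indicator K x * weight_density a p (\<lambda>\<alpha>. multi_deriv \<alpha> (\<lambda>x. w x ^ Suc k)) \<alpha> x \<partial>lborel"])
           (simp_all add: finite_mi_order_le)
      finally show ?thesis .
    qed
    have fin: "?E (\<lambda>x. w x ^ Suc k) < \<infinity>" for k using X by (simp add: kondratiev_space_def)
    have "enn2real \<mu> powr (1 / p) \<le> (1 / 2) ^ k * ?N w" for k
    proof -
      have "enn2real \<mu> \<le> enn2real (?E (\<lambda>x. w x ^ Suc k))" using \<mu>E[of k] fin[of k] by (intro enn2real_mono) auto
      then have "enn2real \<mu> powr (1 / p) \<le> ?N (\<lambda>x. w x ^ Suc k)" unfolding kondratiev_norm_def using p by (intro powr_mono2) auto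
      then show ?thesis using Npow[of k] by linarith
    qed
    moreover have "(\<lambda>k. (1 / 2) ^ k * ?N w) \<longlonglongrightarrow> 0 * ?N w"
      by (intro tendsto_mult tendsto_const LIMSEQ_power_zero) simp
    ultimately have "enn2real \<mu> powr (1 / p) \<le> 0 * ?N w" by (intro LIMSEQ_le_const) auto
    then have "enn2real \<mu> = 0" by simp
    moreover have "\<mu> < \<infinity>" by (rule order_le_less_trans[OF \<mu>E[of 0] fin])
    ultimately have "\<mu> = 0" by (auto simp: enn2real_eq_0_iff)
    then have "AE x in lborel. indicator B x * ennreal ((norm x powr - a) powr p) = 0"
      unfolding \<mu>_def by (subst (asm) nn_integral_0_iff_AE) auto
    then have "AE x in lborel. x \<notin> B"
    proof eventually_elim
      case (elim x)
      show ?case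
      proof
        assume "x \<in> B"
        then have "x \<noteq> 0" using B(3) K(2) by auto
        with \<open>x \<in> B\<close> elim show False by (simp add: ennreal_eq_0_iff)
      qed
    qed
    then have "AE x in lebesgue. x \<notin> B" by (rule AE_completion)
    then have "B \<in> null_sets lebesgue" by (subst AE_iff_null_sets) auto
    then have "negligible B" by (simp add: negligible_iff_null_sets)
    then show False using open_not_negligible[OF B(1,2)] by simp
  qed
  then have "\<forall>w\<in>test_functions K. \<forall>B. open B \<longrightarrow> B \<noteq> {} \<longrightarrow> B \<subseteq> K \<longrightarrow> (\<forall>x\<in>B. w x = 1) \<longrightarrow> ennreal r \<le> ?E w"
    using not_less by blast
  then show ?thesis using r by (intro exI[of _ "ennreal r"]) simp
qed

lemma sum_null_sequence_small:
  fixes F :: "'a \<Rightarrow> nat \<Rightarrow> ennreal"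
  assumes "finite A" and F: "\<And>i. i \<in> A \<Longrightarrow> \<exists>C s. 0 < s \<and> (\<forall>N. F i N \<le> ennreal (C * real (Suc N) powr - s))" and "0 < \<epsilon>"
  shows "\<exists>N. (\<Sum>i\<in>A. F i N) < \<epsilon>"
proof -
  have "(\<lambda>N. F i N) \<longlonglongrightarrow> 0" if i: "i \<in> A" for i
  proof -
    obtain C s where s: "0 < s" and b: "\<And>N. F i N \<le> ennreal (C * real (Suc N) powr - s)" using F[OF i] by blast
    have "(\<lambda>N. C * real (Suc N) powr - s) \<longlonglongrightarrow> C * 0"
      by (intro tendsto_mult tendsto_const tendsto_neg_powr filterlim_compose[OF filterlim_real_sequentially filterlim_Suc]) (use s in simp)
    then have "(\<lambda>N. ennreal (C * real (Suc N) powr - s)) \<longlonglongrightarrow> ennreal 0" by (intro tendsto_ennrealI) simp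
    then have lim: "(\<lambda>N. ennreal (C * real (Suc N) powr - s)) \<longlonglongrightarrow> 0" by simp
    show ?thesis
      by (rule tendsto_sandwich[OF _ always_eventually[OF allI[OF b]] tendsto_const lim]) simp
  qed
  then have "(\<lambda>N. \<Sum>i\<in>A. F i N) \<longlonglongrightarrow> (\<Sum>i\<in>A. 0)" by (intro tendsto_sum)
  then have "\<forall>\<^sub>F N in sequentially. (\<Sum>i\<in>A. F i N) < \<epsilon>" using assms(3) by (intro order_tendstoD(2)) auto
  then show ?thesis by (auto simp: eventually_sequentially)
qed

text \<open>The common end of both counterexamples. Constants and rates may depend on the
  multi-index; with finitely many of them the total energy still falls below the threshold.\<close>

lemma no_small_plateaus:
  fixes K :: "(real^'n) set" and w :: "nat \<Rightarrow> real^'n \<Rightarrow> real"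
  assumes alg: "kondratiev_algebra m a p K" and K: "open K" "0 \<notin> K" and p: "1 \<le> p"
    and w: "\<And>N. w N \<in> test_functions K" and one: "\<And>N. \<exists>B. open B \<and> B \<noteq> {} \<and> B \<subseteq> K \<and> (\<forall>x\<in>B. w N x = 1)"
    and small: "\<And>\<alpha>. mi_order \<alpha> \<le> m \<Longrightarrow> \<exists>C s. 0 < s \<and> (\<forall>N. (\<integral>\<^sup>+x. indicator K x * weight_density a p (\<lambda>\<alpha>. multi_deriv \<alpha> (w N)) \<alpha> x \<partial>lborel) \<le> ennreal (C * real (Suc N) powr - s))"
  shows False
proof -
  obtain \<epsilon> where \<epsilon>: "0 < \<epsilon>" and ge: "\<forall>w\<in>test_functions K. \<forall>B. open B \<longrightarrow> B \<noteq> {} \<longrightarrow> B \<subseteq> K \<longrightarrow> (\<forall>x\<in>B. w x = 1) \<longrightarrow> \<epsilon> \<le> kondratiev_energy m a p K w"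
    using algebra_plateau[OF alg K p] by (elim exE conjE)
  obtain N where N: "(\<Sum>\<alpha> | mi_order \<alpha> \<le> m. \<integral>\<^sup>+x. indicator K x * weight_density a p (\<lambda>\<alpha>. multi_deriv \<alpha> (w N)) \<alpha> x \<partial>lborel) < \<epsilon>"
    using sum_null_sequence_small[OF finite_mi_order_le[where 'n = 'n and m = m] _ \<epsilon>, of "\<lambda>\<alpha> N. \<integral>\<^sup>+x. indicator K x * weight_density a p (\<lambda>\<alpha>. multi_deriv \<alpha> (w N)) \<alpha> x \<partial>lborel"] small
    by auto
  obtain B where "open B" "B \<noteq> {}" "B \<subseteq> K" "\<forall>x\<in>B. w N x = 1" using one[of N] by blast
  from ge[rule_format, OF w this(1-3), of N] this(4) have "\<epsilon> \<le> kondratiev_energy m a p K (w N)" by blast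
  with N show False unfolding test_energy[OF K(1) w] weight_energy_def by simp
qed

subsection \<open>A standard bump\<close>

text \<open>Steepness 2 makes the bump equal to 1 on the cube of half the size. Its support is
  bounded, crudely, by the ball whose radius is the dimension.\<close>

definition cube_bump :: "real^'n \<Rightarrow> real" where
  "cube_bump = box_bump 2 (\<chi> i. -1) (\<chi> i. 1)"

lemma smooth_cube_bump: "smooth cube_bump"
  unfolding cube_bump_def by (rule smooth_box_bump)

lemma cube_bump_test: "(cube_bump :: real^'n \<Rightarrow> real) \<in> test_functions UNIV"
  unfolding cube_bump_def by (rule box_bump_test) auto

lemma cube_bump_bounds: "0 \<le> cube_bump x" "cube_bump x \<le> 1"
  unfolding cube_bump_def by (rule box_bump_bounds)+

lemma cube_bump_one:
  fixes x :: "real^'n"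
  assumes "norm x \<le> 1 / 2"
  shows "cube_bump x = 1"
  unfolding cube_bump_def
proof (rule box_bump_one)
  fix i
  have "\<bar>x $ i\<bar> \<le> 1 / 2" using component_le_norm_cart[of x i] assms by linarith
  then show "(\<chi> i. - 1) $ i + 1 / 2 \<le> x $ i \<and> x $ i \<le> (\<chi> i. 1) $ i - 1 / 2" by auto
qed simp

lemma cube_bump_zero:
  fixes x :: "real^'n"
  assumes "real CARD('n) < norm x"
  shows "cube_bump x = 0"
  unfolding cube_bump_def
proof (rule box_bump_zero)
  show "x \<notin> box (\<chi> i. - 1) (\<chi> i. 1)"
  proof
    assume "x \<in> box (\<chi> i. - 1) (\<chi> i. 1)"
    then have "\<bar>x $ i\<bar> \<le> 1" for i by (auto simp: mem_box_cart abs_le_iff intro: less_imp_le)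
    then have "(\<Sum>i\<in>UNIV. \<bar>x $ i\<bar>) \<le> (\<Sum>i\<in>(UNIV :: 'n set). 1)" by (intro sum_mono)
    then show False using norm_le_l1_cart[of x] assms by simp
  qed
qed simp

text \<open>The bump is constant near the centre and far away, so proper derivatives live in an
  annulus. The ratio of its radii, twice the dimension, later dictates the lacunarity.\<close>

lemma cube_bump_deriv_annulus:
  fixes x :: "real^'n"
  assumes \<alpha>: "0 < mi_order \<alpha>" and x: "norm x < 1 / 2 \<or> real CARD('n) < norm x"
  shows "multi_deriv \<alpha> cube_bump x = 0"
  using x
proof
  assume "norm x < 1 / 2"
  then have "multi_deriv \<alpha> cube_bump x = multi_deriv \<alpha> (\<lambda>x. 1) x"
    by (intro multi_deriv_local[of "ball 0 (1 / 2)"] cube_bump_one smooth_cube_bump smooth_const) auto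
  \<comment> \<open>A constant is unchanged by the affine substitution with factor 0; the chain rule
    then produces the factor \<open>0 ^ mi_order \<alpha>\<close>, which vanishes as the order is
    positive.\<close>
  also have "\<dots> = 0 ^ mi_order \<alpha> * multi_deriv \<alpha> (\<lambda>x. 1) (0 *\<^sub>R (x - 0))"
    by (rule fun_cong[OF multi_deriv_affine[OF smooth_const]])
  also have "\<dots> = 0" using \<alpha> by (simp only: zero_power mult_zero_left)
  finally show ?thesis .
next
  assume x: "real CARD('n) < norm x"
  show ?thesis
    by (rule multi_deriv_zero_outside[OF smooth_cube_bump, of "cball 0 (real CARD('n))"])
       (use x in \<open>auto intro: cube_bump_zero\<close>)
qed

section \<open>Dilated bumps\<close>

lemma scaled_bump:
  fixes x0 :: "real^'n"
  assumes c: "0 < c" and sub: "cball x0 (real CARD('n) / c) \<subseteq> K"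
  shows "(\<lambda>x. cube_bump (c *\<^sub>R (x - x0))) \<in> test_functions K"
    "\<And>x. x \<notin> cball x0 (real CARD('n) / c) \<Longrightarrow> cube_bump (c *\<^sub>R (x - x0)) = 0"
    "\<And>x. x \<in> ball x0 (1 / (2 * c)) \<Longrightarrow> cube_bump (c *\<^sub>R (x - x0)) = 1"
proof -
  have n: "norm (c *\<^sub>R (x - x0)) = c * dist x0 x" for x using c by (simp add: dist_norm norm_minus_commute)
  show zero: "cube_bump (c *\<^sub>R (x - x0)) = 0" if "x \<notin> cball x0 (real CARD('n) / c)" for x
    by (rule cube_bump_zero, unfold n) (use that c in \<open>simp add: not_le field_simps\<close>)
  show "cube_bump (c *\<^sub>R (x - x0)) = 1" if "x \<in> ball x0 (1 / (2 * c))" for x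
    by (rule cube_bump_one, unfold n) (use that c in \<open>simp add: field_simps\<close>)
  show "(\<lambda>x. cube_bump (c *\<^sub>R (x - x0))) \<in> test_functions K"
    by (rule test_functionsI[OF smooth_affine[OF smooth_cube_bump] compact_cball sub]) (use zero in blast)
qed

lemma nn_integral_scaled:
  fixes f :: "real^'n \<Rightarrow> ennreal"
  assumes [measurable]: "f \<in> borel_measurable borel" and c: "0 < c"
  shows "(\<integral>\<^sup>+x. f (c *\<^sub>R (x - x0)) \<partial>lborel) = ennreal (c powr - real CARD('n)) * (\<integral>\<^sup>+x. f x \<partial>lborel)"
proof -
  have "(\<integral>\<^sup>+x. f (c *\<^sub>R (x - x0)) \<partial>lborel) = ennreal (\<bar>1 / c\<bar> ^ DIM(real^'n)) * (\<integral>\<^sup>+x. f (c *\<^sub>R (x0 + (1 / c) *\<^sub>R x - x0)) \<partial>lborel)"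
    by (rule nn_integral_scale) (use c in auto)
  also have "\<bar>1 / c\<bar> ^ DIM(real^'n) = c powr - real CARD('n)"
    using c by (simp add: powr_minus powr_realpow power_one_over inverse_eq_divide)
  also have "(\<integral>\<^sup>+x. f (c *\<^sub>R (x0 + (1 / c) *\<^sub>R x - x0)) \<partial>lborel) = (\<integral>\<^sup>+x. f x \<partial>lborel)" using c by simp
  finally show ?thesis .
qed

subsection \<open>The weight exponent\<close>

text \<open>Dilating a bump towards the vertex multiplies its energy by a power of the dilation
  factor with exponent \<open>d - a p\<close>.\<close>

lemma algebra_weight_bound:
  fixes K :: "(real^'n) set"
  assumes alg: "kondratiev_algebra m a p K" and K: "open K" "0 \<notin> K" "K \<noteq> {}" and p: "1 \<le> p"
    and star: "\<And>x t. x \<in> K \<Longrightarrow> 0 < t \<Longrightarrow> t \<le> 1 \<Longrightarrow> t *\<^sub>R x \<in> K"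
  shows "real CARD('n) / p \<le> a"
proof (rule ccontr)
  assume "\<not> real CARD('n) / p \<le> a"
  then have ap: "0 < real CARD('n) - a * p" using p by (simp add: field_simps)
  obtain x0 r where x0: "x0 \<in> K" and r: "0 < r" "cball x0 r \<subseteq> K" using K open_contains_cball by blast
  \<comment> \<open>With this scale the support of the bump, of radius \<open>d / c\<close>, fits
    into the given ball of radius \<open>r\<close>.\<close>
  define c where "c = real CARD('n) / r"
  have c: "0 < c" using r by (simp add: c_def)
  have sub: "cball x0 (real CARD('n) / c) \<subseteq> K" using r by (simp add: c_def)
  define \<phi> where "\<phi> x = cube_bump (c *\<^sub>R (x - x0))" for x
  have \<phi>: "\<phi> \<in> test_functions K" unfolding \<phi>_def by (rule scaled_bump(1)[OF c sub])
  have s\<phi>: "smooth \<phi>" by (rule test_functionsD(1)[OF \<phi>])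
  obtain C where C: "compact C" "C \<subseteq> K" "\<forall>x. x \<notin> C \<longrightarrow> \<phi> x = 0" using test_functionsD(2)[OF \<phi>] by blast
  define w where "w N x = \<phi> (real (Suc N) *\<^sub>R (x - 0))" for N x
  have wtest: "w N \<in> test_functions K" for N
    unfolding w_def
  proof (rule test_functionsI[OF smooth_affine[OF s\<phi>]])
    show "compact ((\<lambda>x. (1 / real (Suc N)) *\<^sub>R x) ` C)" using C(1) by (rule compact_scaling)
    show "(\<lambda>x. (1 / real (Suc N)) *\<^sub>R x) ` C \<subseteq> K" using C(2) by (auto intro!: star)
    fix x assume "\<phi> (real (Suc N) *\<^sub>R (x - 0)) \<noteq> 0"
    then have "real (Suc N) *\<^sub>R x \<in> C" using C(3) by auto
    then show "x \<in> (\<lambda>x. (1 / real (Suc N)) *\<^sub>R x) ` C" by (intro image_eqI[of _ _ "real (Suc N) *\<^sub>R x"]) auto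
  qed
  show False
  proof (rule no_small_plateaus[OF alg K(1,2) p wtest])
    fix N
    \<comment> \<open>Dilation carries the first ball into the plateau of the bump and the second
      into the ball inside \<open>K\<close>; as \<open>K\<close> is closed under contraction, the
      intersection lies in \<open>K\<close>.\<close>
    let ?B = "(\<lambda>x. real (Suc N) *\<^sub>R x) -` ball x0 (1 / (2 * c)) \<inter> (\<lambda>x. real (Suc N) *\<^sub>R x) -` ball x0 r"
    have "open ?B" by (intro open_Int open_vimage open_ball continuous_intros)
    moreover have "(1 / real (Suc N)) *\<^sub>R x0 \<in> ?B" using c r by simp
    moreover have "?B \<subseteq> K"
    proof
      fix x assume "x \<in> ?B"
      then have "real (Suc N) *\<^sub>R x \<in> K" using r(2) by auto
      from star[OF this, of "1 / real (Suc N)"] show "x \<in> K" by simp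
    qed
    moreover have "\<forall>x\<in>?B. w N x = 1" unfolding w_def \<phi>_def by (auto intro: scaled_bump(3)[OF c sub])
    ultimately show "\<exists>B. open B \<and> B \<noteq> {} \<and> B \<subseteq> K \<and> (\<forall>x\<in>B. w N x = 1)" by blast
  next
    fix \<alpha> :: "'n \<Rightarrow> nat" assume \<alpha>: "mi_order \<alpha> \<le> m"
    let ?I = "\<integral>\<^sup>+x. indicator K x * weight_density a p (\<lambda>\<alpha>. multi_deriv \<alpha> \<phi>) \<alpha> x \<partial>lborel"
    have [measurable]: "multi_deriv \<alpha> \<phi> \<in> borel_measurable borel" "K \<in> sets borel"
      using K(1) by (auto intro: smooth_borel smooth_multi_deriv[OF s\<phi>])
    have fin: "?I < \<infinity>"
    proof -
      have "0 \<notin> C" using C(2) K(2) by auto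
      from powr_bounded_compact[OF C(1) this] obtain W where W: "\<forall>x\<in>C. norm x powr (real (mi_order \<alpha>) - a) \<le> W" by blast
      show ?thesis
        by (rule order_le_less_trans[OF test_density_bound[OF s\<phi> compact_imp_closed[OF C(1)] _ _ W]])
           (use p C(3) test_powr_integral_finite[OF test_functions_multi_deriv[OF \<phi>]] in \<open>auto simp: ennreal_mult_less_top\<close>)
    qed
    have "(\<integral>\<^sup>+x. indicator K x * weight_density a p (\<lambda>\<alpha>. multi_deriv \<alpha> (w N)) \<alpha> x \<partial>lborel)
      \<le> ennreal (enn2real ?I * real (Suc N) powr - (real CARD('n) - a * p))" for N
    proof -
      let ?n = "real (Suc N)" and ?s = "real (mi_order \<alpha>) - a"
      let ?g = "\<lambda>x. indicator K x * weight_density a p (\<lambda>\<alpha>. multi_deriv \<alpha> \<phi>) \<alpha> x"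
      have gm: "?g \<in> borel_measurable borel" unfolding weight_density_def by measurable
      have pt: "indicator K x * weight_density a p (\<lambda>\<alpha>. multi_deriv \<alpha> (w N)) \<alpha> x \<le> ennreal (?n powr (a * p)) * ?g (?n *\<^sub>R (x - 0))" for x
      proof (cases "?n *\<^sub>R x \<in> C")
        case True
        then have nK: "?n *\<^sub>R x \<in> K" using C(2) by auto
        \<comment> \<open>The order of the derivative cancels: for every \<open>\<alpha>\<close> the
          dilation by n contributes the same factor \<open>n powr a\<close>, and the Jacobian then
          turns \<open>n powr (a * p)\<close> into \<open>n powr (a * p - d)\<close>.\<close>
        have "norm x powr ?s * ?n ^ mi_order \<alpha> = ?n powr a * norm (?n *\<^sub>R x) powr ?s"
        proof -
          have "?n ^ mi_order \<alpha> = ?n powr (a + ?s)" by (simp add: powr_realpow)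
          also have "\<dots> = ?n powr a * ?n powr ?s" by (rule powr_add)
          finally show ?thesis by (simp add: powr_mult)
        qed
        then have eq: "norm x powr ?s * multi_deriv \<alpha> (w N) x = ?n powr a * (norm (?n *\<^sub>R x) powr ?s * multi_deriv \<alpha> \<phi> (?n *\<^sub>R x))"
          unfolding w_def multi_deriv_affine[OF s\<phi>] by (simp only: mult.assoc[symmetric] diff_zero)
        have "\<bar>?n powr a * Z\<bar> powr p = ?n powr (a * p) * \<bar>Z\<bar> powr p" for Z
          by (simp add: abs_mult powr_mult powr_powr del: of_nat_Suc)
        then have "weight_density a p (\<lambda>\<alpha>. multi_deriv \<alpha> (w N)) \<alpha> x = ennreal (?n powr (a * p)) * weight_density a p (\<lambda>\<alpha>. multi_deriv \<alpha> \<phi>) \<alpha> (?n *\<^sub>R x)"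
          unfolding weight_density_def eq by (simp only: ennreal_mult' powr_ge_zero)
        then have "weight_density a p (\<lambda>\<alpha>. multi_deriv \<alpha> (w N)) \<alpha> x = ennreal (?n powr (a * p)) * ?g (?n *\<^sub>R (x - 0))"
          using nK by (simp del: of_nat_Suc)
        then show ?thesis by (cases "x \<in> K") (simp_all del: of_nat_Suc diff_zero)
      next
        case False
        then have "multi_deriv \<alpha> \<phi> (?n *\<^sub>R x) = 0"
          using multi_deriv_zero_outside[OF s\<phi> compact_imp_closed[OF C(1)]] C(3) by blast
        then have "multi_deriv \<alpha> (w N) x = 0" unfolding w_def multi_deriv_affine[OF s\<phi>] by simp
        then show ?thesis by (simp add: weight_density_def)
      qed
      have gm': "(\<lambda>x. ?g (?n *\<^sub>R (x - 0))) \<in> borel_measurable lborel"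
        using gm by (intro measurable_compose[OF _ gm]) measurable
      have "(\<integral>\<^sup>+x. indicator K x * weight_density a p (\<lambda>\<alpha>. multi_deriv \<alpha> (w N)) \<alpha> x \<partial>lborel) \<le> (\<integral>\<^sup>+x. ennreal (?n powr (a * p)) * ?g (?n *\<^sub>R (x - 0)) \<partial>lborel)"
        by (intro nn_integral_mono pt)
      also have "\<dots> = ennreal (?n powr (a * p)) * (\<integral>\<^sup>+x. ?g (?n *\<^sub>R (x - 0)) \<partial>lborel)" by (rule nn_integral_cmult[OF gm'])
      also have "\<dots> = ennreal (?n powr (a * p)) * (ennreal (?n powr - real CARD('n)) * ?I)"
        using nn_integral_scaled[OF gm, of ?n 0] by simp
      also have "\<dots> = ennreal (?n powr (a * p)) * (ennreal (?n powr - real CARD('n)) * ennreal (enn2real ?I))" using fin by simp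
      also have "\<dots> = ennreal (enn2real ?I * (?n powr (a * p) * ?n powr - real CARD('n)))" by (simp add: ennreal_mult' mult_ac del: of_nat_Suc)
      also have "?n powr (a * p) * ?n powr - real CARD('n) = ?n powr - (real CARD('n) - a * p)" by (simp add: powr_add[symmetric] del: of_nat_Suc)
      finally show ?thesis .
    qed
    then show "\<exists>C s. 0 < s \<and> (\<forall>N. (\<integral>\<^sup>+x. indicator K x * weight_density a p (\<lambda>\<alpha>. multi_deriv \<alpha> (w N)) \<alpha> x \<partial>lborel) \<le> ennreal (C * real (Suc N) powr - s))"
      using ap by (intro exI[of _ "enn2real ?I"] exI[of _ "real CARD('n) - a * p"] conjI allI)
  qed
qed

subsection \<open>The smoothness exponent\<close>

lemma sum_single_powr:
  fixes t :: "'a \<Rightarrow> real"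
  assumes S: "finite S" and t: "\<And>i j. i \<in> S \<Longrightarrow> j \<in> S \<Longrightarrow> i \<noteq> j \<Longrightarrow> t i = 0 \<or> t j = 0"
  shows "\<bar>\<Sum>i\<in>S. t i\<bar> powr p = (\<Sum>i\<in>S. \<bar>t i\<bar> powr p)"
proof (cases "\<exists>i\<in>S. t i \<noteq> 0")
  case True
  then obtain i where i: "i \<in> S" "t i \<noteq> 0" by blast
  then have z: "t j = 0" if "j \<in> S - {i}" for j using t[OF i(1), of j] that by auto
  show ?thesis unfolding sum.remove[OF S i(1)] using z by simp
qed simp

lemma nn_integral_dilates:
  fixes h :: "real^'n \<Rightarrow> ennreal"
  assumes [measurable]: "h \<in> borel_measurable borel" and R: "\<And>k. 0 < R k" and c: "\<And>k. 0 \<le> c k"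
  shows "(\<integral>\<^sup>+x. (\<Sum>k<(n::nat). ennreal (c k) * h (R k *\<^sub>R (x - x0))) \<partial>lborel) = ennreal (\<Sum>k<n. c k * R k powr - real CARD('n)) * (\<integral>\<^sup>+x. h x \<partial>lborel)"
proof -
  have m: "(\<lambda>x. h (R k *\<^sub>R (x - x0))) \<in> borel_measurable lborel" for k by measurable
  have "(\<integral>\<^sup>+x. (\<Sum>k<n. ennreal (c k) * h (R k *\<^sub>R (x - x0))) \<partial>lborel) = (\<Sum>k<n. \<integral>\<^sup>+x. ennreal (c k) * h (R k *\<^sub>R (x - x0)) \<partial>lborel)"
    by (rule nn_integral_sum) measurable
  also have "\<dots> = (\<Sum>k<n. ennreal (c k * R k powr - real CARD('n)) * (\<integral>\<^sup>+x. h x \<partial>lborel))"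
    by (intro sum.cong refl) (simp add: nn_integral_cmult[OF m] nn_integral_scaled R c ennreal_mult mult.assoc)
  also have "\<dots> = ennreal (\<Sum>k<n. c k * R k powr - real CARD('n)) * (\<integral>\<^sup>+x. h x \<partial>lborel)"
    using c by (simp add: sum_distrib_right[symmetric] sum_ennreal)
  finally show ?thesis .
qed

lemma sum_half_powers_le: "(\<Sum>k<n. (1 / 2 :: real) ^ k) \<le> 2"
proof -
  have "(\<Sum>k<n. (1 / 2 :: real) ^ k) = 2 - 2 * (1 / 2) ^ n" by (induction n) auto
  then show ?thesis by simp
qed

text \<open>Averages of bumps at lacunary scales around one point: the derivatives of the summands
  have disjoint supports, so that averaging makes even the scale-invariant energies small.\<close>

lemma algebra_smoothness_bound:
  fixes K :: "(real^'n) set"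
  assumes alg: "kondratiev_algebra m a p K" and K: "open K" "0 \<notin> K" "K \<noteq> {}" and p: "1 \<le> p"
  shows "1 < p \<and> real CARD('n) / p < real m \<or> p = 1 \<and> CARD('n) \<le> m"
proof (rule ccontr)
  assume neg: "\<not> ?thesis"
  let ?d = "real CARD('n)"
  have d1: "1 \<le> ?d" using zero_less_card_finite[where 'a = 'n] by linarith
  \<comment> \<open>For p = 1 integrality improves \<open>m < d\<close> to
    \<open>m + 1 \<le> d\<close>, which is used to sum a geometric series; for p > 1 the equality
    \<open>m * p = d\<close> is included.\<close>
  have crit: "1 < p \<and> real m * p \<le> ?d \<or> p = 1 \<and> real m + 1 \<le> ?d"
  proof (cases "p = 1")
    case True
    then have "Suc m \<le> CARD('n)" using neg by simp
    then have "real (Suc m) \<le> ?d" by (simp only: of_nat_le_iff)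
    then show ?thesis using True by simp
  next
    case False
    then show ?thesis using neg p by (simp add: field_simps)
  qed
  obtain x0 r where r: "0 < r" "cball x0 r \<subseteq> K" using K open_contains_cball by blast
  \<comment> \<open>Larger than the ratio 2d of the annulus that carries the derivatives of a bump,
    so annuli of different scales are disjoint.\<close>
  define Q where "Q = 2 * ?d + 1"
  \<comment> \<open>The prefactor keeps all supports inside the ball of radius \<open>r\<close> and
    all scales at least 1.\<close>
  define R where "R k = max 1 (?d / r) * Q ^ k" for k
  have Q: "2 \<le> Q" "1 \<le> Q" unfolding Q_def using d1 by linarith+
  have RQ: "Q ^ k \<le> R k" for k unfolding R_def using Q mult_right_mono[of 1 "max 1 (?d / r)" "Q ^ k"] by simp
  have R1: "1 \<le> R k" for k using RQ[of k] one_le_power[OF Q(2), of k] by linarith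
  then have R0: "0 < R k" for k by (rule less_le_trans[OF zero_less_one])
  have R2: "2 ^ k \<le> R k" for k using RQ[of k] power_mono[OF Q(1), of k] by simp
  have Rmono: "R j \<le> R k" if "j \<le> k" for j k
    unfolding R_def using Q(2) that by (intro mult_left_mono power_increasing) auto
  have Rstep: "Q * R j \<le> R k" if "j < k" for j k
    using Rmono[of "Suc j" k] that by (simp add: R_def mult_ac)
  have Rr: "?d / R k \<le> r" for k
  proof -
    have "?d / r \<le> R k" using Rmono[of 0 k] by (simp add: R_def)
    then show ?thesis using r(1) R0[of k] by (simp add: field_simps)
  qed
  have sub: "cball x0 (?d / R k) \<subseteq> cball x0 r" for k using Rr by (intro subset_cball) auto
  define b where "b k x = cube_bump (R k *\<^sub>R (x - x0))" for k x
  have sb: "smooth (b k)" for k unfolding b_def by (rule smooth_affine[OF smooth_cube_bump])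
  have b0: "b k x = 0" if "x \<notin> cball x0 r" for k x
    unfolding b_def using scaled_bump(2)[OF R0 subset_UNIV] sub[of k] that by blast
  define w where "w N x = (1 / real (Suc N)) * (\<Sum>k<Suc N. b k x)" for N x
  have sw: "smooth (w N)" for N unfolding w_def by (intro smooth_cmult smooth_sum sb)
  have w0: "w N x = 0" if "x \<notin> cball x0 r" for N x unfolding w_def using b0[OF that] by simp
  have wtest: "w N \<in> test_functions K" for N
    by (rule test_functionsI[OF sw compact_cball r(2)]) (use w0 in blast)
  have Dw: "multi_deriv \<alpha> (w N) x = (\<Sum>k<Suc N. 1 / real (Suc N) * (R k ^ mi_order \<alpha> * multi_deriv \<alpha> cube_bump (R k *\<^sub>R (x - x0))))" for \<alpha> N x
    unfolding w_def multi_deriv_cmult[OF smooth_sum[OF sb]] multi_deriv_sum[OF finite_lessThan sb]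
    unfolding b_def multi_deriv_affine[OF smooth_cube_bump] sum_distrib_left ..
  \<comment> \<open>As \<open>R k \<ge> 2 ^ k\<close>, exponents of at most -1 lead to geometric
    series with a sum bounded independently of \<open>N\<close>.\<close>
  have half: "R k powr s \<le> (1 / 2) ^ k" if "s \<le> -1" for k s
  proof -
    have "R k powr s \<le> R k powr -1" using that R1[of k] by (intro powr_mono) auto
    also have "\<dots> = 1 / R k" using R0[of k] by (simp add: powr_minus_divide)
    also have "\<dots> \<le> 1 / 2 ^ k" using R2[of k] by (intro divide_left_mono) (auto intro!: mult_pos_pos R0)
    finally show ?thesis by (simp add: power_one_over)
  qed
  show False
  proof (rule no_small_plateaus[OF alg K(1,2) p wtest])
    fix N
    have "1 / (2 * R N) \<le> r"
    proof -
      have "1 / 2 / R N \<le> ?d / R N" by (rule divide_right_mono) (use d1 R0[of N] in linarith)+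
      then show ?thesis using Rr[of N] by simp
    qed
    then have "ball x0 (1 / (2 * R N)) \<subseteq> K" using r(2) by (meson ball_subset_cball subset_ball subset_trans)
    moreover have "w N x = 1" if x: "x \<in> ball x0 (1 / (2 * R N))" for x
    proof -
      have "b k x = 1" if "k < Suc N" for k
      proof -
        have "1 / (2 * R N) \<le> 1 / (2 * R k)" using Rmono[of k N] that R0 by (intro divide_left_mono) auto
        then have "x \<in> ball x0 (1 / (2 * R k))" using x by auto
        then show ?thesis unfolding b_def by (rule scaled_bump(3)[OF R0 subset_UNIV])
      qed
      then have "(\<Sum>k<Suc N. b k x) = (\<Sum>k<Suc N. 1)" by (intro sum.cong) auto
      then show ?thesis unfolding w_def by simp
    qed
    moreover have "ball x0 (1 / (2 * R N)) \<noteq> {}" using R0[of N] by simp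
    ultimately show "\<exists>B. open B \<and> B \<noteq> {} \<and> B \<subseteq> K \<and> (\<forall>x\<in>B. w N x = 1)"
      by (intro exI[of _ "ball x0 (1 / (2 * R N))"]) auto
  next
    fix \<alpha> :: "'n \<Rightarrow> nat" assume \<alpha>: "mi_order \<alpha> \<le> m"
    have unweighted: "\<exists>C s. 0 < s \<and> 0 \<le> C \<and> (\<forall>N. (\<integral>\<^sup>+x. ennreal (\<bar>multi_deriv \<alpha> (w N) x\<bar> powr p) \<partial>lborel) \<le> ennreal (C * real (Suc N) powr - s))"
    proof (cases "mi_order \<alpha> = 0")
      case True
      then have \<alpha>0: "\<alpha> = (\<lambda>_. 0)" by (auto simp: mi_order_def)
      \<comment> \<open>Without derivatives the supports are nested instead of disjoint. Since
        \<open>w N\<close> takes values between 0 and 1, its p-th power is at most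
        \<open>w N\<close> itself; the integrals of the single bumps are summable, and the factor
        1/(N+1) of the average gives the decay.\<close>
      define h :: "real^'n \<Rightarrow> ennreal" where "h x = ennreal (\<bar>cube_bump x\<bar> powr 1)" for x
      have hm[measurable]: "h \<in> borel_measurable borel"
        unfolding h_def using smooth_borel[OF smooth_cube_bump] by measurable
      define j where "j = enn2real (\<integral>\<^sup>+x. h x \<partial>lborel)"
      have j: "(\<integral>\<^sup>+x. h x \<partial>lborel) = ennreal j" "0 \<le> j"
      proof -
        have "(\<integral>\<^sup>+x. h x \<partial>lborel) < \<infinity>" unfolding h_def by (rule test_powr_integral_finite[OF cube_bump_test]) simp
        then show "(\<integral>\<^sup>+x. h x \<partial>lborel) = ennreal j" "0 \<le> j" unfolding j_def by simp_all
      qed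
      have "(\<integral>\<^sup>+x. ennreal (\<bar>w N x\<bar> powr p) \<partial>lborel) \<le> ennreal (2 * j * real (Suc N) powr - 1)" for N
      proof -
        let ?n = "real (Suc N)"
        have pt: "ennreal (\<bar>w N x\<bar> powr p) \<le> (\<Sum>k<Suc N. ennreal (1 / ?n) * h (R k *\<^sub>R (x - x0)))" for x
        proof -
          have w: "0 \<le> w N x" unfolding w_def b_def by (intro mult_nonneg_nonneg sum_nonneg cube_bump_bounds) simp
          have "(\<Sum>k<Suc N. b k x) \<le> (\<Sum>k<Suc N. 1)" unfolding b_def by (intro sum_mono cube_bump_bounds)
          then have w1: "w N x \<le> 1" unfolding w_def by (simp add: field_simps)
          have "\<bar>w N x\<bar> powr p \<le> \<bar>w N x\<bar> powr 1" using w w1 p by (intro powr_mono') auto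
          also have "\<dots> = (\<Sum>k<Suc N. 1 / ?n * \<bar>b k x\<bar> powr 1)"
          proof -
            have bp: "\<bar>b k x\<bar> powr 1 = b k x" for k unfolding b_def using cube_bump_bounds(1)[of "R k *\<^sub>R (x - x0)"] by simp
            have "\<bar>w N x\<bar> powr 1 = w N x" using w by simp
            then show ?thesis unfolding bp w_def sum_distrib_left .
          qed
          finally have "ennreal (\<bar>w N x\<bar> powr p) \<le> ennreal (\<Sum>k<Suc N. 1 / ?n * \<bar>b k x\<bar> powr 1)" by (rule ennreal_leI)
          also have "\<dots> = (\<Sum>k<Suc N. ennreal (1 / ?n * \<bar>b k x\<bar> powr 1))" by (rule sum_ennreal[symmetric]) simp
          also have "\<dots> = (\<Sum>k<Suc N. ennreal (1 / ?n) * h (R k *\<^sub>R (x - x0)))"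
            unfolding h_def b_def by (intro sum.cong refl ennreal_mult) simp_all
          finally show ?thesis .
        qed
        have "(\<integral>\<^sup>+x. ennreal (\<bar>w N x\<bar> powr p) \<partial>lborel) \<le> (\<integral>\<^sup>+x. (\<Sum>k<Suc N. ennreal (1 / ?n) * h (R k *\<^sub>R (x - x0))) \<partial>lborel)"
          by (intro nn_integral_mono pt)
        also have "\<dots> = ennreal (\<Sum>k<Suc N. 1 / ?n * R k powr - ?d) * ennreal j"
          unfolding j(1)[symmetric] by (rule nn_integral_dilates[OF hm R0]) simp
        also have "\<dots> \<le> ennreal (1 / ?n * 2) * ennreal j"
        proof (intro mult_right_mono ennreal_leI)
          have "(\<Sum>k<Suc N. R k powr - ?d) \<le> (\<Sum>k<Suc N. (1 / 2) ^ k)" using d1 by (intro sum_mono half) simp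
          also have "\<dots> \<le> 2" by (rule sum_half_powers_le)
          finally show "(\<Sum>k<Suc N. 1 / ?n * R k powr - ?d) \<le> 1 / ?n * 2"
            unfolding sum_distrib_left[symmetric] by (rule mult_left_mono) simp
        qed simp
        also have "\<dots> = ennreal (1 / ?n * 2 * j)" using j(2) by (intro ennreal_mult[symmetric]) auto
        also have "1 / ?n * 2 * j = 2 * j * ?n powr - 1" by (simp add: powr_minus_divide del: of_nat_Suc)
        finally show ?thesis .
      qed
      then show ?thesis using j(2) unfolding \<alpha>0 multi_deriv_zero
        by (intro exI[of _ "2 * j"] exI[of _ 1] conjI allI) auto
    next
      case False
      define h :: "real^'n \<Rightarrow> ennreal" where "h x = ennreal (\<bar>multi_deriv \<alpha> cube_bump x\<bar> powr p)" for x
      have hm[measurable]: "h \<in> borel_measurable borel"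
        unfolding h_def using smooth_borel[OF smooth_multi_deriv[OF smooth_cube_bump]] by measurable
      define j where "j = enn2real (\<integral>\<^sup>+x. h x \<partial>lborel)"
      have j: "(\<integral>\<^sup>+x. h x \<partial>lborel) = ennreal j" "0 \<le> j"
      proof -
        have "(\<integral>\<^sup>+x. h x \<partial>lborel) < \<infinity>"
          unfolding h_def by (rule test_powr_integral_finite[OF test_functions_multi_deriv[OF cube_bump_test]]) (use p in simp)
        then show "(\<integral>\<^sup>+x. h x \<partial>lborel) = ennreal j" "0 \<le> j" unfolding j_def by simp_all
      qed
      \<comment> \<open>The sum over all scales of the p-th power of the derivative factor times the
        volume factor; disjointness of supports turns the power of the sum into the sum of the
        powers.\<close>
      define T where "T N = (\<Sum>k<Suc N. R k powr (real (mi_order \<alpha>) * p - ?d))" for N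
      have T: "0 \<le> T N" for N unfolding T_def by (intro sum_nonneg) simp
      have main: "(\<integral>\<^sup>+x. ennreal (\<bar>multi_deriv \<alpha> (w N) x\<bar> powr p) \<partial>lborel) = ennreal (real (Suc N) powr - p * T N * j)" for N
      proof -
        let ?n = "real (Suc N)"
        let ?c = "\<lambda>k. ?n powr - p * R k powr (real (mi_order \<alpha>) * p)"
        have pt: "ennreal (\<bar>multi_deriv \<alpha> (w N) x\<bar> powr p) = (\<Sum>k<Suc N. ennreal (?c k) * h (R k *\<^sub>R (x - x0)))" for x
        proof -
          let ?t = "\<lambda>k. 1 / ?n * (R k ^ mi_order \<alpha> * multi_deriv \<alpha> cube_bump (R k *\<^sub>R (x - x0)))"
          \<comment> \<open>Either \<open>x\<close> lies in the inner constant region of the wider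
            bump, or, by the choice of \<open>Q\<close>, it lies beyond the support of the narrower
            one.\<close>
          have ord: "?t i = 0 \<or> ?t k = 0" if "i < k" for i k
          proof (cases "R i * norm (x - x0) < 1 / 2")
            case True
            then have "multi_deriv \<alpha> cube_bump (R i *\<^sub>R (x - x0)) = 0"
              using False R0[of i] by (intro cube_bump_deriv_annulus) auto
            then show ?thesis by simp
          next
            case False2: False
            have "?d < Q * (1 / 2)" by (simp add: Q_def)
            also have "\<dots> \<le> Q * (R i * norm (x - x0))" using False2 Q by (intro mult_left_mono) auto
            also have "\<dots> \<le> R k * norm (x - x0)" using mult_right_mono[OF Rstep[OF that], of "norm (x - x0)"] by (simp add: mult.assoc)
            finally have "multi_deriv \<alpha> cube_bump (R k *\<^sub>R (x - x0)) = 0"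
              using False R0[of k] by (intro cube_bump_deriv_annulus) auto
            then show ?thesis by simp
          qed
          have disj: "?t i = 0 \<or> ?t k = 0" if "i \<noteq> k" for i k
            using ord[of i k] ord[of k i] that by (metis linorder_neqE_nat)
          have t: "\<bar>?t k\<bar> powr p = ?c k * \<bar>multi_deriv \<alpha> cube_bump (R k *\<^sub>R (x - x0))\<bar> powr p" for k
          proof -
            have e1: "\<bar>?t k\<bar> = 1 / ?n * (R k powr real (mi_order \<alpha>) * \<bar>multi_deriv \<alpha> cube_bump (R k *\<^sub>R (x - x0))\<bar>)"
              using R0[of k] by (simp add: abs_mult powr_realpow del: of_nat_Suc)
            have e2: "(1 / ?n) powr p = ?n powr - p" by (simp add: powr_divide powr_minus_divide del: of_nat_Suc)
            show ?thesis
              by (simp only: e1 e2 powr_mult powr_powr mult.assoc of_nat_0_le_iff abs_ge_zero powr_ge_zero mult_nonneg_nonneg zero_le_divide_1_iff)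
          qed
          have "\<bar>multi_deriv \<alpha> (w N) x\<bar> powr p = (\<Sum>k<Suc N. \<bar>?t k\<bar> powr p)"
            unfolding Dw by (rule sum_single_powr[OF finite_lessThan disj])
          also have "ennreal \<dots> = (\<Sum>k<Suc N. ennreal (\<bar>?t k\<bar> powr p))" by (rule sum_ennreal[symmetric]) simp
          also have "\<dots> = (\<Sum>k<Suc N. ennreal (?c k) * h (R k *\<^sub>R (x - x0)))"
            unfolding t h_def by (intro sum.cong refl ennreal_mult) simp_all
          finally show ?thesis .
        qed
        have "(\<integral>\<^sup>+x. ennreal (\<bar>multi_deriv \<alpha> (w N) x\<bar> powr p) \<partial>lborel) = ennreal (\<Sum>k<Suc N. ?c k * R k powr - ?d) * ennreal j"
          unfolding pt j(1)[symmetric] by (rule nn_integral_dilates[OF hm R0]) simp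
        also have "(\<Sum>k<Suc N. ?c k * R k powr - ?d) = ?n powr - p * T N"
          unfolding T_def sum_distrib_left mult.assoc powr_add[symmetric] by simp
        finally show ?thesis using T j(2) by (simp add: ennreal_mult')
      qed
      show ?thesis
      proof (cases "p = 1")
        case True
        \<comment> \<open>At p = 1 the exponent is at most -1, so the sum is bounded and the decay
          1/(N+1) comes from the averaging alone.\<close>
        have "T N \<le> 2" for N
        proof -
          have "T N \<le> (\<Sum>k<Suc N. (1 / 2) ^ k)" unfolding T_def using crit True \<alpha> by (intro sum_mono half) auto
          also have "\<dots> \<le> 2" by (rule sum_half_powers_le)
          finally show ?thesis .
        qed
        then have "real (Suc N) powr - p * T N * j \<le> 2 * j * real (Suc N) powr - 1" for N
          using True mult_left_mono[of "T N" 2 "real (Suc N) powr - 1 * j"] j(2) by (simp add: mult_ac)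
        then show ?thesis unfolding main using j(2)
          by (intro exI[of _ "2 * j"] exI[of _ 1] conjI allI ennreal_leI) auto
      next
        case pn: False
        \<comment> \<open>For p > 1 the exponent is merely nonpositive and each of the N+1 terms is
          at most 1; against the factor \<open>real (Suc N) powr - p\<close> of the average this
          leaves the exponent 1 - p, which is negative.\<close>
        have "real (mi_order \<alpha>) * p \<le> real m * p" using \<alpha> p by (intro mult_right_mono) auto
        then have "real (mi_order \<alpha>) * p - ?d \<le> 0" using crit pn by linarith
        then have "R k powr (real (mi_order \<alpha>) * p - ?d) \<le> 1" for k
          using powr_mono[of "real (mi_order \<alpha>) * p - ?d" 0 "R k"] R1[of k] R0[of k] by simp
        then have "T N \<le> (\<Sum>k<Suc N. 1)" for N unfolding T_def by (intro sum_mono)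
        then have TN: "T N \<le> real (Suc N)" for N by simp
        have "real (Suc N) powr - p * T N * j \<le> j * real (Suc N) powr - (p - 1)" for N
        proof -
          have "real (Suc N) powr - p * T N * j \<le> real (Suc N) powr - p * real (Suc N) * j"
            using TN j(2) by (intro mult_right_mono mult_left_mono) auto
          also have "real (Suc N) powr - p * real (Suc N) = real (Suc N) powr (- p + 1)"
            unfolding powr_add by (simp del: of_nat_Suc)
          finally show ?thesis by (simp add: mult.commute del: of_nat_Suc)
        qed
        then show ?thesis unfolding main using j(2) p pn
          by (intro exI[of _ j] exI[of _ "p - 1"] conjI allI ennreal_leI) auto
      qed
    qed
    then obtain C s where s: "0 < s" and C: "0 \<le> C" and Cs: "\<And>N. (\<integral>\<^sup>+x. ennreal (\<bar>multi_deriv \<alpha> (w N) x\<bar> powr p) \<partial>lborel) \<le> ennreal (C * real (Suc N) powr - s)"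
      by blast
    \<comment> \<open>The construction takes place at a fixed distance from the vertex, where the
      weights are bounded; hence the value of \<open>a\<close> does not matter here.\<close>
    have "0 \<notin> cball x0 r" using r(2) K(2) by blast
    from powr_bounded_compact[OF compact_cball this] obtain W where W: "\<forall>x\<in>cball x0 r. norm x powr (real (mi_order \<alpha>) - a) \<le> W" by blast
    have "(\<integral>\<^sup>+x. indicator K x * weight_density a p (\<lambda>\<alpha>. multi_deriv \<alpha> (w N)) \<alpha> x \<partial>lborel) \<le> ennreal ((W powr p * C) * real (Suc N) powr - s)" for N
    proof -
      have "(\<integral>\<^sup>+x. indicator K x * weight_density a p (\<lambda>\<alpha>. multi_deriv \<alpha> (w N)) \<alpha> x \<partial>lborel) \<le> ennreal (W powr p) * (\<integral>\<^sup>+x. ennreal (\<bar>multi_deriv \<alpha> (w N) x\<bar> powr p) \<partial>lborel)"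
        by (rule test_density_bound[OF sw closed_cball w0 _ W]) (use p in auto)
      also have "\<dots> \<le> ennreal (W powr p) * ennreal (C * real (Suc N) powr - s)"
        by (intro mult_left_mono Cs) simp
      also have "\<dots> = ennreal ((W powr p * C) * real (Suc N) powr - s)" using C by (simp add: ennreal_mult'[symmetric] mult.assoc)
      finally show ?thesis .
    qed
    then show "\<exists>C s. 0 < s \<and> (\<forall>N. (\<integral>\<^sup>+x. indicator K x * weight_density a p (\<lambda>\<alpha>. multi_deriv \<alpha> (w N)) \<alpha> x \<partial>lborel) \<le> ennreal (C * real (Suc N) powr - s))"
      by (intro exI[of _ "W powr p * C"] exI[of _ s] conjI allI s)
  qed
qed

subsection \<open>The characterization\<close>

lemma opening_angle_open_cone:
  assumes "has_opening_angle k \<gamma> K'" and \<gamma>: "0 < \<gamma>" "\<gamma> < pi"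
  shows "\<exists>e. norm e = 1 \<and> K' \<inter> ball 0 1 = open_cone e (cos \<gamma>)"
proof -
  from assms(1) obtain e where "e = axis k 1 \<or> e = - axis k 1"
    and K': "K' = {x. x \<noteq> 0 \<and> arccos ((x \<bullet> e) / norm x) < \<gamma>}"
    unfolding has_opening_angle_def by blast
  then have e: "norm e = 1" by auto
  have "arccos ((x \<bullet> e) / norm x) < \<gamma> \<longleftrightarrow> cos \<gamma> * norm x < x \<bullet> e" if "x \<noteq> 0" for x
  proof -
    have b: "\<bar>(x \<bullet> e) / norm x\<bar> \<le> 1"
      using Cauchy_Schwarz_ineq2[of x e] e that by (simp add: field_simps)
    have "arccos ((x \<bullet> e) / norm x) < arccos (cos \<gamma>) \<longleftrightarrow> cos \<gamma> < (x \<bullet> e) / norm x"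
      using b by (intro arccos_less_mono) auto
    then show ?thesis using \<gamma> that by (simp add: arccos_cos field_simps)
  qed
  then have "K' \<inter> ball 0 1 = open_cone e (cos \<gamma>)"
    unfolding K' open_cone_def by (intro set_eqI) (case_tac "x = 0"; simp add: dist_norm)
  with e show ?thesis by blast
qed

theorem corollary46:
  fixes K' K :: "(real^'n) set" and k :: 'n
    and m :: nat and a p \<gamma> :: real
  assumes "CARD('n) \<ge> 2"
    and "1 \<le> p" and "m \<ge> 1"
    and "infinite_smooth_cone K'"
    and "rotationally_invariant k K'"
    and "has_opening_angle k \<gamma> K'" and "0 < \<gamma>" and "\<gamma> < pi"
    and "K = K' \<inter> ball 0 1"
  shows "kondratiev_algebra m a p K \<longleftrightarrow>
    a \<ge> real CARD('n) / p \<and>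
    ((1 < p \<and> real m > real CARD('n) / p) \<or> (p = 1 \<and> m \<ge> CARD('n)))"
proof -
  obtain e where e: "norm e = 1" and K: "K = open_cone e (cos \<gamma>)"
    using opening_angle_open_cone[OF assms(6-8)] assms(9) by blast
  have c: "\<bar>cos \<gamma>\<bar> < 1"
    using cos_monotone_0_pi[of 0 \<gamma>] cos_monotone_0_pi[of \<gamma> pi] assms(7,8) by simp
  have oK: "open K" "0 \<notin> K" unfolding K by (rule open_open_cone, rule open_cone_nonzero)
  have "e \<bullet> e = 1" using e by (simp add: dot_square_norm)
  then have "(1 / 2) *\<^sub>R e \<in> K" using e c by (simp add: K open_cone_def)
  then have ne: "K \<noteq> {}" by blast
  have star: "t *\<^sub>R x \<in> K" if x: "x \<in> K" and t: "0 < t" "t \<le> 1" for x t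
  proof -
    have "t * (cos \<gamma> * norm x) < t * (x \<bullet> e)" using x t by (simp add: K open_cone_def)
    moreover have "t * norm x < 1" using x t mult_right_mono[of t 1 "norm x"] by (simp add: K open_cone_def)
    ultimately show ?thesis using t by (simp add: K open_cone_def mult_ac)
  qed
  show ?thesis
    using algebra_weight_bound[OF _ oK ne assms(2) star] algebra_smoothness_bound[OF _ oK ne assms(2)]
      open_cone_algebra[OF e c assms(2)] unfolding K by blast
qed

end
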